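(* The forgetful strict 2-functor $\mathbf{NM}_{\mho}\to\mathbf{DC}_{\mho}$, from the strict 2-category of small natural models that admit a type classifier to the strict 2-category of small display categories that admit a universe, is a 2-equivalence.
   Context: **2-equivalence.** A 2-equivalence is an equivalence of 2-categories in the weak sense (biequivalence): essentially surjective on objects (up to equivalence), and on hom-categories essentially surjective on objects (up to isomorphism) and bijective on 2-morphisms. **Display categories.** A display category $\mathbf{C}$ is a category (also denoted $\mathbf{C}$) with a class $\mathcal{D}_{\mathbf{C}}$ of morphisms, called displays, such that every display $p:E\to B$ has, along every $f:A\to B$, a pullback $f^*p:f^*E\to A$ that is a display, and $\mathcal{D}_{\mathbf{C}}$ is closed under composition with isomorphisms. A choice of such pullbacks is fixed. $\mathcal{D}_{\mathbf{C}}$ also denotes the $\mathbf{C}$-indexed category (pseudofunctor $\mathbf{C}^{\mathrm{op}}\to\mathbf{Cat}$) whose value at $A$ is the full subcategory of $\mathbf{C}/A$ on displays, with reindexing by the chosen pullbacks. A display functor is a functor taking displays to displays and pullbacks of displays to pullbacks of displays. $\mathbf{DC}$ is the strict 2-category of small display categories, display functors and natural transformations. **Universes.** The externalization of a category $\mathbf{E}$ internal to $\mathbf{C}$ is the strict $\mathbf{C}$-indexed category $\Gamma\mapsto(\mathbf{C}(\Gamma,\mathbf{E}_1)\rightrightarrows\mathbf{C}(\Gamma,\mathbf{E}_0))$. A universe for a small display category $\mathbf{C}$ is an internal discrete opfibration $p:\mho_\bullet\to\mho$ in $\mathbf{C}$ whose object part $p_0$ is a display and such that the $\mathbf{C}$-indexed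 functor from (the externalization of) $\mho$ to $\mathcal{D}_{\mathbf{C}}$ sending $A:\Gamma\to\mho_0$ to the pullback of $p_0$ along $A$ is a $\mathbf{C}$-indexed equivalence (each component is an equivalence of categories). $\mathbf{DC}_\mho$ is the full strict sub-2-category of $\mathbf{DC}$ on the small display categories that admit a universe. **Natural models.** A small pre-natural model $\mathbf{C}$ is a small display category $\mathbf{C}$ with small strict $\mathbf{C}$-indexed categories $\mathbf{Tp}_{\mathbf{C}},\mathbf{Tm}_{\mathbf{C}}:\mathbf{C}^{\mathrm{op}}\to\mathbf{Cat}$ (strict functors) and a strictly natural $p_{\mathbf{C}}:\mathbf{Tm}_{\mathbf{C}}\to\mathbf{Tp}_{\mathbf{C}}$, each component of which is a discrete opfibration, that is representable: for all $\Gamma\in\mathbf{C}$ and $A\in\mathbf{Tp}_{\mathbf{C}}(\Gamma)$, the presheaf $\Delta\mapsto\{(u:\Delta\to\Gamma,\ t\in\mathbf{Tm}_{\mathbf{C}}(\Delta)) : p_{\mathbf{C}}(t)=A[u]\}$ over $\Gamma$ is represented by a (chosen) display $p_A:\Gamma.A\to\Gamma$, with universal element $v_A\in\mathbf{Tm}_{\mathbf{C}}(\Gamma.A)$. Here $A[u]$ denotes $\mathbf{Tp}_{\mathbf{C}}(u)(A)$, and similarly for morphisms and terms. The $\mathbf{C}$-indexed functor $\mathrm{comp}_{\mathbf{C}}:\mathbf{Tp}_{\mathbf{C}}\to\mathcal{D}_{\mathbf{C}}$ sends $A$ to $p_A$ and $f:A\to B$ to the map $\Gamma.f:\Gamma.A\to\Gamma.B$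 over $\Gamma$ with $v_B[\Gamma.f]$ equal to the codomain of the unique lift of $f[p_A]$ with domain $v_A$. A small natural model is a small pre-natural model for which $\mathrm{comp}_{\mathbf{C}}$ is a $\mathbf{C}$-indexed equivalence. A type classifier for it is a category in $\mathbf{C}$ whose externalization is isomorphic to $\mathbf{Tp}_{\mathbf{C}}$ via strict $\mathbf{C}$-indexed functors. (The underlying display category then admits a universe.) **Morphisms.** A morphism $F:\mathbf{C}\to\mathbf{D}$ of small natural models is a display functor $F$ with strictly natural $\mathbf{Tp}_F:\mathbf{Tp}_{\mathbf{C}}\to F^*\mathbf{Tp}_{\mathbf{D}}$ and $\mathbf{Tm}_F:\mathbf{Tm}_{\mathbf{C}}\to F^*\mathbf{Tm}_{\mathbf{D}}$ commuting with $p_{\mathbf{C}},F^*p_{\mathbf{D}}$ (one writes $FA,Ft$ for their values), such that for each $A\in\mathbf{Tp}_{\mathbf{C}}(\Gamma)$ the canonical map $(\tau_F)_A:F(\Gamma.A)\to F\Gamma.FA$ over $F\Gamma$ (with $v_{FA}[(\tau_F)_A]=Fv_A$) is an isomorphism. A 2-morphism $\alpha:F\Rightarrow G$ is a natural transformation $\alpha$ with $\mathbf{C}$-indexed natural transformations $\mathbf{Tp}_\alpha:\mathbf{Tp}_F\Rightarrow\alpha^*\mathbf{Tp}_{\mathbf{D}}\circ\mathbf{Tp}_G$ and $\mathbf{Tm}_\alpha:\mathbf{Tm}_F\Rightarrow\alpha^*\mathbf{Tm}_{\mathbf{D}}\circ\mathbf{Tm}_G$, with components $\alpha_A:FA\to(GA)[\alpha_\Gamma]$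 and $\alpha_t:Ft\to(Gt)[\alpha_\Gamma]$, such that $p_{\mathbf{D}}(\alpha_t)=\alpha_{p_{\mathbf{C}}(t)}$. $\mathbf{NM}$ is the resulting strict 2-category; $\mathbf{NM}_\mho$ is its full strict sub-2-category on the small natural models that admit a type classifier. *)

theory Defs
  imports "HOL-Library.FuncSet" "HOL-Library.Equipollence"
begin

text \<open>
  Conventions.  Maps between carriers that have to be compared for equality (functors, natural
  transformations, and the 1-cells and 2-cells below) are extensional, i.e. \<^const>\<open>undefined\<close> off
  their carriers.  The operations of a category are not constrained off the carriers; two records
  which differ only there are distinct but isomorphic objects of the 2-categories below.
\<close>

section \<open>Categories, functors, natural transformations\<close>

record ('o, 'm) cat =
  Obj :: "'o set"
  Arr :: "'m set"
  Dom :: "'m \<Rightarrow> 'o"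
  Cod :: "'m \<Rightarrow> 'o"
  Ident :: "'o \<Rightarrow> 'm"
  Comp :: "'m \<Rightarrow> 'm \<Rightarrow> 'm" (infixl "\<cdot>\<index>" 75)

definition hom :: "('o, 'm, 'x) cat_scheme \<Rightarrow> 'o \<Rightarrow> 'o \<Rightarrow> 'm set" where
  "hom C A B = {f \<in> Arr C. Dom C f = A \<and> Cod C f = B}"

locale category =
  fixes C :: "('o, 'm, 'x) cat_scheme" (structure)
  assumes dom_obj: "f \<in> Arr C \<Longrightarrow> Dom C f \<in> Obj C"
    and cod_obj: "f \<in> Arr C \<Longrightarrow> Cod C f \<in> Obj C"
    and ident_hom: "A \<in> Obj C \<Longrightarrow> Ident C A \<in> hom C A A"
    and comp_hom: "\<lbrakk>f \<in> hom C A B; g \<in> hom C B D\<rbrakk> \<Longrightarrow> g \<cdot> f \<in> hom C A D"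
    and comp_assoc: "\<lbrakk>f \<in> hom C A B; g \<in> hom C B D; h \<in> hom C D E\<rbrakk> \<Longrightarrow> h \<cdot> (g \<cdot> f) = h \<cdot> g \<cdot> f"
    and comp_ident_right: "f \<in> hom C A B \<Longrightarrow> f \<cdot> Ident C A = f"
    and comp_ident_left: "f \<in> hom C A B \<Longrightarrow> Ident C B \<cdot> f = f"

definition is_iso :: "('o, 'm, 'x) cat_scheme \<Rightarrow> 'm \<Rightarrow> bool" where
  "is_iso C f \<longleftrightarrow> f \<in> Arr C \<and>
     (\<exists>g \<in> hom C (Cod C f) (Dom C f).
        g \<cdot>\<^bsub>C\<^esub> f = Ident C (Dom C f) \<and> f \<cdot>\<^bsub>C\<^esub> g = Ident C (Cod C f))"

definition isomorphic :: "('o, 'm, 'x) cat_scheme \<Rightarrow> 'o \<Rightarrow> 'o \<Rightarrow> bool" where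
  "isomorphic C A B \<longleftrightarrow> (\<exists>f \<in> hom C A B. is_iso C f)"

text \<open>
  The type \<^typ>\<open>'u\<close> plays the role of the universe of sets: the objects and arrows of small
  categories are elements of it, and a collection of such elements is small if it has strictly
  fewer elements than the universe.  If \<^typ>\<open>'u\<close> has inaccessible cardinality (e.g. if it is the
  type of elements of a Grothendieck universe), the small collections are, up to bijection,
  precisely the sets belonging to that universe.
\<close>

definition small :: "'u set \<Rightarrow> bool" where
  "small A \<longleftrightarrow> A \<prec> (UNIV :: 'u set)"

definition small_cat :: "('u, 'u, 'x) cat_scheme \<Rightarrow> bool" where
  "small_cat C \<longleftrightarrow> small (Obj C) \<and> small (Arr C)"

record ('o, 'm, 'p, 'n) ftr =
  FO :: "'o \<Rightarrow> 'p"
  FA :: "'m \<Rightarrow> 'n"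

locale is_functor = dom: category C + cod: category D
  for C :: "('o, 'm, 'x) cat_scheme" and D :: "('p, 'n, 'y) cat_scheme"
    and F :: "('o, 'm, 'p, 'n, 'z) ftr_scheme" +
  assumes obj_ext: "FO F \<in> extensional (Obj C)"
    and arr_ext: "FA F \<in> extensional (Arr C)"
    and obj_map: "A \<in> Obj C \<Longrightarrow> FO F A \<in> Obj D"
    and arr_map: "f \<in> hom C A B \<Longrightarrow> FA F f \<in> hom D (FO F A) (FO F B)"
    and map_ident: "A \<in> Obj C \<Longrightarrow> FA F (Ident C A) = Ident D (FO F A)"
    and map_comp: "\<lbrakk>f \<in> hom C A B; g \<in> hom C B E\<rbrakk> \<Longrightarrow>
      FA F (g \<cdot>\<^bsub>C\<^esub> f) = FA F g \<cdot>\<^bsub>D\<^esub> FA F f"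

definition ftr_id :: "('o, 'm, 'x) cat_scheme \<Rightarrow> ('o, 'm, 'o, 'm) ftr" where
  "ftr_id C = \<lparr>FO = (\<lambda>A \<in> Obj C. A), FA = (\<lambda>f \<in> Arr C. f)\<rparr>"

text \<open>\<open>ftr_comp C G F\<close> is the composite \<open>G \<circ> F\<close> of functors, \<open>F\<close> having domain \<open>C\<close>.\<close>

definition ftr_comp :: "('o, 'm, 'x) cat_scheme \<Rightarrow> ('p, 'n, 'q, 'r, 'y) ftr_scheme \<Rightarrow>
    ('o, 'm, 'p, 'n, 'z) ftr_scheme \<Rightarrow> ('o, 'm, 'q, 'r) ftr" where
  "ftr_comp C G F = \<lparr>FO = (\<lambda>A \<in> Obj C. FO G (FO F A)), FA = (\<lambda>f \<in> Arr C. FA G (FA F f))\<rparr>"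

definition is_nat :: "('o, 'm, 'x) cat_scheme \<Rightarrow> ('p, 'n, 'y) cat_scheme \<Rightarrow>
    ('o, 'm, 'p, 'n, 'z) ftr_scheme \<Rightarrow> ('o, 'm, 'p, 'n, 'w) ftr_scheme \<Rightarrow> ('o \<Rightarrow> 'n) \<Rightarrow> bool" where
  "is_nat C D F G \<alpha> \<longleftrightarrow>
     \<alpha> \<in> extensional (Obj C) \<and>
     (\<forall>A \<in> Obj C. \<alpha> A \<in> hom D (FO F A) (FO G A)) \<and>
     (\<forall>f \<in> Arr C. FA G f \<cdot>\<^bsub>D\<^esub> \<alpha> (Dom C f) = \<alpha> (Cod C f) \<cdot>\<^bsub>D\<^esub> FA F f)"

definition is_nat_iso :: "('o, 'm, 'x) cat_scheme \<Rightarrow> ('p, 'n, 'y) cat_scheme \<Rightarrow>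
    ('o, 'm, 'p, 'n, 'z) ftr_scheme \<Rightarrow> ('o, 'm, 'p, 'n, 'w) ftr_scheme \<Rightarrow> ('o \<Rightarrow> 'n) \<Rightarrow> bool" where
  "is_nat_iso C D F G \<alpha> \<longleftrightarrow> is_nat C D F G \<alpha> \<and> (\<forall>A \<in> Obj C. is_iso D (\<alpha> A))"

definition is_equivalence :: "('o, 'm, 'x) cat_scheme \<Rightarrow> ('p, 'n, 'y) cat_scheme \<Rightarrow>
    ('o, 'm, 'p, 'n, 'z) ftr_scheme \<Rightarrow> bool" where
  "is_equivalence C D F \<longleftrightarrow> is_functor C D F \<and>
     (\<exists>G :: ('p, 'n, 'o, 'm) ftr. is_functor D C G \<and>
        (\<exists>\<eta>. is_nat_iso C C (ftr_id C) (ftr_comp C G F) \<eta>) \<and>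
        (\<exists>\<epsilon>. is_nat_iso D D (ftr_comp D F G) (ftr_id D) \<epsilon>))"

definition discrete_opfibration :: "('o, 'm, 'x) cat_scheme \<Rightarrow> ('p, 'n, 'y) cat_scheme \<Rightarrow>
    ('o, 'm, 'p, 'n, 'z) ftr_scheme \<Rightarrow> bool" where
  "discrete_opfibration E B P \<longleftrightarrow> is_functor E B P \<and>
     (\<forall>e \<in> Obj E. \<forall>f \<in> Arr B. Dom B f = FO P e \<longrightarrow> (\<exists>!g. g \<in> Arr E \<and> Dom E g = e \<and> FA P g = f))"

definition opfib_lift :: "('o, 'm, 'x) cat_scheme \<Rightarrow> ('o, 'm, 'p, 'n, 'z) ftr_scheme \<Rightarrow>
    'o \<Rightarrow> 'n \<Rightarrow> 'm" where
  "opfib_lift E P e f = (THE g. g \<in> Arr E \<and> Dom E g = e \<and> FA P g = f)"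

section \<open>Strict 2-categories and 2-equivalences\<close>

text \<open>
  A strict 2-category is a category enriched in categories: hom-categories, identity 1-cells, and
  composition functors with object part \<open>HC1 K A B D\<close> and arrow part \<open>HC2 K A B D\<close>.
  Composition depends on the objects because 1-cells do not record their source and target.
\<close>

record ('a, 'b, 'c) two_cat =
  TObj :: "'a set"
  THom :: "'a \<Rightarrow> 'a \<Rightarrow> ('b, 'c) cat"
  TId :: "'a \<Rightarrow> 'b"
  HC1 :: "'a \<Rightarrow> 'a \<Rightarrow> 'a \<Rightarrow> 'b \<Rightarrow> 'b \<Rightarrow> 'b"
  HC2 :: "'a \<Rightarrow> 'a \<Rightarrow> 'a \<Rightarrow> 'c \<Rightarrow> 'c \<Rightarrow> 'c"

locale strict_2_category =
  fixes K :: "('a, 'b, 'c, 'x) two_cat_scheme"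
  assumes hom_category: "\<lbrakk>A \<in> TObj K; B \<in> TObj K\<rbrakk> \<Longrightarrow> category (THom K A B)"
    and id_cell: "A \<in> TObj K \<Longrightarrow> TId K A \<in> Obj (THom K A A)"
    and hcomp_cell: "\<lbrakk>A \<in> TObj K; B \<in> TObj K; D \<in> TObj K;
        f \<in> Obj (THom K A B); g \<in> Obj (THom K B D)\<rbrakk> \<Longrightarrow> HC1 K A B D g f \<in> Obj (THom K A D)"
    and hcomp_2cell: "\<lbrakk>A \<in> TObj K; B \<in> TObj K; D \<in> TObj K;
        \<alpha> \<in> hom (THom K A B) f f'; \<beta> \<in> hom (THom K B D) g g'\<rbrakk> \<Longrightarrow>
        HC2 K A B D \<beta> \<alpha> \<in> hom (THom K A D) (HC1 K A B D g f) (HC1 K A B D g' f')"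
    and hcomp_ident: "\<lbrakk>A \<in> TObj K; B \<in> TObj K; D \<in> TObj K;
        f \<in> Obj (THom K A B); g \<in> Obj (THom K B D)\<rbrakk> \<Longrightarrow>
        HC2 K A B D (Ident (THom K B D) g) (Ident (THom K A B) f)
          = Ident (THom K A D) (HC1 K A B D g f)"
    and interchange: "\<lbrakk>A \<in> TObj K; B \<in> TObj K; D \<in> TObj K;
        \<alpha> \<in> hom (THom K A B) f f'; \<alpha>' \<in> hom (THom K A B) f' f'';
        \<beta> \<in> hom (THom K B D) g g'; \<beta>' \<in> hom (THom K B D) g' g''\<rbrakk> \<Longrightarrow>
        HC2 K A B D (\<beta>' \<cdot>\<^bsub>THom K B D\<^esub> \<beta>) (\<alpha>' \<cdot>\<^bsub>THom K A B\<^esub> \<alpha>)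
          = HC2 K A B D \<beta>' \<alpha>' \<cdot>\<^bsub>THom K A D\<^esub> HC2 K A B D \<beta> \<alpha>"
    and hcomp_assoc: "\<lbrakk>A \<in> TObj K; B \<in> TObj K; D \<in> TObj K; E \<in> TObj K;
        f \<in> Obj (THom K A B); g \<in> Obj (THom K B D); h \<in> Obj (THom K D E)\<rbrakk> \<Longrightarrow>
        HC1 K A D E h (HC1 K A B D g f) = HC1 K A B E (HC1 K B D E h g) f"
    and hcomp2_assoc: "\<lbrakk>A \<in> TObj K; B \<in> TObj K; D \<in> TObj K; E \<in> TObj K;
        \<alpha> \<in> Arr (THom K A B); \<beta> \<in> Arr (THom K B D); \<gamma> \<in> Arr (THom K D E)\<rbrakk> \<Longrightarrow>
        HC2 K A D E \<gamma> (HC2 K A B D \<beta> \<alpha>) = HC2 K A B E (HC2 K B D E \<gamma> \<beta>) \<alpha>"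
    and hcomp_id_right: "\<lbrakk>A \<in> TObj K; B \<in> TObj K; f \<in> Obj (THom K A B)\<rbrakk> \<Longrightarrow>
        HC1 K A A B f (TId K A) = f"
    and hcomp_id_left: "\<lbrakk>A \<in> TObj K; B \<in> TObj K; f \<in> Obj (THom K A B)\<rbrakk> \<Longrightarrow>
        HC1 K A B B (TId K B) f = f"
    and hcomp2_id_right: "\<lbrakk>A \<in> TObj K; B \<in> TObj K; \<alpha> \<in> Arr (THom K A B)\<rbrakk> \<Longrightarrow>
        HC2 K A A B \<alpha> (Ident (THom K A A) (TId K A)) = \<alpha>"
    and hcomp2_id_left: "\<lbrakk>A \<in> TObj K; B \<in> TObj K; \<alpha> \<in> Arr (THom K A B)\<rbrakk> \<Longrightarrow>
        HC2 K A B B (Ident (THom K B B) (TId K B)) \<alpha> = \<alpha>"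

definition full_sub_2cat :: "('a, 'b, 'c) two_cat \<Rightarrow> ('a \<Rightarrow> bool) \<Rightarrow> ('a, 'b, 'c) two_cat" where
  "full_sub_2cat K P = K\<lparr>TObj := {A \<in> TObj K. P A}\<rparr>"

record ('a, 'b, 'c, 'd, 'e, 'f) two_ftr =
  T0 :: "'a \<Rightarrow> 'd"
  T1 :: "'a \<Rightarrow> 'a \<Rightarrow> 'b \<Rightarrow> 'e"
  T2 :: "'a \<Rightarrow> 'a \<Rightarrow> 'c \<Rightarrow> 'f"

locale strict_2_functor = dom: strict_2_category K + cod: strict_2_category L
  for K :: "('a, 'b, 'c, 'x) two_cat_scheme" and L :: "('d, 'e, 'f, 'y) two_cat_scheme"
    and U :: "('a, 'b, 'c, 'd, 'e, 'f, 'z) two_ftr_scheme" +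
  assumes obj_map: "A \<in> TObj K \<Longrightarrow> T0 U A \<in> TObj L"
    and cell_map: "\<lbrakk>A \<in> TObj K; B \<in> TObj K; f \<in> Obj (THom K A B)\<rbrakk> \<Longrightarrow>
        T1 U A B f \<in> Obj (THom L (T0 U A) (T0 U B))"
    and cell2_map: "\<lbrakk>A \<in> TObj K; B \<in> TObj K; \<alpha> \<in> hom (THom K A B) f g\<rbrakk> \<Longrightarrow>
        T2 U A B \<alpha> \<in> hom (THom L (T0 U A) (T0 U B)) (T1 U A B f) (T1 U A B g)"
    and map_ident: "\<lbrakk>A \<in> TObj K; B \<in> TObj K; f \<in> Obj (THom K A B)\<rbrakk> \<Longrightarrow>
        T2 U A B (Ident (THom K A B) f) = Ident (THom L (T0 U A) (T0 U B)) (T1 U A B f)"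
    and map_vcomp: "\<lbrakk>A \<in> TObj K; B \<in> TObj K;
        \<alpha> \<in> hom (THom K A B) f g; \<beta> \<in> hom (THom K A B) g h\<rbrakk> \<Longrightarrow>
        T2 U A B (\<beta> \<cdot>\<^bsub>THom K A B\<^esub> \<alpha>) = T2 U A B \<beta> \<cdot>\<^bsub>THom L (T0 U A) (T0 U B)\<^esub> T2 U A B \<alpha>"
    and map_id_cell: "A \<in> TObj K \<Longrightarrow> T1 U A A (TId K A) = TId L (T0 U A)"
    and map_hcomp: "\<lbrakk>A \<in> TObj K; B \<in> TObj K; D \<in> TObj K;
        f \<in> Obj (THom K A B); g \<in> Obj (THom K B D)\<rbrakk> \<Longrightarrow>
        T1 U A D (HC1 K A B D g f)
          = HC1 L (T0 U A) (T0 U B) (T0 U D) (T1 U B D g) (T1 U A B f)"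
    and map_hcomp2: "\<lbrakk>A \<in> TObj K; B \<in> TObj K; D \<in> TObj K;
        \<alpha> \<in> Arr (THom K A B); \<beta> \<in> Arr (THom K B D)\<rbrakk> \<Longrightarrow>
        T2 U A D (HC2 K A B D \<beta> \<alpha>)
          = HC2 L (T0 U A) (T0 U B) (T0 U D) (T2 U B D \<beta>) (T2 U A B \<alpha>)"

definition equivalent_in :: "('a, 'b, 'c, 'x) two_cat_scheme \<Rightarrow> 'a \<Rightarrow> 'a \<Rightarrow> bool" where
  "equivalent_in K A B \<longleftrightarrow>
     (\<exists>f \<in> Obj (THom K A B). \<exists>g \<in> Obj (THom K B A).
        isomorphic (THom K A A) (HC1 K A B A g f) (TId K A) \<and>
        isomorphic (THom K B B) (HC1 K B A B f g) (TId K B))"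

locale two_equivalence = strict_2_functor K L U
  for K :: "('a, 'b, 'c, 'x) two_cat_scheme" and L :: "('d, 'e, 'f, 'y) two_cat_scheme"
    and U :: "('a, 'b, 'c, 'd, 'e, 'f, 'z) two_ftr_scheme" +
  assumes ess_surj_obj: "D \<in> TObj L \<Longrightarrow> \<exists>A \<in> TObj K. equivalent_in L (T0 U A) D"
    and ess_surj_cell: "\<lbrakk>A \<in> TObj K; B \<in> TObj K; k \<in> Obj (THom L (T0 U A) (T0 U B))\<rbrakk> \<Longrightarrow>
        \<exists>f \<in> Obj (THom K A B). isomorphic (THom L (T0 U A) (T0 U B)) (T1 U A B f) k"
    and bij_2cell: "\<lbrakk>A \<in> TObj K; B \<in> TObj K; f \<in> Obj (THom K A B); g \<in> Obj (THom K A B)\<rbrakk> \<Longrightarrow>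
        bij_betw (T2 U A B) (hom (THom K A B) f g)
          (hom (THom L (T0 U A) (T0 U B)) (T1 U A B f) (T1 U A B g))"

section \<open>Display categories\<close>

text \<open>
  \<open>pullback_square C f p p' q\<close>: the square \<open>f \<circ> p' = p \<circ> q\<close> is a pullback, with \<open>p'\<close> opposite
  to \<open>p\<close>.
\<close>

definition pullback_square :: "('o, 'm, 'x) cat_scheme \<Rightarrow> 'm \<Rightarrow> 'm \<Rightarrow> 'm \<Rightarrow> 'm \<Rightarrow> bool" where
  "pullback_square C f p p' q \<longleftrightarrow>
     f \<in> Arr C \<and> p \<in> Arr C \<and> p' \<in> Arr C \<and> q \<in> Arr C \<and>
     Cod C f = Cod C p \<and> Dom C p' = Dom C q \<and> Cod C p' = Dom C f \<and> Cod C q = Dom C p \<and>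
     f \<cdot>\<^bsub>C\<^esub> p' = p \<cdot>\<^bsub>C\<^esub> q \<and>
     (\<forall>a \<in> Arr C. \<forall>b \<in> Arr C. Dom C a = Dom C b \<and> Cod C a = Dom C f \<and> Cod C b = Dom C p \<and>
        f \<cdot>\<^bsub>C\<^esub> a = p \<cdot>\<^bsub>C\<^esub> b \<longrightarrow>
        (\<exists>!h. h \<in> hom C (Dom C a) (Dom C p') \<and> p' \<cdot>\<^bsub>C\<^esub> h = a \<and> q \<cdot>\<^bsub>C\<^esub> h = b))"

text \<open>The arrow into a pullback with projections \<open>p'\<close> and \<open>q\<close> induced by \<open>a\<close> and \<open>b\<close>.\<close>

definition pairing :: "('o, 'm, 'x) cat_scheme \<Rightarrow> 'm \<Rightarrow> 'm \<Rightarrow> 'm \<Rightarrow> 'm \<Rightarrow> 'm" where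
  "pairing C p' q a b =
     (THE h. h \<in> hom C (Dom C a) (Dom C p') \<and> p' \<cdot>\<^bsub>C\<^esub> h = a \<and> q \<cdot>\<^bsub>C\<^esub> h = b)"

text \<open>
  The chosen pullback of a display \<open>p\<close> along \<open>f\<close> has projections \<open>Pb C f p\<close> (the display
  \<open>f\<^sup>*p\<close>) and \<open>PbTop C f p\<close>.
\<close>

record 'u dcat = "('u, 'u) cat" +
  Disp :: "'u set"
  Pb :: "'u \<Rightarrow> 'u \<Rightarrow> 'u"
  PbTop :: "'u \<Rightarrow> 'u \<Rightarrow> 'u"

locale display_category = category C for C :: "('u, 'x) dcat_scheme" (structure) +
  assumes disp_arr: "p \<in> Disp C \<Longrightarrow> p \<in> Arr C"
    and disp_pullback: "\<lbrakk>p \<in> Disp C; f \<in> Arr C; Cod C f = Cod C p\<rbrakk> \<Longrightarrow>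
      Pb C f p \<in> Disp C \<and> pullback_square C f p (Pb C f p) (PbTop C f p)"
    and disp_iso_left: "\<lbrakk>p \<in> Disp C; is_iso C i; Dom C i = Cod C p\<rbrakk> \<Longrightarrow> i \<cdot> p \<in> Disp C"
    and disp_iso_right: "\<lbrakk>p \<in> Disp C; is_iso C i; Cod C i = Dom C p\<rbrakk> \<Longrightarrow> p \<cdot> i \<in> Disp C"

text \<open>
  \<open>disp_fibre C A\<close> is the value at \<open>A\<close> of the indexed category of displays, i.e. the full
  subcategory of the slice over \<open>A\<close> on displays; \<open>(p, h, q)\<close> is the arrow \<open>h\<close> from \<open>p\<close> to \<open>q\<close>.
  Being an indexed equivalence is a condition on the components of an indexed functor, so only the
  fibres of this indexed category enter the definitions below, not its reindexing (by \<open>Pb\<close>).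
\<close>

definition disp_fibre :: "('u, 'x) dcat_scheme \<Rightarrow> 'u \<Rightarrow> ('u, 'u \<times> 'u \<times> 'u) cat" where
  "disp_fibre C A = \<lparr>
     Obj = {p \<in> Disp C. Cod C p = A},
     Arr = {(p, h, q). p \<in> Disp C \<and> Cod C p = A \<and> q \<in> Disp C \<and> Cod C q = A \<and>
              h \<in> hom C (Dom C p) (Dom C q) \<and> q \<cdot>\<^bsub>C\<^esub> h = p},
     Dom = (\<lambda>(p, h, q). p),
     Cod = (\<lambda>(p, h, q). q),
     Ident = (\<lambda>p. (p, Ident C (Dom C p), p)),
     Comp = (\<lambda>(q', k, r) (p, h, q). (p, k \<cdot>\<^bsub>C\<^esub> h, r))\<rparr>"

locale display_functor = is_functor C D F +
  dom: display_category C + cod: display_category D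
  for C :: "('u, 'x) dcat_scheme" and D :: "('u, 'y) dcat_scheme"
    and F :: "('u, 'u, 'u, 'u, 'z) ftr_scheme" +
  assumes map_disp: "p \<in> Disp C \<Longrightarrow> FA F p \<in> Disp D"
    and map_pullback: "\<lbrakk>p \<in> Disp C; pullback_square C f p p' q\<rbrakk> \<Longrightarrow>
      pullback_square D (FA F f) (FA F p) (FA F p') (FA F q)"

record ('f, 'o, 'n) ntrans =
  NSrc :: 'f
  NTrg :: 'f
  NCmp :: "'o \<Rightarrow> 'n"

type_synonym 'u dftr = "('u, 'u, 'u, 'u) ftr"
type_synonym 'u dtrans = "('u dftr, 'u, 'u) ntrans"

definition DC_hom :: "'u dcat \<Rightarrow> 'u dcat \<Rightarrow> ('u dftr, 'u dtrans) cat" where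
  "DC_hom C D = \<lparr>
     Obj = {F. display_functor C D F},
     Arr = {\<alpha>. display_functor C D (NSrc \<alpha>) \<and> display_functor C D (NTrg \<alpha>) \<and>
               is_nat C D (NSrc \<alpha>) (NTrg \<alpha>) (NCmp \<alpha>)},
     Dom = NSrc,
     Cod = NTrg,
     Ident = (\<lambda>F. \<lparr>NSrc = F, NTrg = F, NCmp = (\<lambda>A \<in> Obj C. Ident D (FO F A))\<rparr>),
     Comp = (\<lambda>\<beta> \<alpha>. \<lparr>NSrc = NSrc \<alpha>, NTrg = NTrg \<beta>,
                    NCmp = (\<lambda>A \<in> Obj C. NCmp \<beta> A \<cdot>\<^bsub>D\<^esub> NCmp \<alpha> A)\<rparr>)\<rparr>"

definition DC :: "('u dcat, 'u dftr, 'u dtrans) two_cat" where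
  "DC = \<lparr>
     TObj = {C. display_category C \<and> small_cat C},
     THom = DC_hom,
     TId = (\<lambda>C. ftr_id C),
     HC1 = (\<lambda>A B C G F. ftr_comp A G F),
     HC2 = (\<lambda>A B C \<beta> \<alpha>. \<lparr>
       NSrc = ftr_comp A (NSrc \<beta>) (NSrc \<alpha>),
       NTrg = ftr_comp A (NTrg \<beta>) (NTrg \<alpha>),
       NCmp = (\<lambda>X \<in> Obj A. NCmp \<beta> (FO (NTrg \<alpha>) X) \<cdot>\<^bsub>C\<^esub> FA (NSrc \<beta>) (NCmp \<alpha> X))\<rparr>)\<rparr>"

section \<open>Strict indexed categories\<close>

record 'u sicat =
  Fib :: "'u \<Rightarrow> ('u, 'u) cat"
  Reix :: "'u \<Rightarrow> 'u dftr"

locale strict_indexed_category = base: category C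
  for C :: "('u, 'u, 'x) cat_scheme" and T :: "'u sicat" +
  assumes reix_functor: "u \<in> hom C \<Delta> \<Gamma> \<Longrightarrow> is_functor (Fib T \<Gamma>) (Fib T \<Delta>) (Reix T u)"
    and fib_category: "\<Gamma> \<in> Obj C \<Longrightarrow> category (Fib T \<Gamma>)"
    and reix_ident: "\<Gamma> \<in> Obj C \<Longrightarrow> Reix T (Ident C \<Gamma>) = ftr_id (Fib T \<Gamma>)"
    and reix_comp: "\<lbrakk>w \<in> hom C \<Theta> \<Delta>; u \<in> hom C \<Delta> \<Gamma>\<rbrakk> \<Longrightarrow>
      Reix T (u \<cdot>\<^bsub>C\<^esub> w) = ftr_comp (Fib T \<Gamma>) (Reix T w) (Reix T u)"

locale strict_indexed_functor =
  src: strict_indexed_category C S + trg: strict_indexed_category C T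
  for C :: "('u, 'u, 'x) cat_scheme" and S T :: "'u sicat" and \<phi> :: "'u \<Rightarrow> 'u dftr" +
  assumes ext: "\<phi> \<in> extensional (Obj C)"
    and fib_functor: "\<Gamma> \<in> Obj C \<Longrightarrow> is_functor (Fib S \<Gamma>) (Fib T \<Gamma>) (\<phi> \<Gamma>)"
    and natural: "u \<in> hom C \<Delta> \<Gamma> \<Longrightarrow>
      ftr_comp (Fib S \<Gamma>) (Reix T u) (\<phi> \<Gamma>) = ftr_comp (Fib S \<Gamma>) (\<phi> \<Delta>) (Reix S u)"

definition sicat_isomorphic :: "('u, 'u, 'x) cat_scheme \<Rightarrow> 'u sicat \<Rightarrow> 'u sicat \<Rightarrow> bool" where
  "sicat_isomorphic C S T \<longleftrightarrow>
     (\<exists>\<phi> \<psi>. strict_indexed_functor C S T \<phi> \<and> strict_indexed_functor C T S \<psi> \<and>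
        (\<forall>\<Gamma> \<in> Obj C. ftr_comp (Fib S \<Gamma>) (\<psi> \<Gamma>) (\<phi> \<Gamma>) = ftr_id (Fib S \<Gamma>) \<and>
                     ftr_comp (Fib T \<Gamma>) (\<phi> \<Gamma>) (\<psi> \<Gamma>) = ftr_id (Fib T \<Gamma>)))"

text \<open>The reindexing \<open>F\<^sup>*T\<close> of an indexed category along a functor \<open>F\<close> between base categories.\<close>

definition base_change :: "('u, 'u, 'u, 'u, 'z) ftr_scheme \<Rightarrow> 'u sicat \<Rightarrow> 'u sicat" where
  "base_change F T = \<lparr>Fib = (\<lambda>\<Gamma>. Fib T (FO F \<Gamma>)), Reix = (\<lambda>u. Reix T (FA F u))\<rparr>"

section \<open>Internal categories and universes\<close>

text \<open>
  The pullback \<open>E\<^sub>1 \<times> E\<^sub>1\<close> over \<open>E\<^sub>0\<close> of composable pairs is part of the data, with projections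
  \<open>EFst\<close> (the arrow applied first) and \<open>ESnd\<close>.  Associativity and the unit laws are stated on
  generalized elements, so that no further pullbacks are required.
\<close>

record 'u incat =
  E0 :: 'u
  E1 :: 'u
  ESrc :: 'u
  ETrg :: 'u
  EUnit :: 'u
  EFst :: 'u
  ESnd :: 'u
  EMult :: 'u

definition gcomp :: "('u, 'u, 'x) cat_scheme \<Rightarrow> 'u incat \<Rightarrow> 'u \<Rightarrow> 'u \<Rightarrow> 'u" where
  "gcomp C E g f = EMult E \<cdot>\<^bsub>C\<^esub> pairing C (EFst E) (ESnd E) f g"

locale internal_category = category C for C :: "('u, 'u, 'x) cat_scheme" (structure)
    and E :: "'u incat" +
  assumes obj: "E0 E \<in> Obj C" "E1 E \<in> Obj C"
    and src_hom: "ESrc E \<in> hom C (E1 E) (E0 E)"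
    and trg_hom: "ETrg E \<in> hom C (E1 E) (E0 E)"
    and unit_hom: "EUnit E \<in> hom C (E0 E) (E1 E)"
    and pullback: "pullback_square C (ETrg E) (ESrc E) (EFst E) (ESnd E)"
    and mult_hom: "EMult E \<in> hom C (Dom C (EFst E)) (E1 E)"
    and src_unit: "ESrc E \<cdot> EUnit E = Ident C (E0 E)"
    and trg_unit: "ETrg E \<cdot> EUnit E = Ident C (E0 E)"
    and src_mult: "ESrc E \<cdot> EMult E = ESrc E \<cdot> EFst E"
    and trg_mult: "ETrg E \<cdot> EMult E = ETrg E \<cdot> ESnd E"
    and unit_right: "f \<in> hom C \<Gamma> (E1 E) \<Longrightarrow> gcomp C E f (EUnit E \<cdot> (ESrc E \<cdot> f)) = f"
    and unit_left: "f \<in> hom C \<Gamma> (E1 E) \<Longrightarrow> gcomp C E (EUnit E \<cdot> (ETrg E \<cdot> f)) f = f"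
    and assoc: "\<lbrakk>f \<in> hom C \<Gamma> (E1 E); g \<in> hom C \<Gamma> (E1 E); h \<in> hom C \<Gamma> (E1 E);
        ETrg E \<cdot> f = ESrc E \<cdot> g; ETrg E \<cdot> g = ESrc E \<cdot> h\<rbrakk> \<Longrightarrow>
        gcomp C E h (gcomp C E g f) = gcomp C E (gcomp C E h g) f"

definition externalization :: "('u, 'u, 'x) cat_scheme \<Rightarrow> 'u incat \<Rightarrow> 'u sicat" where
  "externalization C E = \<lparr>
     Fib = (\<lambda>\<Gamma>. \<lparr>
       Obj = hom C \<Gamma> (E0 E),
       Arr = hom C \<Gamma> (E1 E),
       Dom = (\<lambda>f. ESrc E \<cdot>\<^bsub>C\<^esub> f),
       Cod = (\<lambda>f. ETrg E \<cdot>\<^bsub>C\<^esub> f),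
       Ident = (\<lambda>a. EUnit E \<cdot>\<^bsub>C\<^esub> a),
       Comp = gcomp C E\<rparr>),
     Reix = (\<lambda>u. \<lparr>
       FO = (\<lambda>a \<in> hom C (Cod C u) (E0 E). a \<cdot>\<^bsub>C\<^esub> u),
       FA = (\<lambda>f \<in> hom C (Cod C u) (E1 E). f \<cdot>\<^bsub>C\<^esub> u)\<rparr>)\<rparr>"

locale internal_functor =
  dom: internal_category C E' + cod: internal_category C E
  for C :: "('u, 'u, 'x) cat_scheme" (structure) and E' E :: "'u incat" and p0 p1 :: 'u +
  assumes obj_part: "p0 \<in> hom C (E0 E') (E0 E)"
    and arr_part: "p1 \<in> hom C (E1 E') (E1 E)"
    and map_src: "ESrc E \<cdot> p1 = p0 \<cdot> ESrc E'"
    and map_trg: "ETrg E \<cdot> p1 = p0 \<cdot> ETrg E'"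
    and map_unit: "p1 \<cdot> EUnit E' = EUnit E \<cdot> p0"
    and map_mult: "p1 \<cdot> EMult E' = gcomp C E (p1 \<cdot> ESnd E') (p1 \<cdot> EFst E')"

locale internal_discrete_opfibration = internal_functor C E' E p0 p1
  for C :: "('u, 'u, 'x) cat_scheme" (structure) and E' E :: "'u incat" and p0 p1 :: 'u +
  assumes lifting: "pullback_square C (ESrc E) p0 p1 (ESrc E')"

text \<open>
  The functor from \<open>C(\<Gamma>, E\<^sub>1) \<rightrightarrows> C(\<Gamma>, E\<^sub>0)\<close> to displays over \<open>\<Gamma>\<close> which sends \<open>A\<close> to the chosen
  pullback of \<open>p0\<close> along \<open>A\<close>.  On \<open>f\<close> from \<open>A\<close> to \<open>B\<close> it acts by the internal opfibration: the
  generic element \<open>PbTop C A p0\<close> of \<open>A\<^sup>*p0\<close> is transported along (the restriction of) \<open>f\<close>.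
\<close>

definition classify :: "('u, 'x) dcat_scheme \<Rightarrow> 'u incat \<Rightarrow> 'u incat \<Rightarrow> 'u \<Rightarrow> 'u \<Rightarrow> 'u \<Rightarrow>
    ('u, 'u, 'u, 'u \<times> 'u \<times> 'u) ftr" where
  "classify C E' E p0 p1 \<Gamma> = \<lparr>
     FO = (\<lambda>A \<in> hom C \<Gamma> (E0 E). Pb C A p0),
     FA = (\<lambda>f \<in> hom C \<Gamma> (E1 E).
       let A = ESrc E \<cdot>\<^bsub>C\<^esub> f; B = ETrg E \<cdot>\<^bsub>C\<^esub> f;
           l = pairing C p1 (ESrc E') (f \<cdot>\<^bsub>C\<^esub> Pb C A p0) (PbTop C A p0)
       in (Pb C A p0,
           pairing C (Pb C B p0) (PbTop C B p0) (Pb C A p0) (ETrg E' \<cdot>\<^bsub>C\<^esub> l),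
           Pb C B p0))\<rparr>"

locale universe =
  display_category C + internal_discrete_opfibration C E' E p0 p1
  for C :: "('u, 'x) dcat_scheme" and E' E :: "'u incat" and p0 p1 :: 'u +
  assumes display: "p0 \<in> Disp C"
    and equivalence: "\<Gamma> \<in> Obj C \<Longrightarrow>
      is_equivalence (Fib (externalization C E) \<Gamma>) (disp_fibre C \<Gamma>) (classify C E' E p0 p1 \<Gamma>)"

definition admits_universe :: "('u, 'x) dcat_scheme \<Rightarrow> bool" where
  "admits_universe C \<longleftrightarrow> (\<exists>E' E p0 p1. universe C E' E p0 p1)"

definition DC_U :: "('u dcat, 'u dftr, 'u dtrans) two_cat" where
  "DC_U = full_sub_2cat DC admits_universe"

section \<open>Natural models\<close>

text \<open>
  \<open>Ext N \<Gamma> A\<close> is the chosen display \<open>\<Gamma>.A \<rightarrow> \<Gamma>\<close> (so that \<open>\<Gamma>.A\<close> is its domain) and \<open>Var N \<Gamma> A\<close>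
  the universal element.
\<close>

record 'u nm = "'u dcat" +
  Tp :: "'u sicat"
  Tm :: "'u sicat"
  TmTp :: "'u \<Rightarrow> 'u dftr"
  Ext :: "'u \<Rightarrow> 'u \<Rightarrow> 'u"
  Var :: "'u \<Rightarrow> 'u \<Rightarrow> 'u"

locale small_pre_natural_model = display_category N +
  types: strict_indexed_category N "Tp N" + terms: strict_indexed_category N "Tm N" +
  typing: strict_indexed_functor N "Tm N" "Tp N" "TmTp N"
  for N :: "('u, 'x) nm_scheme" +
  assumes small_base: "small_cat N"
    and small_types: "\<Gamma> \<in> Obj N \<Longrightarrow> small_cat (Fib (Tp N) \<Gamma>)"
    and small_terms: "\<Gamma> \<in> Obj N \<Longrightarrow> small_cat (Fib (Tm N) \<Gamma>)"
    and opfibration: "\<Gamma> \<in> Obj N \<Longrightarrow>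
      discrete_opfibration (Fib (Tm N) \<Gamma>) (Fib (Tp N) \<Gamma>) (TmTp N \<Gamma>)"
    and ext_disp: "\<lbrakk>\<Gamma> \<in> Obj N; A \<in> Obj (Fib (Tp N) \<Gamma>)\<rbrakk> \<Longrightarrow>
      Ext N \<Gamma> A \<in> Disp N \<and> Cod N (Ext N \<Gamma> A) = \<Gamma>"
    and var_term: "\<lbrakk>\<Gamma> \<in> Obj N; A \<in> Obj (Fib (Tp N) \<Gamma>)\<rbrakk> \<Longrightarrow>
      Var N \<Gamma> A \<in> Obj (Fib (Tm N) (Dom N (Ext N \<Gamma> A)))"
    and var_type: "\<lbrakk>\<Gamma> \<in> Obj N; A \<in> Obj (Fib (Tp N) \<Gamma>)\<rbrakk> \<Longrightarrow>
      FO (TmTp N (Dom N (Ext N \<Gamma> A))) (Var N \<Gamma> A) = FO (Reix (Tp N) (Ext N \<Gamma> A)) A"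
    and representable: "\<lbrakk>\<Gamma> \<in> Obj N; A \<in> Obj (Fib (Tp N) \<Gamma>); u \<in> hom N \<Delta> \<Gamma>;
        t \<in> Obj (Fib (Tm N) \<Delta>); FO (TmTp N \<Delta>) t = FO (Reix (Tp N) u) A\<rbrakk> \<Longrightarrow>
        \<exists>!w. w \<in> hom N \<Delta> (Dom N (Ext N \<Gamma> A)) \<and> Ext N \<Gamma> A \<cdot>\<^bsub>N\<^esub> w = u \<and>
             FO (Reix (Tm N) w) (Var N \<Gamma> A) = t"

text \<open>
  The map \<open>\<Gamma>.f\<close> over \<open>\<Gamma>\<close>: it classifies the codomain of the lift of \<open>f[p\<^sub>A]\<close> with domain \<open>v\<^sub>A\<close>.
\<close>

definition ext_map :: "('u, 'x) nm_scheme \<Rightarrow> 'u \<Rightarrow> 'u \<Rightarrow> 'u" where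
  "ext_map N \<Gamma> f =
     (let A = Dom (Fib (Tp N) \<Gamma>) f; B = Cod (Fib (Tp N) \<Gamma>) f;
          \<Gamma>A = Dom N (Ext N \<Gamma> A); \<Gamma>B = Dom N (Ext N \<Gamma> B);
          l = opfib_lift (Fib (Tm N) \<Gamma>A) (TmTp N \<Gamma>A) (Var N \<Gamma> A) (FA (Reix (Tp N) (Ext N \<Gamma> A)) f)
      in THE h. h \<in> hom N \<Gamma>A \<Gamma>B \<and> Ext N \<Gamma> B \<cdot>\<^bsub>N\<^esub> h = Ext N \<Gamma> A \<and>
           FO (Reix (Tm N) h) (Var N \<Gamma> B) = Cod (Fib (Tm N) \<Gamma>A) l)"

definition comprehension :: "('u, 'x) nm_scheme \<Rightarrow> 'u \<Rightarrow> ('u, 'u, 'u, 'u \<times> 'u \<times> 'u) ftr" where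
  "comprehension N \<Gamma> = \<lparr>
     FO = (\<lambda>A \<in> Obj (Fib (Tp N) \<Gamma>). Ext N \<Gamma> A),
     FA = (\<lambda>f \<in> Arr (Fib (Tp N) \<Gamma>).
       (Ext N \<Gamma> (Dom (Fib (Tp N) \<Gamma>) f), ext_map N \<Gamma> f, Ext N \<Gamma> (Cod (Fib (Tp N) \<Gamma>) f)))\<rparr>"

locale small_natural_model = small_pre_natural_model N for N :: "('u, 'x) nm_scheme" +
  assumes comprehension_equivalence: "\<Gamma> \<in> Obj N \<Longrightarrow>
    is_equivalence (Fib (Tp N) \<Gamma>) (disp_fibre N \<Gamma>) (comprehension N \<Gamma>)"

definition admits_type_classifier :: "('u, 'x) nm_scheme \<Rightarrow> bool" where
  "admits_type_classifier N \<longleftrightarrow>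
     (\<exists>E. internal_category N E \<and> sicat_isomorphic N (externalization N E) (Tp N))"

record 'u nmor = "('u, 'u, 'u, 'u) ftr" +
  TpF :: "'u \<Rightarrow> 'u dftr"
  TmF :: "'u \<Rightarrow> 'u dftr"

text \<open>The canonical map \<open>F(\<Gamma>.A) \<rightarrow> F\<Gamma>.FA\<close>.\<close>

definition ext_compare :: "('u, 'x) nm_scheme \<Rightarrow> ('u, 'y) nm_scheme \<Rightarrow> ('u, 'z) nmor_scheme \<Rightarrow>
    'u \<Rightarrow> 'u \<Rightarrow> 'u" where
  "ext_compare M N F \<Gamma> A =
     (let \<Gamma>A = Dom M (Ext M \<Gamma> A); q = Ext N (FO F \<Gamma>) (FO (TpF F \<Gamma>) A)
      in THE h. h \<in> hom N (FO F \<Gamma>A) (Dom N q) \<and> q \<cdot>\<^bsub>N\<^esub> h = FA F (Ext M \<Gamma> A) \<and>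
           FO (Reix (Tm N) h) (Var N (FO F \<Gamma>) (FO (TpF F \<Gamma>) A)) = FO (TmF F \<Gamma>A) (Var M \<Gamma> A))"

locale nm_morphism = dom: small_natural_model M + cod: small_natural_model N +
  display_functor M N F +
  types: strict_indexed_functor M "Tp M" "base_change F (Tp N)" "TpF F" +
  terms: strict_indexed_functor M "Tm M" "base_change F (Tm N)" "TmF F"
  for M :: "('u, 'x) nm_scheme" and N :: "('u, 'y) nm_scheme" and F :: "('u, 'z) nmor_scheme" +
  assumes map_typing: "\<Gamma> \<in> Obj M \<Longrightarrow>
      ftr_comp (Fib (Tm M) \<Gamma>) (TmTp N (FO F \<Gamma>)) (TmF F \<Gamma>)
        = ftr_comp (Fib (Tm M) \<Gamma>) (TpF F \<Gamma>) (TmTp M \<Gamma>)"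
    and compare_iso: "\<lbrakk>\<Gamma> \<in> Obj M; A \<in> Obj (Fib (Tp M) \<Gamma>)\<rbrakk> \<Longrightarrow> is_iso N (ext_compare M N F \<Gamma> A)"

record 'u ncell = "('u nmor, 'u, 'u) ntrans" +
  TpCmp :: "'u \<Rightarrow> 'u \<Rightarrow> 'u"
  TmCmp :: "'u \<Rightarrow> 'u \<Rightarrow> 'u"

text \<open>
  An indexed natural transformation \<open>S\<^sub>F \<Rightarrow> \<alpha>\<^sup>*T \<circ> S\<^sub>G\<close> over \<open>\<alpha> : F \<Rightarrow> G\<close>, where
  \<open>\<phi> : S \<rightarrow> F\<^sup>*T\<close> and \<open>\<psi> : S \<rightarrow> G\<^sup>*T\<close> are strict indexed functors: components
  \<open>\<theta> \<Gamma> A : \<phi> A \<rightarrow> (\<psi> A)[\<alpha>\<^sub>\<Gamma>]\<close>, natural in \<open>A\<close> and compatible with reindexing.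
\<close>

locale indexed_nat_over =
  fixes C :: "('u, 'u, 'x) cat_scheme" and S T :: "'u sicat"
    and F :: "('u, 'u, 'u, 'u, 'y) ftr_scheme" and \<alpha> :: "'u \<Rightarrow> 'u"
    and \<phi> \<psi> :: "'u \<Rightarrow> 'u dftr" and \<theta> :: "'u \<Rightarrow> 'u \<Rightarrow> 'u"
  assumes ext: "\<theta> \<in> extensional (Obj C)"
    and fib_nat: "\<Gamma> \<in> Obj C \<Longrightarrow>
      is_nat (Fib S \<Gamma>) (Fib T (FO F \<Gamma>)) (\<phi> \<Gamma>) (ftr_comp (Fib S \<Gamma>) (Reix T (\<alpha> \<Gamma>)) (\<psi> \<Gamma>)) (\<theta> \<Gamma>)"
    and reindex: "\<lbrakk>u \<in> hom C \<Delta> \<Gamma>; A \<in> Obj (Fib S \<Gamma>)\<rbrakk> \<Longrightarrow>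
      \<theta> \<Delta> (FO (Reix S u) A) = FA (Reix T (FA F u)) (\<theta> \<Gamma> A)"

locale nm_2cell = src: nm_morphism M N "NSrc \<alpha>" + trg: nm_morphism M N "NTrg \<alpha>" +
  types: indexed_nat_over M "Tp M" "Tp N" "NSrc \<alpha>" "NCmp \<alpha>" "TpF (NSrc \<alpha>)" "TpF (NTrg \<alpha>)" "TpCmp \<alpha>" +
  terms: indexed_nat_over M "Tm M" "Tm N" "NSrc \<alpha>" "NCmp \<alpha>" "TmF (NSrc \<alpha>)" "TmF (NTrg \<alpha>)" "TmCmp \<alpha>"
  for M :: "('u, 'x) nm_scheme" and N :: "('u, 'y) nm_scheme" and \<alpha> :: "('u, 'z) ncell_scheme" +
  assumes natural: "is_nat M N (NSrc \<alpha>) (NTrg \<alpha>) (NCmp \<alpha>)"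
    and typing: "\<lbrakk>\<Gamma> \<in> Obj M; t \<in> Obj (Fib (Tm M) \<Gamma>)\<rbrakk> \<Longrightarrow>
      FA (TmTp N (FO (NSrc \<alpha>) \<Gamma>)) (TmCmp \<alpha> \<Gamma> t) = TpCmp \<alpha> \<Gamma> (FO (TmTp M \<Gamma>) t)"

text \<open>
  Vertical composition on types is \<open>A \<mapsto> \<beta>\<^sub>A[\<alpha>\<^sub>\<Gamma>] \<circ> \<alpha>\<^sub>A\<close>, and horizontal composition (for
  \<open>\<alpha> : F \<Rightarrow> F'\<close> and \<open>\<beta> : G \<Rightarrow> G'\<close>) is \<open>A \<mapsto> \<beta>\<^bsub>F'A\<^esub>[G\<alpha>\<^sub>\<Gamma>] \<circ> G\<alpha>\<^sub>A\<close>; likewise on terms.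
\<close>

definition NM_hom :: "'u nm \<Rightarrow> 'u nm \<Rightarrow> ('u nmor, 'u ncell) cat" where
  "NM_hom M N = \<lparr>
     Obj = {F. nm_morphism M N F},
     Arr = {\<alpha>. nm_2cell M N \<alpha>},
     Dom = NSrc,
     Cod = NTrg,
     Ident = (\<lambda>F. \<lparr>
       NSrc = F, NTrg = F,
       NCmp = (\<lambda>\<Gamma> \<in> Obj M. Ident N (FO F \<Gamma>)),
       TpCmp = (\<lambda>\<Gamma> \<in> Obj M. \<lambda>A \<in> Obj (Fib (Tp M) \<Gamma>).
         Ident (Fib (Tp N) (FO F \<Gamma>)) (FO (TpF F \<Gamma>) A)),
       TmCmp = (\<lambda>\<Gamma> \<in> Obj M. \<lambda>t \<in> Obj (Fib (Tm M) \<Gamma>).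
         Ident (Fib (Tm N) (FO F \<Gamma>)) (FO (TmF F \<Gamma>) t))\<rparr>),
     Comp = (\<lambda>\<beta> \<alpha>. \<lparr>
       NSrc = NSrc \<alpha>, NTrg = NTrg \<beta>,
       NCmp = (\<lambda>\<Gamma> \<in> Obj M. NCmp \<beta> \<Gamma> \<cdot>\<^bsub>N\<^esub> NCmp \<alpha> \<Gamma>),
       TpCmp = (\<lambda>\<Gamma> \<in> Obj M. \<lambda>A \<in> Obj (Fib (Tp M) \<Gamma>).
         FA (Reix (Tp N) (NCmp \<alpha> \<Gamma>)) (TpCmp \<beta> \<Gamma> A)
           \<cdot>\<^bsub>Fib (Tp N) (FO (NSrc \<alpha>) \<Gamma>)\<^esub> TpCmp \<alpha> \<Gamma> A),
       TmCmp = (\<lambda>\<Gamma> \<in> Obj M. \<lambda>t \<in> Obj (Fib (Tm M) \<Gamma>).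
         FA (Reix (Tm N) (NCmp \<alpha> \<Gamma>)) (TmCmp \<beta> \<Gamma> t)
           \<cdot>\<^bsub>Fib (Tm N) (FO (NSrc \<alpha>) \<Gamma>)\<^esub> TmCmp \<alpha> \<Gamma> t)\<rparr>)\<rparr>"

definition nmor_id :: "'u nm \<Rightarrow> 'u nmor" where
  "nmor_id N = ftr.extend (ftr_id N) \<lparr>
     TpF = (\<lambda>\<Gamma> \<in> Obj N. ftr_id (Fib (Tp N) \<Gamma>)),
     TmF = (\<lambda>\<Gamma> \<in> Obj N. ftr_id (Fib (Tm N) \<Gamma>))\<rparr>"

definition nmor_comp :: "'u nm \<Rightarrow> 'u nmor \<Rightarrow> 'u nmor \<Rightarrow> 'u nmor" where
  "nmor_comp L G F = ftr.extend (ftr_comp L G F) \<lparr>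
     TpF = (\<lambda>\<Gamma> \<in> Obj L. ftr_comp (Fib (Tp L) \<Gamma>) (TpF G (FO F \<Gamma>)) (TpF F \<Gamma>)),
     TmF = (\<lambda>\<Gamma> \<in> Obj L. ftr_comp (Fib (Tm L) \<Gamma>) (TmF G (FO F \<Gamma>)) (TmF F \<Gamma>))\<rparr>"

definition ncell_hcomp :: "'u nm \<Rightarrow> 'u nm \<Rightarrow> 'u ncell \<Rightarrow> 'u ncell \<Rightarrow> 'u ncell" where
  "ncell_hcomp L N \<beta> \<alpha> =
     (let F = NSrc \<alpha>; F' = NTrg \<alpha>; G = NSrc \<beta>; G' = NTrg \<beta> in \<lparr>
       NSrc = nmor_comp L G F,
       NTrg = nmor_comp L G' F',
       NCmp = (\<lambda>\<Gamma> \<in> Obj L. NCmp \<beta> (FO F' \<Gamma>) \<cdot>\<^bsub>N\<^esub> FA G (NCmp \<alpha> \<Gamma>)),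
       TpCmp = (\<lambda>\<Gamma> \<in> Obj L. \<lambda>A \<in> Obj (Fib (Tp L) \<Gamma>).
         FA (Reix (Tp N) (FA G (NCmp \<alpha> \<Gamma>))) (TpCmp \<beta> (FO F' \<Gamma>) (FO (TpF F' \<Gamma>) A))
           \<cdot>\<^bsub>Fib (Tp N) (FO G (FO F \<Gamma>))\<^esub> FA (TpF G (FO F \<Gamma>)) (TpCmp \<alpha> \<Gamma> A)),
       TmCmp = (\<lambda>\<Gamma> \<in> Obj L. \<lambda>t \<in> Obj (Fib (Tm L) \<Gamma>).
         FA (Reix (Tm N) (FA G (NCmp \<alpha> \<Gamma>))) (TmCmp \<beta> (FO F' \<Gamma>) (FO (TmF F' \<Gamma>) t))
           \<cdot>\<^bsub>Fib (Tm N) (FO G (FO F \<Gamma>))\<^esub> FA (TmF G (FO F \<Gamma>)) (TmCmp \<alpha> \<Gamma> t))\<rparr>)"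

definition NM :: "('u nm, 'u nmor, 'u ncell) two_cat" where
  "NM = \<lparr>
     TObj = {N. small_natural_model N},
     THom = NM_hom,
     TId = nmor_id,
     HC1 = (\<lambda>L M N G F. nmor_comp L G F),
     HC2 = (\<lambda>L M N \<beta> \<alpha>. ncell_hcomp L N \<beta> \<alpha>)\<rparr>"

definition NM_U :: "('u nm, 'u nmor, 'u ncell) two_cat" where
  "NM_U = full_sub_2cat NM admits_type_classifier"

definition forgetful :: "('u nm, 'u nmor, 'u ncell, 'u dcat, 'u dftr, 'u dtrans) two_ftr" where
  "forgetful = \<lparr>
     T0 = dcat.truncate,
     T1 = (\<lambda>M N F. ftr.truncate F),
     T2 = (\<lambda>M N \<alpha>. \<lparr>NSrc = ftr.truncate (NSrc \<alpha>), NTrg = ftr.truncate (NTrg \<alpha>), NCmp = NCmp \<alpha>\<rparr>)\<rparr>"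

end

theory Submission
  imports Defs
begin

text \<open>
  For a type \<open>A\<close> with universal element \<open>v\<close> over \<open>\<Gamma>.A\<close>, an arrow of types \<open>f : A \<rightarrow> B\<close> is determined by the term
  of type \<open>B\<close> over \<open>\<Gamma>.A\<close> to which \<open>f\<close> transports \<open>v\<close>, and in a natural model every such term arises: this is full
  faithfulness of comprehension.  The same holds with \<open>(\<Gamma>.A, v)\<close> replaced by any isomorphic pair, in
  particular by \<open>(F(\<Gamma>.A), F v)\<close> for a morphism \<open>F\<close>.  A 2-morphism over \<open>\<alpha>\<close> must transport \<open>F v\<close> to
  \<open>(G v)[\<alpha>]\<close>, so it exists and is unique.

  A display functor \<open>K\<close> lifts because types have codes \<open>x : \<Gamma> \<rightarrow> E\<^sub>0\<close>: it suffices to choose the image of the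
  generic type, up to isomorphism of displays, and to substitute along \<open>K x\<close>.  A universe is a natural model
  whose types and terms are the externalizations of the base and of the total category of the opfibration.
  Conversely, a type classifier is the base of a universe whose total category classifies the terms; its
  objects of objects, arrows and composable pairs are the extensions of the corresponding objects
  of the classifier by the generic type.
\<close>

text \<open>The forgetful 2-functor is hit on the nose: objects and 1-cells lift strictly, and the
  isomorphisms demanded by a 2-equivalence are identities. The obstacle is strictness. Display
  functors preserve pullbacks, and comprehension identifies types with displays, only up to
  isomorphism, whereas the action of a morphism on types must commute with substitution as an
  equation; choosing the image of each type separately would destroy this. A type classifier is
  isomorphic to \<open>Tp\<close> by strict functors, so codes are unique and substitution is
  precomposition, and a single choice spreads to all types coherently. Choices on arrows do no harm:
  the transport condition has exactly one solution, and laws for arrows of types are proved by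
  showing that both sides solve it. Arrows of terms need only their source and their image, as
  typing is a discrete opfibration. The chosen pullback of a display need not be a chosen extension;
  that they are merely isomorphic is a further reason for testing transport on isomorphic
  pairs.\<close>

lemma homI: "f \<in> Arr C \<Longrightarrow> Dom C f = A \<Longrightarrow> Cod C f = B \<Longrightarrow> f \<in> hom C A B"
  by (simp add: hom_def)

lemma homD:
  assumes "f \<in> hom C A B"
  shows "f \<in> Arr C" "Dom C f = A" "Cod C f = B"
  using assms by (auto simp: hom_def)

section \<open>Arrows and isomorphisms of a category\<close>

context category
begin

text \<open>Typing is split into membership in \<open>Arr\<close> and equations for
  \<open>Dom\<close> and \<open>Cod\<close>, which the simplifier can discharge one by one;
  \<open>hom\<close> is unfolded on demand.\<close>

lemma comp_arr [simp]:
  assumes "f \<in> Arr C" "g \<in> Arr C" "Cod C f = Dom C g"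
  shows "g \<cdot> f \<in> Arr C" "Dom C (g \<cdot> f) = Dom C f" "Cod C (g \<cdot> f) = Cod C g"
  using comp_hom[of f "Dom C f" "Cod C f" g "Cod C g"] assms by (auto simp: hom_def)

lemma ident_arr [simp]:
  assumes "A \<in> Obj C"
  shows "Ident C A \<in> Arr C" "Dom C (Ident C A) = A" "Cod C (Ident C A) = A"
  using ident_hom[OF assms] by (auto simp: hom_def)

lemma comp_ident [simp]:
  "f \<in> Arr C \<Longrightarrow> Dom C f = A \<Longrightarrow> f \<cdot> Ident C A = f"
  "f \<in> Arr C \<Longrightarrow> Cod C f = B \<Longrightarrow> Ident C B \<cdot> f = f"
  using comp_ident_right comp_ident_left by (auto simp: hom_def)

lemma assoc_right [simp]:
  assumes "f \<in> Arr C" "g \<in> Arr C" "h \<in> Arr C" "Cod C f = Dom C g" "Cod C g = Dom C h"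
  shows "(h \<cdot> g) \<cdot> f = h \<cdot> (g \<cdot> f)"
  using comp_assoc[of f "Dom C f" "Cod C f" g "Cod C g" h "Cod C h"] assms by (auto simp: hom_def)

lemma dom_obj' [simp]: "f \<in> Arr C \<Longrightarrow> Dom C f \<in> Obj C"
  and cod_obj' [simp]: "f \<in> Arr C \<Longrightarrow> Cod C f \<in> Obj C"
  by (rule dom_obj, assumption, rule cod_obj, assumption)

lemma hom_obj: assumes "f \<in> hom C A B" shows "A \<in> Obj C" "B \<in> Obj C"
  using assms by (auto simp: hom_def)

text \<open>Composites are normalized to the right by \<open>assoc_right\<close>, which hides a
  known equation \<open>p \<cdot> w = u\<close> inside \<open>p \<cdot> (w \<cdot> x)\<close>.
  Instantiated with such an equation, this is the rewrite rule for the normalized form.\<close>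

lemma comp_reduce:
  assumes "p \<cdot> w = u" "w \<in> Arr C" "p \<in> Arr C" "Cod C w = Dom C p" "x \<in> Arr C" "Cod C x = Dom C w"
  shows "p \<cdot> (w \<cdot> x) = u \<cdot> x"
  using assms by (metis assoc_right)

lemma is_isoI:
  assumes "f \<in> hom C A B" "g \<in> hom C B A" "g \<cdot> f = Ident C A" "f \<cdot> g = Ident C B"
  shows "is_iso C f"
  using assms unfolding is_iso_def by (auto simp: hom_def)

lemma is_isoE:
  assumes "is_iso C f" "f \<in> hom C A B"
  obtains g where "g \<in> hom C B A" "g \<cdot> f = Ident C A" "f \<cdot> g = Ident C B" "is_iso C g"
proof -
  from assms obtain g where g: "g \<in> hom C B A" "g \<cdot> f = Ident C A" "f \<cdot> g = Ident C B"
    unfolding is_iso_def by (auto simp: hom_def)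
  with assms show thesis
    by (intro that[of g] is_isoI[of g B A f]) auto
qed

lemma ident_iso: "A \<in> Obj C \<Longrightarrow> is_iso C (Ident C A)"
  by (rule is_isoI[of _ A A "Ident C A"]) (auto simp: hom_def)

lemma iso_comp:
  assumes "is_iso C f" "f \<in> hom C A B" "is_iso C g" "g \<in> hom C B D"
  shows "is_iso C (g \<cdot> f)"
proof -
  obtain f' where f': "f' \<in> hom C B A" "f' \<cdot> f = Ident C A" "f \<cdot> f' = Ident C B"
    by (rule is_isoE[OF assms(1,2)])
  obtain g' where g': "g' \<in> hom C D B" "g' \<cdot> g = Ident C B" "g \<cdot> g' = Ident C D"
    by (rule is_isoE[OF assms(3,4)])
  have a: "g' \<cdot> (g \<cdot> f) = f" "f \<cdot> (f' \<cdot> g') = g'"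
    using assms f' g' by (auto simp: hom_def comp_reduce[OF g'(2)] comp_reduce[OF f'(3)])
  show ?thesis
    by (rule is_isoI[of _ A D "f' \<cdot> g'"]) (use assms f' g' a in \<open>auto simp: hom_def\<close>)
qed

lemma iso_cancel_right:
  assumes "is_iso C i" "i \<in> Arr C" "f \<in> Arr C" "g \<in> Arr C" "Dom C f = Cod C i" "Dom C g = Cod C i"
    and eq: "f \<cdot> i = g \<cdot> i"
  shows "f = g"
proof -
  obtain j where j: "j \<in> hom C (Cod C i) (Dom C i)" "i \<cdot> j = Ident C (Cod C i)"
    by (rule is_isoE[OF assms(1), of "Dom C i" "Cod C i"]) (use assms in \<open>auto simp: hom_def\<close>)
  have "(f \<cdot> i) \<cdot> j = f" "(g \<cdot> i) \<cdot> j = g"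
    using assms(2-6) homD[OF j(1)] j(2) by simp_all
  then show ?thesis using eq by metis
qed

lemma iso_cancel_left:
  assumes "is_iso C i" "i \<in> Arr C" "f \<in> Arr C" "g \<in> Arr C" "Cod C f = Dom C i" "Cod C g = Dom C i"
    and eq: "i \<cdot> f = i \<cdot> g"
  shows "f = g"
proof -
  obtain j where j: "j \<in> hom C (Cod C i) (Dom C i)" "j \<cdot> i = Ident C (Dom C i)"
    by (rule is_isoE[OF assms(1), of "Dom C i" "Cod C i"]) (use assms in \<open>auto simp: hom_def\<close>)
  have "j \<cdot> (i \<cdot> f) = f" "j \<cdot> (i \<cdot> g) = g"
    using assms(2-6) homD[OF j(1)] j(2) by (simp_all add: comp_reduce[OF j(2)])
  then show ?thesis using eq by metis
qed

end

section \<open>Functors and their composition\<close>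

context is_functor
begin

lemma map_arr [simp]:
  assumes "f \<in> Arr C"
  shows "FA F f \<in> Arr D" "Dom D (FA F f) = FO F (Dom C f)" "Cod D (FA F f) = FO F (Cod C f)"
  using arr_map[of f "Dom C f" "Cod C f"] assms by (auto simp: hom_def)

declare obj_map [simp] map_ident [simp]

lemma map_comp' [simp]:
  assumes "f \<in> Arr C" "g \<in> Arr C" "Cod C f = Dom C g"
  shows "FA F (g \<cdot>\<^bsub>C\<^esub> f) = FA F g \<cdot>\<^bsub>D\<^esub> FA F f"
  using map_comp[of f "Dom C f" "Cod C f" g "Cod C g"] assms by (auto simp: hom_def)

lemma map_iso:
  assumes "is_iso C f"
  shows "is_iso D (FA F f)"
proof -
  obtain g where g: "f \<in> Arr C" "g \<in> hom C (Cod C f) (Dom C f)"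
    "g \<cdot>\<^bsub>C\<^esub> f = Ident C (Dom C f)" "f \<cdot>\<^bsub>C\<^esub> g = Ident C (Cod C f)"
    using assms unfolding is_iso_def by auto
  show ?thesis
  proof (rule cod.is_isoI)
    show "FA F f \<in> hom D (FO F (Dom C f)) (FO F (Cod C f))"
      "FA F g \<in> hom D (FO F (Cod C f)) (FO F (Dom C f))"
      using g by (auto intro!: arr_map simp: hom_def)
    show "FA F g \<cdot>\<^bsub>D\<^esub> FA F f = Ident D (FO F (Dom C f))"
      using g map_comp'[of f g] by (auto simp: hom_def simp del: map_comp')
    show "FA F f \<cdot>\<^bsub>D\<^esub> FA F g = Ident D (FO F (Cod C f))"
      using g map_comp'[of g f] by (auto simp: hom_def simp del: map_comp')
  qed
qed

end

lemma ftr_eqI: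
  fixes F G :: "('o, 'm, 'p, 'n) ftr"
  assumes "FO F \<in> extensional A" "FO G \<in> extensional A" "FA F \<in> extensional B" "FA G \<in> extensional B"
    and "\<And>x. x \<in> A \<Longrightarrow> FO F x = FO G x" "\<And>x. x \<in> B \<Longrightarrow> FA F x = FA G x"
  shows "F = G"
  using assms by (auto intro!: ftr.equality extensionalityI)

lemma ftr_id_simps [simp]:
  "A \<in> Obj C \<Longrightarrow> FO (ftr_id C) A = A" "f \<in> Arr C \<Longrightarrow> FA (ftr_id C) f = f"
  "FO (ftr_id C) \<in> extensional (Obj C)" "FA (ftr_id C) \<in> extensional (Arr C)"
  by (auto simp: ftr_id_def)

lemma ftr_comp_simps [simp]:
  "A \<in> Obj C \<Longrightarrow> FO (ftr_comp C G F) A = FO G (FO F A)"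
  "f \<in> Arr C \<Longrightarrow> FA (ftr_comp C G F) f = FA G (FA F f)"
  "FO (ftr_comp C G F) \<in> extensional (Obj C)" "FA (ftr_comp C G F) \<in> extensional (Arr C)"
  by (auto simp: ftr_comp_def)

lemma is_functor_ident: "category C \<Longrightarrow> is_functor C C (ftr_id C)"
proof -
  assume "category C"
  then interpret category C .
  show ?thesis by unfold_locales (auto simp: hom_def)
qed

lemma is_functor_comp:
  assumes "is_functor B C F" "is_functor C D G"
  shows "is_functor B D (ftr_comp B G F)"
proof -
  interpret F: is_functor B C F by fact
  interpret G: is_functor C D G by fact
  show ?thesis by unfold_locales (auto simp: hom_def)
qed

lemma ftr_comp_assoc:
  assumes "is_functor A B F"
  shows "ftr_comp A H (ftr_comp A G F) = ftr_comp A (ftr_comp B H G) F"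
proof -
  interpret is_functor A B F by fact
  show ?thesis by (rule ftr_eqI[where A="Obj A" and B="Arr A"]) auto
qed

lemma ftr_comp_ident_right:
  assumes "is_functor C D (F :: ('o, 'm, 'p, 'n) ftr)"
  shows "ftr_comp C F (ftr_id C) = F" "ftr_comp C (ftr_id D) F = F"
proof -
  interpret is_functor C D F by fact
  show "ftr_comp C F (ftr_id C) = F" "ftr_comp C (ftr_id D) F = F"
    by (rule ftr_eqI[where A="Obj C" and B="Arr C"]; simp add: obj_ext arr_ext)+
qed

section \<open>Equivalences of categories\<close>

text \<open>A fully faithful and essentially surjective functor has a quasi-inverse, by choice. This
  spares the explicit inverse functor and natural isomorphisms that \<open>is_equivalence\<close>
  asks for.\<close>

lemma is_equivalenceI:
  fixes C :: "('o, 'm, 'x) cat_scheme" and D :: "('p, 'n, 'y) cat_scheme"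
  assumes F: "is_functor C D F"
    and faithful: "\<And>A B f g. \<lbrakk>f \<in> hom C A B; g \<in> hom C A B; FA F f = FA F g\<rbrakk> \<Longrightarrow> f = g"
    and full: "\<And>A B k. \<lbrakk>A \<in> Obj C; B \<in> Obj C; k \<in> hom D (FO F A) (FO F B)\<rbrakk> \<Longrightarrow>
      \<exists>f \<in> hom C A B. FA F f = k"
    and ess_surj: "\<And>X. X \<in> Obj D \<Longrightarrow> \<exists>A \<in> Obj C. isomorphic D (FO F A) X"
  shows "is_equivalence C D F"
proof -
  interpret is_functor C D F by fact
  obtain G0 where G0: "\<And>X. X \<in> Obj D \<Longrightarrow> G0 X \<in> Obj C \<and> isomorphic D (FO F (G0 X)) X"
    using ess_surj by metis
  then obtain e where e: "\<And>X. X \<in> Obj D \<Longrightarrow> e X \<in> hom D (FO F (G0 X)) X \<and> is_iso D (e X)"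
    unfolding isomorphic_def by metis
  then have "\<forall>X. \<exists>d. X \<in> Obj D \<longrightarrow> d \<in> hom D X (FO F (G0 X)) \<and>
      d \<cdot>\<^bsub>D\<^esub> e X = Ident D (FO F (G0 X)) \<and> e X \<cdot>\<^bsub>D\<^esub> d = Ident D X \<and> is_iso D d"
    by (metis cod.is_isoE)
  then obtain d where d: "\<And>X. X \<in> Obj D \<Longrightarrow> d X \<in> hom D X (FO F (G0 X)) \<and>
      d X \<cdot>\<^bsub>D\<^esub> e X = Ident D (FO F (G0 X)) \<and> e X \<cdot>\<^bsub>D\<^esub> d X = Ident D X \<and> is_iso D (d X)"
    by metis
  note [simp] = homD[OF conjunct1[OF e]] homD[OF conjunct1[OF d]] conjunct1[OF G0]
    conjunct1[OF conjunct2[OF d]] conjunct1[OF conjunct2[OF conjunct2[OF d]]]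
  have red [simp]: "X \<in> Obj D \<Longrightarrow> x \<in> Arr D \<Longrightarrow> Cod D x = X \<Longrightarrow> e X \<cdot>\<^bsub>D\<^esub> (d X \<cdot>\<^bsub>D\<^esub> x) = x"
    "X \<in> Obj D \<Longrightarrow> x \<in> Arr D \<Longrightarrow> Cod D x = FO F (G0 X) \<Longrightarrow> d X \<cdot>\<^bsub>D\<^esub> (e X \<cdot>\<^bsub>D\<^esub> x) = x" for X x
    using d[of X] e[of X] cod.comp_reduce[of "e X" "d X" "Ident D X" x]
      cod.comp_reduce[of "d X" "e X" "Ident D (FO F (G0 X))" x]
    by (auto simp: hom_def)
  \<comment> \<open>A preimage under fullness. Faithfulness makes it unique, so equations between
    lifts may be checked after applying \<open>F\<close>.\<close>
  define lift where "lift A B k = (SOME f. f \<in> hom C A B \<and> FA F f = k)" for A B k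
  have lift: "lift A B k \<in> hom C A B \<and> FA F (lift A B k) = k"
    if "A \<in> Obj C" "B \<in> Obj C" "k \<in> hom D (FO F A) (FO F B)" for A B k
    unfolding lift_def by (rule someI_ex) (use full[OF that] in blast)
  \<comment> \<open>The arrow \<open>k\<close> is conjugated by the chosen isomorphisms
    \<open>e\<close> and \<open>d\<close> into an arrow between objects in the image of
    \<open>F\<close>, and then lifted.\<close>
  define G where "G = \<lparr>FO = (\<lambda>X \<in> Obj D. G0 X),
     FA = (\<lambda>k \<in> Arr D. lift (G0 (Dom D k)) (G0 (Cod D k)) (d (Cod D k) \<cdot>\<^bsub>D\<^esub> (k \<cdot>\<^bsub>D\<^esub> e (Dom D k))))\<rparr>"
  have GO [simp]: "X \<in> Obj D \<Longrightarrow> FO G X = G0 X" for X by (simp add: G_def)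
  have GA: "FA G k \<in> hom C (G0 (Dom D k)) (G0 (Cod D k)) \<and>
      FA F (FA G k) = d (Cod D k) \<cdot>\<^bsub>D\<^esub> (k \<cdot>\<^bsub>D\<^esub> e (Dom D k))" if "k \<in> Arr D" for k
    using that lift[of "G0 (Dom D k)" "G0 (Cod D k)" "d (Cod D k) \<cdot>\<^bsub>D\<^esub> (k \<cdot>\<^bsub>D\<^esub> e (Dom D k))"]
    by (auto simp: G_def hom_def)
  note [simp] = homD[OF conjunct1[OF GA]] conjunct2[OF GA]
  have FG: "is_functor D C G"
  proof unfold_locales
    fix X assume X: "X \<in> Obj D"
    show "FA G (Ident D X) = Ident C (FO G X)"
      by (rule faithful[of _ "G0 X" "G0 X"]) (use X in \<open>auto simp: hom_def\<close>)
  next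
    fix f X Y g Z assume fg: "f \<in> hom D X Y" "g \<in> hom D Y Z"
    show "FA G (g \<cdot>\<^bsub>D\<^esub> f) = FA G g \<cdot>\<^bsub>C\<^esub> FA G f"
      by (rule faithful[of _ "G0 X" "G0 Z"]) (use fg in \<open>auto simp: hom_def\<close>)
  next
    show "FO G \<in> extensional (Obj D)" "FA G \<in> extensional (Arr D)" by (simp_all add: G_def)
  qed (auto simp: hom_def)
  then interpret G: is_functor D C G .
  \<comment> \<open>\<open>d (FO F A)\<close> goes from \<open>FO F A\<close> to
    \<open>FO F (G0 (FO F A))\<close>, so fullness turns it into an arrow out of \<open>A\<close>;
    the lift of \<open>e\<close> is its inverse.\<close>
  define \<eta> where "\<eta> = (\<lambda>A \<in> Obj C. lift A (G0 (FO F A)) (d (FO F A)))"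
  have \<eta>: "\<eta> A \<in> hom C A (G0 (FO F A)) \<and> FA F (\<eta> A) = d (FO F A)" if "A \<in> Obj C" for A
    using that lift[of A "G0 (FO F A)" "d (FO F A)"] d[of "FO F A"] by (auto simp: \<eta>_def)
  define \<eta>' where "\<eta>' A = lift (G0 (FO F A)) A (e (FO F A))" for A
  have \<eta>': "\<eta>' A \<in> hom C (G0 (FO F A)) A \<and> FA F (\<eta>' A) = e (FO F A)" if "A \<in> Obj C" for A
    using that lift[of "G0 (FO F A)" A "e (FO F A)"] e[of "FO F A"] by (auto simp: \<eta>'_def)
  note [simp] = homD[OF conjunct1[OF \<eta>]] conjunct2[OF \<eta>] homD[OF conjunct1[OF \<eta>']] conjunct2[OF \<eta>']
  have "is_nat_iso C C (ftr_id C) (ftr_comp C G F) \<eta>"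
    unfolding is_nat_iso_def is_nat_def
  proof (intro conjI ballI)
    fix f assume f: "f \<in> Arr C"
    show "FA (ftr_comp C G F) f \<cdot>\<^bsub>C\<^esub> \<eta> (Dom C f) = \<eta> (Cod C f) \<cdot>\<^bsub>C\<^esub> FA (ftr_id C) f"
      by (rule faithful[of _ "Dom C f" "G0 (FO F (Cod C f))"]) (use f in \<open>auto simp: hom_def\<close>)
  next
    fix A assume A: "A \<in> Obj C"
    show "is_iso C (\<eta> A)"
    proof (rule dom.is_isoI)
      show "\<eta> A \<in> hom C A (G0 (FO F A))" "\<eta>' A \<in> hom C (G0 (FO F A)) A" using \<eta> \<eta>' A by auto
      show "\<eta>' A \<cdot>\<^bsub>C\<^esub> \<eta> A = Ident C A"
        by (rule faithful[of _ A A]) (use A in \<open>auto simp: hom_def\<close>)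
      show "\<eta> A \<cdot>\<^bsub>C\<^esub> \<eta>' A = Ident C (G0 (FO F A))"
        by (rule faithful[of _ "G0 (FO F A)" "G0 (FO F A)"]) (use A in \<open>auto simp: hom_def\<close>)
    qed
  next
    fix A assume A: "A \<in> Obj C"
    then show "\<eta> A \<in> hom C (FO (ftr_id C) A) (FO (ftr_comp C G F) A)" using \<eta>[OF A] by simp
  qed (simp add: \<eta>_def)
  moreover have "is_nat_iso D D (ftr_comp D F G) (ftr_id D) (\<lambda>X \<in> Obj D. e X)"
    unfolding is_nat_iso_def is_nat_def
  proof (intro conjI ballI)
    fix f assume f: "f \<in> Arr D"
    show "FA (ftr_id D) f \<cdot>\<^bsub>D\<^esub> restrict e (Obj D) (Dom D f)
        = restrict e (Obj D) (Cod D f) \<cdot>\<^bsub>D\<^esub> FA (ftr_comp D F G) f"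
      using f by simp
  next
    fix X assume X: "X \<in> Obj D"
    then show "restrict e (Obj D) X \<in> hom D (FO (ftr_comp D F G) X) (FO (ftr_id D) X)"
      "is_iso D (restrict e (Obj D) X)" using e[OF X] by simp_all
  qed simp
  ultimately show ?thesis unfolding is_equivalence_def using F FG by blast
qed

text \<open>Faithfulness holds because \<open>\<eta>\<close> is natural and invertible. The same
  argument with \<open>\<epsilon>\<close> makes the inverse \<open>G\<close> faithful, and fullness
  of \<open>F\<close> rests on that.\<close>

lemma is_equivalenceD:
  fixes C :: "('o, 'm, 'x) cat_scheme" and D :: "('p, 'n, 'y) cat_scheme"
  assumes eq: "is_equivalence C D F"
  shows "is_functor C D F"
    and "\<And>A B f g. \<lbrakk>f \<in> hom C A B; g \<in> hom C A B; FA F f = FA F g\<rbrakk> \<Longrightarrow> f = g"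
    and "\<And>A B k. \<lbrakk>A \<in> Obj C; B \<in> Obj C; k \<in> hom D (FO F A) (FO F B)\<rbrakk> \<Longrightarrow>
      \<exists>f \<in> hom C A B. FA F f = k"
    and "\<And>X. X \<in> Obj D \<Longrightarrow> \<exists>A \<in> Obj C. isomorphic D (FO F A) X"
proof -
  show F: "is_functor C D F" using eq by (simp add: is_equivalence_def)
  interpret is_functor C D F by fact
  obtain G :: "('p, 'n, 'o, 'm) ftr" and \<eta> \<epsilon> where FG: "is_functor D C G"
    and \<eta>: "is_nat_iso C C (ftr_id C) (ftr_comp C G F) \<eta>"
    and \<epsilon>: "is_nat_iso D D (ftr_comp D F G) (ftr_id D) \<epsilon>"
    using eq unfolding is_equivalence_def by blast
  interpret G: is_functor D C G by fact
  have \<eta>_iso: "is_iso C (\<eta> A)" and \<eta>_hom: "\<eta> A \<in> hom C A (FO G (FO F A))" if "A \<in> Obj C" for A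
    using \<eta> that by (auto simp: is_nat_iso_def is_nat_def)
  have \<epsilon>_iso: "is_iso D (\<epsilon> X)" and \<epsilon>_hom: "\<epsilon> X \<in> hom D (FO F (FO G X)) X" if "X \<in> Obj D" for X
    using \<epsilon> that by (auto simp: is_nat_iso_def is_nat_def)
  note [simp] = homD[OF \<eta>_hom] homD[OF \<epsilon>_hom]
  have \<eta>_nat: "FA G (FA F f) \<cdot>\<^bsub>C\<^esub> \<eta> (Dom C f) = \<eta> (Cod C f) \<cdot>\<^bsub>C\<^esub> f" if "f \<in> Arr C" for f
    using \<eta> that by (auto simp: is_nat_iso_def is_nat_def)
  have \<epsilon>_nat: "f \<cdot>\<^bsub>D\<^esub> \<epsilon> (Dom D f) = \<epsilon> (Cod D f) \<cdot>\<^bsub>D\<^esub> FA F (FA G f)" if "f \<in> Arr D" for f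
    using \<epsilon> that by (auto simp: is_nat_iso_def is_nat_def)
  show "f = g" if fg: "f \<in> hom C A B" "g \<in> hom C A B" "FA F f = FA F g" for A B f g
    by (rule dom.iso_cancel_left[of "\<eta> B"])
      (use fg \<eta>_nat[of f] \<eta>_nat[of g] in \<open>auto simp: hom_def \<eta>_iso\<close>)
  have G_faithful: "k = l" if kl: "k \<in> hom D X Y" "l \<in> hom D X Y" "FA G k = FA G l" for X Y k l
    by (rule cod.iso_cancel_right[of "\<epsilon> X"])
      (use kl \<epsilon>_nat[of k] \<epsilon>_nat[of l] in \<open>auto simp: hom_def \<epsilon>_iso\<close>)
  show "\<exists>f \<in> hom C A B. FA F f = k" if AB: "A \<in> Obj C" "B \<in> Obj C" and k: "k \<in> hom D (FO F A) (FO F B)"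
    for A B k
  proof -
    obtain j where j: "j \<in> hom C (FO G (FO F B)) B" "\<eta> B \<cdot>\<^bsub>C\<^esub> j = Ident C (FO G (FO F B))"
      using \<eta>_iso \<eta>_hom AB by (metis dom.is_isoE)
    \<comment> \<open>With \<open>j\<close> inverse to \<open>\<eta> B\<close>, naturality of
      \<open>\<eta>\<close> leaves only this candidate. It is sent to \<open>k\<close> because both
      have the same image under the faithful \<open>G\<close>.\<close>
    define f where "f = j \<cdot>\<^bsub>C\<^esub> (FA G k \<cdot>\<^bsub>C\<^esub> \<eta> A)"
    have f: "f \<in> hom C A B" using j k AB by (auto simp: f_def hom_def)
    have "\<eta> B \<cdot>\<^bsub>C\<^esub> f = FA G k \<cdot>\<^bsub>C\<^esub> \<eta> A"
      unfolding f_def using j k AB by (auto simp: hom_def dom.comp_reduce[OF j(2)])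
    then have "FA G (FA F f) \<cdot>\<^bsub>C\<^esub> \<eta> A = FA G k \<cdot>\<^bsub>C\<^esub> \<eta> A"
      using \<eta>_nat[of f] f by (auto simp: hom_def)
    then have "FA G (FA F f) = FA G k"
      by (rule dom.iso_cancel_right[of "\<eta> A", rotated 6]) (use AB f k in \<open>auto simp: hom_def \<eta>_iso\<close>)
    then have "FA F f = k" by (rule G_faithful[of _ "FO F A" "FO F B", rotated 2]) (use f k in \<open>auto simp: hom_def\<close>)
    with f show ?thesis by blast
  qed
  show "\<exists>A \<in> Obj C. isomorphic D (FO F A) X" if "X \<in> Obj D" for X
    using that \<epsilon>_iso[OF that] \<epsilon>_hom[OF that] by (auto simp: isomorphic_def intro!: bexI[of _ "FO G X"])
qed

section \<open>Pullbacks\<close>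

lemma pullback_squareD:
  assumes "pullback_square C f p p' q"
  shows "f \<in> Arr C" "p \<in> Arr C" "p' \<in> Arr C" "q \<in> Arr C" "Cod C f = Cod C p" "Dom C q = Dom C p'"
    "Cod C p' = Dom C f" "Cod C q = Dom C p" "f \<cdot>\<^bsub>C\<^esub> p' = p \<cdot>\<^bsub>C\<^esub> q"
  using assms by (auto simp: pullback_square_def)

lemma pullback_universal:
  assumes "pullback_square C f p p' q" "a \<in> hom C X (Dom C f)" "b \<in> hom C X (Dom C p)"
    "f \<cdot>\<^bsub>C\<^esub> a = p \<cdot>\<^bsub>C\<^esub> b"
  shows "\<exists>!h. h \<in> hom C X (Dom C p') \<and> p' \<cdot>\<^bsub>C\<^esub> h = a \<and> q \<cdot>\<^bsub>C\<^esub> h = b"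
proof -
  have a: "a \<in> Arr C" "b \<in> Arr C" "Dom C a = X"
    "Dom C a = Dom C b \<and> Cod C a = Dom C f \<and> Cod C b = Dom C p \<and> f \<cdot>\<^bsub>C\<^esub> a = p \<cdot>\<^bsub>C\<^esub> b"
    using assms by (auto simp: hom_def)
  show ?thesis
    using assms(1) a(1,2,4) unfolding pullback_square_def a(3)[symmetric] by blast
qed

lemma pairing:
  assumes "pullback_square C f p p' q" "a \<in> hom C X (Dom C f)" "b \<in> hom C X (Dom C p)"
    "f \<cdot>\<^bsub>C\<^esub> a = p \<cdot>\<^bsub>C\<^esub> b"
  shows "pairing C p' q a b \<in> hom C X (Dom C p')" "p' \<cdot>\<^bsub>C\<^esub> pairing C p' q a b = a"
    "q \<cdot>\<^bsub>C\<^esub> pairing C p' q a b = b"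
proof -
  have "Dom C a = X" using assms by (simp add: hom_def)
  with theI'[OF pullback_universal[OF assms]]
  show "pairing C p' q a b \<in> hom C X (Dom C p')" "p' \<cdot>\<^bsub>C\<^esub> pairing C p' q a b = a"
    "q \<cdot>\<^bsub>C\<^esub> pairing C p' q a b = b"
    by (simp_all add: pairing_def)
qed

lemma pairing_unique:
  assumes "pullback_square C f p p' q" "h \<in> hom C X (Dom C p')" "category C"
  shows "pairing C p' q (p' \<cdot>\<^bsub>C\<^esub> h) (q \<cdot>\<^bsub>C\<^esub> h) = h"
proof -
  interpret category C by fact
  note P = pullback_squareD[OF assms(1)]
  have "f \<cdot>\<^bsub>C\<^esub> (p' \<cdot>\<^bsub>C\<^esub> h) = p \<cdot>\<^bsub>C\<^esub> (q \<cdot>\<^bsub>C\<^esub> h)"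
    using P assms(2) comp_reduce[OF P(9), of h] by (simp add: hom_def)
  with P assms(2) have U: "\<exists>!k. k \<in> hom C X (Dom C p') \<and> p' \<cdot>\<^bsub>C\<^esub> k = p' \<cdot>\<^bsub>C\<^esub> h \<and> q \<cdot>\<^bsub>C\<^esub> k = q \<cdot>\<^bsub>C\<^esub> h"
    by (intro pullback_universal[OF assms(1)]) (auto simp: hom_def)
  have X: "Dom C (p' \<cdot>\<^bsub>C\<^esub> h) = X" using P assms(2) by (simp add: hom_def)
  show ?thesis unfolding pairing_def X by (rule the1_equality[OF U]) (use assms(2) in auto)
qed

lemma pullback_eqI:
  assumes "pullback_square C f p p' q" "h \<in> hom C X (Dom C p')" "k \<in> hom C X (Dom C p')" "category C"
    "p' \<cdot>\<^bsub>C\<^esub> h = p' \<cdot>\<^bsub>C\<^esub> k" "q \<cdot>\<^bsub>C\<^esub> h = q \<cdot>\<^bsub>C\<^esub> k"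
  shows "h = k"
  using pairing_unique[OF assms(1,2,4)] pairing_unique[OF assms(1,3,4)] assms(5,6) by metis

lemma pullback_squareI:
  assumes "category C" "f \<in> hom C A B" "p \<in> hom C E B" "p' \<in> hom C P A" "q \<in> hom C P E"
    "f \<cdot>\<^bsub>C\<^esub> p' = p \<cdot>\<^bsub>C\<^esub> q"
    and ex: "\<And>X a b. \<lbrakk>a \<in> hom C X A; b \<in> hom C X E; f \<cdot>\<^bsub>C\<^esub> a = p \<cdot>\<^bsub>C\<^esub> b\<rbrakk> \<Longrightarrow>
      \<exists>h \<in> hom C X P. p' \<cdot>\<^bsub>C\<^esub> h = a \<and> q \<cdot>\<^bsub>C\<^esub> h = b"
    and un: "\<And>X h k. \<lbrakk>h \<in> hom C X P; k \<in> hom C X P; p' \<cdot>\<^bsub>C\<^esub> h = p' \<cdot>\<^bsub>C\<^esub> k; q \<cdot>\<^bsub>C\<^esub> h = q \<cdot>\<^bsub>C\<^esub> k\<rbrakk> \<Longrightarrow> h = k"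
  shows "pullback_square C f p p' q"
  unfolding pullback_square_def
proof (intro conjI ballI impI)
  fix a b assume ab: "a \<in> Arr C" "b \<in> Arr C"
    "Dom C a = Dom C b \<and> Cod C a = Dom C f \<and> Cod C b = Dom C p \<and> f \<cdot>\<^bsub>C\<^esub> a = p \<cdot>\<^bsub>C\<^esub> b"
  then obtain h where "h \<in> hom C (Dom C a) P" "p' \<cdot>\<^bsub>C\<^esub> h = a" "q \<cdot>\<^bsub>C\<^esub> h = b"
    using ex[of a "Dom C a" b] assms(2-5) by (auto simp: hom_def)
  moreover have "Dom C p' = P" using assms(4) by (simp add: hom_def)
  ultimately show "\<exists>!h. h \<in> hom C (Dom C a) (Dom C p') \<and> p' \<cdot>\<^bsub>C\<^esub> h = a \<and> q \<cdot>\<^bsub>C\<^esub> h = b"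
    by (intro ex1I[of _ h]) (auto intro: un)
qed (use assms in \<open>auto simp: hom_def\<close>)

section \<open>The 2-category of display categories\<close>

lemma is_natD:
  assumes "is_nat C D F G \<alpha>"
  shows "\<alpha> \<in> extensional (Obj C)"
    and "A \<in> Obj C \<Longrightarrow> \<alpha> A \<in> Arr D" "A \<in> Obj C \<Longrightarrow> Dom D (\<alpha> A) = FO F A"
    "A \<in> Obj C \<Longrightarrow> Cod D (\<alpha> A) = FO G A"
    and "f \<in> Arr C \<Longrightarrow> FA G f \<cdot>\<^bsub>D\<^esub> \<alpha> (Dom C f) = \<alpha> (Cod C f) \<cdot>\<^bsub>D\<^esub> FA F f"
  using assms by (auto simp: is_nat_def hom_def)

lemma is_nat_ident:
  assumes "is_functor C D F"
  shows "is_nat C D F F (\<lambda>A \<in> Obj C. Ident D (FO F A))"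
proof -
  interpret is_functor C D F by fact
  show ?thesis by (auto simp: is_nat_def hom_def)
qed

lemma is_nat_vcomp:
  assumes "is_functor C D F" "is_functor C D G" "is_functor C D H" "is_nat C D F G \<alpha>" "is_nat C D G H \<beta>"
  shows "is_nat C D F H (\<lambda>A \<in> Obj C. \<beta> A \<cdot>\<^bsub>D\<^esub> \<alpha> A)"
proof -
  interpret F: is_functor C D F by fact
  interpret G: is_functor C D G by fact
  interpret H: is_functor C D H by fact
  note [simp] = is_natD[OF assms(4)] is_natD[OF assms(5)]
  show ?thesis unfolding is_nat_def
  proof (intro conjI ballI)
    fix f assume f: "f \<in> Arr C"
    have "FA H f \<cdot>\<^bsub>D\<^esub> (\<beta> (Dom C f) \<cdot>\<^bsub>D\<^esub> \<alpha> (Dom C f)) = (\<beta> (Cod C f) \<cdot>\<^bsub>D\<^esub> FA G f) \<cdot>\<^bsub>D\<^esub> \<alpha> (Dom C f)"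
      using f is_natD(5)[OF assms(5) f] F.cod.comp_reduce[of "FA H f" "\<beta> (Dom C f)" _ "\<alpha> (Dom C f)"] by simp
    also have "\<dots> = \<beta> (Cod C f) \<cdot>\<^bsub>D\<^esub> (\<alpha> (Cod C f) \<cdot>\<^bsub>D\<^esub> FA F f)"
      using f is_natD(5)[OF assms(4) f] by simp
    finally show "FA H f \<cdot>\<^bsub>D\<^esub> (\<lambda>A\<in>Obj C. \<beta> A \<cdot>\<^bsub>D\<^esub> \<alpha> A) (Dom C f) =
         (\<lambda>A\<in>Obj C. \<beta> A \<cdot>\<^bsub>D\<^esub> \<alpha> A) (Cod C f) \<cdot>\<^bsub>D\<^esub> FA F f"
      using f by simp
  qed (simp_all add: hom_def)
qed

lemma is_nat_hcomp:
  assumes "is_functor B C F" "is_functor B C F'" "is_functor C D G" "is_functor C D G'"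
    "is_nat B C F F' \<alpha>" "is_nat C D G G' \<beta>"
  shows "is_nat B D (ftr_comp B G F) (ftr_comp B G' F') (\<lambda>X \<in> Obj B. \<beta> (FO F' X) \<cdot>\<^bsub>D\<^esub> FA G (\<alpha> X))"
proof -
  interpret F: is_functor B C F by fact
  interpret F': is_functor B C F' by fact
  interpret G: is_functor C D G by fact
  interpret G': is_functor C D G' by fact
  note [simp] = is_natD(1-4)[OF assms(5)] is_natD(1-4)[OF assms(6)]
  show ?thesis unfolding is_nat_def
  proof (intro conjI ballI)
    fix f assume f: "f \<in> Arr B"
    \<comment> \<open>Naturality of \<open>\<beta>\<close> at \<open>FA F' f\<close> comes first;
      naturality of \<open>\<alpha>\<close> is then used under \<open>G\<close>.\<close>
    have "FA G' (FA F' f) \<cdot>\<^bsub>D\<^esub> (\<beta> (FO F' (Dom B f)) \<cdot>\<^bsub>D\<^esub> FA G (\<alpha> (Dom B f)))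
        = \<beta> (FO F' (Cod B f)) \<cdot>\<^bsub>D\<^esub> FA G (FA F' f \<cdot>\<^bsub>C\<^esub> \<alpha> (Dom B f))"
      using f is_natD(5)[OF assms(6), of "FA F' f"]
        G.cod.comp_reduce[of "FA G' (FA F' f)" "\<beta> (FO F' (Dom B f))" _ "FA G (\<alpha> (Dom B f))"] by simp
    also have "\<dots> = \<beta> (FO F' (Cod B f)) \<cdot>\<^bsub>D\<^esub> FA G (\<alpha> (Cod B f) \<cdot>\<^bsub>C\<^esub> FA F f)"
      using is_natD(5)[OF assms(5) f] by simp
    finally show "FA (ftr_comp B G' F') f \<cdot>\<^bsub>D\<^esub> (\<lambda>X\<in>Obj B. \<beta> (FO F' X) \<cdot>\<^bsub>D\<^esub> FA G (\<alpha> X)) (Dom B f) =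
         (\<lambda>X\<in>Obj B. \<beta> (FO F' X) \<cdot>\<^bsub>D\<^esub> FA G (\<alpha> X)) (Cod B f) \<cdot>\<^bsub>D\<^esub> FA (ftr_comp B G F) f"
      using f by simp
  qed (simp_all add: hom_def)
qed

lemma display_functor_ident: "display_category C \<Longrightarrow> display_functor C C (ftr_id C)"
proof -
  assume "display_category C"
  then interpret display_category C .
  interpret is_functor C C "ftr_id C" by (rule is_functor_ident) unfold_locales
  show ?thesis
  proof
    show "FA (ftr_id C) p \<in> Disp C" if "p \<in> Disp C" for p
      using that by (simp add: disp_arr)
    show "pullback_square C (FA (ftr_id C) f) (FA (ftr_id C) p) (FA (ftr_id C) p') (FA (ftr_id C) q)"
      if "pullback_square C f p p' q" for f p p' q
      using that pullback_squareD[OF that] by simp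
  qed
qed

lemma display_functor_comp:
  assumes "display_functor B C F" "display_functor C D G"
  shows "display_functor B D (ftr_comp B G F)"
proof -
  interpret F: display_functor B C F by fact
  interpret G: display_functor C D G by fact
  interpret is_functor B D "ftr_comp B G F"
    by (rule is_functor_comp[OF F.is_functor_axioms G.is_functor_axioms])
  show ?thesis
  proof
    show "FA (ftr_comp B G F) p \<in> Disp D" if "p \<in> Disp B" for p
      using that by (simp add: F.dom.disp_arr F.map_disp G.map_disp)
    show "pullback_square D (FA (ftr_comp B G F) f) (FA (ftr_comp B G F) p)
        (FA (ftr_comp B G F) p') (FA (ftr_comp B G F) q)"
      if "p \<in> Disp B" "pullback_square B f p p' q" for f p p' q
      using G.map_pullback[OF F.map_disp F.map_pullback] that pullback_squareD[OF that(2)] by simp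
  qed
qed

lemma DC_simps [simp]:
  "A \<in> TObj DC \<longleftrightarrow> display_category A \<and> small_cat A"
  "THom DC A B = DC_hom A B" "TId DC A = ftr_id A" "HC1 DC A B C G F = ftr_comp A G F"
  "HC2 DC A B C \<beta> \<alpha> = \<lparr>
       NSrc = ftr_comp A (NSrc \<beta>) (NSrc \<alpha>),
       NTrg = ftr_comp A (NTrg \<beta>) (NTrg \<alpha>),
       NCmp = (\<lambda>X \<in> Obj A. NCmp \<beta> (FO (NTrg \<alpha>) X) \<cdot>\<^bsub>C\<^esub> FA (NSrc \<beta>) (NCmp \<alpha> X))\<rparr>"
  by (auto simp: DC_def)

lemma DC_hom_simps [simp]:
  "F \<in> Obj (DC_hom C D) \<longleftrightarrow> display_functor C D F"
  "\<alpha> \<in> Arr (DC_hom C D) \<longleftrightarrow> display_functor C D (NSrc \<alpha>) \<and> display_functor C D (NTrg \<alpha>) \<and>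
     is_nat C D (NSrc \<alpha>) (NTrg \<alpha>) (NCmp \<alpha>)"
  "Dom (DC_hom C D) = NSrc" "Cod (DC_hom C D) = NTrg"
  "Ident (DC_hom C D) F = \<lparr>NSrc = F, NTrg = F, NCmp = (\<lambda>A \<in> Obj C. Ident D (FO F A))\<rparr>"
  "\<beta> \<cdot>\<^bsub>DC_hom C D\<^esub> \<alpha> = \<lparr>NSrc = NSrc \<alpha>, NTrg = NTrg \<beta>,
                    NCmp = (\<lambda>A \<in> Obj C. NCmp \<beta> A \<cdot>\<^bsub>D\<^esub> NCmp \<alpha> A)\<rparr>"
  by (auto simp: DC_hom_def)

lemma display_functorD:
  assumes "display_functor C D F"
  shows "is_functor C D F" "display_category C" "display_category D" "category C" "category D"
  using assms by (auto simp: display_functor_def is_functor_def)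

lemma dtrans_eqI:
  fixes \<alpha> \<beta> :: "('f, 'o, 'n) ntrans"
  assumes "NSrc \<alpha> = NSrc \<beta>" "NTrg \<alpha> = NTrg \<beta>" "NCmp \<alpha> \<in> extensional A" "NCmp \<beta> \<in> extensional A"
    "\<And>x. x \<in> A \<Longrightarrow> NCmp \<alpha> x = NCmp \<beta> x"
  shows "\<alpha> = \<beta>"
  using assms by (auto intro!: ntrans.equality extensionalityI)

lemma DC_hom_category:
  assumes "display_category C" "display_category D"
  shows "category (DC_hom C D)"
proof -
  interpret C: display_category C by fact
  interpret D: display_category D by fact
  have nat: "NCmp \<alpha> \<in> extensional (Obj C)"
    "A \<in> Obj C \<Longrightarrow> NCmp \<alpha> A \<in> Arr D" "A \<in> Obj C \<Longrightarrow> Dom D (NCmp \<alpha> A) = FO (NSrc \<alpha>) A"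
    "A \<in> Obj C \<Longrightarrow> Cod D (NCmp \<alpha> A) = FO (NTrg \<alpha>) A"
    if "is_nat C D (NSrc \<alpha>) (NTrg \<alpha>) (NCmp \<alpha>)" for \<alpha> :: "'a dtrans" and A
    using is_natD[OF that] by auto
  have obj: "FO F A \<in> Obj D" if "display_functor C D F" "A \<in> Obj C" for F :: "'a dftr" and A
    using is_functor.obj_map[OF display_functorD(1)[OF that(1)] that(2)] .
  show ?thesis
  proof
    fix F assume "F \<in> Obj (DC_hom C D)"
    then show "Ident (DC_hom C D) F \<in> hom (DC_hom C D) F F"
      by (simp add: hom_def is_nat_ident display_functorD)
  next
    fix \<alpha> F G \<beta> H assume "\<alpha> \<in> hom (DC_hom C D) F G" "\<beta> \<in> hom (DC_hom C D) G H"
    then show "\<beta> \<cdot>\<^bsub>DC_hom C D\<^esub> \<alpha> \<in> hom (DC_hom C D) F H"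
      by (auto simp: hom_def display_functorD intro!: is_nat_vcomp)
  next
    fix \<alpha> F G \<beta> H \<gamma> K assume "\<alpha> \<in> hom (DC_hom C D) F G" "\<beta> \<in> hom (DC_hom C D) G H" "\<gamma> \<in> hom (DC_hom C D) H K"
    then show "\<gamma> \<cdot>\<^bsub>DC_hom C D\<^esub> (\<beta> \<cdot>\<^bsub>DC_hom C D\<^esub> \<alpha>) = \<gamma> \<cdot>\<^bsub>DC_hom C D\<^esub> \<beta> \<cdot>\<^bsub>DC_hom C D\<^esub> \<alpha>"
      by (intro dtrans_eqI[where A="Obj C"]) (auto simp: hom_def nat)
  next
    fix \<alpha> F G assume "\<alpha> \<in> hom (DC_hom C D) F G"
    then show "\<alpha> \<cdot>\<^bsub>DC_hom C D\<^esub> Ident (DC_hom C D) F = \<alpha>" "Ident (DC_hom C D) G \<cdot>\<^bsub>DC_hom C D\<^esub> \<alpha> = \<alpha>"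
      by (intro dtrans_eqI[where A="Obj C"]; auto simp: hom_def nat)+
  qed auto
qed

lemma DC_strict_2_category: "strict_2_category (DC :: ('u dcat, 'u dftr, 'u dtrans) two_cat)"
proof -
  \<comment> \<open>The cells below are bound variables, so the laws for functors and
    transformations are collected with explicit \<open>C\<close> and \<open>D\<close> instead of
    interpreting a locale for each cell.\<close>
  have nat: "NCmp \<alpha> \<in> extensional (Obj C)"
    "A \<in> Obj C \<Longrightarrow> NCmp \<alpha> A \<in> Arr D" "A \<in> Obj C \<Longrightarrow> Dom D (NCmp \<alpha> A) = FO (NSrc \<alpha>) A"
    "A \<in> Obj C \<Longrightarrow> Cod D (NCmp \<alpha> A) = FO (NTrg \<alpha>) A"
    if "is_nat C D (NSrc \<alpha>) (NTrg \<alpha>) (NCmp \<alpha>)" for \<alpha> :: "'u dtrans" and C D :: "'u dcat" and A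
    using is_natD[OF that] by auto
  have obj: "FO F A \<in> Obj D" if "display_functor C D F" "A \<in> Obj C"
    for F :: "'u dftr" and C D :: "'u dcat" and A
    using is_functor.obj_map[OF display_functorD(1)[OF that(1)] that(2)] .
  have arr: "FA F f \<in> Arr D" "Dom D (FA F f) = FO F (Dom C f)" "Cod D (FA F f) = FO F (Cod C f)"
    if "display_functor C D F" "f \<in> Arr C" for F :: "'u dftr" and C D :: "'u dcat" and f
    using is_functor.map_arr[OF display_functorD(1)[OF that(1)] that(2)] .
  have ident: "FA F (Ident C A) = Ident D (FO F A)"
    if "display_functor C D F" "A \<in> Obj C" for F :: "'u dftr" and C D :: "'u dcat" and A
    using is_functor.map_ident[OF display_functorD(1)[OF that(1)] that(2)] .
  have comp: "FA F (g \<cdot>\<^bsub>C\<^esub> f) = FA F g \<cdot>\<^bsub>D\<^esub> FA F f"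
    if "display_functor C D F" "f \<in> Arr C" "g \<in> Arr C" "Cod C f = Dom C g"
    for F :: "'u dftr" and C D :: "'u dcat" and f g
    using is_functor.map_comp'[OF display_functorD(1)[OF that(1)] that(2-4)] .
  note simps = nat obj arr ident comp
  show ?thesis
  proof (rule strict_2_category.intro)
    fix A B :: "'u dcat" assume "A \<in> TObj DC" "B \<in> TObj DC"
    then show "category (THom DC A B)" by (simp add: DC_hom_category)
  next
    fix A :: "'u dcat" assume "A \<in> TObj DC"
    then show "TId DC A \<in> Obj (THom DC A A)" by (simp add: display_functor_ident)
  next
    fix A B D :: "'u dcat" and f g assume "f \<in> Obj (THom DC A B)" "g \<in> Obj (THom DC B D)"
    then show "HC1 DC A B D g f \<in> Obj (THom DC A D)" by (simp add: display_functor_comp)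
  next
    fix A B D :: "'u dcat" and \<alpha> f f' \<beta> g g'
    assume "\<alpha> \<in> hom (THom DC A B) f f'" "\<beta> \<in> hom (THom DC B D) g g'"
    then show "HC2 DC A B D \<beta> \<alpha> \<in> hom (THom DC A D) (HC1 DC A B D g f) (HC1 DC A B D g' f')"
      by (auto simp: hom_def display_functorD intro!: is_nat_hcomp display_functor_comp)
  next
    fix A B D :: "'u dcat" and f g
    assume "A \<in> TObj DC" "B \<in> TObj DC" "D \<in> TObj DC" and fg: "f \<in> Obj (THom DC A B)" "g \<in> Obj (THom DC B D)"
    then interpret A: display_category A + B: display_category B + D: display_category D by auto
    show "HC2 DC A B D (Ident (THom DC B D) g) (Ident (THom DC A B) f)
          = Ident (THom DC A D) (HC1 DC A B D g f)"
      using fg by (intro dtrans_eqI[where A="Obj A"]) (auto simp: simps[of A B] simps[of B D])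
  next
    fix A B D :: "'u dcat" and \<alpha> f f' \<alpha>' f'' \<beta> g g' \<beta>' g''
    assume "A \<in> TObj DC" "B \<in> TObj DC" "D \<in> TObj DC"
      and a: "\<alpha> \<in> hom (THom DC A B) f f'" "\<alpha>' \<in> hom (THom DC A B) f' f''"
        "\<beta> \<in> hom (THom DC B D) g g'" "\<beta>' \<in> hom (THom DC B D) g' g''"
    then interpret A: display_category A + B: display_category B + D: display_category D by auto
    show "HC2 DC A B D (\<beta>' \<cdot>\<^bsub>THom DC B D\<^esub> \<beta>) (\<alpha>' \<cdot>\<^bsub>THom DC A B\<^esub> \<alpha>)
          = HC2 DC A B D \<beta>' \<alpha>' \<cdot>\<^bsub>THom DC A D\<^esub> HC2 DC A B D \<beta> \<alpha>"
    proof (rule dtrans_eqI[where A="Obj A"])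
      fix X assume X: "X \<in> Obj A"
      have b: "display_functor B D g" "display_functor B D g'" "is_nat B D g g' (NCmp \<beta>)"
          "display_functor B D g''" "is_nat B D g' g'' (NCmp \<beta>')"
          "display_functor A B f" "display_functor A B f'" "display_functor A B f''"
          "is_nat A B f f' (NCmp \<alpha>)" "is_nat A B f' f'' (NCmp \<alpha>')"
          "NSrc \<alpha> = f" "NTrg \<alpha> = f'" "NSrc \<alpha>' = f'" "NTrg \<alpha>' = f''"
          "NSrc \<beta> = g" "NTrg \<beta> = g'" "NSrc \<beta>' = g'" "NTrg \<beta>' = g''"
        using a by (auto simp: hom_def)
      note [simp] = is_natD[OF b(3)] is_natD[OF b(5)] is_natD[OF b(9)] is_natD[OF b(10)]
      \<comment> \<open>Naturality of \<open>\<beta>\<close> at a component of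
        \<open>\<alpha>'\<close> exchanges the two middle factors; the rest of interchange is
        associativity and functoriality.\<close>
      have n: "FA g' (NCmp \<alpha>' X) \<cdot>\<^bsub>D\<^esub> NCmp \<beta> (FO f' X) = NCmp \<beta> (FO f'' X) \<cdot>\<^bsub>D\<^esub> FA g (NCmp \<alpha>' X)"
        using is_natD(5)[OF b(3), of "NCmp \<alpha>' X"] X by simp
      show "NCmp (HC2 DC A B D (\<beta>' \<cdot>\<^bsub>THom DC B D\<^esub> \<beta>) (\<alpha>' \<cdot>\<^bsub>THom DC A B\<^esub> \<alpha>)) X
          = NCmp (HC2 DC A B D \<beta>' \<alpha>' \<cdot>\<^bsub>THom DC A D\<^esub> HC2 DC A B D \<beta> \<alpha>) X"
        using X b(1,2,4,6,7,8)
        by (simp add: b(11-18) simps(5-10)[of A B] simps(5-10)[of B D] D.comp_reduce[OF n])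
    qed (use a in \<open>auto simp: hom_def\<close>)
  next
    fix A B D E :: "'u dcat" and f g h
    assume "f \<in> Obj (THom DC A B)" "g \<in> Obj (THom DC B D)" "h \<in> Obj (THom DC D E)"
    then show "HC1 DC A D E h (HC1 DC A B D g f) = HC1 DC A B E (HC1 DC B D E h g) f"
      by (simp add: ftr_comp_assoc[OF display_functorD(1)])
  next
    fix A B D E :: "'u dcat" and \<alpha> \<beta> \<gamma>
    assume "A \<in> TObj DC" "B \<in> TObj DC" "D \<in> TObj DC" "E \<in> TObj DC"
      and a: "\<alpha> \<in> Arr (THom DC A B)" "\<beta> \<in> Arr (THom DC B D)" "\<gamma> \<in> Arr (THom DC D E)"
    then interpret A: display_category A + B: display_category B + D: display_category D + E: display_category E by auto
    show "HC2 DC A D E \<gamma> (HC2 DC A B D \<beta> \<alpha>) = HC2 DC A B E (HC2 DC B D E \<gamma> \<beta>) \<alpha>"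
      using a by (intro dtrans_eqI[where A="Obj A"])
        (auto simp: simps(2-10)[of A B] simps(2-10)[of B D] simps(2-10)[of D E] ftr_comp_assoc[OF display_functorD(1)])
  next
    fix A B :: "'u dcat" and f assume "f \<in> Obj (THom DC A B)"
    then show "HC1 DC A A B f (TId DC A) = f" "HC1 DC A B B (TId DC B) f = f"
      by (simp_all add: ftr_comp_ident_right[OF display_functorD(1)])
  next
    fix A B :: "'u dcat" and \<alpha> assume "A \<in> TObj DC" "B \<in> TObj DC" and a: "\<alpha> \<in> Arr (THom DC A B)"
    then interpret A: display_category A + B: display_category B by auto
    show "HC2 DC A A B \<alpha> (Ident (THom DC A A) (TId DC A)) = \<alpha>"
      "HC2 DC A B B (Ident (THom DC B B) (TId DC B)) \<alpha> = \<alpha>"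
      using a by (intro dtrans_eqI[where A="Obj A"];
        auto simp: simps[of A B] ftr_comp_ident_right[OF display_functorD(1)])+
  qed
qed

lemma full_sub_2cat_simps [simp]:
  "A \<in> TObj (full_sub_2cat K P) \<longleftrightarrow> A \<in> TObj K \<and> P A"
  "THom (full_sub_2cat K P) = THom K" "TId (full_sub_2cat K P) = TId K"
  "HC1 (full_sub_2cat K P) = HC1 K" "HC2 (full_sub_2cat K P) = HC2 K"
  by (auto simp: full_sub_2cat_def)

lemma strict_2_category_full_sub: 
  assumes "strict_2_category K" shows "strict_2_category (full_sub_2cat K P)"
proof -
  interpret strict_2_category K by fact
  show ?thesis
    by (rule strict_2_category.intro)
      (auto intro: hom_category id_cell hcomp_cell hcomp_2cell hcomp_ident interchange hcomp_assoc
        hcomp2_assoc hcomp_id_right hcomp_id_left hcomp2_id_right hcomp2_id_left)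
qed

section \<open>Calculus of types and terms\<close>

context strict_indexed_category
begin

lemma sub_obj: "\<lbrakk>u \<in> hom C \<Delta> \<Gamma>; A \<in> Obj (Fib T \<Gamma>)\<rbrakk> \<Longrightarrow> FO (Reix T u) A \<in> Obj (Fib T \<Delta>)"
  using is_functor.obj_map[OF reix_functor] .

lemma sub_hom: "\<lbrakk>u \<in> hom C \<Delta> \<Gamma>; f \<in> hom (Fib T \<Gamma>) A B\<rbrakk> \<Longrightarrow>
    FA (Reix T u) f \<in> hom (Fib T \<Delta>) (FO (Reix T u) A) (FO (Reix T u) B)"
  using is_functor.arr_map[OF reix_functor] .

lemma sub_ident: "\<lbrakk>u \<in> hom C \<Delta> \<Gamma>; A \<in> Obj (Fib T \<Gamma>)\<rbrakk> \<Longrightarrow>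
    FA (Reix T u) (Ident (Fib T \<Gamma>) A) = Ident (Fib T \<Delta>) (FO (Reix T u) A)"
  using is_functor.map_ident[OF reix_functor] .

lemma sub_fcomp: "\<lbrakk>u \<in> hom C \<Delta> \<Gamma>; f \<in> hom (Fib T \<Gamma>) A B; g \<in> hom (Fib T \<Gamma>) B D\<rbrakk> \<Longrightarrow>
    FA (Reix T u) (g \<cdot>\<^bsub>Fib T \<Gamma>\<^esub> f) = FA (Reix T u) g \<cdot>\<^bsub>Fib T \<Delta>\<^esub> FA (Reix T u) f"
  using is_functor.map_comp[OF reix_functor] .

lemma sub_id:
  assumes "\<Gamma> \<in> Obj C"
  shows "A \<in> Obj (Fib T \<Gamma>) \<Longrightarrow> FO (Reix T (Ident C \<Gamma>)) A = A"
    and "f \<in> hom (Fib T \<Gamma>) A B \<Longrightarrow> FA (Reix T (Ident C \<Gamma>)) f = f"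
  using assms by (simp_all add: reix_ident hom_def)

lemma sub_comp:
  assumes "w \<in> hom C \<Theta> \<Delta>" "u \<in> hom C \<Delta> \<Gamma>"
  shows "A \<in> Obj (Fib T \<Gamma>) \<Longrightarrow> FO (Reix T (u \<cdot>\<^bsub>C\<^esub> w)) A = FO (Reix T w) (FO (Reix T u) A)"
    and "f \<in> hom (Fib T \<Gamma>) A B \<Longrightarrow> FA (Reix T (u \<cdot>\<^bsub>C\<^esub> w)) f = FA (Reix T w) (FA (Reix T u) f)"
  using reix_comp[OF assms] by (simp_all add: hom_def)

end

context strict_indexed_functor
begin

lemma map_obj: "\<lbrakk>\<Gamma> \<in> Obj C; A \<in> Obj (Fib S \<Gamma>)\<rbrakk> \<Longrightarrow> FO (\<phi> \<Gamma>) A \<in> Obj (Fib T \<Gamma>)"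
  using is_functor.obj_map[OF fib_functor] .

lemma map_hom: "\<lbrakk>\<Gamma> \<in> Obj C; f \<in> hom (Fib S \<Gamma>) A B\<rbrakk> \<Longrightarrow>
    FA (\<phi> \<Gamma>) f \<in> hom (Fib T \<Gamma>) (FO (\<phi> \<Gamma>) A) (FO (\<phi> \<Gamma>) B)"
  using is_functor.arr_map[OF fib_functor] .

lemma map_id: "\<lbrakk>\<Gamma> \<in> Obj C; A \<in> Obj (Fib S \<Gamma>)\<rbrakk> \<Longrightarrow>
    FA (\<phi> \<Gamma>) (Ident (Fib S \<Gamma>) A) = Ident (Fib T \<Gamma>) (FO (\<phi> \<Gamma>) A)"
  using is_functor.map_ident[OF fib_functor] .

lemma map_fcomp: "\<lbrakk>\<Gamma> \<in> Obj C; f \<in> hom (Fib S \<Gamma>) A B; g \<in> hom (Fib S \<Gamma>) B D\<rbrakk> \<Longrightarrow>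
    FA (\<phi> \<Gamma>) (g \<cdot>\<^bsub>Fib S \<Gamma>\<^esub> f) = FA (\<phi> \<Gamma>) g \<cdot>\<^bsub>Fib T \<Gamma>\<^esub> FA (\<phi> \<Gamma>) f"
  using is_functor.map_comp[OF fib_functor] .

lemma map_sub:
  assumes "u \<in> hom C \<Delta> \<Gamma>"
  shows "A \<in> Obj (Fib S \<Gamma>) \<Longrightarrow> FO (\<phi> \<Delta>) (FO (Reix S u) A) = FO (Reix T u) (FO (\<phi> \<Gamma>) A)"
    and "f \<in> Arr (Fib S \<Gamma>) \<Longrightarrow> FA (\<phi> \<Delta>) (FA (Reix S u) f) = FA (Reix T u) (FA (\<phi> \<Gamma>) f)"
  using natural[OF assms, THEN arg_cong, of "\<lambda>G. FO G A"]
    natural[OF assms, THEN arg_cong, of "\<lambda>G. FA G f"] by simp_all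

end

section \<open>Types, substitution, terms and transport\<close>

abbreviation Ty :: "('u, 'x) nm_scheme \<Rightarrow> 'u \<Rightarrow> 'u set" where
  "Ty N \<Gamma> \<equiv> Obj (Fib (Tp N) \<Gamma>)"

abbreviation ctxt :: "('u, 'x) nm_scheme \<Rightarrow> 'u \<Rightarrow> 'u \<Rightarrow> 'u" where
  "ctxt N \<Gamma> A \<equiv> Dom N (Ext N \<Gamma> A)"

abbreviation tsub :: "('u, 'x) nm_scheme \<Rightarrow> 'u \<Rightarrow> 'u \<Rightarrow> 'u" where
  "tsub N u A \<equiv> FO (Reix (Tp N) u) A"

abbreviation asub :: "('u, 'x) nm_scheme \<Rightarrow> 'u \<Rightarrow> 'u \<Rightarrow> 'u" where
  "asub N u f \<equiv> FA (Reix (Tp N) u) f"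

abbreviation tmsub :: "('u, 'x) nm_scheme \<Rightarrow> 'u \<Rightarrow> 'u \<Rightarrow> 'u" where
  "tmsub N u t \<equiv> FO (Reix (Tm N) u) t"

definition Tms :: "('u, 'x) nm_scheme \<Rightarrow> 'u \<Rightarrow> 'u \<Rightarrow> 'u set" where
  "Tms N \<Gamma> A = {t \<in> Obj (Fib (Tm N) \<Gamma>). FO (TmTp N \<Gamma>) t = A}"

text \<open>Transport of the term \<open>t\<close> along the arrow of types \<open>f\<close>: the
  covariant action on fibres that a discrete opfibration amounts to.\<close>

definition act :: "('u, 'x) nm_scheme \<Rightarrow> 'u \<Rightarrow> 'u \<Rightarrow> 'u \<Rightarrow> 'u" where
  "act N \<Gamma> f t = Cod (Fib (Tm N) \<Gamma>) (opfib_lift (Fib (Tm N) \<Gamma>) (TmTp N \<Gamma>) t f)"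

text \<open>The arrow into a context extension given by a substitution \<open>u\<close> and a term
  \<open>t\<close>, usually written as a pair.\<close>

definition tup :: "('u, 'x) nm_scheme \<Rightarrow> 'u \<Rightarrow> 'u \<Rightarrow> 'u \<Rightarrow> 'u \<Rightarrow> 'u" where
  "tup N \<Gamma> A u t = (THE w. w \<in> hom N (Dom N u) (ctxt N \<Gamma> A) \<and> Ext N \<Gamma> A \<cdot>\<^bsub>N\<^esub> w = u \<and>
      tmsub N w (Var N \<Gamma> A) = t)"

context small_pre_natural_model
begin

lemma TmsD: "t \<in> Tms N \<Gamma> A \<Longrightarrow> t \<in> Obj (Fib (Tm N) \<Gamma>)" "t \<in> Tms N \<Gamma> A \<Longrightarrow> FO (TmTp N \<Gamma>) t = A"
  by (simp_all add: Tms_def)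

lemma ext_hom: "\<lbrakk>\<Gamma> \<in> Obj N; A \<in> Ty N \<Gamma>\<rbrakk> \<Longrightarrow> Ext N \<Gamma> A \<in> hom N (ctxt N \<Gamma> A) \<Gamma>"
  using ext_disp disp_arr by (auto simp: hom_def)

lemma ctxt_obj: "\<lbrakk>\<Gamma> \<in> Obj N; A \<in> Ty N \<Gamma>\<rbrakk> \<Longrightarrow> ctxt N \<Gamma> A \<in> Obj N"
  using ext_hom[of \<Gamma> A] by (rule hom_obj)

lemma var_Tms: "\<lbrakk>\<Gamma> \<in> Obj N; A \<in> Ty N \<Gamma>\<rbrakk> \<Longrightarrow> Var N \<Gamma> A \<in> Tms N (ctxt N \<Gamma> A) (tsub N (Ext N \<Gamma> A) A)"
  by (simp add: Tms_def var_term var_type)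

lemma Tms_ty: "\<lbrakk>\<Gamma> \<in> Obj N; t \<in> Tms N \<Gamma> A\<rbrakk> \<Longrightarrow> A \<in> Ty N \<Gamma>"
  using typing.map_obj by (auto simp: Tms_def)

lemma tms_sub:
  assumes "u \<in> hom N \<Delta> \<Gamma>" "t \<in> Tms N \<Gamma> A"
  shows "tmsub N u t \<in> Tms N \<Delta> (tsub N u A)"
  using assms typing.map_sub(1)[OF assms(1)] terms.sub_obj[OF assms(1)] by (simp add: Tms_def)

lemma tms_sub':
  assumes "u \<in> hom N \<Delta> \<Gamma>" "t \<in> Tms N \<Gamma> A" "B = tsub N u A"
  shows "tmsub N u t \<in> Tms N \<Delta> B"
  using tms_sub[OF assms(1,2)] assms(3) by simp

lemma lift_ex1:
  assumes "\<Gamma> \<in> Obj N" "f \<in> hom (Fib (Tp N) \<Gamma>) A B" "t \<in> Tms N \<Gamma> A"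
  shows "\<exists>!g. g \<in> Arr (Fib (Tm N) \<Gamma>) \<and> Dom (Fib (Tm N) \<Gamma>) g = t \<and> FA (TmTp N \<Gamma>) g = f"
  using opfibration[OF assms(1)] assms(2,3) unfolding discrete_opfibration_def
  by (auto simp: hom_def Tms_def)

lemma lift:
  assumes "\<Gamma> \<in> Obj N" "f \<in> hom (Fib (Tp N) \<Gamma>) A B" "t \<in> Tms N \<Gamma> A"
  shows "opfib_lift (Fib (Tm N) \<Gamma>) (TmTp N \<Gamma>) t f \<in> hom (Fib (Tm N) \<Gamma>) t (act N \<Gamma> f t)"
    and "FA (TmTp N \<Gamma>) (opfib_lift (Fib (Tm N) \<Gamma>) (TmTp N \<Gamma>) t f) = f"
  using theI'[OF lift_ex1[OF assms]] by (auto simp: opfib_lift_def act_def hom_def)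

text \<open>Uniqueness of lifts, without assuming that the targets agree. Laws for arrows of terms
  reduce by it to the corresponding laws for arrows of types.\<close>

lemma term_arr_eqI:
  assumes "\<Gamma> \<in> Obj N" "g \<in> hom (Fib (Tm N) \<Gamma>) t s" "g' \<in> hom (Fib (Tm N) \<Gamma>) t s'"
    "FA (TmTp N \<Gamma>) g = FA (TmTp N \<Gamma>) g'"
  shows "g = g'"
proof -
  have "t \<in> Tms N \<Gamma> (FO (TmTp N \<Gamma>) t)"
    using assms(1,2) category.hom_obj[OF terms.fib_category] by (auto simp: Tms_def)
  from lift_ex1[OF assms(1) typing.map_hom[OF assms(1,2)] this] assms(2-4)
  show ?thesis by (auto simp: hom_def)
qed

lemma lift_eqI:
  assumes "\<Gamma> \<in> Obj N" "g \<in> hom (Fib (Tm N) \<Gamma>) t s" "FA (TmTp N \<Gamma>) g = f"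
  shows "opfib_lift (Fib (Tm N) \<Gamma>) (TmTp N \<Gamma>) t f = g"
proof -
  have "t \<in> Tms N \<Gamma> (FO (TmTp N \<Gamma>) t)"
    using assms(1,2) category.hom_obj[OF terms.fib_category] by (auto simp: Tms_def)
  from lift[OF assms(1) typing.map_hom[OF assms(1,2)] this]
  have "opfib_lift (Fib (Tm N) \<Gamma>) (TmTp N \<Gamma>) t f \<in> hom (Fib (Tm N) \<Gamma>) t (act N \<Gamma> f t)"
    "FA (TmTp N \<Gamma>) (opfib_lift (Fib (Tm N) \<Gamma>) (TmTp N \<Gamma>) t f) = f"
    unfolding assms(3) by simp_all
  then show ?thesis using term_arr_eqI[OF assms(1) _ assms(2)] assms(3) by metis
qed

text \<open>Any arrow of terms over \<open>f\<close> starting at \<open>t\<close> is the lift, so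
  exhibiting one computes the transport. Identities, composites and reindexings of lifts are such
  arrows, which makes transport functorial and stable.\<close>

lemma act_eqI:
  assumes "\<Gamma> \<in> Obj N" "g \<in> hom (Fib (Tm N) \<Gamma>) t s" "FA (TmTp N \<Gamma>) g = f"
  shows "act N \<Gamma> f t = s"
  using lift_eqI[OF assms] assms(2) by (simp add: act_def hom_def)

lemma act_Tms:
  assumes "\<Gamma> \<in> Obj N" "f \<in> hom (Fib (Tp N) \<Gamma>) A B" "t \<in> Tms N \<Gamma> A"
  shows "act N \<Gamma> f t \<in> Tms N \<Gamma> B"
  using typing.map_hom[OF assms(1) lift(1)[OF assms]] lift(2)[OF assms] assms(1,2)
    category.hom_obj[OF terms.fib_category lift(1)[OF assms]]
  by (auto simp: Tms_def hom_def)

lemma act_ident: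
  assumes "\<Gamma> \<in> Obj N" "t \<in> Tms N \<Gamma> A"
  shows "act N \<Gamma> (Ident (Fib (Tp N) \<Gamma>) A) t = t"
  by (rule act_eqI[of _ "Ident (Fib (Tm N) \<Gamma>) t"])
    (use assms typing.map_id category.ident_hom[OF terms.fib_category] in \<open>auto simp: Tms_def\<close>)

lemma act_comp:
  assumes "\<Gamma> \<in> Obj N" "f \<in> hom (Fib (Tp N) \<Gamma>) A B" "g \<in> hom (Fib (Tp N) \<Gamma>) B D" "t \<in> Tms N \<Gamma> A"
  shows "act N \<Gamma> (g \<cdot>\<^bsub>Fib (Tp N) \<Gamma>\<^esub> f) t = act N \<Gamma> g (act N \<Gamma> f t)"
proof -
  note l1 = lift[OF assms(1,2,4)]
  note l2 = lift[OF assms(1,3) act_Tms[OF assms(1,2,4)]]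
  show ?thesis
    by (rule act_eqI[OF assms(1) category.comp_hom[OF terms.fib_category[OF assms(1)] l1(1) l2(1)]])
      (simp add: typing.map_fcomp[OF assms(1) l1(1) l2(1)] l1(2) l2(2))
qed

lemma act_sub:
  assumes "u \<in> hom N \<Delta> \<Gamma>" "f \<in> hom (Fib (Tp N) \<Gamma>) A B" "t \<in> Tms N \<Gamma> A"
  shows "act N \<Delta> (asub N u f) (tmsub N u t) = tmsub N u (act N \<Gamma> f t)"
proof -
  note l = lift[OF hom_obj(2)[OF assms(1)] assms(2,3)]
  show ?thesis
    by (rule act_eqI[OF hom_obj(1)[OF assms(1)] terms.sub_hom[OF assms(1) l(1)]])
      (use l assms(1) in \<open>simp add: typing.map_sub(2)[OF assms(1)] hom_def\<close>)
qed

lemma tup: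
  assumes "A \<in> Ty N \<Gamma>" "u \<in> hom N \<Delta> \<Gamma>" "t \<in> Tms N \<Delta> (tsub N u A)"
  shows "tup N \<Gamma> A u t \<in> hom N \<Delta> (ctxt N \<Gamma> A)" "Ext N \<Gamma> A \<cdot>\<^bsub>N\<^esub> tup N \<Gamma> A u t = u"
    "tmsub N (tup N \<Gamma> A u t) (Var N \<Gamma> A) = t"
  using theI'[OF representable[OF hom_obj(2)[OF assms(2)] assms(1,2) TmsD[OF assms(3)]]] assms(2)
  by (auto simp: tup_def hom_def)

lemma tup_eqI:
  assumes "\<Gamma> \<in> Obj N" "A \<in> Ty N \<Gamma>" "w \<in> hom N \<Delta> (ctxt N \<Gamma> A)" "Ext N \<Gamma> A \<cdot>\<^bsub>N\<^esub> w = u"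
    "tmsub N w (Var N \<Gamma> A) = t"
  shows "tup N \<Gamma> A u t = w"
proof -
  have u: "u \<in> hom N \<Delta> \<Gamma>" using comp_hom[OF assms(3) ext_hom[OF assms(1,2)]] assms(4) by simp
  have t: "t \<in> Tms N \<Delta> (tsub N u A)"
    using tms_sub[OF assms(3) var_Tms[OF assms(1,2)]] types.sub_comp(1)[OF assms(3) ext_hom[OF assms(1,2)] assms(2)]
      assms(4,5) by simp
  have D: "Dom N u = \<Delta>" using u by (simp add: hom_def)
  show ?thesis
    unfolding tup_def D by (rule the1_equality[OF representable[OF assms(1,2) u TmsD[OF t]]]) (use assms in auto)
qed

text \<open>The uniqueness half of representability, with restriction of the universal element as a
  second projection.\<close>

lemma ext_eqI:
  assumes "\<Gamma> \<in> Obj N" "A \<in> Ty N \<Gamma>" "w \<in> hom N \<Delta> (ctxt N \<Gamma> A)" "w' \<in> hom N \<Delta> (ctxt N \<Gamma> A)"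
    "Ext N \<Gamma> A \<cdot>\<^bsub>N\<^esub> w = Ext N \<Gamma> A \<cdot>\<^bsub>N\<^esub> w'" "tmsub N w (Var N \<Gamma> A) = tmsub N w' (Var N \<Gamma> A)"
  shows "w = w'"
  using tup_eqI[OF assms(1-3) refl refl] tup_eqI[OF assms(1,2,4) refl refl] assms(5,6) by metis

lemma var_sub_Tms:
  assumes "\<Gamma> \<in> Obj N" "A \<in> Ty N \<Gamma>" "w \<in> hom N \<Delta> (ctxt N \<Gamma> A)"
  shows "tmsub N w (Var N \<Gamma> A) \<in> Tms N \<Delta> (tsub N (Ext N \<Gamma> A \<cdot>\<^bsub>N\<^esub> w) A)"
  using tms_sub[OF assms(3) var_Tms[OF assms(1,2)]] types.sub_comp(1)[OF assms(3) ext_hom[OF assms(1,2)] assms(2)]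
  by simp

lemma tup_sub:
  assumes "A \<in> Ty N \<Gamma>" "u \<in> hom N \<Delta> \<Gamma>" "t \<in> Tms N \<Delta> (tsub N u A)" "w \<in> hom N \<Theta> \<Delta>"
  shows "tup N \<Gamma> A u t \<cdot>\<^bsub>N\<^esub> w = tup N \<Gamma> A (u \<cdot>\<^bsub>N\<^esub> w) (tmsub N w t)"
proof -
  note \<Gamma> = hom_obj(2)[OF assms(2)]
  note t = tup[OF assms(1-3)]
  show ?thesis
    using comp_hom[OF assms(4) t(1)] ext_hom[OF \<Gamma> assms(1)] assms(4) t
      terms.sub_comp(1)[OF assms(4) t(1) TmsD(1)[OF var_Tms[OF \<Gamma> assms(1)]]]
    by (intro tup_eqI[symmetric, OF \<Gamma> assms(1)]) (auto simp: hom_def comp_reduce[OF t(2)])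
qed

text \<open>Arrows into the extension by \<open>A[u]\<close> and into the pullback of the extension
  by \<open>A\<close> classify the same data, because \<open>A[u][a]\<close> and
  \<open>A[u \<cdot> a]\<close> are equal and not merely isomorphic. Hence substitution of types is
  pullback of displays.\<close>

lemma ext_pullback:
  assumes "u \<in> hom N \<Delta> \<Gamma>" "A \<in> Ty N \<Gamma>"
  defines "q \<equiv> tup N \<Gamma> A (u \<cdot>\<^bsub>N\<^esub> Ext N \<Delta> (tsub N u A)) (Var N \<Delta> (tsub N u A))"
  shows "q \<in> hom N (ctxt N \<Delta> (tsub N u A)) (ctxt N \<Gamma> A)"
    and "Ext N \<Gamma> A \<cdot>\<^bsub>N\<^esub> q = u \<cdot>\<^bsub>N\<^esub> Ext N \<Delta> (tsub N u A)"
    and "tmsub N q (Var N \<Gamma> A) = Var N \<Delta> (tsub N u A)"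
    and "pullback_square N u (Ext N \<Gamma> A) (Ext N \<Delta> (tsub N u A)) q"
proof -
  note obj = hom_obj[OF assms(1)]
  note Au = types.sub_obj[OF assms(1,2)]
  note p = ext_hom[OF obj(1) Au]
  note up = comp_hom[OF p assms(1)]
  have v: "Var N \<Delta> (tsub N u A) \<in> Tms N (ctxt N \<Delta> (tsub N u A)) (tsub N (u \<cdot>\<^bsub>N\<^esub> Ext N \<Delta> (tsub N u A)) A)"
    using var_Tms[OF obj(1) Au] types.sub_comp(1)[OF p assms(1,2)] by simp
  note q = tup[OF assms(2) up v, folded q_def]
  show "q \<in> hom N (ctxt N \<Delta> (tsub N u A)) (ctxt N \<Gamma> A)"
    "Ext N \<Gamma> A \<cdot>\<^bsub>N\<^esub> q = u \<cdot>\<^bsub>N\<^esub> Ext N \<Delta> (tsub N u A)"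
    "tmsub N q (Var N \<Gamma> A) = Var N \<Delta> (tsub N u A)" by (fact q)+
  \<comment> \<open>The universal term of \<open>A[u]\<close> is the restriction of that of
    \<open>A\<close> along \<open>q\<close>, so an arrow has the same term component before and
    after composition with \<open>q\<close>.\<close>
  have vq: "tmsub N h (Var N \<Delta> (tsub N u A)) = tmsub N (q \<cdot>\<^bsub>N\<^esub> h) (Var N \<Gamma> A)"
    if "h \<in> hom N X (ctxt N \<Delta> (tsub N u A))" for X h
    using terms.sub_comp(1)[OF that q(1) TmsD(1)[OF var_Tms[OF obj(2) assms(2)]]] q(3) by simp
  show "pullback_square N u (Ext N \<Gamma> A) (Ext N \<Delta> (tsub N u A)) q"
  proof (rule pullback_squareI)
    show "category N" by unfold_locales
  next
    fix X a b assume a: "a \<in> hom N X \<Delta>" and b: "b \<in> hom N X (ctxt N \<Gamma> A)"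
      and ab: "u \<cdot>\<^bsub>N\<^esub> a = Ext N \<Gamma> A \<cdot>\<^bsub>N\<^esub> b"
    have t: "tmsub N b (Var N \<Gamma> A) \<in> Tms N X (tsub N a (tsub N u A))"
      using var_sub_Tms[OF obj(2) assms(2) b] types.sub_comp(1)[OF a assms(1,2)] by (simp add: ab)
    note h = tup[OF Au a t]
    have "q \<cdot>\<^bsub>N\<^esub> tup N \<Delta> (tsub N u A) a (tmsub N b (Var N \<Gamma> A)) = b"
    proof (rule ext_eqI[OF obj(2) assms(2) comp_hom[OF h(1) q(1)] b])
      show "Ext N \<Gamma> A \<cdot>\<^bsub>N\<^esub> (q \<cdot>\<^bsub>N\<^esub> tup N \<Delta> (tsub N u A) a (tmsub N b (Var N \<Gamma> A))) = Ext N \<Gamma> A \<cdot>\<^bsub>N\<^esub> b"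
        using h(1,2) q p assms(1) ext_hom[OF obj(2) assms(2)] ab by (simp add: hom_def comp_reduce[OF q(2)])
    qed (simp add: vq[OF h(1), symmetric] h(3))
    then show "\<exists>h\<in>hom N X (ctxt N \<Delta> (tsub N u A)). Ext N \<Delta> (tsub N u A) \<cdot>\<^bsub>N\<^esub> h = a \<and> q \<cdot>\<^bsub>N\<^esub> h = b"
      by (intro bexI[OF _ h(1)] conjI h(2))
  next
    fix X h k assume hk: "h \<in> hom N X (ctxt N \<Delta> (tsub N u A))" "k \<in> hom N X (ctxt N \<Delta> (tsub N u A))"
      "Ext N \<Delta> (tsub N u A) \<cdot>\<^bsub>N\<^esub> h = Ext N \<Delta> (tsub N u A) \<cdot>\<^bsub>N\<^esub> k" "q \<cdot>\<^bsub>N\<^esub> h = q \<cdot>\<^bsub>N\<^esub> k"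
    show "h = k" by (rule ext_eqI[OF obj(1) Au hk(1-3)]) (use hk(4) in \<open>simp add: vq[OF hk(1)] vq[OF hk(2)]\<close>)
  qed (fact assms(1) ext_hom[OF obj(2) assms(2)] p q(1) q(2)[symmetric])+
qed

lemma gen_Tms:
  assumes "\<Gamma> \<in> Obj N" "f \<in> hom (Fib (Tp N) \<Gamma>) A B"
  shows "act N (ctxt N \<Gamma> A) (asub N (Ext N \<Gamma> A) f) (Var N \<Gamma> A)
    \<in> Tms N (ctxt N \<Gamma> A) (tsub N (Ext N \<Gamma> A) B)"
proof -
  have A: "A \<in> Ty N \<Gamma>" using category.hom_obj[OF types.fib_category[OF assms(1)] assms(2)] by simp
  show ?thesis
    by (rule act_Tms[OF ctxt_obj[OF assms(1) A] types.sub_hom[OF ext_hom[OF assms(1) A] assms(2)] var_Tms[OF assms(1) A]])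
qed

lemma ext_map_eq:
  assumes "\<Gamma> \<in> Obj N" "f \<in> hom (Fib (Tp N) \<Gamma>) A B"
  shows "ext_map N \<Gamma> f = tup N \<Gamma> B (Ext N \<Gamma> A) (act N (ctxt N \<Gamma> A) (asub N (Ext N \<Gamma> A) f) (Var N \<Gamma> A))"
  using homD[OF assms(2)] by (simp add: ext_map_def Let_def tup_def act_def)

text \<open>Every term is a substitution instance of a variable, so the transport along a
  reindexed arrow is determined by the transport of the variable.\<close>

lemma act_gen:
  assumes "u \<in> hom N \<Delta> \<Gamma>" "f \<in> hom (Fib (Tp N) \<Gamma>) A B" "w \<in> hom N \<Delta> (ctxt N \<Gamma> A)"
    "Ext N \<Gamma> A \<cdot>\<^bsub>N\<^esub> w = u" "tmsub N w (Var N \<Gamma> A) = t"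
  shows "act N \<Delta> (asub N u f) t =
    tmsub N w (act N (ctxt N \<Gamma> A) (asub N (Ext N \<Gamma> A) f) (Var N \<Gamma> A))"
proof -
  note \<Gamma> = hom_obj(2)[OF assms(1)]
  have A: "A \<in> Ty N \<Gamma>" using category.hom_obj[OF types.fib_category[OF \<Gamma>] assms(2)] by simp
  show ?thesis
    using act_sub[OF assms(3) types.sub_hom[OF ext_hom[OF \<Gamma> A] assms(2)] var_Tms[OF \<Gamma> A]]
      types.sub_comp(2)[OF assms(3) ext_hom[OF \<Gamma> A] assms(2)] assms(4,5) by simp
qed

lemma tmsub_iso_cancel:
  assumes "is_iso N i" "i \<in> hom N \<Delta> \<Gamma>" "t \<in> Tms N \<Gamma> A" "s \<in> Tms N \<Gamma> B" "tmsub N i t = tmsub N i s"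
  shows "t = s"
proof -
  obtain j where j: "j \<in> hom N \<Gamma> \<Delta>" "i \<cdot>\<^bsub>N\<^esub> j = Ident N \<Gamma>" using is_isoE[OF assms(1,2)] by metis
  have "tmsub N j (tmsub N i r) = r" if "r \<in> Obj (Fib (Tm N) \<Gamma>)" for r
    using terms.sub_comp(1)[OF j(1) assms(2) that] terms.sub_id(1)[OF hom_obj(2)[OF assms(2)] that] j(2) by simp
  then show ?thesis using assms(3-5) by (metis TmsD(1))
qed

end

section \<open>Full faithfulness of comprehension, expressed by transport\<close>

context small_natural_model
begin

text \<open>The map that comprehension assigns to an arrow is the tuple of the domain display and
  the transported variable. Equal transports therefore give equal images under a faithful
  functor.\<close>

lemma gen_inj:
  assumes \<Gamma>: "\<Gamma> \<in> Obj N" and f: "f \<in> hom (Fib (Tp N) \<Gamma>) A B" and g: "g \<in> hom (Fib (Tp N) \<Gamma>) A B"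
    and eq: "act N (ctxt N \<Gamma> A) (asub N (Ext N \<Gamma> A) f) (Var N \<Gamma> A) =
      act N (ctxt N \<Gamma> A) (asub N (Ext N \<Gamma> A) g) (Var N \<Gamma> A)"
  shows "f = g"
  by (rule is_equivalenceD(2)[OF comprehension_equivalence[OF \<Gamma>] f g])
    (use homD[OF f] homD[OF g] eq in \<open>simp add: comprehension_def ext_map_eq[OF \<Gamma> f] ext_map_eq[OF \<Gamma> g]\<close>)

text \<open>The term \<open>b\<close> induces a map between displays, fullness of comprehension
  yields an arrow of types inducing that map, and \<open>b\<close> is recovered as the term
  component of the map.\<close>

lemma gen_surj:
  assumes \<Gamma>: "\<Gamma> \<in> Obj N" and A: "A \<in> Ty N \<Gamma>" and B: "B \<in> Ty N \<Gamma>"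
    and b: "b \<in> Tms N (ctxt N \<Gamma> A) (tsub N (Ext N \<Gamma> A) B)"
  obtains f where "f \<in> hom (Fib (Tp N) \<Gamma>) A B"
    "act N (ctxt N \<Gamma> A) (asub N (Ext N \<Gamma> A) f) (Var N \<Gamma> A) = b"
proof -
  define h where "h = tup N \<Gamma> B (Ext N \<Gamma> A) b"
  note h = tup[OF B ext_hom[OF \<Gamma> A] b, folded h_def]
  have "(Ext N \<Gamma> A, h, Ext N \<Gamma> B) \<in> hom (disp_fibre N \<Gamma>) (FO (comprehension N \<Gamma>) A) (FO (comprehension N \<Gamma>) B)"
    using A B \<Gamma> h ext_disp by (auto simp: comprehension_def disp_fibre_def hom_def)
  then obtain f where f: "f \<in> hom (Fib (Tp N) \<Gamma>) A B" "FA (comprehension N \<Gamma>) f = (Ext N \<Gamma> A, h, Ext N \<Gamma> B)"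
    using is_equivalenceD(3)[OF comprehension_equivalence[OF \<Gamma>] A B] by blast
  then have "ext_map N \<Gamma> f = h" using homD[OF f(1)] by (simp add: comprehension_def)
  then have "h = tup N \<Gamma> B (Ext N \<Gamma> A) (act N (ctxt N \<Gamma> A) (asub N (Ext N \<Gamma> A) f) (Var N \<Gamma> A))"
    by (simp add: ext_map_eq[OF \<Gamma> f(1)])
  with tup(3)[OF B ext_hom[OF \<Gamma> A] gen_Tms[OF \<Gamma> f(1)]] h(3)
  have "act N (ctxt N \<Gamma> A) (asub N (Ext N \<Gamma> A) f) (Var N \<Gamma> A) = b" by simp
  with f(1) show thesis by (rule that)
qed

text \<open>The isomorphism \<open>tup N \<Gamma> A q t\<close> identifies \<open>(X, t)\<close>
  with the extension and its variable. The transport of \<open>t\<close> is the transport of the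
  variable restricted along it, and restriction along an isomorphism is injective.\<close>

lemma test_inj:
  assumes \<Gamma>: "\<Gamma> \<in> Obj N" and f: "f \<in> hom (Fib (Tp N) \<Gamma>) A B" and g: "g \<in> hom (Fib (Tp N) \<Gamma>) A B"
    and q: "q \<in> hom N X \<Gamma>" and t: "t \<in> Tms N X (tsub N q A)" and iso: "is_iso N (tup N \<Gamma> A q t)"
    and eq: "act N X (asub N q f) t = act N X (asub N q g) t"
  shows "f = g"
proof -
  have A: "A \<in> Ty N \<Gamma>" using category.hom_obj[OF types.fib_category[OF \<Gamma>] f] by simp
  note i = tup[OF A q t]
  show ?thesis
    by (rule gen_inj[OF \<Gamma> f g], rule tmsub_iso_cancel[OF iso i(1) gen_Tms[OF \<Gamma> f] gen_Tms[OF \<Gamma> g]])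
      (use act_gen[OF q f i] act_gen[OF q g i] eq in simp)
qed

lemma test_surj:
  assumes \<Gamma>: "\<Gamma> \<in> Obj N" and A: "A \<in> Ty N \<Gamma>" and B: "B \<in> Ty N \<Gamma>"
    and q: "q \<in> hom N X \<Gamma>" and t: "t \<in> Tms N X (tsub N q A)" and iso: "is_iso N (tup N \<Gamma> A q t)"
    and b: "b \<in> Tms N X (tsub N q B)"
  obtains f where "f \<in> hom (Fib (Tp N) \<Gamma>) A B" "act N X (asub N q f) t = b"
proof -
  note i = tup[OF A q t]
  obtain j where j: "j \<in> hom N (ctxt N \<Gamma> A) X" "j \<cdot>\<^bsub>N\<^esub> tup N \<Gamma> A q t = Ident N X"
    "tup N \<Gamma> A q t \<cdot>\<^bsub>N\<^esub> j = Ident N (ctxt N \<Gamma> A)"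
    using is_isoE[OF iso i(1)] by metis
  \<comment> \<open>Being inverse to an arrow over \<open>\<Gamma>\<close>, \<open>j\<close> lies
    over \<open>\<Gamma>\<close> too, so \<open>b\<close> can be moved to the extension.\<close>
  have "q \<cdot>\<^bsub>N\<^esub> j = Ext N \<Gamma> A"
    using i(1,2) j q ext_hom[OF \<Gamma> A] assoc_right[of j "tup N \<Gamma> A q t" "Ext N \<Gamma> A"] by (auto simp: hom_def)
  then have "tmsub N j b \<in> Tms N (ctxt N \<Gamma> A) (tsub N (Ext N \<Gamma> A) B)"
    using tms_sub[OF j(1) b] types.sub_comp(1)[OF j(1) q B] by simp
  then obtain f where f: "f \<in> hom (Fib (Tp N) \<Gamma>) A B"
    "act N (ctxt N \<Gamma> A) (asub N (Ext N \<Gamma> A) f) (Var N \<Gamma> A) = tmsub N j b"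
    by (rule gen_surj[OF \<Gamma> A B])
  have "act N X (asub N q f) t = tmsub N (tup N \<Gamma> A q t) (tmsub N j b)"
    using act_gen[OF q f(1) i] f(2) by simp
  also have "\<dots> = b"
    using terms.sub_comp(1)[OF i(1) j(1) TmsD(1)[OF b]] terms.sub_id(1)[OF hom_obj(1)[OF q] TmsD(1)[OF b]] j(2) by simp
  finally show thesis using f(1) by (rule that[rotated])
qed

end

section \<open>Morphisms and 2-morphisms of natural models\<close>

lemma base_change_simps [simp]:
  "Fib (base_change F T) \<Gamma> = Fib T (FO F \<Gamma>)" "Reix (base_change F T) u = Reix T (FA F u)"
  by (simp_all add: base_change_def)

lemma strict_indexed_category_base_change:
  assumes "is_functor C D F" "strict_indexed_category D T"
  shows "strict_indexed_category C (base_change F T)"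
proof -
  interpret F: is_functor C D F by fact
  interpret T: strict_indexed_category D T by fact
  show ?thesis
    by (intro strict_indexed_category.intro strict_indexed_category_axioms.intro F.dom.category_axioms)
      (auto simp: T.reix_ident T.fib_category F.map_comp intro!: T.reix_functor T.reix_comp F.arr_map)
qed

context nm_morphism
begin

lemmas ty_obj = types.map_obj[simplified]
  and ty_hom = types.map_hom[simplified]
  and ty_ident = types.map_id[simplified]
  and ty_fcomp = types.map_fcomp[simplified]
  and ty_sub = types.map_sub[simplified]
  and tm_obj = terms.map_obj[simplified]
  and tm_hom = terms.map_hom[simplified]
  and tm_fcomp = terms.map_fcomp[simplified]
  and tm_ident = terms.map_id[simplified]
  and tm_sub = terms.map_sub[simplified]

lemma typ_map:
  assumes "\<Gamma> \<in> Obj M"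
  shows "t \<in> Obj (Fib (Tm M) \<Gamma>) \<Longrightarrow>
      FO (TmTp N (FO F \<Gamma>)) (FO (TmF F \<Gamma>) t) = FO (TpF F \<Gamma>) (FO (TmTp M \<Gamma>) t)"
    and "g \<in> Arr (Fib (Tm M) \<Gamma>) \<Longrightarrow>
      FA (TmTp N (FO F \<Gamma>)) (FA (TmF F \<Gamma>) g) = FA (TpF F \<Gamma>) (FA (TmTp M \<Gamma>) g)"
  using map_typing[OF assms, THEN arg_cong, of "\<lambda>G. FO G t"]
    map_typing[OF assms, THEN arg_cong, of "\<lambda>G. FA G g"] by simp_all

lemma tm_Tms:
  assumes "\<Gamma> \<in> Obj M" "t \<in> Tms M \<Gamma> A"
  shows "FO (TmF F \<Gamma>) t \<in> Tms N (FO F \<Gamma>) (FO (TpF F \<Gamma>) A)"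
  using assms typ_map(1)[OF assms(1)] tm_obj[OF assms(1)] by (auto simp: Tms_def)

text \<open>A morphism sends the lift of \<open>f\<close> at \<open>t\<close> to an arrow over the
  image of \<open>f\<close>, which can only be the lift there.\<close>

lemma tm_act:
  assumes "\<Gamma> \<in> Obj M" "f \<in> hom (Fib (Tp M) \<Gamma>) A B" "t \<in> Tms M \<Gamma> A"
  shows "FO (TmF F \<Gamma>) (act M \<Gamma> f t) = act N (FO F \<Gamma>) (FA (TpF F \<Gamma>) f) (FO (TmF F \<Gamma>) t)"
proof -
  note l = dom.lift[OF assms]
  show ?thesis
    by (rule cod.act_eqI[symmetric, OF _ tm_hom[OF assms(1) l(1)]])
      (use assms(1) typ_map(2)[OF assms(1)] l in \<open>simp_all add: hom_def\<close>)
qed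

text \<open>The image of the extension together with the image of the variable is the pair on which
  arrows out of the image of \<open>A\<close> are tested; \<open>compare_iso\<close> says exactly
  that this pair is isomorphic to an extension with its variable.\<close>

lemma map_var:
  assumes "\<Gamma> \<in> Obj M" "A \<in> Ty M \<Gamma>"
  shows "FA F (Ext M \<Gamma> A) \<in> hom N (FO F (ctxt M \<Gamma> A)) (FO F \<Gamma>)"
    and "FO (TmF F (ctxt M \<Gamma> A)) (Var M \<Gamma> A) \<in>
      Tms N (FO F (ctxt M \<Gamma> A)) (tsub N (FA F (Ext M \<Gamma> A)) (FO (TpF F \<Gamma>) A))"
proof -
  note p = dom.ext_hom[OF assms]
  show "FA F (Ext M \<Gamma> A) \<in> hom N (FO F (ctxt M \<Gamma> A)) (FO F \<Gamma>)" using arr_map[OF p] .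
  show "FO (TmF F (ctxt M \<Gamma> A)) (Var M \<Gamma> A) \<in>
      Tms N (FO F (ctxt M \<Gamma> A)) (tsub N (FA F (Ext M \<Gamma> A)) (FO (TpF F \<Gamma>) A))"
    using tm_Tms[OF dom.ctxt_obj[OF assms] dom.var_Tms[OF assms]] ty_sub(1)[OF p assms(2)] by simp
qed

lemma ext_compare_eq:
  assumes "\<Gamma> \<in> Obj M" "A \<in> Ty M \<Gamma>"
  shows "ext_compare M N F \<Gamma> A =
    tup N (FO F \<Gamma>) (FO (TpF F \<Gamma>) A) (FA F (Ext M \<Gamma> A)) (FO (TmF F (ctxt M \<Gamma> A)) (Var M \<Gamma> A))"
  using homD[OF map_var(1)[OF assms]] by (simp add: ext_compare_def Let_def tup_def)

lemma compare_iso':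
  assumes "\<Gamma> \<in> Obj M" "A \<in> Ty M \<Gamma>"
  shows "is_iso N (tup N (FO F \<Gamma>) (FO (TpF F \<Gamma>) A) (FA F (Ext M \<Gamma> A)) (FO (TmF F (ctxt M \<Gamma> A)) (Var M \<Gamma> A)))"
  using compare_iso[OF assms] ext_compare_eq[OF assms] by simp

lemma test_inj:
  assumes "\<Gamma> \<in> Obj M" "A \<in> Ty M \<Gamma>"
    "f \<in> hom (Fib (Tp N) (FO F \<Gamma>)) (FO (TpF F \<Gamma>) A) B" "g \<in> hom (Fib (Tp N) (FO F \<Gamma>)) (FO (TpF F \<Gamma>) A) B"
    "act N (FO F (ctxt M \<Gamma> A)) (asub N (FA F (Ext M \<Gamma> A)) f) (FO (TmF F (ctxt M \<Gamma> A)) (Var M \<Gamma> A)) =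
     act N (FO F (ctxt M \<Gamma> A)) (asub N (FA F (Ext M \<Gamma> A)) g) (FO (TmF F (ctxt M \<Gamma> A)) (Var M \<Gamma> A))"
  shows "f = g"
  using cod.test_inj[OF _ assms(3,4) map_var[OF assms(1,2)] compare_iso'[OF assms(1,2)] assms(5)] assms(1)
  by simp

end

text \<open>Only the base transformation is given. The results serve both to construct the remaining
  components and to show that those of an existing 2-morphism are forced.\<close>

locale nm_base_cell = F: nm_morphism M N F + G: nm_morphism M N G
  for M :: "('u, 'x) nm_scheme" and N :: "('u, 'y) nm_scheme"
    and F :: "('u, 'z) nmor_scheme" and G :: "('u, 'w) nmor_scheme" +
  fixes \<alpha> :: "'u \<Rightarrow> 'u"
  assumes nat: "is_nat M N F G \<alpha>"
begin

lemma cmp_hom: "\<Gamma> \<in> Obj M \<Longrightarrow> \<alpha> \<Gamma> \<in> hom N (FO F \<Gamma>) (FO G \<Gamma>)"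
  using nat by (simp add: is_nat_def)

lemma cmp_nat: "u \<in> hom M \<Delta> \<Gamma> \<Longrightarrow> FA G u \<cdot>\<^bsub>N\<^esub> \<alpha> \<Delta> = \<alpha> \<Gamma> \<cdot>\<^bsub>N\<^esub> FA F u"
  using nat by (auto simp: is_nat_def hom_def)

text \<open>Naturality of \<open>\<alpha>\<close>, read through strictly functorial reindexing. It
  makes the two sides of the transport condition terms of the same type over the same
  context.\<close>

lemma sub_swap:
  assumes "u \<in> hom M \<Delta> \<Gamma>"
  shows "A \<in> Ty N (FO G \<Gamma>) \<Longrightarrow> tsub N (FA F u) (tsub N (\<alpha> \<Gamma>) A) = tsub N (\<alpha> \<Delta>) (tsub N (FA G u) A)"
    and "f \<in> hom (Fib (Tp N) (FO G \<Gamma>)) A B \<Longrightarrow>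
      asub N (FA F u) (asub N (\<alpha> \<Gamma>) f) = asub N (\<alpha> \<Delta>) (asub N (FA G u) f)"
    and "t \<in> Obj (Fib (Tm N) (FO G \<Gamma>)) \<Longrightarrow>
      tmsub N (FA F u) (tmsub N (\<alpha> \<Gamma>) t) = tmsub N (\<alpha> \<Delta>) (tmsub N (FA G u) t)"
    and "g \<in> hom (Fib (Tm N) (FO G \<Gamma>)) t s \<Longrightarrow>
      FA (Reix (Tm N) (FA F u)) (FA (Reix (Tm N) (\<alpha> \<Gamma>)) g) =
      FA (Reix (Tm N) (\<alpha> \<Delta>)) (FA (Reix (Tm N) (FA G u)) g)"
proof -
  note o = F.dom.hom_obj[OF assms]
  note a = F.arr_map[OF assms] cmp_hom[OF o(2)] cmp_hom[OF o(1)] G.arr_map[OF assms]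
  note n = cmp_nat[OF assms]
  show "A \<in> Ty N (FO G \<Gamma>) \<Longrightarrow> tsub N (FA F u) (tsub N (\<alpha> \<Gamma>) A) = tsub N (\<alpha> \<Delta>) (tsub N (FA G u) A)"
    using F.cod.types.sub_comp(1)[OF a(1,2)] F.cod.types.sub_comp(1)[OF a(3,4)] by (simp add: n)
  show "f \<in> hom (Fib (Tp N) (FO G \<Gamma>)) A B \<Longrightarrow>
      asub N (FA F u) (asub N (\<alpha> \<Gamma>) f) = asub N (\<alpha> \<Delta>) (asub N (FA G u) f)"
    using F.cod.types.sub_comp(2)[OF a(1,2)] F.cod.types.sub_comp(2)[OF a(3,4)] by (metis n)
  show "t \<in> Obj (Fib (Tm N) (FO G \<Gamma>)) \<Longrightarrow>
      tmsub N (FA F u) (tmsub N (\<alpha> \<Gamma>) t) = tmsub N (\<alpha> \<Delta>) (tmsub N (FA G u) t)"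
    using F.cod.terms.sub_comp(1)[OF a(1,2)] F.cod.terms.sub_comp(1)[OF a(3,4)] by (simp add: n)
  show "g \<in> hom (Fib (Tm N) (FO G \<Gamma>)) t s \<Longrightarrow>
      FA (Reix (Tm N) (FA F u)) (FA (Reix (Tm N) (\<alpha> \<Gamma>)) g) =
      FA (Reix (Tm N) (\<alpha> \<Delta>)) (FA (Reix (Tm N) (FA G u)) g)"
    using F.cod.terms.sub_comp(2)[OF a(1,2)] F.cod.terms.sub_comp(2)[OF a(3,4)] by (metis n)
qed

text \<open>The only possible type component of a 2-morphism over \<open>\<alpha>\<close>: it must transport
  \<open>F v\<^sub>A\<close> to \<open>(G v\<^sub>A)[\<alpha>\<^bsub>\<Gamma>.A\<^esub>]\<close>.\<close>

definition cell_arrow :: "'u \<Rightarrow> 'u \<Rightarrow> 'u \<Rightarrow> bool" where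
  "cell_arrow \<Gamma> A f \<longleftrightarrow>
     f \<in> hom (Fib (Tp N) (FO F \<Gamma>)) (FO (TpF F \<Gamma>) A) (tsub N (\<alpha> \<Gamma>) (FO (TpF G \<Gamma>) A)) \<and>
     act N (FO F (ctxt M \<Gamma> A)) (asub N (FA F (Ext M \<Gamma> A)) f) (FO (TmF F (ctxt M \<Gamma> A)) (Var M \<Gamma> A))
       = tmsub N (\<alpha> (ctxt M \<Gamma> A)) (FO (TmF G (ctxt M \<Gamma> A)) (Var M \<Gamma> A))"

lemma cell_arrow_unique:
  assumes "\<Gamma> \<in> Obj M" "A \<in> Ty M \<Gamma>" "cell_arrow \<Gamma> A f" "cell_arrow \<Gamma> A g"
  shows "f = g"
  using F.test_inj[OF assms(1,2) assms(3)[unfolded cell_arrow_def, THEN conjunct1]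
      assms(4)[unfolded cell_arrow_def, THEN conjunct1]] assms(3,4)
  unfolding cell_arrow_def by simp

lemma cell_arrow_ex:
  assumes "\<Gamma> \<in> Obj M" "A \<in> Ty M \<Gamma>"
  shows "\<exists>f. cell_arrow \<Gamma> A f"
proof -
  note p = F.dom.ext_hom[OF assms] and \<Gamma>A = F.dom.ctxt_obj[OF assms]
  note FA = F.ty_obj[OF assms] and GA = G.ty_obj[OF assms]
  note GA' = F.cod.types.sub_obj[OF cmp_hom[OF assms(1)] GA]
  \<comment> \<open>The prescribed result of the transport has the type that transport along an
    arrow into \<open>(G A)[\<alpha>]\<close> would produce, so \<open>test_surj\<close> applies to
    it.\<close>
  have b: "tmsub N (\<alpha> (ctxt M \<Gamma> A)) (FO (TmF G (ctxt M \<Gamma> A)) (Var M \<Gamma> A)) \<in>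
      Tms N (FO F (ctxt M \<Gamma> A)) (tsub N (FA F (Ext M \<Gamma> A)) (tsub N (\<alpha> \<Gamma>) (FO (TpF G \<Gamma>) A)))"
    by (rule F.cod.tms_sub'[OF cmp_hom[OF \<Gamma>A] G.map_var(2)[OF assms] sub_swap(1)[OF p GA]])
  show ?thesis
    using F.cod.test_surj[OF F.obj_map[OF assms(1)] FA GA' F.map_var[OF assms] F.compare_iso'[OF assms] b]
    unfolding cell_arrow_def by blast
qed

text \<open>The condition concerns the variable only, but a term \<open>t\<close> of type
  \<open>A[u]\<close> is the variable restricted along \<open>w\<close>, and transport and
  restriction along \<open>\<alpha>\<close> are compatible with \<open>w\<close>.\<close>

lemma cell_arrow_act:
  assumes c: "cell_arrow \<Gamma> A f" and u: "u \<in> hom M \<Delta> \<Gamma>" and A: "A \<in> Ty M \<Gamma>"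
    and t: "t \<in> Tms M \<Delta> (tsub M u A)"
  shows "act N (FO F \<Delta>) (asub N (FA F u) f) (FO (TmF F \<Delta>) t) = tmsub N (\<alpha> \<Delta>) (FO (TmF G \<Delta>) t)"
proof -
  note \<Gamma> = F.dom.hom_obj(2)[OF u] and \<Delta> = F.dom.hom_obj(1)[OF u]
  note f = c[unfolded cell_arrow_def]
  define w where "w = tup M \<Gamma> A u t"
  note w = F.dom.tup[OF A u t, folded w_def]
  note p = F.dom.ext_hom[OF \<Gamma> A] and v = F.dom.var_Tms[OF \<Gamma> A]
  have 1: "asub N (FA F u) f = asub N (FA F w) (asub N (FA F (Ext M \<Gamma> A)) f)"
    using F.cod.types.sub_comp(2)[OF F.arr_map[OF w(1)] F.arr_map[OF p] f[THEN conjunct1]]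
      F.map_comp[OF w(1) p] w(2) by simp
  have 2: "FO (TmF F \<Delta>) t = tmsub N (FA F w) (FO (TmF F (ctxt M \<Gamma> A)) (Var M \<Gamma> A))"
    "FO (TmF G \<Delta>) t = tmsub N (FA G w) (FO (TmF G (ctxt M \<Gamma> A)) (Var M \<Gamma> A))"
    using F.tm_sub(1)[OF w(1) F.dom.TmsD(1)[OF v]] G.tm_sub(1)[OF w(1) F.dom.TmsD(1)[OF v]] w(3) by simp_all
  show ?thesis
    unfolding 1 2 using F.cod.act_sub[OF F.arr_map[OF w(1)] F.cod.types.sub_hom[OF F.arr_map[OF p] f[THEN conjunct1]]
        F.map_var(2)[OF \<Gamma> A]] f[THEN conjunct2]
      sub_swap(3)[OF w(1) F.cod.TmsD(1)[OF G.map_var(2)[OF \<Gamma> A]]] by simp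
qed

lemma cell_arrow_act_id:
  assumes "\<Gamma> \<in> Obj M" "cell_arrow \<Gamma> A f" "t \<in> Tms M \<Gamma> A"
  shows "act N (FO F \<Gamma>) f (FO (TmF F \<Gamma>) t) = tmsub N (\<alpha> \<Gamma>) (FO (TmF G \<Gamma>) t)"
proof -
  have A: "A \<in> Ty M \<Gamma>" using F.dom.Tms_ty[OF assms(1,3)] .
  show ?thesis
    using cell_arrow_act[OF assms(2) F.dom.ident_hom[OF assms(1)] A] assms(1,3) F.dom.types.sub_id(1)[OF assms(1) A]
      F.cod.types.sub_id(2)[OF F.obj_map[OF assms(1)] assms(2)[unfolded cell_arrow_def, THEN conjunct1]] by simp
qed

text \<open>Both composites are tested on the image of the variable. One transports it along
  \<open>a\<close> and then along the image of \<open>f\<close> under \<open>G\<close>; the other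
  transports along \<open>f\<close> first and then uses the condition for \<open>b\<close>. Either
  way the result is the restriction along \<open>\<alpha>\<close> of the image under
  \<open>G\<close> of the transported variable.\<close>

lemma cell_arrow_nat:
  assumes \<Gamma>: "\<Gamma> \<in> Obj M" and f: "f \<in> hom (Fib (Tp M) \<Gamma>) A B"
    and a: "cell_arrow \<Gamma> A a" and b: "cell_arrow \<Gamma> B b"
  shows "asub N (\<alpha> \<Gamma>) (FA (TpF G \<Gamma>) f) \<cdot>\<^bsub>Fib (Tp N) (FO F \<Gamma>)\<^esub> a
    = b \<cdot>\<^bsub>Fib (Tp N) (FO F \<Gamma>)\<^esub> FA (TpF F \<Gamma>) f"
proof -
  have AB: "A \<in> Ty M \<Gamma>" "B \<in> Ty M \<Gamma>" using category.hom_obj[OF F.dom.types.fib_category[OF \<Gamma>] f] by auto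
  note \<Gamma>A = F.dom.ctxt_obj[OF \<Gamma> AB(1)]
  note F\<Gamma> = F.obj_map[OF \<Gamma>] and FX = F.obj_map[OF \<Gamma>A]
  note p = F.dom.ext_hom[OF \<Gamma> AB(1)] and v = F.dom.var_Tms[OF \<Gamma> AB(1)]
  note a' = a[unfolded cell_arrow_def, THEN conjunct1] and a'' = a[unfolded cell_arrow_def, THEN conjunct2]
  note b' = b[unfolded cell_arrow_def, THEN conjunct1]
  note Ff = F.ty_hom[OF \<Gamma> f] and Gf = G.ty_hom[OF \<Gamma> f]
  note Gf' = F.cod.types.sub_hom[OF cmp_hom[OF \<Gamma>] Gf]
  note pf = F.dom.types.sub_hom[OF p f]
  note q = F.arr_map[OF p] and r = G.arr_map[OF p]
  note s = F.dom.act_Tms[OF \<Gamma>A pf v]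
  let ?v = "FO (TmF F (ctxt M \<Gamma> A)) (Var M \<Gamma> A)"
  let ?w = "FO (TmF G (ctxt M \<Gamma> A)) (Var M \<Gamma> A)"
  let ?\<alpha> = "\<alpha> (ctxt M \<Gamma> A)"
  let ?act = "act N (FO F (ctxt M \<Gamma> A))"
  let ?q = "asub N (FA F (Ext M \<Gamma> A))"
  have fA: "f \<in> Arr (Fib (Tp M) \<Gamma>)" using f by (simp add: hom_def)
  have "?act (?q (asub N (\<alpha> \<Gamma>) (FA (TpF G \<Gamma>) f) \<cdot>\<^bsub>Fib (Tp N) (FO F \<Gamma>)\<^esub> a)) ?v
      = ?act (?q (asub N (\<alpha> \<Gamma>) (FA (TpF G \<Gamma>) f))) (?act (?q a) ?v)"
    using F.cod.types.sub_fcomp[OF q a' Gf'] F.cod.act_comp[OF FX F.cod.types.sub_hom[OF q a']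
        F.cod.types.sub_hom[OF q Gf'] F.map_var(2)[OF \<Gamma> AB(1)]] by simp
  also have "\<dots> = ?act (asub N ?\<alpha> (asub N (FA G (Ext M \<Gamma> A)) (FA (TpF G \<Gamma>) f))) (tmsub N ?\<alpha> ?w)"
    by (simp add: a'' sub_swap(2)[OF p Gf])
  also have "\<dots> = tmsub N ?\<alpha> (FO (TmF G (ctxt M \<Gamma> A)) (act M (ctxt M \<Gamma> A) (asub M (Ext M \<Gamma> A) f) (Var M \<Gamma> A)))"
    using F.cod.act_sub[OF cmp_hom[OF \<Gamma>A] F.cod.types.sub_hom[OF r Gf] G.map_var(2)[OF \<Gamma> AB(1)]]
      G.tm_act[OF \<Gamma>A pf v] G.ty_sub(2)[OF p fA] by simp
  \<comment> \<open>Here the condition for \<open>b\<close> is needed at the transported variable,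
    which is a term of \<open>B\<close> but not its variable.\<close>
  also have "\<dots> = ?act (?q b) (FO (TmF F (ctxt M \<Gamma> A)) (act M (ctxt M \<Gamma> A) (asub M (Ext M \<Gamma> A) f) (Var M \<Gamma> A)))"
    by (rule cell_arrow_act[OF b p AB(2) s, symmetric])
  also have "\<dots> = ?act (?q b) (?act (?q (FA (TpF F \<Gamma>) f)) ?v)"
    using F.tm_act[OF \<Gamma>A pf v] F.ty_sub(2)[OF p fA] by simp
  also have "\<dots> = ?act (?q (b \<cdot>\<^bsub>Fib (Tp N) (FO F \<Gamma>)\<^esub> FA (TpF F \<Gamma>) f)) ?v"
    using F.cod.types.sub_fcomp[OF q Ff b'] F.cod.act_comp[OF FX F.cod.types.sub_hom[OF q Ff]
        F.cod.types.sub_hom[OF q b'] F.map_var(2)[OF \<Gamma> AB(1)]] by simp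
  finally show ?thesis
    by (rule F.test_inj[OF \<Gamma> AB(1) category.comp_hom[OF F.cod.types.fib_category[OF F\<Gamma>] a' Gf']
        category.comp_hom[OF F.cod.types.fib_category[OF F\<Gamma>] Ff b']])
qed

text \<open>The variable of the reindexed type is a term of the type \<open>A[u \<cdot> p]\<close>,
  so this is the condition for \<open>a\<close> at that term. Combined with uniqueness it yields
  compatibility with reindexing.\<close>

lemma cell_arrow_sub:
  assumes u: "u \<in> hom M \<Delta> \<Gamma>" and A: "A \<in> Ty M \<Gamma>" and a: "cell_arrow \<Gamma> A a"
  shows "cell_arrow \<Delta> (tsub M u A) (asub N (FA F u) a)"
proof -
  note \<Gamma> = F.dom.hom_obj(2)[OF u] and \<Delta> = F.dom.hom_obj(1)[OF u]
  note a' = a[unfolded cell_arrow_def, THEN conjunct1]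
  note Au = F.dom.types.sub_obj[OF u A]
  note p = F.dom.ext_hom[OF \<Delta> Au]
  have v: "Var M \<Delta> (tsub M u A) \<in> Tms M (ctxt M \<Delta> (tsub M u A)) (tsub M (u \<cdot>\<^bsub>M\<^esub> Ext M \<Delta> (tsub M u A)) A)"
    using F.dom.var_Tms[OF \<Delta> Au] F.dom.types.sub_comp(1)[OF p u A] by simp
  have 1: "asub N (FA F (Ext M \<Delta> (tsub M u A))) (asub N (FA F u) a)
      = asub N (FA F (u \<cdot>\<^bsub>M\<^esub> Ext M \<Delta> (tsub M u A))) a"
    using F.cod.types.sub_comp(2)[OF F.arr_map[OF p] F.arr_map[OF u] a'] F.map_comp[OF p u] by simp
  show ?thesis
    unfolding cell_arrow_def 1
    using cell_arrow_act[OF a F.dom.comp_hom[OF p u] A v] F.cod.types.sub_hom[OF F.arr_map[OF u] a']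
      F.ty_sub(1)[OF u A] G.ty_sub(1)[OF u A] sub_swap(1)[OF u G.ty_obj[OF \<Gamma> A]] by simp
qed

text \<open>For types, naturality and stability under reindexing follow from the transport
  condition; the discrete opfibration carries them over to terms. Record fields are equated one by
  one because \<open>F\<close> and \<open>G\<close> may have further fields.\<close>

lemma nm_2cellI:
  fixes \<gamma> :: "('u, 'v) ncell_scheme"
  assumes \<gamma>: "NCmp \<gamma> = \<alpha>" and FG: "FO (NSrc \<gamma>) = FO F" "FA (NSrc \<gamma>) = FA F" "TpF (NSrc \<gamma>) = TpF F" "TmF (NSrc \<gamma>) = TmF F"
      "FO (NTrg \<gamma>) = FO G" "FA (NTrg \<gamma>) = FA G" "TpF (NTrg \<gamma>) = TpF G" "TmF (NTrg \<gamma>) = TmF G"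
      "nm_morphism M N (NSrc \<gamma>)" "nm_morphism M N (NTrg \<gamma>)"
    and ext: "TpCmp \<gamma> \<in> extensional (Obj M)" "TmCmp \<gamma> \<in> extensional (Obj M)"
      "\<And>\<Gamma>. \<Gamma> \<in> Obj M \<Longrightarrow> TpCmp \<gamma> \<Gamma> \<in> extensional (Ty M \<Gamma>)"
      "\<And>\<Gamma>. \<Gamma> \<in> Obj M \<Longrightarrow> TmCmp \<gamma> \<Gamma> \<in> extensional (Obj (Fib (Tm M) \<Gamma>))"
    and tp: "\<And>\<Gamma> A. \<lbrakk>\<Gamma> \<in> Obj M; A \<in> Ty M \<Gamma>\<rbrakk> \<Longrightarrow> cell_arrow \<Gamma> A (TpCmp \<gamma> \<Gamma> A)"
    and tm: "\<And>\<Gamma> t. \<lbrakk>\<Gamma> \<in> Obj M; t \<in> Obj (Fib (Tm M) \<Gamma>)\<rbrakk> \<Longrightarrow>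
      TmCmp \<gamma> \<Gamma> t \<in> hom (Fib (Tm N) (FO F \<Gamma>)) (FO (TmF F \<Gamma>) t) (tmsub N (\<alpha> \<Gamma>) (FO (TmF G \<Gamma>) t)) \<and>
      FA (TmTp N (FO F \<Gamma>)) (TmCmp \<gamma> \<Gamma> t) = TpCmp \<gamma> \<Gamma> (FO (TmTp M \<Gamma>) t)"
  shows "nm_2cell M N \<gamma>"
proof -
  have tpI: "indexed_nat_over M (Tp M) (Tp N) (NSrc \<gamma>) \<alpha> (TpF F) (TpF G) (TpCmp \<gamma>)"
  proof
    show "TpCmp \<gamma> \<in> extensional (Obj M)" by (fact ext)
    show "is_nat (Fib (Tp M) \<Gamma>) (Fib (Tp N) (FO (NSrc \<gamma>) \<Gamma>)) (TpF F \<Gamma>)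
        (ftr_comp (Fib (Tp M) \<Gamma>) (Reix (Tp N) (\<alpha> \<Gamma>)) (TpF G \<Gamma>)) (TpCmp \<gamma> \<Gamma>)" if \<Gamma>: "\<Gamma> \<in> Obj M" for \<Gamma>
      unfolding is_nat_def
    proof (intro conjI ballI)
      fix f assume f: "f \<in> Arr (Fib (Tp M) \<Gamma>)"
      interpret T: category "Fib (Tp M) \<Gamma>" using F.dom.types.fib_category[OF \<Gamma>] .
      show "FA (ftr_comp (Fib (Tp M) \<Gamma>) (Reix (Tp N) (\<alpha> \<Gamma>)) (TpF G \<Gamma>)) f \<cdot>\<^bsub>Fib (Tp N) (FO (NSrc \<gamma>) \<Gamma>)\<^esub>
          TpCmp \<gamma> \<Gamma> (Dom (Fib (Tp M) \<Gamma>) f)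
        = TpCmp \<gamma> \<Gamma> (Cod (Fib (Tp M) \<Gamma>) f) \<cdot>\<^bsub>Fib (Tp N) (FO (NSrc \<gamma>) \<Gamma>)\<^esub> FA (TpF F \<Gamma>) f"
        using cell_arrow_nat[OF \<Gamma> homI[OF f refl refl] tp[OF \<Gamma>] tp[OF \<Gamma>]] f by (simp add: FG)
    qed (use ext(3)[OF \<Gamma>] tp[OF \<Gamma>] in \<open>simp_all add: cell_arrow_def FG\<close>)
    show "TpCmp \<gamma> \<Delta> (tsub M u A) = asub N (FA (NSrc \<gamma>) u) (TpCmp \<gamma> \<Gamma> A)"
      if u: "u \<in> hom M \<Delta> \<Gamma>" and A: "A \<in> Ty M \<Gamma>" for u \<Delta> \<Gamma> A
      unfolding FG
      by (rule cell_arrow_unique[OF F.dom.hom_obj(1)[OF u] F.dom.types.sub_obj[OF u A]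
          tp[OF F.dom.hom_obj(1)[OF u] F.dom.types.sub_obj[OF u A]]
          cell_arrow_sub[OF u A tp[OF F.dom.hom_obj(2)[OF u] A]]])
  qed
  have tmI: "indexed_nat_over M (Tm M) (Tm N) (NSrc \<gamma>) \<alpha> (TmF F) (TmF G) (TmCmp \<gamma>)"
  proof
    show "TmCmp \<gamma> \<in> extensional (Obj M)" by (fact ext)
    show "is_nat (Fib (Tm M) \<Gamma>) (Fib (Tm N) (FO (NSrc \<gamma>) \<Gamma>)) (TmF F \<Gamma>)
        (ftr_comp (Fib (Tm M) \<Gamma>) (Reix (Tm N) (\<alpha> \<Gamma>)) (TmF G \<Gamma>)) (TmCmp \<gamma> \<Gamma>)" if \<Gamma>: "\<Gamma> \<in> Obj M" for \<Gamma>
      unfolding is_nat_def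
    proof (intro conjI ballI)
      fix g assume g: "g \<in> Arr (Fib (Tm M) \<Gamma>)"
      interpret T: category "Fib (Tm M) \<Gamma>" using F.dom.terms.fib_category[OF \<Gamma>] .
      interpret T': category "Fib (Tm N) (FO F \<Gamma>)" using F.cod.terms.fib_category[OF F.obj_map[OF \<Gamma>]] .
      let ?s = "Dom (Fib (Tm M) \<Gamma>) g" and ?t = "Cod (Fib (Tm M) \<Gamma>) g"
      let ?a = "FO (TmTp M \<Gamma>) ?s" and ?b = "FO (TmTp M \<Gamma>) ?t"
      have g': "g \<in> hom (Fib (Tm M) \<Gamma>) ?s ?t" using g by (simp add: hom_def)
      have st: "?s \<in> Obj (Fib (Tm M) \<Gamma>)" "?t \<in> Obj (Fib (Tm M) \<Gamma>)" using g by auto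
      note f = F.dom.typing.map_hom[OF \<Gamma> g']
      have AB: "?a \<in> Ty M \<Gamma>" "?b \<in> Ty M \<Gamma>" using F.dom.typing.map_obj[OF \<Gamma>] st by auto
      note tms = tm[OF \<Gamma> st(1), THEN conjunct1] tm[OF \<Gamma> st(2), THEN conjunct1]
      note Gg = G.tm_hom[OF \<Gamma> g'] and Fg = F.tm_hom[OF \<Gamma> g']
      note Gg' = F.cod.terms.sub_hom[OF cmp_hom[OF \<Gamma>] Gg]
      \<comment> \<open>Both sides start at the image of \<open>?s\<close>, and their images under
        typing are the two sides of naturality on types.\<close>
      have "FA (Reix (Tm N) (\<alpha> \<Gamma>)) (FA (TmF G \<Gamma>) g) \<cdot>\<^bsub>Fib (Tm N) (FO F \<Gamma>)\<^esub> TmCmp \<gamma> \<Gamma> ?s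
         = TmCmp \<gamma> \<Gamma> ?t \<cdot>\<^bsub>Fib (Tm N) (FO F \<Gamma>)\<^esub> FA (TmF F \<Gamma>) g"
      proof (rule F.cod.term_arr_eqI[OF F.obj_map[OF \<Gamma>] T'.comp_hom[OF tms(1) Gg'] T'.comp_hom[OF Fg tms(2)]])
        show "FA (TmTp N (FO F \<Gamma>)) (FA (Reix (Tm N) (\<alpha> \<Gamma>)) (FA (TmF G \<Gamma>) g) \<cdot>\<^bsub>Fib (Tm N) (FO F \<Gamma>)\<^esub> TmCmp \<gamma> \<Gamma> ?s)
          = FA (TmTp N (FO F \<Gamma>)) (TmCmp \<gamma> \<Gamma> ?t \<cdot>\<^bsub>Fib (Tm N) (FO F \<Gamma>)\<^esub> FA (TmF F \<Gamma>) g)"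
          using F.cod.typing.map_fcomp[OF F.obj_map[OF \<Gamma>] tms(1) Gg'] F.cod.typing.map_fcomp[OF F.obj_map[OF \<Gamma>] Fg tms(2)]
            F.cod.typing.map_sub(2)[OF cmp_hom[OF \<Gamma>] homD(1)[OF Gg]] F.typ_map(2)[OF \<Gamma> g] G.typ_map(2)[OF \<Gamma> g]
            tm[OF \<Gamma> st(1)] tm[OF \<Gamma> st(2)] cell_arrow_nat[OF \<Gamma> f tp[OF \<Gamma> AB(1)] tp[OF \<Gamma> AB(2)]] by simp
      qed
      then show "FA (ftr_comp (Fib (Tm M) \<Gamma>) (Reix (Tm N) (\<alpha> \<Gamma>)) (TmF G \<Gamma>)) g \<cdot>\<^bsub>Fib (Tm N) (FO (NSrc \<gamma>) \<Gamma>)\<^esub>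
          TmCmp \<gamma> \<Gamma> ?s = TmCmp \<gamma> \<Gamma> ?t \<cdot>\<^bsub>Fib (Tm N) (FO (NSrc \<gamma>) \<Gamma>)\<^esub> FA (TmF F \<Gamma>) g"
        using g by (simp add: FG)
    qed (use ext(4)[OF \<Gamma>] tm[OF \<Gamma>] in \<open>simp_all add: FG\<close>)
    show "TmCmp \<gamma> \<Delta> (tmsub M u t) = FA (Reix (Tm N) (FA (NSrc \<gamma>) u)) (TmCmp \<gamma> \<Gamma> t)"
      if u: "u \<in> hom M \<Delta> \<Gamma>" and t: "t \<in> Obj (Fib (Tm M) \<Gamma>)" for u \<Delta> \<Gamma> t
    proof -
      note \<Gamma> = F.dom.hom_obj(2)[OF u] and \<Delta> = F.dom.hom_obj(1)[OF u]
      note tu = F.dom.terms.sub_obj[OF u t]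
      note 1 = tm[OF \<Delta> tu, THEN conjunct1] and 2 = tm[OF \<Gamma> t, THEN conjunct1]
      note 3 = F.cod.terms.sub_hom[OF F.arr_map[OF u] 2]
      show ?thesis
        unfolding FG
      proof (rule F.cod.term_arr_eqI[OF F.obj_map[OF \<Delta>] 1])
        show "FA (Reix (Tm N) (FA F u)) (TmCmp \<gamma> \<Gamma> t) \<in> hom (Fib (Tm N) (FO F \<Delta>)) (FO (TmF F \<Delta>) (tmsub M u t))
            (tmsub N (FA F u) (tmsub N (\<alpha> \<Gamma>) (FO (TmF G \<Gamma>) t)))"
          using 3 F.tm_sub(1)[OF u t] by simp
        have A: "FO (TmTp M \<Gamma>) t \<in> Ty M \<Gamma>" using F.dom.typing.map_obj[OF \<Gamma> t] .
        have "TpCmp \<gamma> \<Delta> (tsub M u (FO (TmTp M \<Gamma>) t)) = asub N (FA F u) (TpCmp \<gamma> \<Gamma> (FO (TmTp M \<Gamma>) t))"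
          using indexed_nat_over.reindex[OF tpI u A] by (simp add: FG)
        then show "FA (TmTp N (FO F \<Delta>)) (TmCmp \<gamma> \<Delta> (tmsub M u t)) =
            FA (TmTp N (FO F \<Delta>)) (FA (Reix (Tm N) (FA F u)) (TmCmp \<gamma> \<Gamma> t))"
          using tm[OF \<Delta> tu] tm[OF \<Gamma> t] F.cod.typing.map_sub(2)[OF F.arr_map[OF u] homD(1)[OF 2]]
            F.dom.typing.map_sub(1)[OF u t] by simp
      qed
    qed
  qed
  show ?thesis
    unfolding nm_2cell_def nm_2cell_axioms_def
    using FG(9,10) tpI tmI nat tm by (simp add: \<gamma> FG is_nat_def)
qed

end

lemma (in nm_2cell) base_cell: "nm_base_cell M N (NSrc \<alpha>) (NTrg \<alpha>) (NCmp \<alpha>)"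
  by (intro nm_base_cell.intro nm_base_cell_axioms.intro natural) unfold_locales

context nm_2cell
begin

sublocale base: nm_base_cell M N "NSrc \<alpha>" "NTrg \<alpha>" "NCmp \<alpha>"
  by (rule base_cell)

lemma tm_hom:
  assumes "\<Gamma> \<in> Obj M" "t \<in> Obj (Fib (Tm M) \<Gamma>)"
  shows "TmCmp \<alpha> \<Gamma> t \<in> hom (Fib (Tm N) (FO (NSrc \<alpha>) \<Gamma>)) (FO (TmF (NSrc \<alpha>) \<Gamma>) t)
    (tmsub N (NCmp \<alpha> \<Gamma>) (FO (TmF (NTrg \<alpha>) \<Gamma>) t))"
  using terms.fib_nat[OF assms(1)] assms(2) by (simp add: is_nat_def)

lemma tp_hom:
  assumes "\<Gamma> \<in> Obj M" "A \<in> Ty M \<Gamma>"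
  shows "TpCmp \<alpha> \<Gamma> A \<in> hom (Fib (Tp N) (FO (NSrc \<alpha>) \<Gamma>)) (FO (TpF (NSrc \<alpha>) \<Gamma>) A)
    (tsub N (NCmp \<alpha> \<Gamma>) (FO (TpF (NTrg \<alpha>) \<Gamma>) A))"
  using types.fib_nat[OF assms(1)] assms(2) by (simp add: is_nat_def)

text \<open>The term component at the variable lies over the type component at the reindexed type,
  which is the reindexed component at \<open>A\<close>. An arrow over it is the lift, so its target
  is the transport.\<close>

lemma cell_arrow:
  assumes "\<Gamma> \<in> Obj M" "A \<in> Ty M \<Gamma>"
  shows "base.cell_arrow \<Gamma> A (TpCmp \<alpha> \<Gamma> A)"
proof -
  note p = src.dom.ext_hom[OF assms] and v = src.dom.var_Tms[OF assms] and X = src.dom.ctxt_obj[OF assms]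
  have "act N (FO (NSrc \<alpha>) (ctxt M \<Gamma> A)) (TpCmp \<alpha> (ctxt M \<Gamma> A) (tsub M (Ext M \<Gamma> A) A))
        (FO (TmF (NSrc \<alpha>) (ctxt M \<Gamma> A)) (Var M \<Gamma> A))
      = tmsub N (NCmp \<alpha> (ctxt M \<Gamma> A)) (FO (TmF (NTrg \<alpha>) (ctxt M \<Gamma> A)) (Var M \<Gamma> A))"
    using typing[OF X src.dom.TmsD(1)[OF v]] src.dom.TmsD(2)[OF v]
    by (intro src.cod.act_eqI[OF src.obj_map[OF X] tm_hom[OF X src.dom.TmsD(1)[OF v]]]) simp
  then show ?thesis
    unfolding base.cell_arrow_def using tp_hom[OF assms] types.reindex[OF p assms(2)] by simp
qed

end

text \<open>Type components solve the same transport condition; term components then have the same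
  source and the same image; extensionality settles the values off the carriers.\<close>

lemma ncell_eqI:
  fixes \<alpha> \<beta> :: "'u ncell"
  assumes \<alpha>: "nm_2cell M N \<alpha>" and \<beta>: "nm_2cell M N \<beta>"
    and eq: "NSrc \<alpha> = NSrc \<beta>" "NTrg \<alpha> = NTrg \<beta>" "NCmp \<alpha> = NCmp \<beta>"
  shows "\<alpha> = \<beta>"
proof -
  interpret \<alpha>: nm_2cell M N \<alpha> by fact
  interpret \<beta>: nm_2cell M N \<beta> by fact
  have tp: "TpCmp \<alpha> \<Gamma> A = TpCmp \<beta> \<Gamma> A" if "\<Gamma> \<in> Obj M" "A \<in> Ty M \<Gamma>" for \<Gamma> A
    using \<alpha>.base.cell_arrow_unique[OF that \<alpha>.cell_arrow[OF that]] \<beta>.cell_arrow[OF that] by (simp add: eq)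
  have tm: "TmCmp \<alpha> \<Gamma> t = TmCmp \<beta> \<Gamma> t" if "\<Gamma> \<in> Obj M" "t \<in> Obj (Fib (Tm M) \<Gamma>)" for \<Gamma> t
    using \<alpha>.typing[OF that] \<beta>.typing[OF that] tp[OF that(1) \<alpha>.src.dom.typing.map_obj[OF that]] eq
    by (intro \<alpha>.src.cod.term_arr_eqI[OF \<alpha>.src.obj_map[OF that(1)] \<alpha>.tm_hom[OF that]
        \<beta>.tm_hom[OF that, folded eq]]) simp
  have "TpCmp \<alpha> \<Gamma> = TpCmp \<beta> \<Gamma>" if "\<Gamma> \<in> Obj M" for \<Gamma>
    by (rule extensionalityI[OF is_natD(1)[OF \<alpha>.types.fib_nat[OF that]] is_natD(1)[OF \<beta>.types.fib_nat[OF that]]])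
      (rule tp[OF that])
  moreover have "TmCmp \<alpha> \<Gamma> = TmCmp \<beta> \<Gamma>" if "\<Gamma> \<in> Obj M" for \<Gamma>
    by (rule extensionalityI[OF is_natD(1)[OF \<alpha>.terms.fib_nat[OF that]] is_natD(1)[OF \<beta>.terms.fib_nat[OF that]]])
      (rule tm[OF that])
  ultimately have "TpCmp \<alpha> = TpCmp \<beta>" "TmCmp \<alpha> = TmCmp \<beta>"
    using extensionalityI[OF \<alpha>.types.ext \<beta>.types.ext] extensionalityI[OF \<alpha>.terms.ext \<beta>.terms.ext] by blast+
  with eq show ?thesis by (intro ncell.equality) auto
qed

lemma ncell_exists:
  fixes F G :: "'u nmor"
  assumes F: "nm_morphism M N F" and G: "nm_morphism M N G" and \<alpha>: "is_nat M N F G \<alpha>"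
  obtains \<gamma> :: "'u ncell" where "nm_2cell M N \<gamma>" "NSrc \<gamma> = F" "NTrg \<gamma> = G" "NCmp \<gamma> = \<alpha>"
proof -
  interpret nm_base_cell M N F G \<alpha> by (intro nm_base_cell.intro nm_base_cell_axioms.intro F G \<alpha>)
  define a where "a \<Gamma> A = (SOME f. cell_arrow \<Gamma> A f)" for \<Gamma> A
  have a: "cell_arrow \<Gamma> A (a \<Gamma> A)" if "\<Gamma> \<in> Obj M" "A \<in> Ty M \<Gamma>" for \<Gamma> A
    unfolding a_def using cell_arrow_ex[OF that] by (rule someI_ex)
  \<comment> \<open>The term component can only be the lift of the type component at the image of
    \<open>t\<close>. That it ends at the right restriction is the transport condition at
    \<open>t\<close>.\<close>
  define \<gamma> :: "'u ncell" where "\<gamma> = \<lparr>NSrc = F, NTrg = G, NCmp = \<alpha>,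
    TpCmp = (\<lambda>\<Gamma> \<in> Obj M. \<lambda>A \<in> Ty M \<Gamma>. a \<Gamma> A),
    TmCmp = (\<lambda>\<Gamma> \<in> Obj M. \<lambda>t \<in> Obj (Fib (Tm M) \<Gamma>).
      opfib_lift (Fib (Tm N) (FO F \<Gamma>)) (TmTp N (FO F \<Gamma>)) (FO (TmF F \<Gamma>) t) (a \<Gamma> (FO (TmTp M \<Gamma>) t)))\<rparr>"
  have "nm_2cell M N \<gamma>"
  proof (rule nm_2cellI)
    fix \<Gamma> t assume \<Gamma>: "\<Gamma> \<in> Obj M" and t: "t \<in> Obj (Fib (Tm M) \<Gamma>)"
    have t': "t \<in> Tms M \<Gamma> (FO (TmTp M \<Gamma>) t)" using t by (simp add: Tms_def)
    note A = F.dom.typing.map_obj[OF \<Gamma> t]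
    note b = a[OF \<Gamma> A]
    note l = F.cod.lift[OF F.obj_map[OF \<Gamma>] b[unfolded cell_arrow_def, THEN conjunct1] F.tm_Tms[OF \<Gamma> t']]
    show "TmCmp \<gamma> \<Gamma> t \<in> hom (Fib (Tm N) (FO F \<Gamma>)) (FO (TmF F \<Gamma>) t) (tmsub N (\<alpha> \<Gamma>) (FO (TmF G \<Gamma>) t)) \<and>
      FA (TmTp N (FO F \<Gamma>)) (TmCmp \<gamma> \<Gamma> t) = TpCmp \<gamma> \<Gamma> (FO (TmTp M \<Gamma>) t)"
      using l cell_arrow_act_id[OF \<Gamma> b t'] \<Gamma> t A by (simp add: \<gamma>_def)
  qed (simp_all add: \<gamma>_def a F.nm_morphism_axioms G.nm_morphism_axioms)
  then show thesis by (rule that) (simp_all add: \<gamma>_def)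
qed

section \<open>The 2-category of natural models\<close>

text \<open>The underlying display category is a truncated record, hence a value of another type.
  These rules reduce each notion to the fields it reads, so that results pass between a model and
  its truncation.\<close>

lemma truncate_simps [simp]:
  "Obj (dcat.truncate C) = Obj C" "Arr (dcat.truncate C) = Arr C" "Dom (dcat.truncate C) = Dom C"
  "Cod (dcat.truncate C) = Cod C" "Ident (dcat.truncate C) = Ident C" "Comp (dcat.truncate C) = Comp C"
  "Disp (dcat.truncate C) = Disp C" "Pb (dcat.truncate C) = Pb C" "PbTop (dcat.truncate C) = PbTop C"
  by (simp_all add: dcat.truncate_def)

lemma ftr_truncate_simps [simp]:
  "FO (ftr.truncate F) = FO F" "FA (ftr.truncate F) = FA F"
  by (simp_all add: ftr.truncate_def)

lemma hom_truncate [simp]: "hom (dcat.truncate C) = hom C"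
  by (simp add: hom_def fun_eq_iff)

lemma is_iso_truncate [simp]: "is_iso (dcat.truncate C) = is_iso C"
  by (simp add: is_iso_def fun_eq_iff)

lemma pullback_square_truncate [simp]: "pullback_square (dcat.truncate C) = pullback_square C"
  by (simp add: pullback_square_def fun_eq_iff)

lemma small_cat_truncate [simp]: "small_cat (dcat.truncate C) = small_cat C"
  by (simp add: small_cat_def)

lemma category_truncate [simp]: "category (dcat.truncate C) = category C"
  by (simp add: category_def)

lemma display_category_truncate [simp]: "display_category (dcat.truncate C) = display_category C"
  by (simp add: display_category_def display_category_axioms_def)

lemma is_functor_truncate [simp]:
  "is_functor (dcat.truncate C) (dcat.truncate D) (ftr.truncate F) = is_functor C D F"
  by (simp add: is_functor_def is_functor_axioms_def)

lemma display_functor_truncate [simp]: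
  "display_functor (dcat.truncate C) (dcat.truncate D) (ftr.truncate F) = display_functor C D F"
  by (simp add: display_functor_def display_functor_axioms_def)

lemma is_nat_truncate [simp]:
  "is_nat (dcat.truncate C) (dcat.truncate D) (ftr.truncate F) (ftr.truncate G) \<alpha> = is_nat C D F G \<alpha>"
  by (simp add: is_nat_def)

lemma ftr_id_truncate [simp]: "ftr_id (dcat.truncate C) = ftr_id C"
  by (simp add: ftr_id_def)

lemma ftr_comp_truncate [simp]:
  "ftr_comp (dcat.truncate C) (ftr.truncate G) (ftr.truncate F) = ftr_comp C G F"
  by (simp add: ftr_comp_def)

lemma nmor_id_simps [simp]:
  "FO (nmor_id N) = FO (ftr_id N)" "FA (nmor_id N) = FA (ftr_id N)"
  "TpF (nmor_id N) = (\<lambda>\<Gamma> \<in> Obj N. ftr_id (Fib (Tp N) \<Gamma>))"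
  "TmF (nmor_id N) = (\<lambda>\<Gamma> \<in> Obj N. ftr_id (Fib (Tm N) \<Gamma>))"
  "ftr.truncate (nmor_id N) = ftr_id N"
  by (simp_all add: nmor_id_def ftr.defs ftr_id_def)

lemma nmor_comp_simps [simp]:
  "FO (nmor_comp L G F) = FO (ftr_comp L G F)" "FA (nmor_comp L G F) = FA (ftr_comp L G F)"
  "TpF (nmor_comp L G F) = (\<lambda>\<Gamma> \<in> Obj L. ftr_comp (Fib (Tp L) \<Gamma>) (TpF G (FO F \<Gamma>)) (TpF F \<Gamma>))"
  "TmF (nmor_comp L G F) = (\<lambda>\<Gamma> \<in> Obj L. ftr_comp (Fib (Tm L) \<Gamma>) (TmF G (FO F \<Gamma>)) (TmF F \<Gamma>))"
  "ftr.truncate (nmor_comp L G F) = ftr_comp L G F"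
  by (simp_all add: nmor_comp_def ftr.defs ftr_comp_def)

lemma display_functor_cong:
  assumes "FO F = FO G" "FA F = FA G"
  shows "display_functor C D F \<longleftrightarrow> display_functor C D G"
  using assms by (simp add: display_functor_def display_functor_axioms_def is_functor_def is_functor_axioms_def)

lemma is_functor_cong:
  assumes "FO F = FO G" "FA F = FA G"
  shows "is_functor C D F \<longleftrightarrow> is_functor C D G"
  using assms by (simp add: is_functor_def is_functor_axioms_def)

text \<open>Stated for any \<open>F\<close> that agrees with the identity on objects and arrows,
  since an identity morphism carries further fields.\<close>

lemma strict_indexed_functor_ident:
  assumes T: "strict_indexed_category C T" and F: "FO F = FO (ftr_id C)" "FA F = FA (ftr_id C)"
  shows "strict_indexed_functor C T (base_change F T) (\<lambda>\<Gamma> \<in> Obj C. ftr_id (Fib T \<Gamma>))"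
proof -
  interpret T: strict_indexed_category C T by fact
  have fF: "is_functor C C F"
    using is_functor_ident[OF T.base.category_axioms] is_functor_cong[OF F] by blast
  show ?thesis
  proof (intro strict_indexed_functor.intro strict_indexed_functor_axioms.intro T
      strict_indexed_category_base_change[OF fF T])
    fix \<Gamma> assume "\<Gamma> \<in> Obj C"
    then show "is_functor (Fib T \<Gamma>) (Fib (base_change F T) \<Gamma>) ((\<lambda>\<Gamma> \<in> Obj C. ftr_id (Fib T \<Gamma>)) \<Gamma>)"
      by (simp add: F is_functor_ident T.fib_category)
  next
    fix u \<Delta> \<Gamma> assume u: "u \<in> hom C \<Delta> \<Gamma>"
    note obj = T.base.hom_obj[OF u]
    show "ftr_comp (Fib T \<Gamma>) (Reix (base_change F T) u) ((\<lambda>\<Gamma> \<in> Obj C. ftr_id (Fib T \<Gamma>)) \<Gamma>)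
      = ftr_comp (Fib T \<Gamma>) ((\<lambda>\<Gamma> \<in> Obj C. ftr_id (Fib T \<Gamma>)) \<Delta>) (Reix T u)"
      using obj homD[OF u] by (simp add: F ftr_comp_ident_right[OF T.reix_functor[OF u]])
  qed simp
qed

lemma strict_indexed_functor_comp:
  assumes F: "is_functor L M F" and G: "is_functor M N G"
    and K: "FO K = FO (ftr_comp L G F)" "FA K = FA (ftr_comp L G F)"
    and \<phi>: "strict_indexed_functor L S (base_change F T) \<phi>"
    and \<psi>: "strict_indexed_functor M T (base_change G R) \<psi>"
    and R: "strict_indexed_category N R"
  shows "strict_indexed_functor L S (base_change K R)
    (\<lambda>\<Gamma> \<in> Obj L. ftr_comp (Fib S \<Gamma>) (\<psi> (FO F \<Gamma>)) (\<phi> \<Gamma>))"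
proof -
  interpret F: is_functor L M F by fact
  interpret G: is_functor M N G by fact
  interpret \<phi>: strict_indexed_functor L S "base_change F T" \<phi> by fact
  interpret \<psi>: strict_indexed_functor M T "base_change G R" \<psi> by fact
  have fK: "is_functor L N K" using is_functor_comp[OF F G] is_functor_cong[OF K] by blast
  note \<phi>1 = \<phi>.fib_functor[simplified] and \<psi>1 = \<psi>.fib_functor[simplified]
  show ?thesis
  proof (intro strict_indexed_functor.intro strict_indexed_functor_axioms.intro
      \<phi>.src.strict_indexed_category_axioms strict_indexed_category_base_change[OF fK R])
    fix \<Gamma> assume "\<Gamma> \<in> Obj L"
    then show "is_functor (Fib S \<Gamma>) (Fib (base_change K R) \<Gamma>)
        ((\<lambda>\<Gamma> \<in> Obj L. ftr_comp (Fib S \<Gamma>) (\<psi> (FO F \<Gamma>)) (\<phi> \<Gamma>)) \<Gamma>)"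
      by (simp add: K is_functor_comp[OF \<phi>1 \<psi>1])
  next
    fix u \<Delta> \<Gamma> assume u: "u \<in> hom L \<Delta> \<Gamma>"
    note obj = F.dom.hom_obj[OF u]
    note s = \<phi>.src.sub_obj[OF u] is_functor.map_arr(1)[OF \<phi>.src.reix_functor[OF u]]
    note p = is_functor.obj_map[OF \<phi>1[OF obj(2)]] is_functor.map_arr(1)[OF \<phi>1[OF obj(2)]]
    have "ftr_comp (Fib S \<Gamma>) (Reix R (FA G (FA F u))) (ftr_comp (Fib S \<Gamma>) (\<psi> (FO F \<Gamma>)) (\<phi> \<Gamma>))
      = ftr_comp (Fib S \<Gamma>) (ftr_comp (Fib S \<Delta>) (\<psi> (FO F \<Delta>)) (\<phi> \<Delta>)) (Reix S u)"
      using s p \<phi>.map_sub[OF u, simplified] \<psi>.map_sub[OF F.arr_map[OF u], simplified]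
      by (intro ftr_eqI[where A="Obj (Fib S \<Gamma>)" and B="Arr (Fib S \<Gamma>)"]) simp_all
    then show "ftr_comp (Fib S \<Gamma>) (Reix (base_change K R) u)
        ((\<lambda>\<Gamma> \<in> Obj L. ftr_comp (Fib S \<Gamma>) (\<psi> (FO F \<Gamma>)) (\<phi> \<Gamma>)) \<Gamma>)
      = ftr_comp (Fib S \<Gamma>) ((\<lambda>\<Gamma> \<in> Obj L. ftr_comp (Fib S \<Gamma>) (\<psi> (FO F \<Gamma>)) (\<phi> \<Gamma>)) \<Delta>) (Reix S u)"
      using obj homD[OF u] by (simp add: K)
  qed simp
qed

text \<open>A version outside the locale \<open>nm_morphism\<close>, for use while a candidate is
  still to be shown a morphism.\<close>

lemma ext_compare_tup:
  assumes "Dom N (FA F (Ext M \<Gamma> A)) = FO F (ctxt M \<Gamma> A)"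
  shows "ext_compare M N F \<Gamma> A =
    tup N (FO F \<Gamma>) (FO (TpF F \<Gamma>) A) (FA F (Ext M \<Gamma> A)) (FO (TmF F (ctxt M \<Gamma> A)) (Var M \<Gamma> A))"
  using assms by (simp add: ext_compare_def Let_def tup_def)

lemma nm_morphism_ident:
  assumes "small_natural_model N"
  shows "nm_morphism N N (nmor_id N)"
proof -
  interpret small_natural_model N by fact
  have "display_functor N N (nmor_id N)"
    using display_functor_ident[OF display_category_axioms] display_functor_cong[of "nmor_id N" "ftr_id N" N N]
    by simp
  moreover have "ftr_comp (Fib (Tm N) \<Gamma>) (TmTp N (FO (nmor_id N) \<Gamma>)) (TmF (nmor_id N) \<Gamma>) =
      ftr_comp (Fib (Tm N) \<Gamma>) (TpF (nmor_id N) \<Gamma>) (TmTp N \<Gamma>)" if "\<Gamma> \<in> Obj N" for \<Gamma>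
    using that by (simp add: ftr_comp_ident_right[OF typing.fib_functor[OF that]])
  moreover have "is_iso N (ext_compare N N (nmor_id N) \<Gamma> A)" if \<Gamma>: "\<Gamma> \<in> Obj N" and A: "A \<in> Ty N \<Gamma>" for \<Gamma> A
  proof -
    note p = ext_hom[OF \<Gamma> A] and v = var_Tms[OF \<Gamma> A] and X = ctxt_obj[OF \<Gamma> A]
    have "ext_compare N N (nmor_id N) \<Gamma> A = tup N \<Gamma> A (Ext N \<Gamma> A) (Var N \<Gamma> A)"
      using \<Gamma> A X p TmsD(1)[OF v] by (simp add: ext_compare_tup hom_def)
    \<comment> \<open>The comparison map of the identity is induced by the universal element
      itself.\<close>
    also have "\<dots> = Ident N (ctxt N \<Gamma> A)"
      by (rule tup_eqI[OF \<Gamma> A ident_hom[OF X]]) (use p terms.sub_id(1)[OF X TmsD(1)[OF v]] in \<open>auto simp: hom_def\<close>)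
    finally show ?thesis using ident_iso[OF X] by simp
  qed
  ultimately show ?thesis
    by (intro nm_morphism.intro nm_morphism_axioms.intro assms)
      (simp_all add: strict_indexed_functor_ident types.strict_indexed_category_axioms terms.strict_indexed_category_axioms)
qed

lemma nm_morphism_comp:
  assumes F: "nm_morphism L M F" and G: "nm_morphism M N G"
  shows "nm_morphism L N (nmor_comp L G F)"
proof -
  interpret F: nm_morphism L M F by fact
  interpret G: nm_morphism M N G by fact
  have "display_functor L N (nmor_comp L G F)"
    using display_functor_comp[OF F.display_functor_axioms G.display_functor_axioms]
      display_functor_cong[of "nmor_comp L G F" "ftr_comp L G F" L N] by simp
  moreover have "ftr_comp (Fib (Tm L) \<Gamma>) (TmTp N (FO (nmor_comp L G F) \<Gamma>)) (TmF (nmor_comp L G F) \<Gamma>) =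
      ftr_comp (Fib (Tm L) \<Gamma>) (TpF (nmor_comp L G F) \<Gamma>) (TmTp L \<Gamma>)" if \<Gamma>: "\<Gamma> \<in> Obj L" for \<Gamma>
  proof -
    note l = F.typ_map[OF \<Gamma>] G.typ_map[OF F.obj_map[OF \<Gamma>]] F.tm_obj[OF \<Gamma>]
      is_functor.map_arr(1)[OF F.terms.fib_functor[OF \<Gamma>], simplified] F.dom.typing.map_obj[OF \<Gamma>]
      is_functor.map_arr(1)[OF F.dom.typing.fib_functor[OF \<Gamma>]]
    show ?thesis
      using \<Gamma> l by (intro ftr_eqI[where A="Obj (Fib (Tm L) \<Gamma>)" and B="Arr (Fib (Tm L) \<Gamma>)"]) simp_all
  qed
  moreover have "is_iso N (ext_compare L N (nmor_comp L G F) \<Gamma> A)" if \<Gamma>: "\<Gamma> \<in> Obj L" and A: "A \<in> Ty L \<Gamma>" for \<Gamma> A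
  proof -
    note p = F.dom.ext_hom[OF \<Gamma> A] and v = F.dom.var_Tms[OF \<Gamma> A] and X = F.dom.ctxt_obj[OF \<Gamma> A]
    note F\<Gamma> = F.obj_map[OF \<Gamma>] and FA = F.ty_obj[OF \<Gamma> A]
    let ?\<tau> = "tup M (FO F \<Gamma>) (FO (TpF F \<Gamma>) A) (FA F (Ext L \<Gamma> A)) (FO (TmF F (ctxt L \<Gamma> A)) (Var L \<Gamma> A))"
    let ?FX = "ctxt M (FO F \<Gamma>) (FO (TpF F \<Gamma>) A)"
    let ?\<sigma> = "tup N (FO G (FO F \<Gamma>)) (FO (TpF G (FO F \<Gamma>)) (FO (TpF F \<Gamma>) A))
      (FA G (Ext M (FO F \<Gamma>) (FO (TpF F \<Gamma>) A))) (FO (TmF G ?FX) (Var M (FO F \<Gamma>) (FO (TpF F \<Gamma>) A)))"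
    note \<tau> = F.cod.tup[OF FA F.map_var[OF \<Gamma> A]]
    note \<sigma> = G.cod.tup[OF G.ty_obj[OF F\<Gamma> FA] G.map_var[OF F\<Gamma> FA]]
    note G\<tau> = G.arr_map[OF \<tau>(1)]
    have "ext_compare L N (nmor_comp L G F) \<Gamma> A
      = tup N (FO G (FO F \<Gamma>)) (FO (TpF G (FO F \<Gamma>)) (FO (TpF F \<Gamma>) A)) (FA G (FA F (Ext L \<Gamma> A)))
          (FO (TmF G (FO F (ctxt L \<Gamma> A))) (FO (TmF F (ctxt L \<Gamma> A)) (Var L \<Gamma> A)))"
      using \<Gamma> A X homD[OF p] F.dom.TmsD(1)[OF v] by (simp add: ext_compare_tup)
    \<comment> \<open>The comparison map of a composite is the image under \<open>G\<close> of the
      first comparison map followed by the second, hence invertible.\<close>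
    also have "\<dots> = ?\<sigma> \<cdot>\<^bsub>N\<^esub> FA G ?\<tau>"
    proof (rule G.cod.tup_eqI[OF G.obj_map[OF F\<Gamma>] G.ty_obj[OF F\<Gamma> FA] G.cod.comp_hom[OF G\<tau> \<sigma>(1)]])
      show "Ext N (FO G (FO F \<Gamma>)) (FO (TpF G (FO F \<Gamma>)) (FO (TpF F \<Gamma>) A)) \<cdot>\<^bsub>N\<^esub> (?\<sigma> \<cdot>\<^bsub>N\<^esub> FA G ?\<tau>)
        = FA G (FA F (Ext L \<Gamma> A))"
        using G.cod.comp_assoc[OF G\<tau> \<sigma>(1) G.cod.ext_hom[OF G.obj_map[OF F\<Gamma>] G.ty_obj[OF F\<Gamma> FA]]] \<sigma>(2) \<tau>(2)
          G.map_comp[OF \<tau>(1) F.cod.ext_hom[OF F\<Gamma> FA]] by simp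
      show "tmsub N (?\<sigma> \<cdot>\<^bsub>N\<^esub> FA G ?\<tau>) (Var N (FO G (FO F \<Gamma>)) (FO (TpF G (FO F \<Gamma>)) (FO (TpF F \<Gamma>) A)))
        = FO (TmF G (FO F (ctxt L \<Gamma> A))) (FO (TmF F (ctxt L \<Gamma> A)) (Var L \<Gamma> A))"
        using G.cod.terms.sub_comp(1)[OF G\<tau> \<sigma>(1) G.cod.var_term[OF G.obj_map[OF F\<Gamma>] G.ty_obj[OF F\<Gamma> FA]]]
          \<sigma>(3) \<tau>(3) G.tm_sub(1)[OF \<tau>(1) F.cod.var_term[OF F\<Gamma> FA]] by simp
    qed
    finally show ?thesis
      using G.cod.iso_comp[OF G.map_iso[OF F.compare_iso'[OF \<Gamma> A]] G\<tau> G.compare_iso'[OF F\<Gamma> FA] \<sigma>(1)] by simp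
  qed
  ultimately show ?thesis
    using strict_indexed_functor_comp[OF F.is_functor_axioms G.is_functor_axioms _ _
        F.types.strict_indexed_functor_axioms G.types.strict_indexed_functor_axioms
        G.cod.types.strict_indexed_category_axioms, of "nmor_comp L G F"]
      strict_indexed_functor_comp[OF F.is_functor_axioms G.is_functor_axioms _ _
        F.terms.strict_indexed_functor_axioms G.terms.strict_indexed_functor_axioms
        G.cod.terms.strict_indexed_category_axioms, of "nmor_comp L G F"]
    by (intro nm_morphism.intro nm_morphism_axioms.intro F.dom.small_natural_model_axioms
        G.cod.small_natural_model_axioms) simp_all
qed

section \<open>Identities and composites of 2-morphisms\<close>

lemma NM_simps [simp]:
  "N \<in> TObj NM \<longleftrightarrow> small_natural_model N"
  "THom NM = NM_hom" "TId NM = nmor_id" "HC1 NM L M N G F = nmor_comp L G F"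
  "HC2 NM L M N \<beta> \<alpha> = ncell_hcomp L N \<beta> \<alpha>"
  by (auto simp: NM_def)

lemma NM_hom_simps [simp]:
  "F \<in> Obj (NM_hom M N) \<longleftrightarrow> nm_morphism M N F" "\<alpha> \<in> Arr (NM_hom M N) \<longleftrightarrow> nm_2cell M N \<alpha>"
  "Dom (NM_hom M N) = NSrc" "Cod (NM_hom M N) = NTrg"
  by (auto simp: NM_hom_def)

lemma NM_ident_simps [simp]:
  "NSrc (Ident (NM_hom M N) F) = F" "NTrg (Ident (NM_hom M N) F) = F"
  "NCmp (Ident (NM_hom M N) F) = (\<lambda>\<Gamma> \<in> Obj M. Ident N (FO F \<Gamma>))"
  by (simp_all add: NM_hom_def)

lemma NM_vcomp_simps [simp]:
  "NSrc (\<beta> \<cdot>\<^bsub>NM_hom M N\<^esub> \<alpha>) = NSrc \<alpha>" "NTrg (\<beta> \<cdot>\<^bsub>NM_hom M N\<^esub> \<alpha>) = NTrg \<beta>"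
  "NCmp (\<beta> \<cdot>\<^bsub>NM_hom M N\<^esub> \<alpha>) = (\<lambda>\<Gamma> \<in> Obj M. NCmp \<beta> \<Gamma> \<cdot>\<^bsub>N\<^esub> NCmp \<alpha> \<Gamma>)"
  by (simp_all add: NM_hom_def)

lemma ncell_hcomp_simps [simp]:
  "NSrc (ncell_hcomp L N \<beta> \<alpha>) = nmor_comp L (NSrc \<beta>) (NSrc \<alpha>)"
  "NTrg (ncell_hcomp L N \<beta> \<alpha>) = nmor_comp L (NTrg \<beta>) (NTrg \<alpha>)"
  "NCmp (ncell_hcomp L N \<beta> \<alpha>) =
    (\<lambda>\<Gamma> \<in> Obj L. NCmp \<beta> (FO (NTrg \<alpha>) \<Gamma>) \<cdot>\<^bsub>N\<^esub> FA (NSrc \<beta>) (NCmp \<alpha> \<Gamma>))"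
  by (simp_all add: ncell_hcomp_def Let_def)

lemma nm_2cell_ident:
  assumes F: "nm_morphism M N F"
  shows "nm_2cell M N (Ident (NM_hom M N) F)"
proof -
  interpret F: nm_morphism M N F by fact
  let ?\<alpha> = "\<lambda>\<Gamma> \<in> Obj M. Ident N (FO F \<Gamma>)"
  interpret nm_base_cell M N F F ?\<alpha>
    by (intro nm_base_cell.intro nm_base_cell_axioms.intro F is_nat_ident F.is_functor_axioms)
  show ?thesis
  proof (rule nm_2cellI)
    fix \<Gamma> A assume \<Gamma>: "\<Gamma> \<in> Obj M" and A: "A \<in> Ty M \<Gamma>"
    note FA = F.ty_obj[OF \<Gamma> A] and F\<Gamma> = F.obj_map[OF \<Gamma>] and X = F.dom.ctxt_obj[OF \<Gamma> A]
    note m = F.map_var[OF \<Gamma> A]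
    show "cell_arrow \<Gamma> A (TpCmp (Ident (NM_hom M N) F) \<Gamma> A)"
      using F.cod.act_ident[OF F.obj_map[OF X] m(2)] F.cod.types.sub_ident[OF m(1) FA]
        F.cod.types.sub_id(1)[OF F\<Gamma> FA] category.ident_hom[OF F.cod.types.fib_category[OF F\<Gamma>] FA]
        F.cod.terms.sub_id(1)[OF F.obj_map[OF X] F.cod.TmsD(1)[OF m(2)]] \<Gamma> A X
      by (simp add: cell_arrow_def NM_hom_def)
  next
    fix \<Gamma> t assume \<Gamma>: "\<Gamma> \<in> Obj M" and t: "t \<in> Obj (Fib (Tm M) \<Gamma>)"
    note Ft = F.tm_obj[OF \<Gamma> t] and F\<Gamma> = F.obj_map[OF \<Gamma>]
    show "TmCmp (Ident (NM_hom M N) F) \<Gamma> t \<in>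
        hom (Fib (Tm N) (FO F \<Gamma>)) (FO (TmF F \<Gamma>) t) (tmsub N (?\<alpha> \<Gamma>) (FO (TmF F \<Gamma>) t)) \<and>
      FA (TmTp N (FO F \<Gamma>)) (TmCmp (Ident (NM_hom M N) F) \<Gamma> t)
        = TpCmp (Ident (NM_hom M N) F) \<Gamma> (FO (TmTp M \<Gamma>) t)"
      using F.cod.terms.sub_id(1)[OF F\<Gamma> Ft] category.ident_hom[OF F.cod.terms.fib_category[OF F\<Gamma>] Ft]
        F.cod.typing.map_id[OF F\<Gamma> Ft] F.typ_map(1)[OF \<Gamma> t] F.dom.typing.map_obj[OF \<Gamma> t] \<Gamma> t
      by (simp add: NM_hom_def)
  qed (simp_all add: F NM_hom_def)
qed

text \<open>On types only the transport condition has to be checked: transport along the component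
  of \<open>\<alpha>\<close> leads to the image of the variable under \<open>G\<close>, restricted
  along \<open>\<alpha>\<close>, and the reindexed component of \<open>\<beta>\<close> continues
  from there.\<close>

lemma nm_2cell_vcomp:
  assumes \<alpha>: "nm_2cell M N \<alpha>" and \<beta>: "nm_2cell M N \<beta>" and eq: "NTrg \<alpha> = NSrc \<beta>"
  shows "nm_2cell M N (\<beta> \<cdot>\<^bsub>NM_hom M N\<^esub> \<alpha>)"
proof -
  interpret \<alpha>: nm_2cell M N \<alpha> by fact
  interpret \<beta>: nm_2cell M N \<beta> by fact
  define F where "F = NSrc \<alpha>"
  define G where "G = NSrc \<beta>"
  define H where "H = NTrg \<beta>"
  note [simp] = F_def[symmetric] G_def[symmetric] H_def[symmetric] eq
  interpret F: nm_morphism M N F using \<alpha>.src.nm_morphism_axioms by simp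
  interpret G: nm_morphism M N G using \<beta>.src.nm_morphism_axioms by simp
  interpret H: nm_morphism M N H using \<beta>.trg.nm_morphism_axioms by simp
  let ?\<gamma> = "\<lambda>\<Gamma> \<in> Obj M. NCmp \<beta> \<Gamma> \<cdot>\<^bsub>N\<^esub> NCmp \<alpha> \<Gamma>"
  have nat: "is_nat M N F H ?\<gamma>"
    using \<alpha>.natural \<beta>.natural
    by (intro is_nat_vcomp[OF F.is_functor_axioms G.is_functor_axioms H.is_functor_axioms]) simp_all
  interpret \<gamma>: nm_base_cell M N F H ?\<gamma>
    by (intro nm_base_cell.intro nm_base_cell_axioms.intro nat) unfold_locales
  note \<alpha>h = \<alpha>.base.cmp_hom[simplified] and \<beta>h = \<beta>.base.cmp_hom[simplified]
  show ?thesis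
  proof (rule \<gamma>.nm_2cellI)
    fix \<Gamma> A assume \<Gamma>: "\<Gamma> \<in> Obj M" and A: "A \<in> Ty M \<Gamma>"
    note F\<Gamma> = F.obj_map[OF \<Gamma>] and X = \<alpha>.src.dom.ctxt_obj[OF \<Gamma> A]
    note FX = F.obj_map[OF X]
    note p = \<alpha>.src.dom.ext_hom[OF \<Gamma> A]
    note q = F.map_var(1)[OF \<Gamma> A] and v = F.map_var(2)[OF \<Gamma> A]
    note a = \<alpha>.tp_hom[OF \<Gamma> A, simplified] and b = \<beta>.tp_hom[OF \<Gamma> A, simplified]
    note b' = \<alpha>.src.cod.types.sub_hom[OF \<alpha>h[OF \<Gamma>] b]
    note a2 = \<alpha>.cell_arrow[OF \<Gamma> A, unfolded \<alpha>.base.cell_arrow_def, THEN conjunct2, simplified]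
    note b2 = \<beta>.cell_arrow[OF \<Gamma> A, unfolded \<beta>.base.cell_arrow_def, THEN conjunct2, simplified]
    let ?X = "ctxt M \<Gamma> A"
    have "act N (FO F ?X) (asub N (FA F (Ext M \<Gamma> A)) (asub N (NCmp \<alpha> \<Gamma>) (TpCmp \<beta> \<Gamma> A) \<cdot>\<^bsub>Fib (Tp N) (FO F \<Gamma>)\<^esub> TpCmp \<alpha> \<Gamma> A))
        (FO (TmF F ?X) (Var M \<Gamma> A))
      = act N (FO F ?X) (asub N (FA F (Ext M \<Gamma> A)) (asub N (NCmp \<alpha> \<Gamma>) (TpCmp \<beta> \<Gamma> A)))
         (tmsub N (NCmp \<alpha> ?X) (FO (TmF G ?X) (Var M \<Gamma> A)))"
      using \<alpha>.src.cod.types.sub_fcomp[OF q a b'] \<alpha>.src.cod.act_comp[OF FX \<alpha>.src.cod.types.sub_hom[OF q a]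
        \<alpha>.src.cod.types.sub_hom[OF q b'] v] a2 by simp
    also have "\<dots> = tmsub N (NCmp \<alpha> ?X) (tmsub N (NCmp \<beta> ?X) (FO (TmF H ?X) (Var M \<Gamma> A)))"
      using \<alpha>.base.sub_swap(2)[simplified, OF p b] b2 \<alpha>.src.cod.act_sub[OF \<alpha>h[OF X] \<alpha>.src.cod.types.sub_hom[OF G.map_var(1)[OF \<Gamma> A] b]
        G.map_var(2)[OF \<Gamma> A]] by simp
    also have "\<dots> = tmsub N (?\<gamma> ?X) (FO (TmF H ?X) (Var M \<Gamma> A))"
      using \<alpha>.src.cod.terms.sub_comp(1)[OF \<alpha>h[OF X] \<beta>h[OF X] \<alpha>.src.cod.TmsD(1)[OF H.map_var(2)[OF \<Gamma> A]]] X by simp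
    finally show "\<gamma>.cell_arrow \<Gamma> A (TpCmp (\<beta> \<cdot>\<^bsub>NM_hom M N\<^esub> \<alpha>) \<Gamma> A)"
      using category.comp_hom[OF \<alpha>.src.cod.types.fib_category[OF F\<Gamma>] a b']
        \<alpha>.src.cod.types.sub_comp(1)[OF \<alpha>h[OF \<Gamma>] \<beta>h[OF \<Gamma>] H.ty_obj[OF \<Gamma> A]] \<Gamma> A X
      by (simp add: \<gamma>.cell_arrow_def NM_hom_def)
  next
    fix \<Gamma> t assume \<Gamma>: "\<Gamma> \<in> Obj M" and t: "t \<in> Obj (Fib (Tm M) \<Gamma>)"
    note F\<Gamma> = F.obj_map[OF \<Gamma>]
    note a = \<alpha>.tm_hom[OF \<Gamma> t, simplified] and b = \<beta>.tm_hom[OF \<Gamma> t, simplified]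
    note b' = \<alpha>.src.cod.terms.sub_hom[OF \<alpha>h[OF \<Gamma>] b]
    show "TmCmp (\<beta> \<cdot>\<^bsub>NM_hom M N\<^esub> \<alpha>) \<Gamma> t \<in>
        hom (Fib (Tm N) (FO F \<Gamma>)) (FO (TmF F \<Gamma>) t) (tmsub N (?\<gamma> \<Gamma>) (FO (TmF H \<Gamma>) t)) \<and>
      FA (TmTp N (FO F \<Gamma>)) (TmCmp (\<beta> \<cdot>\<^bsub>NM_hom M N\<^esub> \<alpha>) \<Gamma> t)
        = TpCmp (\<beta> \<cdot>\<^bsub>NM_hom M N\<^esub> \<alpha>) \<Gamma> (FO (TmTp M \<Gamma>) t)"
      using category.comp_hom[OF \<alpha>.src.cod.terms.fib_category[OF F\<Gamma>] a b']
        \<alpha>.src.cod.terms.sub_comp(1)[OF \<alpha>h[OF \<Gamma>] \<beta>h[OF \<Gamma>] H.tm_obj[OF \<Gamma> t]]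
        \<alpha>.src.cod.typing.map_fcomp[OF F\<Gamma> a b'] \<alpha>.src.cod.typing.map_sub(2)[OF \<alpha>h[OF \<Gamma>] homD(1)[OF b]]
        \<alpha>.typing[OF \<Gamma> t] \<beta>.typing[OF \<Gamma> t] \<alpha>.src.dom.typing.map_obj[OF \<Gamma> t] \<Gamma> t
      by (simp add: NM_hom_def)
  qed (simp_all add: F.nm_morphism_axioms H.nm_morphism_axioms, simp_all add: NM_hom_def)
qed

lemma nm_2cell_hcomp:
  assumes \<alpha>: "nm_2cell L M \<alpha>" and \<beta>: "nm_2cell M N \<beta>"
  shows "nm_2cell L N (ncell_hcomp L N \<beta> \<alpha>)"
proof -
  interpret \<alpha>: nm_2cell L M \<alpha> by fact
  interpret \<beta>: nm_2cell M N \<beta> by fact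
  define F F' G G' where d: "F = NSrc \<alpha>" "F' = NTrg \<alpha>" "G = NSrc \<beta>" "G' = NTrg \<beta>"
  note [simp] = d[symmetric]
  interpret F: nm_morphism L M F using \<alpha>.src.nm_morphism_axioms by simp
  interpret F': nm_morphism L M F' using \<alpha>.trg.nm_morphism_axioms by simp
  interpret G: nm_morphism M N G using \<beta>.src.nm_morphism_axioms by simp
  interpret G': nm_morphism M N G' using \<beta>.trg.nm_morphism_axioms by simp
  let ?GF = "nmor_comp L G F" and ?GF' = "nmor_comp L G' F'"
  interpret GF: nm_morphism L N ?GF by (intro nm_morphism_comp) unfold_locales
  interpret GF': nm_morphism L N ?GF' by (intro nm_morphism_comp) unfold_locales
  let ?\<gamma> = "\<lambda>\<Gamma> \<in> Obj L. NCmp \<beta> (FO F' \<Gamma>) \<cdot>\<^bsub>N\<^esub> FA G (NCmp \<alpha> \<Gamma>)"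
  have "is_nat L N (ftr_comp L G F) (ftr_comp L G' F') ?\<gamma>"
    using \<alpha>.natural \<beta>.natural
    by (intro is_nat_hcomp[OF F.is_functor_axioms F'.is_functor_axioms G.is_functor_axioms G'.is_functor_axioms]) simp_all
  then have nat: "is_nat L N ?GF ?GF' ?\<gamma>" by (simp add: is_nat_def)
  interpret \<gamma>: nm_base_cell L N ?GF ?GF' ?\<gamma>
    by (intro nm_base_cell.intro nm_base_cell_axioms.intro nat) unfold_locales
  note \<alpha>h = \<alpha>.base.cmp_hom[simplified] and \<beta>h = \<beta>.base.cmp_hom[simplified]
  show ?thesis
  proof (rule \<gamma>.nm_2cellI)
    fix \<Gamma> A assume \<Gamma>: "\<Gamma> \<in> Obj L" and A: "A \<in> Ty L \<Gamma>"
    note F\<Gamma> = F.obj_map[OF \<Gamma>] and F'\<Gamma> = F'.obj_map[OF \<Gamma>] and X = \<alpha>.src.dom.ctxt_obj[OF \<Gamma> A]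
    note FX = F.obj_map[OF X] and F'X = F'.obj_map[OF X] and F'A = F'.ty_obj[OF \<Gamma> A]
    note GF\<Gamma> = G.obj_map[OF F\<Gamma>] and GFX = G.obj_map[OF FX]
    note p = \<alpha>.src.dom.ext_hom[OF \<Gamma> A]
    note a = \<alpha>.tp_hom[OF \<Gamma> A, simplified] and b = \<beta>.tp_hom[OF F'\<Gamma> F'A, simplified]
    note q = F.map_var(1)[OF \<Gamma> A] and v = F.map_var(2)[OF \<Gamma> A]
    note q' = F'.map_var(1)[OF \<Gamma> A] and v' = F'.map_var(2)[OF \<Gamma> A]
    note Gq = G.arr_map[OF q] and Gq' = G.arr_map[OF q']
    note Gv = G.tm_Tms[OF FX v] and Gv' = G.tm_Tms[OF F'X v']
    note G\<alpha> = G.arr_map[OF \<alpha>h[OF \<Gamma>]] and G\<alpha>X = G.arr_map[OF \<alpha>h[OF X]]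
    have Ga: "FA (TpF G (FO F \<Gamma>)) (TpCmp \<alpha> \<Gamma> A) \<in> hom (Fib (Tp N) (FO G (FO F \<Gamma>)))
        (FO (TpF G (FO F \<Gamma>)) (FO (TpF F \<Gamma>) A)) (tsub N (FA G (NCmp \<alpha> \<Gamma>)) (FO (TpF G (FO F' \<Gamma>)) (FO (TpF F' \<Gamma>) A)))"
      using G.ty_hom[OF F\<Gamma> a] G.ty_sub(1)[OF \<alpha>h[OF \<Gamma>] F'A] by simp
    note b' = \<beta>.src.cod.types.sub_hom[OF G\<alpha> b]
    note a2 = \<alpha>.cell_arrow[OF \<Gamma> A, unfolded \<alpha>.base.cell_arrow_def, THEN conjunct2, simplified]
    \<comment> \<open>The condition for \<open>\<beta>\<close> is known at variables of
      \<open>M\<close>; here it is needed at the image of a variable of \<open>L\<close>, which is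
      merely some term of \<open>M\<close>.\<close>
    have b2: "act N (FO G (FO F' (ctxt L \<Gamma> A))) (asub N (FA G (FA F' (Ext L \<Gamma> A))) (TpCmp \<beta> (FO F' \<Gamma>) (FO (TpF F' \<Gamma>) A)))
        (FO (TmF G (FO F' (ctxt L \<Gamma> A))) (FO (TmF F' (ctxt L \<Gamma> A)) (Var L \<Gamma> A)))
      = tmsub N (NCmp \<beta> (FO F' (ctxt L \<Gamma> A))) (FO (TmF G' (FO F' (ctxt L \<Gamma> A))) (FO (TmF F' (ctxt L \<Gamma> A)) (Var L \<Gamma> A)))"
      using \<beta>.base.cell_arrow_act[simplified, OF \<beta>.cell_arrow[OF F'\<Gamma> F'A, simplified] q' F'A v'] .
    let ?X = "ctxt L \<Gamma> A"
    let ?a = "FA (TpF G (FO F \<Gamma>)) (TpCmp \<alpha> \<Gamma> A)" and ?b = "TpCmp \<beta> (FO F' \<Gamma>) (FO (TpF F' \<Gamma>) A)"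
    let ?Gv = "FO (TmF G (FO F ?X)) (FO (TmF F ?X) (Var L \<Gamma> A))"
    let ?Gv' = "FO (TmF G (FO F' ?X)) (FO (TmF F' ?X) (Var L \<Gamma> A))"
    let ?G'v' = "FO (TmF G' (FO F' ?X)) (FO (TmF F' ?X) (Var L \<Gamma> A))"
    let ?q = "FA G (FA F (Ext L \<Gamma> A))"
    have Gvq: "?Gv \<in> Tms N (FO G (FO F ?X)) (tsub N ?q (FO (TpF G (FO F \<Gamma>)) (FO (TpF F \<Gamma>) A)))"
      using Gv G.ty_sub(1)[OF q F.ty_obj[OF \<Gamma> A]] by simp
    have Gvq': "?Gv' \<in> Tms N (FO G (FO F' ?X)) (tsub N (FA G (FA F' (Ext L \<Gamma> A))) (FO (TpF G (FO F' \<Gamma>)) (FO (TpF F' \<Gamma>) A)))"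
      using Gv' G.ty_sub(1)[OF q' F'A] by simp
    \<comment> \<open>\<open>G\<close> preserves transport, so the condition for
      \<open>\<alpha>\<close> can be pushed through \<open>G\<close>.\<close>
    have inner: "act N (FO G (FO F ?X)) (asub N ?q ?a) ?Gv = tmsub N (FA G (NCmp \<alpha> ?X)) ?Gv'"
    proof -
      have "act N (FO G (FO F ?X)) (asub N ?q ?a) ?Gv
        = FO (TmF G (FO F ?X)) (act M (FO F ?X) (asub M (FA F (Ext L \<Gamma> A)) (TpCmp \<alpha> \<Gamma> A)) (FO (TmF F ?X) (Var L \<Gamma> A)))"
        using G.tm_act[OF FX \<alpha>.src.cod.types.sub_hom[OF q a] v] G.ty_sub(2)[OF q homD(1)[OF a]] by simp
      also have "\<dots> = tmsub N (FA G (NCmp \<alpha> ?X)) ?Gv'"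
        using a2 G.tm_sub(1)[OF \<alpha>h[OF X] \<alpha>.src.cod.TmsD(1)[OF v']] by simp
      finally show ?thesis .
    qed
    have swap: "asub N ?q (asub N (FA G (NCmp \<alpha> \<Gamma>)) ?b) = asub N (FA G (NCmp \<alpha> ?X)) (asub N (FA G (FA F' (Ext L \<Gamma> A))) ?b)"
      using \<beta>.src.cod.types.sub_comp(2)[OF Gq G\<alpha> b] \<beta>.src.cod.types.sub_comp(2)[OF G\<alpha>X Gq' b]
        G.map_comp[OF q \<alpha>h[OF \<Gamma>]] G.map_comp[OF \<alpha>h[OF X] q'] \<alpha>.base.cmp_nat[simplified, OF p] by metis
    have "act N (FO G (FO F ?X)) (asub N ?q (asub N (FA G (NCmp \<alpha> \<Gamma>)) ?b \<cdot>\<^bsub>Fib (Tp N) (FO G (FO F \<Gamma>))\<^esub> ?a)) ?Gv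
      = act N (FO G (FO F ?X)) (asub N (FA G (NCmp \<alpha> ?X)) (asub N (FA G (FA F' (Ext L \<Gamma> A))) ?b)) (tmsub N (FA G (NCmp \<alpha> ?X)) ?Gv')"
      using \<beta>.src.cod.types.sub_fcomp[OF Gq Ga b'] \<beta>.src.cod.act_comp[OF GFX \<beta>.src.cod.types.sub_hom[OF Gq Ga]
        \<beta>.src.cod.types.sub_hom[OF Gq b'] Gvq] inner swap by simp
    also have "\<dots> = tmsub N (FA G (NCmp \<alpha> ?X)) (tmsub N (NCmp \<beta> (FO F' ?X)) ?G'v')"
      using \<beta>.src.cod.act_sub[OF G\<alpha>X \<beta>.src.cod.types.sub_hom[OF Gq' b] Gvq'] b2 by simp
    also have "\<dots> = tmsub N (?\<gamma> ?X) ?G'v'"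
      using \<beta>.src.cod.terms.sub_comp(1)[OF G\<alpha>X \<beta>h[OF F'X] \<beta>.src.cod.TmsD(1)[OF G'.tm_Tms[OF F'X v']]] X by simp
    finally show "\<gamma>.cell_arrow \<Gamma> A (TpCmp (ncell_hcomp L N \<beta> \<alpha>) \<Gamma> A)"
      using category.comp_hom[OF \<beta>.src.cod.types.fib_category[OF GF\<Gamma>] Ga b']
        \<beta>.src.cod.types.sub_comp(1)[OF G\<alpha> \<beta>h[OF F'\<Gamma>] G'.ty_obj[OF F'\<Gamma> F'A]] \<Gamma> A X \<alpha>.src.dom.var_term[OF \<Gamma> A] homD[OF p]
      by (simp add: \<gamma>.cell_arrow_def ncell_hcomp_def)
  next
    fix \<Gamma> t assume \<Gamma>: "\<Gamma> \<in> Obj L" and t: "t \<in> Obj (Fib (Tm L) \<Gamma>)"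
    note F\<Gamma> = F.obj_map[OF \<Gamma>] and F'\<Gamma> = F'.obj_map[OF \<Gamma>] and F't = F'.tm_obj[OF \<Gamma> t]
    note GF\<Gamma> = G.obj_map[OF F\<Gamma>]
    note a = \<alpha>.tm_hom[OF \<Gamma> t, simplified] and b = \<beta>.tm_hom[OF F'\<Gamma> F't, simplified]
    note G\<alpha> = G.arr_map[OF \<alpha>h[OF \<Gamma>]]
    note b' = \<beta>.src.cod.terms.sub_hom[OF G\<alpha> b]
    have Ga: "FA (TmF G (FO F \<Gamma>)) (TmCmp \<alpha> \<Gamma> t) \<in> hom (Fib (Tm N) (FO G (FO F \<Gamma>)))
        (FO (TmF G (FO F \<Gamma>)) (FO (TmF F \<Gamma>) t)) (tmsub N (FA G (NCmp \<alpha> \<Gamma>)) (FO (TmF G (FO F' \<Gamma>)) (FO (TmF F' \<Gamma>) t)))"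
      using G.tm_hom[OF F\<Gamma> a] G.tm_sub(1)[OF \<alpha>h[OF \<Gamma>] F't] by simp
    show "TmCmp (ncell_hcomp L N \<beta> \<alpha>) \<Gamma> t \<in>
        hom (Fib (Tm N) (FO ?GF \<Gamma>)) (FO (TmF ?GF \<Gamma>) t) (tmsub N (?\<gamma> \<Gamma>) (FO (TmF ?GF' \<Gamma>) t)) \<and>
      FA (TmTp N (FO ?GF \<Gamma>)) (TmCmp (ncell_hcomp L N \<beta> \<alpha>) \<Gamma> t)
        = TpCmp (ncell_hcomp L N \<beta> \<alpha>) \<Gamma> (FO (TmTp L \<Gamma>) t)"
      using category.comp_hom[OF \<beta>.src.cod.terms.fib_category[OF GF\<Gamma>] Ga b']
        \<beta>.src.cod.terms.sub_comp(1)[OF G\<alpha> \<beta>h[OF F'\<Gamma>] G'.tm_obj[OF F'\<Gamma> F't]]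
        \<beta>.src.cod.typing.map_fcomp[OF GF\<Gamma> Ga b'] \<beta>.src.cod.typing.map_sub(2)[OF G\<alpha> homD(1)[OF b]]
        G.typ_map(2)[OF F\<Gamma> homD(1)[OF a]] F'.typ_map(1)[OF \<Gamma> t]
        \<alpha>.typing[OF \<Gamma> t] \<beta>.typing[OF F'\<Gamma> F't] \<alpha>.src.dom.typing.map_obj[OF \<Gamma> t] \<Gamma> t
      by (simp add: ncell_hcomp_def)
  qed (simp_all add: GF.nm_morphism_axioms GF'.nm_morphism_axioms, simp_all add: ncell_hcomp_def Let_def)
qed

section \<open>Comparison with display categories, and the laws of a strict 2-category\<close>

definition ncell_base :: "('u, 'x) ncell_scheme \<Rightarrow> 'u dtrans" where
  "ncell_base \<alpha> = \<lparr>NSrc = ftr.truncate (NSrc \<alpha>), NTrg = ftr.truncate (NTrg \<alpha>), NCmp = NCmp \<alpha>\<rparr>"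

lemma ncell_base_simps [simp]:
  "NSrc (ncell_base \<alpha>) = ftr.truncate (NSrc \<alpha>)" "NTrg (ncell_base \<alpha>) = ftr.truncate (NTrg \<alpha>)"
  "NCmp (ncell_base \<alpha>) = NCmp \<alpha>"
  by (simp_all add: ncell_base_def)

lemma nm_morphismD:
  assumes "nm_morphism M N F"
  shows "display_functor M N F" "small_natural_model M" "small_natural_model N"
  using assms by (auto simp: nm_morphism_def)

lemma nm_2cellD:
  assumes "nm_2cell M N \<alpha>"
  shows "nm_morphism M N (NSrc \<alpha>)" "nm_morphism M N (NTrg \<alpha>)" "is_nat M N (NSrc \<alpha>) (NTrg \<alpha>) (NCmp \<alpha>)"
  using assms by (auto simp: nm_2cell_def nm_2cell_axioms_def)

lemma small_natural_modelD:
  assumes "small_natural_model N"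
  shows "display_category N" "small_cat N"
  using assms by (auto simp: small_natural_model_def small_pre_natural_model_def small_pre_natural_model_axioms_def)

lemma ncell_base_hom:
  assumes "\<alpha> \<in> hom (NM_hom M N) F G"
  shows "ncell_base \<alpha> \<in> hom (DC_hom (dcat.truncate M) (dcat.truncate N)) (ftr.truncate F) (ftr.truncate G)"
  using assms by (auto simp: hom_def dest: nm_2cellD nm_morphismD)

lemma ncell_base_arr:
  assumes "nm_2cell M N \<alpha>"
  shows "ncell_base \<alpha> \<in> Arr (DC_hom (dcat.truncate M) (dcat.truncate N))"
  using assms by (auto dest: nm_2cellD nm_morphismD)

lemma nmor_eqI:
  fixes F G :: "'u nmor"
  assumes "FO F = FO G" "FA F = FA G" "TpF F \<in> extensional A" "TpF G \<in> extensional A"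
    "TmF F \<in> extensional A" "TmF G \<in> extensional A"
    "\<And>\<Gamma>. \<Gamma> \<in> A \<Longrightarrow> TpF F \<Gamma> = TpF G \<Gamma>" "\<And>\<Gamma>. \<Gamma> \<in> A \<Longrightarrow> TmF F \<Gamma> = TmF G \<Gamma>"
  shows "F = G"
  using assms by (auto intro!: nmor.equality extensionalityI)

lemma nmor_comp_assoc:
  assumes "nm_morphism A B f"
  shows "nmor_comp A h (nmor_comp A g f) = nmor_comp A (nmor_comp B h g) f"
proof -
  interpret nm_morphism A B f by fact
  note e = ftr_comp_assoc[OF is_functor_axioms, of h g]
  show ?thesis
  proof (rule nmor_eqI[where A="Obj A"])
    fix \<Gamma> assume \<Gamma>: "\<Gamma> \<in> Obj A"
    show "TpF (nmor_comp A h (nmor_comp A g f)) \<Gamma> = TpF (nmor_comp A (nmor_comp B h g) f) \<Gamma>"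
      using \<Gamma> by (simp add: ftr_comp_assoc[OF types.fib_functor[OF \<Gamma>, simplified]])
    show "TmF (nmor_comp A h (nmor_comp A g f)) \<Gamma> = TmF (nmor_comp A (nmor_comp B h g) f) \<Gamma>"
      using \<Gamma> by (simp add: ftr_comp_assoc[OF terms.fib_functor[OF \<Gamma>, simplified]])
  qed (use e in \<open>simp_all add: ftr_comp_def\<close>)
qed

lemma nmor_comp_ident:
  fixes f :: "'u nmor"
  assumes "nm_morphism A B f"
  shows "nmor_comp A f (nmor_id A) = f" "nmor_comp A (nmor_id B) f = f"
proof -
  interpret nm_morphism A B f by fact
  have e: "ftr_comp A (ftr.truncate f) (ftr_id A) = ftr.truncate f" "ftr_comp A (ftr_id B) (ftr.truncate f) = ftr.truncate f"
    using ftr_comp_ident_right[of A B "ftr.truncate f"] is_functor_axioms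
    by (simp_all add: is_functor_def is_functor_axioms_def)
  have e': "FO (ftr_comp A f (ftr_id A)) = FO f" "FA (ftr_comp A f (ftr_id A)) = FA f"
    "FO (ftr_comp A (ftr_id B) f) = FO f" "FA (ftr_comp A (ftr_id B) f) = FA f"
    using arg_cong[OF e(1), of FO] arg_cong[OF e(1), of FA] arg_cong[OF e(2), of FO] arg_cong[OF e(2), of FA]
    by (simp_all add: ftr_comp_def)
  have e'': "FO (ftr_comp A f (nmor_id A)) = FO f" "FA (ftr_comp A f (nmor_id A)) = FA f"
    "FO (ftr_comp A (nmor_id B) f) = FO f" "FA (ftr_comp A (nmor_id B) f) = FA f"
    using e' by (simp_all add: ftr_comp_def)
  show "nmor_comp A f (nmor_id A) = f"
    by (rule nmor_eqI[where A="Obj A"])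
      (simp_all add: e'' types.ext terms.ext ftr_comp_ident_right[OF types.fib_functor[simplified]]
        ftr_comp_ident_right[OF terms.fib_functor[simplified]])
  show "nmor_comp A (nmor_id B) f = f"
    by (rule nmor_eqI[where A="Obj A"])
      (simp_all add: e'' types.ext terms.ext ftr_comp_ident_right[OF types.fib_functor[simplified]]
        ftr_comp_ident_right[OF terms.fib_functor[simplified]])
qed

lemma nm_2cell_vcomp':
  assumes "\<alpha> \<in> hom (NM_hom M N) F G" "\<beta> \<in> hom (NM_hom M N) G H"
  shows "\<beta> \<cdot>\<^bsub>NM_hom M N\<^esub> \<alpha> \<in> hom (NM_hom M N) F H"
  using assms nm_2cell_vcomp[of M N \<alpha> \<beta>] by (simp add: hom_def)

lemma nm_2cell_hcomp':
  assumes "\<alpha> \<in> hom (NM_hom L M) F F'" "\<beta> \<in> hom (NM_hom M N) G G'"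
  shows "ncell_hcomp L N \<beta> \<alpha> \<in> hom (NM_hom L N) (nmor_comp L G F) (nmor_comp L G' F')"
  using assms nm_2cell_hcomp[of L M \<alpha> N \<beta>] by (auto simp: hom_def)

lemma nm_2cell_ident':
  "nm_morphism M N F \<Longrightarrow> Ident (NM_hom M N) F \<in> hom (NM_hom M N) F F"
  using nm_2cell_ident[of M N F] by (simp add: hom_def)

lemma ncell_hom_eqI:
  fixes \<alpha> \<beta> :: "'u ncell"
  assumes "\<alpha> \<in> hom (NM_hom M N) F G" "\<beta> \<in> hom (NM_hom M N) F G" "NCmp \<alpha> = NCmp \<beta>"
  shows "\<alpha> = \<beta>"
  using assms ncell_eqI[of M N \<alpha> \<beta>] by (simp add: hom_def)

text \<open>A 2-morphism is determined by its base transformation, so all laws for 2-morphisms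
  are inherited from display categories.\<close>

lemma NM_strict_2_category: "strict_2_category (NM :: ('u nm, 'u nmor, 'u ncell) two_cat)"
proof -
  interpret DC: strict_2_category "DC :: ('u dcat, 'u dftr, 'u dtrans) two_cat" by (rule DC_strict_2_category)
  have obj: "dcat.truncate A \<in> TObj DC" if "small_natural_model A" for A :: "'u nm"
    using small_natural_modelD[OF that] by simp
  show ?thesis
  proof (rule strict_2_category.intro)
    fix M N :: "'u nm" assume "M \<in> TObj NM" "N \<in> TObj NM"
    then have MN: "small_natural_model M" "small_natural_model N" by auto
    interpret D: category "DC_hom (dcat.truncate M) (dcat.truncate N)"
      using DC.hom_category[OF obj[OF MN(1)] obj[OF MN(2)]] by simp
    show "category (THom NM M N)"
      unfolding NM_simps
    proof
      fix \<alpha> F G \<beta> H \<gamma> K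
      assume a: "\<alpha> \<in> hom (NM_hom M N) F G" "\<beta> \<in> hom (NM_hom M N) G H" "\<gamma> \<in> hom (NM_hom M N) H K"
      show "\<gamma> \<cdot>\<^bsub>NM_hom M N\<^esub> (\<beta> \<cdot>\<^bsub>NM_hom M N\<^esub> \<alpha>) = \<gamma> \<cdot>\<^bsub>NM_hom M N\<^esub> \<beta> \<cdot>\<^bsub>NM_hom M N\<^esub> \<alpha>"
        using arg_cong[OF D.comp_assoc[OF a[THEN ncell_base_hom]], of NCmp]
          ncell_hom_eqI[OF nm_2cell_vcomp'[OF nm_2cell_vcomp'[OF a(1,2)] a(3)]
            nm_2cell_vcomp'[OF a(1) nm_2cell_vcomp'[OF a(2,3)]]] by simp
    next
      fix \<alpha> F G assume a: "\<alpha> \<in> hom (NM_hom M N) F G"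
      then have FG: "nm_morphism M N F" "nm_morphism M N G" by (auto simp: hom_def dest: nm_2cellD)
      show "\<alpha> \<cdot>\<^bsub>NM_hom M N\<^esub> Ident (NM_hom M N) F = \<alpha>"
        using arg_cong[OF D.comp_ident_right[OF ncell_base_hom[OF a]], of NCmp] a
        by (intro ncell_hom_eqI[OF nm_2cell_vcomp'[OF nm_2cell_ident'[OF FG(1)] a] a]) simp
      show "Ident (NM_hom M N) G \<cdot>\<^bsub>NM_hom M N\<^esub> \<alpha> = \<alpha>"
        using arg_cong[OF D.comp_ident_left[OF ncell_base_hom[OF a]], of NCmp] a
        by (intro ncell_hom_eqI[OF nm_2cell_vcomp'[OF a nm_2cell_ident'[OF FG(2)]] a]) simp
    qed (auto simp: nm_2cell_ident' nm_2cell_vcomp' dest: nm_2cellD)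
  next
    fix A :: "'u nm" assume "A \<in> TObj NM"
    then show "TId NM A \<in> Obj (THom NM A A)" by (simp add: nm_morphism_ident)
  next
    fix A B D :: "'u nm" and f g assume "f \<in> Obj (THom NM A B)" "g \<in> Obj (THom NM B D)"
    then show "HC1 NM A B D g f \<in> Obj (THom NM A D)" by (simp add: nm_morphism_comp)
  next
    fix A B D :: "'u nm" and \<alpha> f f' \<beta> g g'
    assume "\<alpha> \<in> hom (THom NM A B) f f'" "\<beta> \<in> hom (THom NM B D) g g'"
    then show "HC2 NM A B D \<beta> \<alpha> \<in> hom (THom NM A D) (HC1 NM A B D g f) (HC1 NM A B D g' f')"
      by (simp add: nm_2cell_hcomp')
  next
    fix A B D :: "'u nm" and f g
    assume o: "A \<in> TObj NM" "B \<in> TObj NM" "D \<in> TObj NM" and fg: "f \<in> Obj (THom NM A B)" "g \<in> Obj (THom NM B D)"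
    then have d: "display_functor A B f" "display_functor B D g"
      and fg': "nm_morphism A B f" "nm_morphism B D g" by (auto dest: nm_morphismD)
    have "NCmp (ncell_hcomp A D (Ident (NM_hom B D) g) (Ident (NM_hom A B) f))
        = NCmp (Ident (NM_hom A D) (nmor_comp A g f))"
      using arg_cong[OF DC.hcomp_ident[of "dcat.truncate A" "dcat.truncate B" "dcat.truncate D"
        "ftr.truncate f" "ftr.truncate g"], of NCmp] o d obj by simp
    then show "HC2 NM A B D (Ident (THom NM B D) g) (Ident (THom NM A B) f)
          = Ident (THom NM A D) (HC1 NM A B D g f)"
      using ncell_hom_eqI[OF nm_2cell_hcomp'[OF nm_2cell_ident'[OF fg'(1)] nm_2cell_ident'[OF fg'(2)]]
        nm_2cell_ident'[OF nm_morphism_comp[OF fg']]] by simp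
  next
    fix A B D :: "'u nm" and \<alpha> f f' \<alpha>' f'' \<beta> g g' \<beta>' g''
    assume o: "A \<in> TObj NM" "B \<in> TObj NM" "D \<in> TObj NM"
      and "\<alpha> \<in> hom (THom NM A B) f f'" "\<alpha>' \<in> hom (THom NM A B) f' f''"
        "\<beta> \<in> hom (THom NM B D) g g'" "\<beta>' \<in> hom (THom NM B D) g' g''"
    then have a: "\<alpha> \<in> hom (NM_hom A B) f f'" "\<alpha>' \<in> hom (NM_hom A B) f' f''"
        "\<beta> \<in> hom (NM_hom B D) g g'" "\<beta>' \<in> hom (NM_hom B D) g' g''" by simp_all
    note h = a[THEN ncell_base_hom]
    have t: "NTrg \<alpha> = NSrc \<alpha>'" "NTrg \<beta> = NSrc \<beta>'" using a by (simp_all add: hom_def)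
    have "NCmp (ncell_hcomp A D (\<beta>' \<cdot>\<^bsub>NM_hom B D\<^esub> \<beta>) (\<alpha>' \<cdot>\<^bsub>NM_hom A B\<^esub> \<alpha>))
        = NCmp (ncell_hcomp A D \<beta>' \<alpha>' \<cdot>\<^bsub>NM_hom A D\<^esub> ncell_hcomp A D \<beta> \<alpha>)"
      using arg_cong[where f=NCmp, OF DC.interchange[where A="dcat.truncate A" and B="dcat.truncate B" and D="dcat.truncate D"
        and \<alpha>="ncell_base \<alpha>" and \<alpha>'="ncell_base \<alpha>'" and \<beta>="ncell_base \<beta>" and \<beta>'="ncell_base \<beta>'"]]
        o obj h t by simp
    then show "HC2 NM A B D (\<beta>' \<cdot>\<^bsub>THom NM B D\<^esub> \<beta>) (\<alpha>' \<cdot>\<^bsub>THom NM A B\<^esub> \<alpha>)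
          = HC2 NM A B D \<beta>' \<alpha>' \<cdot>\<^bsub>THom NM A D\<^esub> HC2 NM A B D \<beta> \<alpha>"
      using ncell_hom_eqI[OF nm_2cell_hcomp'[OF nm_2cell_vcomp'[OF a(1,2)] nm_2cell_vcomp'[OF a(3,4)]]
        nm_2cell_vcomp'[OF nm_2cell_hcomp'[OF a(1,3)] nm_2cell_hcomp'[OF a(2,4)]]] by simp
  next
    fix A B D E :: "'u nm" and f g h
    assume "f \<in> Obj (THom NM A B)" "g \<in> Obj (THom NM B D)" "h \<in> Obj (THom NM D E)"
    then show "HC1 NM A D E h (HC1 NM A B D g f) = HC1 NM A B E (HC1 NM B D E h g) f"
      by (simp add: nmor_comp_assoc)
  next
    fix A B D E :: "'u nm" and \<alpha> \<beta> \<gamma>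
    assume o: "A \<in> TObj NM" "B \<in> TObj NM" "D \<in> TObj NM" "E \<in> TObj NM"
      and "\<alpha> \<in> Arr (THom NM A B)" "\<beta> \<in> Arr (THom NM B D)" "\<gamma> \<in> Arr (THom NM D E)"
    then have a: "nm_2cell A B \<alpha>" "nm_2cell B D \<beta>" "nm_2cell D E \<gamma>" by simp_all
    \<comment> \<open>\<open>ncell_eqI\<close> also compares sources and targets, and these are
      iterated composites, so associativity of morphisms enters.\<close>
    have s: "nmor_comp A (NSrc \<gamma>) (nmor_comp A (NSrc \<beta>) (NSrc \<alpha>)) = nmor_comp A (nmor_comp B (NSrc \<gamma>) (NSrc \<beta>)) (NSrc \<alpha>)"
      "nmor_comp A (NTrg \<gamma>) (nmor_comp A (NTrg \<beta>) (NTrg \<alpha>)) = nmor_comp A (nmor_comp B (NTrg \<gamma>) (NTrg \<beta>)) (NTrg \<alpha>)"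
      using nmor_comp_assoc nm_2cellD[OF a(1)] by blast+
    have "NCmp (ncell_hcomp A E \<gamma> (ncell_hcomp A D \<beta> \<alpha>)) = NCmp (ncell_hcomp A E (ncell_hcomp B E \<gamma> \<beta>) \<alpha>)"
      using arg_cong[OF DC.hcomp2_assoc[of "dcat.truncate A" "dcat.truncate B" "dcat.truncate D" "dcat.truncate E"
        "ncell_base \<alpha>" "ncell_base \<beta>" "ncell_base \<gamma>"], of NCmp] o obj a[THEN ncell_base_arr] by simp
    then show "HC2 NM A D E \<gamma> (HC2 NM A B D \<beta> \<alpha>) = HC2 NM A B E (HC2 NM B D E \<gamma> \<beta>) \<alpha>"
      using ncell_eqI[OF nm_2cell_hcomp[OF nm_2cell_hcomp[OF a(1,2)] a(3)] nm_2cell_hcomp[OF a(1) nm_2cell_hcomp[OF a(2,3)]]] s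
      by simp
  next
    fix A B :: "'u nm" and f assume "f \<in> Obj (THom NM A B)"
    then show "HC1 NM A A B f (TId NM A) = f" "HC1 NM A B B (TId NM B) f = f"
      by (simp_all add: nmor_comp_ident)
  next
    fix A B :: "'u nm" and \<alpha> assume o: "A \<in> TObj NM" "B \<in> TObj NM" and "\<alpha> \<in> Arr (THom NM A B)"
    then have a: "nm_2cell A B \<alpha>" by simp
    have o': "small_natural_model A" "small_natural_model B" using o by auto
    note s = nmor_comp_ident[OF nm_2cellD(1)[OF a]] nmor_comp_ident[OF nm_2cellD(2)[OF a]]
    have "NCmp (ncell_hcomp A B \<alpha> (Ident (NM_hom A A) (nmor_id A))) = NCmp \<alpha>"
      using arg_cong[OF DC.hcomp2_id_right[of "dcat.truncate A" "dcat.truncate B" "ncell_base \<alpha>"], of NCmp]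
        o obj ncell_base_arr[OF a] by simp
    then show "HC2 NM A A B \<alpha> (Ident (THom NM A A) (TId NM A)) = \<alpha>"
      using ncell_eqI[OF nm_2cell_hcomp[OF nm_2cell_ident[OF nm_morphism_ident[OF o'(1)]] a] a] s by simp
    have "NCmp (ncell_hcomp A B (Ident (NM_hom B B) (nmor_id B)) \<alpha>) = NCmp \<alpha>"
      using arg_cong[OF DC.hcomp2_id_left[of "dcat.truncate A" "dcat.truncate B" "ncell_base \<alpha>"], of NCmp]
        o obj ncell_base_arr[OF a] by simp
    then show "HC2 NM A B B (Ident (THom NM B B) (TId NM B)) \<alpha> = \<alpha>"
      using ncell_eqI[OF nm_2cell_hcomp[OF a nm_2cell_ident[OF nm_morphism_ident[OF o'(2)]]] a] s by simp
  qed
qed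

lemma forgetful_simps [simp]:
  "T0 forgetful = dcat.truncate" "T1 forgetful M N F = ftr.truncate F" "T2 forgetful M N \<alpha> = ncell_base \<alpha>"
  by (simp_all add: forgetful_def ncell_base_def)

lemma DC_U_TObj: "C \<in> TObj DC_U \<longleftrightarrow> display_category C \<and> small_cat C \<and> admits_universe C"
  and NM_U_TObj: "N \<in> TObj NM_U \<longleftrightarrow> small_natural_model N \<and> admits_type_classifier N"
  by (auto simp: DC_U_def NM_U_def)

lemma U_simps [simp]:
  "THom DC_U = THom DC" "TId DC_U = TId DC" "HC1 DC_U = HC1 DC" "HC2 DC_U = HC2 DC"
  "THom NM_U = THom NM" "TId NM_U = TId NM" "HC1 NM_U = HC1 NM" "HC2 NM_U = HC2 NM"
  by (simp_all add: DC_U_def NM_U_def)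

text \<open>That the underlying display category admits a universe is the one part not visible from
  the records. It stands as a premise, to be supplied once type classifiers have been
  analysed.\<close>

lemma forgetful_strict_2_functor:
  assumes "\<And>N :: 'u nm. small_natural_model N \<Longrightarrow> admits_type_classifier N \<Longrightarrow> admits_universe (dcat.truncate N)"
  shows "strict_2_functor (NM_U :: ('u nm, 'u nmor, 'u ncell) two_cat)
     (DC_U :: ('u dcat, 'u dftr, 'u dtrans) two_cat) forgetful"
proof (intro strict_2_functor.intro strict_2_functor_axioms.intro)
  show "strict_2_category (NM_U :: ('u nm, 'u nmor, 'u ncell) two_cat)"
    unfolding NM_U_def by (rule strict_2_category_full_sub[OF NM_strict_2_category])
  show "strict_2_category (DC_U :: ('u dcat, 'u dftr, 'u dtrans) two_cat)"
    unfolding DC_U_def by (rule strict_2_category_full_sub[OF DC_strict_2_category])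
next
  fix A :: "'u nm" assume "A \<in> TObj NM_U"
  then show "T0 forgetful A \<in> TObj DC_U"
    using assms small_natural_modelD by (auto simp: NM_U_TObj DC_U_TObj)
qed (auto simp: ncell_base_hom dest: nm_morphismD intro!: dtrans_eqI[where A=UNIV])

lemma forgetful_bij_2cell:
  fixes f g :: "'u nmor"
  assumes "nm_morphism A B f" "nm_morphism A B g"
  shows "bij_betw (ncell_base :: 'u ncell \<Rightarrow> _) (hom (NM_hom A B) f g)
    (hom (DC_hom (dcat.truncate A) (dcat.truncate B)) (ftr.truncate f) (ftr.truncate g))"
proof (rule bij_betwI')
  fix \<alpha> \<beta> :: "'u ncell" assume "\<alpha> \<in> hom (NM_hom A B) f g" "\<beta> \<in> hom (NM_hom A B) f g"
  then show "(ncell_base \<alpha> = ncell_base \<beta>) = (\<alpha> = \<beta>)"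
    using ncell_hom_eqI[of \<alpha> A B f g \<beta>] by (auto simp: ncell_base_def)
next
  fix \<alpha> :: "'u ncell" assume "\<alpha> \<in> hom (NM_hom A B) f g"
  then show "ncell_base \<alpha> \<in> hom (DC_hom (dcat.truncate A) (dcat.truncate B)) (ftr.truncate f) (ftr.truncate g)"
    by (rule ncell_base_hom)
next
  fix \<beta> assume b: "\<beta> \<in> hom (DC_hom (dcat.truncate A) (dcat.truncate B)) (ftr.truncate f) (ftr.truncate g)"
  then have "is_nat A B f g (NCmp \<beta>)" by (auto simp: hom_def)
  then obtain \<gamma> :: "'u ncell" where "nm_2cell A B \<gamma>" "NSrc \<gamma> = f" "NTrg \<gamma> = g" "NCmp \<gamma> = NCmp \<beta>"
    using ncell_exists[OF assms] by metis
  then show "\<exists>\<gamma> \<in> hom (NM_hom A B) f g. \<beta> = ncell_base \<gamma>"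
    using b by (intro bexI[of _ \<gamma>]) (auto simp: hom_def ncell_base_def intro!: ntrans.equality)
qed

section \<open>Universes give natural models\<close>

lemma pairing_truncate [simp]: "pairing (dcat.truncate C) = pairing C"
  by (simp add: pairing_def fun_eq_iff)

lemma gcomp_truncate [simp]: "gcomp (dcat.truncate C) = gcomp C"
  by (simp add: gcomp_def fun_eq_iff)

lemma internal_category_truncate [simp]: "internal_category (dcat.truncate C) E = internal_category C E"
  by (simp add: internal_category_def internal_category_axioms_def)

lemma externalization_truncate [simp]: "externalization (dcat.truncate C) E = externalization C E"
  by (simp add: externalization_def)

section \<open>Externalizations of internal categories and functors\<close>

context internal_category
begin

lemma comp_sub:
  assumes "f \<in> hom C \<Gamma> (E1 E)" "g \<in> hom C \<Gamma> (E1 E)" "ETrg E \<cdot> f = ESrc E \<cdot> g"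
  shows "pairing C (EFst E) (ESnd E) f g \<in> hom C \<Gamma> (Dom C (EFst E))"
    "EFst E \<cdot> pairing C (EFst E) (ESnd E) f g = f" "ESnd E \<cdot> pairing C (EFst E) (ESnd E) f g = g"
  using pairing[OF pullback, of f \<Gamma> g] assms src_hom trg_hom by (auto simp: hom_def)

lemma proj_hom: "EFst E \<in> hom C (Dom C (EFst E)) (E1 E)" "ESnd E \<in> hom C (Dom C (EFst E)) (E1 E)"
  using pullback_squareD[OF pullback] src_hom trg_hom by (auto simp: hom_def)

lemma gcomp:
  assumes "f \<in> hom C \<Gamma> (E1 E)" "g \<in> hom C \<Gamma> (E1 E)" "ETrg E \<cdot> f = ESrc E \<cdot> g"
  shows "gcomp C E g f \<in> hom C \<Gamma> (E1 E)"
    "ESrc E \<cdot> gcomp C E g f = ESrc E \<cdot> f" "ETrg E \<cdot> gcomp C E g f = ETrg E \<cdot> g"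
proof -
  note c = comp_sub[OF assms]
  show "gcomp C E g f \<in> hom C \<Gamma> (E1 E)" unfolding gcomp_def by (rule comp_hom[OF c(1) mult_hom])
  show "ESrc E \<cdot> gcomp C E g f = ESrc E \<cdot> f" "ETrg E \<cdot> gcomp C E g f = ETrg E \<cdot> g"
    unfolding gcomp_def
    using homD[OF c(1)] homD[OF mult_hom] homD[OF src_hom] homD[OF trg_hom] homD[OF proj_hom(1)] homD[OF proj_hom(2)]
    by (simp_all add: comp_reduce[OF src_mult] comp_reduce[OF trg_mult] c(2,3))
qed

text \<open>A pairing restricted along \<open>u\<close> is the pairing of the restrictions, by
  uniqueness. This makes reindexing of the externalization functorial.\<close>

lemma gcomp_sub:
  assumes "f \<in> hom C \<Gamma> (E1 E)" "g \<in> hom C \<Gamma> (E1 E)" "ETrg E \<cdot> f = ESrc E \<cdot> g" "u \<in> hom C \<Delta> \<Gamma>"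
  shows "gcomp C E g f \<cdot> u = gcomp C E (g \<cdot> u) (f \<cdot> u)"
proof -
  note c = comp_sub[OF assms(1-3)]
  have "pairing C (EFst E) (ESnd E) f g \<cdot> u
      = pairing C (EFst E) (ESnd E) (EFst E \<cdot> (pairing C (EFst E) (ESnd E) f g \<cdot> u)) (ESnd E \<cdot> (pairing C (EFst E) (ESnd E) f g \<cdot> u))"
    by (rule pairing_unique[OF pullback comp_hom[OF assms(4) c(1)] category_axioms, symmetric])
  also have "\<dots> = pairing C (EFst E) (ESnd E) (f \<cdot> u) (g \<cdot> u)"
    using homD[OF c(1)] homD[OF assms(4)] homD[OF proj_hom(1)] homD[OF proj_hom(2)]
    by (simp add: comp_reduce[OF c(2)] comp_reduce[OF c(3)])
  finally have p: "pairing C (EFst E) (ESnd E) f g \<cdot> u = pairing C (EFst E) (ESnd E) (f \<cdot> u) (g \<cdot> u)" .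
  then show ?thesis
    unfolding gcomp_def using homD[OF c(1)] homD[OF assms(4)] homD[OF mult_hom] by simp
qed

lemma externalization_simps [simp]:
  "Obj (Fib (externalization C E) \<Gamma>) = hom C \<Gamma> (E0 E)" "Arr (Fib (externalization C E) \<Gamma>) = hom C \<Gamma> (E1 E)"
  "Dom (Fib (externalization C E) \<Gamma>) f = ESrc E \<cdot> f" "Cod (Fib (externalization C E) \<Gamma>) f = ETrg E \<cdot> f"
  "Ident (Fib (externalization C E) \<Gamma>) a = EUnit E \<cdot> a"
  "Comp (Fib (externalization C E) \<Gamma>) = gcomp C E"
  "FO (Reix (externalization C E) u) = (\<lambda>a \<in> hom C (Cod C u) (E0 E). a \<cdot> u)"
  "FA (Reix (externalization C E) u) = (\<lambda>f \<in> hom C (Cod C u) (E1 E). f \<cdot> u)"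
  by (simp_all add: externalization_def)

lemma externalization_hom:
  "f \<in> hom (Fib (externalization C E) \<Gamma>) a b \<longleftrightarrow> f \<in> hom C \<Gamma> (E1 E) \<and> ESrc E \<cdot> f = a \<and> ETrg E \<cdot> f = b"
  by (subst hom_def) simp

lemma externalization_category: "\<Gamma> \<in> Obj C \<Longrightarrow> category (Fib (externalization C E) \<Gamma>)"
proof -
  note [simp] = homD[OF src_hom] homD[OF trg_hom] homD[OF unit_hom] obj
  have u: "ESrc E \<cdot> (EUnit E \<cdot> a) = a" "ETrg E \<cdot> (EUnit E \<cdot> a) = a" if "a \<in> hom C \<Gamma> (E0 E)" for a \<Gamma>
    using homD[OF that] by (simp_all add: comp_reduce[OF src_unit] comp_reduce[OF trg_unit])
  show "category (Fib (externalization C E) \<Gamma>)"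
  proof
    fix f a b g c d h
    assume f: "f \<in> hom (Fib (externalization C E) \<Gamma>) a b" and g: "g \<in> hom (Fib (externalization C E) \<Gamma>) b c"
    then show "Comp (Fib (externalization C E) \<Gamma>) g f \<in> hom (Fib (externalization C E) \<Gamma>) a c"
      by (auto simp: externalization_hom gcomp)
    assume "h \<in> hom (Fib (externalization C E) \<Gamma>) c d"
    with f g show "Comp (Fib (externalization C E) \<Gamma>) h (Comp (Fib (externalization C E) \<Gamma>) g f)
        = Comp (Fib (externalization C E) \<Gamma>) (Comp (Fib (externalization C E) \<Gamma>) h g) f"
      using assoc by (auto simp: externalization_hom)
  next
    fix f a b assume "f \<in> hom (Fib (externalization C E) \<Gamma>) a b"
    then show "Comp (Fib (externalization C E) \<Gamma>) f (Ident (Fib (externalization C E) \<Gamma>) a) = f"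
      "Comp (Fib (externalization C E) \<Gamma>) (Ident (Fib (externalization C E) \<Gamma>) b) f = f"
      using unit_left unit_right by (auto simp: externalization_hom)
  next
    fix a assume "a \<in> Obj (Fib (externalization C E) \<Gamma>)"
    then show "Ident (Fib (externalization C E) \<Gamma>) a \<in> hom (Fib (externalization C E) \<Gamma>) a a"
      using u by (auto simp: externalization_hom intro: comp_hom unit_hom)
  qed (auto intro: comp_hom src_hom trg_hom)
qed

text \<open>Reindexing is precomposition, so its laws in \<open>u\<close> are equations of
  \<open>C\<close> and hold strictly.\<close>

lemma externalization_indexed: "strict_indexed_category C (externalization C E)"
proof (intro strict_indexed_category.intro strict_indexed_category_axioms.intro category_axioms)
  fix u \<Delta> \<Gamma> assume u: "u \<in> hom C \<Delta> \<Gamma>"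
  note [simp] = homD[OF src_hom] homD[OF trg_hom] homD[OF unit_hom] obj homD[OF u]
  show "is_functor (Fib (externalization C E) \<Gamma>) (Fib (externalization C E) \<Delta>) (Reix (externalization C E) u)"
  proof (intro is_functor.intro is_functor_axioms.intro externalization_category)
    fix f a b g c assume f: "f \<in> hom (Fib (externalization C E) \<Gamma>) a b" and g: "g \<in> hom (Fib (externalization C E) \<Gamma>) b c"
    show "FA (Reix (externalization C E) u) (Comp (Fib (externalization C E) \<Gamma>) g f)
        = Comp (Fib (externalization C E) \<Delta>) (FA (Reix (externalization C E) u) g) (FA (Reix (externalization C E) u) f)"
      using f g gcomp(1)[of f \<Gamma> g] gcomp_sub[OF _ _ _ u, of f g] by (simp add: externalization_hom)
  next
    fix f a b assume f: "f \<in> hom (Fib (externalization C E) \<Gamma>) a b"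
    show "FA (Reix (externalization C E) u) f \<in> hom (Fib (externalization C E) \<Delta>)
       (FO (Reix (externalization C E) u) a) (FO (Reix (externalization C E) u) b)"
      using f by (auto simp: externalization_hom hom_def)
  next
    fix a assume a: "a \<in> Obj (Fib (externalization C E) \<Gamma>)"
    then show "FO (Reix (externalization C E) u) a \<in> Obj (Fib (externalization C E) \<Delta>)"
      using comp_hom[OF u] by simp
    show "FA (Reix (externalization C E) u) (Ident (Fib (externalization C E) \<Gamma>) a)
        = Ident (Fib (externalization C E) \<Delta>) (FO (Reix (externalization C E) u) a)"
      using a by (auto simp: hom_def)
  qed (use hom_obj[OF u] in simp_all)
next
  fix \<Gamma> assume \<Gamma>: "\<Gamma> \<in> Obj C"
  show "category (Fib (externalization C E) \<Gamma>)" by (rule externalization_category[OF \<Gamma>])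
  show "Reix (externalization C E) (Ident C \<Gamma>) = ftr_id (Fib (externalization C E) \<Gamma>)"
    using \<Gamma> by (intro ftr_eqI[where A="hom C \<Gamma> (E0 E)" and B="hom C \<Gamma> (E1 E)"]) (auto simp: hom_def ftr_id_def)
next
  fix w \<Theta> \<Delta> u \<Gamma> assume "w \<in> hom C \<Theta> \<Delta>" "u \<in> hom C \<Delta> \<Gamma>"
  then show "Reix (externalization C E) (u \<cdot> w)
      = ftr_comp (Fib (externalization C E) \<Gamma>) (Reix (externalization C E) w) (Reix (externalization C E) u)"
    by (intro ftr_eqI[where A="hom C \<Gamma> (E0 E)" and B="hom C \<Gamma> (E1 E)"]) (auto simp: hom_def ftr_comp_def)
qed

end

text \<open>The externalization of the internal functor \<open>(p0, p1)\<close>, acting by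
  postcomposition.\<close>

definition induced :: "('u, 'u, 'x) cat_scheme \<Rightarrow> 'u incat \<Rightarrow> 'u \<Rightarrow> 'u \<Rightarrow> 'u \<Rightarrow> 'u dftr" where
  "induced C E' p0 p1 = (\<lambda>\<Gamma> \<in> Obj C. \<lparr>FO = (\<lambda>t \<in> hom C \<Gamma> (E0 E'). p0 \<cdot>\<^bsub>C\<^esub> t),
     FA = (\<lambda>g \<in> hom C \<Gamma> (E1 E'). p1 \<cdot>\<^bsub>C\<^esub> g)\<rparr>)"

lemma induced_simps [simp]:
  "\<Gamma> \<in> Obj C \<Longrightarrow> FO (induced C E' p0 p1 \<Gamma>) = (\<lambda>t \<in> hom C \<Gamma> (E0 E'). p0 \<cdot>\<^bsub>C\<^esub> t)"
  "\<Gamma> \<in> Obj C \<Longrightarrow> FA (induced C E' p0 p1 \<Gamma>) = (\<lambda>g \<in> hom C \<Gamma> (E1 E'). p1 \<cdot>\<^bsub>C\<^esub> g)"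
  by (simp_all add: induced_def)

context internal_functor
begin

text \<open>The axiom \<open>map_mult\<close> speaks of the generic composable pair; every
  composable pair is its restriction along the corresponding pairing.\<close>

lemma map_gcomp:
  assumes "f \<in> hom C \<Gamma> (E1 E')" "g \<in> hom C \<Gamma> (E1 E')" "ETrg E' \<cdot> f = ESrc E' \<cdot> g"
  shows "p1 \<cdot> gcomp C E' g f = gcomp C E (p1 \<cdot> g) (p1 \<cdot> f)"
proof -
  note c = dom.comp_sub[OF assms]
  note [simp] = homD[OF arr_part] homD[OF obj_part] homD[OF c(1)] homD[OF dom.mult_hom] homD[OF cod.src_hom] homD[OF cod.trg_hom]
    homD[OF dom.src_hom] homD[OF dom.trg_hom] homD(1,3)[OF dom.proj_hom(1)] homD[OF dom.proj_hom(2)]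
  have e: "ETrg E \<cdot> (p1 \<cdot> EFst E') = ESrc E \<cdot> (p1 \<cdot> ESnd E')"
    using pullback_squareD(9)[OF dom.pullback] by (simp add: dom.comp_reduce[OF map_src] dom.comp_reduce[OF map_trg])
  have "p1 \<cdot> gcomp C E' g f = gcomp C E (p1 \<cdot> ESnd E') (p1 \<cdot> EFst E') \<cdot> pairing C (EFst E') (ESnd E') f g"
    unfolding gcomp_def[of C E' g] by (rule dom.comp_reduce[OF map_mult]) simp_all
  also have "\<dots> = gcomp C E (p1 \<cdot> g) (p1 \<cdot> f)"
    using cod.gcomp_sub[OF dom.comp_hom[OF dom.proj_hom(1) arr_part] dom.comp_hom[OF dom.proj_hom(2) arr_part] e c(1)] c(2,3)
    by simp
  finally show ?thesis .
qed

lemma induced_indexed: "strict_indexed_functor C (externalization C E') (externalization C E) (induced C E' p0 p1)"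
proof (intro strict_indexed_functor.intro strict_indexed_functor_axioms.intro dom.externalization_indexed cod.externalization_indexed)
  note [simp] = homD[OF arr_part] homD[OF obj_part] homD[OF cod.src_hom] homD[OF cod.trg_hom]
    homD[OF dom.src_hom] homD[OF dom.trg_hom] homD[OF cod.unit_hom] homD[OF dom.unit_hom]
  show "induced C E' p0 p1 \<in> extensional (Obj C)" by (simp add: induced_def)
  fix \<Gamma> assume \<Gamma> [simp]: "\<Gamma> \<in> Obj C"
  show "is_functor (Fib (externalization C E') \<Gamma>) (Fib (externalization C E) \<Gamma>) (induced C E' p0 p1 \<Gamma>)"
  proof (intro is_functor.intro is_functor_axioms.intro dom.externalization_category cod.externalization_category \<Gamma>)
    fix f a b g c assume f: "f \<in> hom (Fib (externalization C E') \<Gamma>) a b" and g: "g \<in> hom (Fib (externalization C E') \<Gamma>) b c"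
    then show "FA (induced C E' p0 p1 \<Gamma>) (Comp (Fib (externalization C E') \<Gamma>) g f)
        = Comp (Fib (externalization C E) \<Gamma>) (FA (induced C E' p0 p1 \<Gamma>) g) (FA (induced C E' p0 p1 \<Gamma>) f)"
      using dom.gcomp(1)[of f \<Gamma> g] map_gcomp[of f \<Gamma> g] by (simp add: dom.externalization_hom)
  next
    fix f a b assume f: "f \<in> hom (Fib (externalization C E') \<Gamma>) a b"
    then show "FA (induced C E' p0 p1 \<Gamma>) f \<in> hom (Fib (externalization C E) \<Gamma>)
       (FO (induced C E' p0 p1 \<Gamma>) a) (FO (induced C E' p0 p1 \<Gamma>) b)"
      by (auto simp: dom.externalization_hom cod.externalization_hom hom_def dom.comp_reduce[OF map_src] dom.comp_reduce[OF map_trg])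
  next
    fix a assume a: "a \<in> Obj (Fib (externalization C E') \<Gamma>)"
    then show "FO (induced C E' p0 p1 \<Gamma>) a \<in> Obj (Fib (externalization C E) \<Gamma>)"
      using dom.comp_hom[OF _ obj_part] by simp
    show "FA (induced C E' p0 p1 \<Gamma>) (Ident (Fib (externalization C E') \<Gamma>) a)
        = Ident (Fib (externalization C E) \<Gamma>) (FO (induced C E' p0 p1 \<Gamma>) a)"
      using a by (auto simp: hom_def dom.comp_reduce[OF map_unit])
  qed simp_all
next
  note [simp] = homD[OF arr_part] homD[OF obj_part]
  fix u \<Delta> \<Gamma> assume u: "u \<in> hom C \<Delta> \<Gamma>"
  then show "ftr_comp (Fib (externalization C E') \<Gamma>) (Reix (externalization C E) u) (induced C E' p0 p1 \<Gamma>)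
      = ftr_comp (Fib (externalization C E') \<Gamma>) (induced C E' p0 p1 \<Delta>) (Reix (externalization C E') u)"
    using dom.hom_obj[OF u]
    by (intro ftr_eqI[where A="hom C \<Gamma> (E0 E')" and B="hom C \<Gamma> (E1 E')"]) (auto simp: hom_def ftr_comp_def)
qed

end

text \<open>At stage \<open>\<Gamma>\<close>, the universal property of the square
  \<open>lifting\<close> is literally the existence of a unique lift.\<close>

lemma (in internal_discrete_opfibration) induced_opfibration:
  assumes \<Gamma>: "\<Gamma> \<in> Obj C"
  shows "discrete_opfibration (Fib (externalization C E') \<Gamma>) (Fib (externalization C E) \<Gamma>) (induced C E' p0 p1 \<Gamma>)"
  unfolding discrete_opfibration_def
proof (intro conjI ballI impI)
  show "is_functor (Fib (externalization C E') \<Gamma>) (Fib (externalization C E) \<Gamma>) (induced C E' p0 p1 \<Gamma>)"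
    using strict_indexed_functor.fib_functor[OF induced_indexed \<Gamma>] .
  fix e f assume e: "e \<in> Obj (Fib (externalization C E') \<Gamma>)" and f: "f \<in> Arr (Fib (externalization C E) \<Gamma>)"
    and ef: "Dom (Fib (externalization C E) \<Gamma>) f = FO (induced C E' p0 p1 \<Gamma>) e"
  have "\<exists>!h. h \<in> hom C \<Gamma> (Dom C p1) \<and> p1 \<cdot> h = f \<and> ESrc E' \<cdot> h = e"
    by (rule pullback_universal[OF lifting]) (use e f ef \<Gamma> homD[OF cod.src_hom] homD[OF obj_part] in auto)
  then show "\<exists>!g. g \<in> Arr (Fib (externalization C E') \<Gamma>) \<and> Dom (Fib (externalization C E') \<Gamma>) g = e \<and>
      FA (induced C E' p0 p1 \<Gamma>) g = f"
    using \<Gamma> homD(2)[OF arr_part] by (auto cong: conj_cong)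
qed

definition universe_nm :: "('u, 'x) dcat_scheme \<Rightarrow> 'u incat \<Rightarrow> 'u incat \<Rightarrow> 'u \<Rightarrow> 'u \<Rightarrow> 'u nm" where
  "universe_nm C E' E p0 p1 = dcat.extend (dcat.truncate C) \<lparr>Tp = externalization C E, Tm = externalization C E',
     TmTp = induced C E' p0 p1, Ext = (\<lambda>\<Gamma> A. Pb C A p0), Var = (\<lambda>\<Gamma> A. PbTop C A p0)\<rparr>"

lemma universe_nm_simps [simp]:
  "Obj (universe_nm C E' E p0 p1) = Obj C" "Arr (universe_nm C E' E p0 p1) = Arr C"
  "Dom (universe_nm C E' E p0 p1) = Dom C" "Cod (universe_nm C E' E p0 p1) = Cod C"
  "Ident (universe_nm C E' E p0 p1) = Ident C" "Comp (universe_nm C E' E p0 p1) = Comp C"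
  "Disp (universe_nm C E' E p0 p1) = Disp C"
  "Tp (universe_nm C E' E p0 p1) = externalization C E" "Tm (universe_nm C E' E p0 p1) = externalization C E'"
  "TmTp (universe_nm C E' E p0 p1) = induced C E' p0 p1"
  "Ext (universe_nm C E' E p0 p1) \<Gamma> A = Pb C A p0" "Var (universe_nm C E' E p0 p1) \<Gamma> A = PbTop C A p0"
  "dcat.truncate (universe_nm C E' E p0 p1) = dcat.truncate C"
  "hom (universe_nm C E' E p0 p1) = hom C"
  by (simp_all add: universe_nm_def dcat.defs hom_def fun_eq_iff)

text \<open>A model built on \<open>C\<close> is a record of another type with the same truncation;
  indexed categories over the one become indexed categories over the other.\<close>

lemma strict_indexed_category_cong:
  assumes "dcat.truncate C = dcat.truncate D" "strict_indexed_category C T"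
  shows "strict_indexed_category D T"
proof -
  have e: "category C = category D" "hom C = hom D" "Obj C = Obj D" "Ident C = Ident D" "Comp C = Comp D"
    using arg_cong[OF assms(1), of Obj] arg_cong[OF assms(1), of Ident] arg_cong[OF assms(1), of Comp]
      arg_cong[OF assms(1), of hom] arg_cong[OF assms(1), of category] by simp_all
  show ?thesis
    using assms(2) unfolding strict_indexed_category_def strict_indexed_category_axioms_def e .
qed

lemma strict_indexed_functor_cong:
  assumes "dcat.truncate C = dcat.truncate D" "strict_indexed_functor C S T \<phi>"
  shows "strict_indexed_functor D S T \<phi>"
proof -
  have e: "hom C = hom D" "Obj C = Obj D"
    using arg_cong[OF assms(1), of Obj] arg_cong[OF assms(1), of hom] by simp_all
  show ?thesis
    using assms strict_indexed_category_cong[OF assms(1)]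
    unfolding strict_indexed_functor_def strict_indexed_functor_axioms_def e by blast
qed

lemma small_subset: "small B \<Longrightarrow> A \<subseteq> B \<Longrightarrow> small A"
  unfolding small_def by (meson lesspoll_def lepoll_trans1 lesspoll_trans1 subset_imp_lepoll)

text \<open>Representability is the universal property of the chosen pullbacks of \<open>p0\<close>,
  smallness holds because hom-sets lie in \<open>Arr C\<close>, and comprehension coincides with
  \<open>classify\<close> as a functor, so the last axiom is the defining equivalence of a
  universe.\<close>

lemma (in universe) universe_nm_natural_model:
  assumes small: "small_cat C"
  shows "small_natural_model (universe_nm C E' E p0 p1)" (is "small_natural_model ?N")
proof -
  note p0 = homD[OF obj_part] and p1 = homD[OF arr_part]
  have dN: "display_category ?N"
    using display_category_truncate[of ?N] display_category_truncate[of C] display_category_axioms by simp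
  have pb: "Pb C A p0 \<in> Disp C" "pullback_square C A p0 (Pb C A p0) (PbTop C A p0)"
    "Pb C A p0 \<in> hom C (Dom C (Pb C A p0)) \<Gamma>" "PbTop C A p0 \<in> hom C (Dom C (Pb C A p0)) (E0 E')"
    "p0 \<cdot>\<^bsub>C\<^esub> PbTop C A p0 = A \<cdot>\<^bsub>C\<^esub> Pb C A p0"
    if "A \<in> hom C \<Gamma> (E0 E)" for A \<Gamma>
    using disp_pullback[OF display, of A] homD[OF that] p0
    by (auto simp: hom_def dest: pullback_squareD)
  have hom_sub: "hom C A B \<subseteq> Arr C" for A B by (auto simp: hom_def)
  have pre: "small_pre_natural_model ?N"
  proof (intro small_pre_natural_model.intro small_pre_natural_model_axioms.intro dN)
    show "strict_indexed_category ?N (Tp ?N)" "strict_indexed_category ?N (Tm ?N)"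
      using strict_indexed_category_cong[of C ?N] cod.externalization_indexed dom.externalization_indexed by simp_all
    show "strict_indexed_functor ?N (Tm ?N) (Tp ?N) (TmTp ?N)"
      using strict_indexed_functor_cong[of C ?N] induced_indexed by simp
    show "small_cat ?N" using small by (simp add: small_cat_def)
    fix \<Gamma> assume "\<Gamma> \<in> Obj ?N"
    then have \<Gamma>: "\<Gamma> \<in> Obj C" by simp
    show "small_cat (Fib (Tp ?N) \<Gamma>)" "small_cat (Fib (Tm ?N) \<Gamma>)"
      using small by (auto simp: small_cat_def intro: small_subset[OF _ hom_sub])
    show "discrete_opfibration (Fib (Tm ?N) \<Gamma>) (Fib (Tp ?N) \<Gamma>) (TmTp ?N \<Gamma>)"
      using induced_opfibration[OF \<Gamma>] by simp
    fix A assume "A \<in> Obj (Fib (Tp ?N) \<Gamma>)"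
    then have A: "A \<in> hom C \<Gamma> (E0 E)" by simp
    note P = pb[OF A]
    show "Ext ?N \<Gamma> A \<in> Disp ?N \<and> Cod ?N (Ext ?N \<Gamma> A) = \<Gamma>" using P homD[OF P(3)] by simp
    show "Var ?N \<Gamma> A \<in> Obj (Fib (Tm ?N) (Dom ?N (Ext ?N \<Gamma> A)))" using P by simp
    show "FO (TmTp ?N (Dom ?N (Ext ?N \<Gamma> A))) (Var ?N \<Gamma> A) = FO (Reix (Tp ?N) (Ext ?N \<Gamma> A)) A"
      using P A homD[OF P(3)] hom_obj[OF P(3)] by simp
    fix u \<Delta> t assume "u \<in> hom ?N \<Delta> \<Gamma>" "t \<in> Obj (Fib (Tm ?N) \<Delta>)"
      and tu: "FO (TmTp ?N \<Delta>) t = FO (Reix (Tp ?N) u) A"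
    then have u: "u \<in> hom C \<Delta> \<Gamma>" and t: "t \<in> hom C \<Delta> (E0 E')" by simp_all
    have "\<exists>!h. h \<in> hom C \<Delta> (Dom C (Pb C A p0)) \<and> Pb C A p0 \<cdot>\<^bsub>C\<^esub> h = u \<and> PbTop C A p0 \<cdot>\<^bsub>C\<^esub> h = t"
      using u t tu A homD[OF A] homD[OF u] hom_obj[OF u] p0 by (intro pullback_universal[OF P(2)]) simp_all
    then show "\<exists>!w. w \<in> hom ?N \<Delta> (Dom ?N (Ext ?N \<Gamma> A)) \<and> Comp ?N (Ext ?N \<Gamma> A) w = u \<and>
        FO (Reix (Tm ?N) w) (Var ?N \<Gamma> A) = t"
      using P(4) by (auto simp: hom_def cong: conj_cong)
  qed
  moreover have "comprehension ?N \<Gamma> = classify C E' E p0 p1 \<Gamma>" if \<Gamma>: "\<Gamma> \<in> Obj C" for \<Gamma>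
  proof (rule ftr_eqI[where A="hom C \<Gamma> (E0 E)" and B="hom C \<Gamma> (E1 E)"])
    fix f assume f: "f \<in> hom C \<Gamma> (E1 E)"
    define A B where "A = ESrc E \<cdot>\<^bsub>C\<^esub> f" and "B = ETrg E \<cdot>\<^bsub>C\<^esub> f"
    have A: "A \<in> hom C \<Gamma> (E0 E)" and B: "B \<in> hom C \<Gamma> (E0 E)"
      using comp_hom[OF f cod.src_hom] comp_hom[OF f cod.trg_hom] by (simp_all add: A_def B_def)
    note P = pb[OF A] and Q = pb[OF B]
    note \<Gamma>A = hom_obj(1)[OF P(3)]
    note fp = comp_hom[OF P(3) f]
    \<comment> \<open>Both sides are definite descriptions with equivalent predicates: lifting the
      restricted \<open>f\<close> at the universal element means finding the arrow induced by the
      pullback \<open>lifting\<close>.\<close>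
    have "opfib_lift (Fib (Tm ?N) (Dom C (Pb C A p0))) (TmTp ?N (Dom C (Pb C A p0))) (PbTop C A p0) (f \<cdot>\<^bsub>C\<^esub> Pb C A p0)
      = pairing C p1 (ESrc E') (f \<cdot>\<^bsub>C\<^esub> Pb C A p0) (PbTop C A p0)"
      unfolding opfib_lift_def pairing_def using \<Gamma>A homD[OF fp] p1
      by (intro arg_cong[where f=The] ext) auto
    moreover define l where "l = pairing C p1 (ESrc E') (f \<cdot>\<^bsub>C\<^esub> Pb C A p0) (PbTop C A p0)"
    ultimately have "ext_map ?N \<Gamma> f = (THE h. h \<in> hom C (Dom C (Pb C A p0)) (Dom C (Pb C B p0)) \<and>
        Pb C B p0 \<cdot>\<^bsub>C\<^esub> h = Pb C A p0 \<and> FO (Reix (externalization C E') h) (PbTop C B p0) = ETrg E' \<cdot>\<^bsub>C\<^esub> l)"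
      using f homD[OF P(3)] by (simp add: ext_map_def Let_def A_def[symmetric] B_def[symmetric] hom_def)
    also have "\<dots> = pairing C (Pb C B p0) (PbTop C B p0) (Pb C A p0) (ETrg E' \<cdot>\<^bsub>C\<^esub> l)"
      unfolding pairing_def using Q(4) by (intro arg_cong[where f=The] ext) (auto simp: hom_def)
    finally show "FA (comprehension ?N \<Gamma>) f = FA (classify C E' E p0 p1 \<Gamma>) f"
      using f by (simp add: comprehension_def classify_def Let_def A_def B_def l_def)
  qed (simp_all add: comprehension_def classify_def)
  moreover have "disp_fibre ?N \<Gamma> = disp_fibre C \<Gamma>" for \<Gamma> by (simp add: disp_fibre_def)
  ultimately show ?thesis
    using equivalence by (intro small_natural_model.intro small_natural_model_axioms.intro) auto
qed

lemma sicat_isomorphic_refl: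
  assumes "strict_indexed_category C T"
  shows "sicat_isomorphic C T T"
proof -
  interpret strict_indexed_category C T by fact
  have "strict_indexed_functor C T (base_change (ftr_id C) T) (\<lambda>\<Gamma> \<in> Obj C. ftr_id (Fib T \<Gamma>))"
    by (rule strict_indexed_functor_ident[OF assms]) simp_all
  \<comment> \<open>\<open>base_change (ftr_id C) T\<close> may differ from \<open>T\<close> off the
    carriers, so the passage goes through the axioms and not through an equation of records.\<close>
  then have "strict_indexed_functor C T T (\<lambda>\<Gamma> \<in> Obj C. ftr_id (Fib T \<Gamma>))"
    by (auto simp: strict_indexed_functor_def strict_indexed_functor_axioms_def assms hom_def)
  then show ?thesis
    unfolding sicat_isomorphic_def
    by (intro exI[of _ "\<lambda>\<Gamma> \<in> Obj C. ftr_id (Fib T \<Gamma>)"] conjI)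
      (auto simp: ftr_comp_ident_right(1)[OF is_functor_ident[OF fib_category]])
qed

lemma universe_natural_model:
  fixes C :: "'u dcat"
  assumes "display_category C" "small_cat C" "admits_universe C"
  obtains N :: "'u nm" where "small_natural_model N" "admits_type_classifier N" "dcat.truncate N = C"
proof -
  obtain E' E p0 p1 where "universe C E' E p0 p1" using assms(3) by (auto simp: admits_universe_def)
  then interpret universe C E' E p0 p1 .
  let ?N = "universe_nm C E' E p0 p1"
  have e: "externalization ?N E = externalization C E"
    using externalization_truncate[of ?N E] externalization_truncate[of C E] by simp
  have "internal_category ?N E"
    using cod.internal_category_axioms internal_category_truncate[of ?N E] internal_category_truncate[of C E] by simp
  moreover have "sicat_isomorphic ?N (externalization ?N E) (Tp ?N)"
    unfolding e using sicat_isomorphic_refl[OF strict_indexed_category_cong[OF _ cod.externalization_indexed, of ?N]] by simp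
  ultimately have "admits_type_classifier ?N" by (auto simp: admits_type_classifier_def)
  \<comment> \<open>A record without further fields equals its truncation, so the model lies over
    \<open>C\<close> itself and not merely over an equivalent display category.\<close>
  moreover have "dcat.truncate C = C" by (simp add: dcat.truncate_def)
  then have "dcat.truncate ?N = C" by simp
  ultimately show thesis using that universe_nm_natural_model[OF assms(2)] by blast
qed

section \<open>Type classifiers give universes\<close>

text \<open>Two pullbacks of the same display along \<open>u\<close> are isomorphic. The form is the
  one that \<open>test_inj\<close> and \<open>test_surj\<close> require: the comparison is a tuple
  whose term is the variable restricted along the top arrow.\<close>

lemma (in small_pre_natural_model) pullback_ext_iso:
  assumes pb: "pullback_square N u (Ext N \<Gamma> A) p' q'" and \<Gamma>: "\<Gamma> \<in> Obj N" and A: "A \<in> Ty N \<Gamma>"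
    and u: "u \<in> hom N \<Delta> \<Gamma>"
  shows "tmsub N q' (Var N \<Gamma> A) \<in> Tms N (Dom N p') (tsub N p' (tsub N u A))"
    and "is_iso N (tup N \<Delta> (tsub N u A) p' (tmsub N q' (Var N \<Gamma> A)))"
proof -
  note d = pullback_squareD[OF pb] and u' = homD[OF u] and e' = homD[OF ext_hom[OF \<Gamma> A]]
  note \<Delta> = hom_obj(1)[OF u] and Au = types.sub_obj[OF u A]
  have p: "p' \<in> hom N (Dom N p') \<Delta>" and q: "q' \<in> hom N (Dom N p') (ctxt N \<Gamma> A)"
    using d u' e' by (auto simp: hom_def)
  show t: "tmsub N q' (Var N \<Gamma> A) \<in> Tms N (Dom N p') (tsub N p' (tsub N u A))"
    using var_sub_Tms[OF \<Gamma> A q] types.sub_comp(1)[OF p u A] d(9) by simp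
  define i where "i = tup N \<Delta> (tsub N u A) p' (tmsub N q' (Var N \<Gamma> A))"
  note i = tup[OF Au p t, folded i_def]
  define r where "r = tup N \<Gamma> A (u \<cdot>\<^bsub>N\<^esub> Ext N \<Delta> (tsub N u A)) (Var N \<Delta> (tsub N u A))"
  note r = ext_pullback[OF u A, folded r_def]
  note pu = ext_hom[OF \<Delta> Au]
  have ri: "r \<cdot>\<^bsub>N\<^esub> i = q'"
  proof (rule ext_eqI[OF \<Gamma> A comp_hom[OF i(1) r(1)] q])
    show "Ext N \<Gamma> A \<cdot>\<^bsub>N\<^esub> (r \<cdot>\<^bsub>N\<^esub> i) = Ext N \<Gamma> A \<cdot>\<^bsub>N\<^esub> q'"
      using homD[OF i(1)] homD[OF r(1)] e' u' homD[OF pu] i(2) d(9) by (simp add: comp_reduce[OF r(2)])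
    show "tmsub N (r \<cdot>\<^bsub>N\<^esub> i) (Var N \<Gamma> A) = tmsub N q' (Var N \<Gamma> A)"
      using terms.sub_comp(1)[OF i(1) r(1) var_term[OF \<Gamma> A]] r(3) i(3) by simp
  qed
  \<comment> \<open>The candidate inverse, induced by the canonical square over \<open>u\<close>;
    both composites are recognized as identities by their projections.\<close>
  obtain j where j: "j \<in> hom N (ctxt N \<Delta> (tsub N u A)) (Dom N p')" "p' \<cdot>\<^bsub>N\<^esub> j = Ext N \<Delta> (tsub N u A)" "q' \<cdot>\<^bsub>N\<^esub> j = r"
    using pullback_universal[OF pb, of "Ext N \<Delta> (tsub N u A)" "ctxt N \<Delta> (tsub N u A)" r] pu r u' by auto
  have X: "Dom N p' \<in> Obj N" using hom_obj(1)[OF p] .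
  have "j \<cdot>\<^bsub>N\<^esub> i = Ident N (Dom N p')"
    by (rule pullback_eqI[OF pb comp_hom[OF i(1) j(1)] ident_hom[OF X] category_axioms])
      (use homD[OF i(1)] homD[OF j(1)] d i(2) ri in \<open>simp_all add: comp_reduce[OF j(2)] comp_reduce[OF j(3)]\<close>)
  moreover have "i \<cdot>\<^bsub>N\<^esub> j = Ident N (ctxt N \<Delta> (tsub N u A))"
    by (rule pullback_eqI[OF r(4) comp_hom[OF j(1) i(1)] ident_hom[OF ctxt_obj[OF \<Delta> Au]] category_axioms])
      (use homD[OF i(1)] homD[OF j(1)] homD[OF r(1)] homD[OF pu] j(2,3) in \<open>simp_all add: comp_reduce[OF i(2)] comp_reduce[OF ri]\<close>)
  ultimately show "is_iso N (tup N \<Delta> (tsub N u A) p' (tmsub N q' (Var N \<Gamma> A)))"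
    using is_isoI[OF i(1) j(1)] by (simp add: i_def)
qed

text \<open>The structure maps of the pointed category below all have this shape, a map of the base
  together with a term. The rule evaluates them on generalized elements.\<close>

lemma (in small_pre_natural_model) tup_comp_tup:
  assumes A: "A \<in> Ty N \<Gamma>" and B: "B \<in> Ty N \<Theta>" and h: "h \<in> hom N \<Gamma> \<Theta>"
    and \<tau>: "\<tau> \<in> Tms N (ctxt N \<Gamma> A) (tsub N (h \<cdot>\<^bsub>N\<^esub> Ext N \<Gamma> A) B)"
    and u: "u \<in> hom N \<Delta> \<Gamma>" and e: "e \<in> Tms N \<Delta> (tsub N u A)"
  shows "tup N \<Theta> B (h \<cdot>\<^bsub>N\<^esub> Ext N \<Gamma> A) \<tau> \<cdot>\<^bsub>N\<^esub> tup N \<Gamma> A u e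
    = tup N \<Theta> B (h \<cdot>\<^bsub>N\<^esub> u) (tmsub N (tup N \<Gamma> A u e) \<tau>)"
proof -
  note p = ext_hom[OF hom_obj(2)[OF u] A] and w = tup[OF A u e]
  show ?thesis
    using tup_sub[OF B comp_hom[OF p h] \<tau> w(1)] homD[OF p] homD[OF h] homD[OF w(1)] w(2) by simp
qed

locale classified_model = small_natural_model N +
  int: internal_category N E + cls: strict_indexed_functor N "externalization N E" "Tp N" \<phi>
  for N :: "('u, 'x) nm_scheme" and E :: "'u incat" and \<phi> :: "'u \<Rightarrow> 'u dftr" +
  fixes \<psi> :: "'u \<Rightarrow> 'u dftr"
  assumes inverse: "strict_indexed_functor N (Tp N) (externalization N E) \<psi>"
    and inv_left: "\<Gamma> \<in> Obj N \<Longrightarrow>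
      ftr_comp (Fib (externalization N E) \<Gamma>) (\<psi> \<Gamma>) (\<phi> \<Gamma>) = ftr_id (Fib (externalization N E) \<Gamma>)"
    and inv_right: "\<Gamma> \<in> Obj N \<Longrightarrow>
      ftr_comp (Fib (Tp N) \<Gamma>) (\<phi> \<Gamma>) (\<psi> \<Gamma>) = ftr_id (Fib (Tp N) \<Gamma>)"
begin

text \<open>By the Yoneda lemma, a strict indexed functor out of an externalization is given by its
  values at the identities of \<open>E0\<close> and \<open>E1\<close>. These are the generic type
  \<open>U\<close> and the generic arrow of types \<open>gen\<close>.\<close>

definition U :: 'u where "U = FO (\<phi> (E0 E)) (Ident N (E0 E))"

definition gen :: 'u where "gen = FA (\<phi> (E1 E)) (Ident N (E1 E))"

lemma U_ty: "U \<in> Ty N (E0 E)"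
  unfolding U_def using cls.map_obj[OF int.obj(1)] ident_hom[OF int.obj(1)] by simp

lemma cls_obj: "x \<in> hom N \<Gamma> (E0 E) \<Longrightarrow> FO (\<phi> \<Gamma>) x = tsub N x U"
  using cls.map_sub(1)[of x \<Gamma> "E0 E" "Ident N (E0 E)"] ident_hom[OF int.obj(1)]
  unfolding U_def by (simp add: hom_def)

lemma cls_arr: "k \<in> hom N \<Gamma> (E1 E) \<Longrightarrow> FA (\<phi> \<Gamma>) k = asub N k gen"
  using cls.map_sub(2)[of k \<Gamma> "E1 E" "Ident N (E1 E)"] ident_hom[OF int.obj(2)]
  unfolding gen_def by (simp add: hom_def)

lemma classify_hom:
  assumes "k \<in> hom N \<Gamma> (E1 E)"
  shows "asub N k gen \<in> hom (Fib (Tp N) \<Gamma>) (tsub N (ESrc E \<cdot>\<^bsub>N\<^esub> k) U) (tsub N (ETrg E \<cdot>\<^bsub>N\<^esub> k) U)"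
  using cls.map_hom[OF hom_obj(1)[OF assms], of k "ESrc E \<cdot>\<^bsub>N\<^esub> k" "ETrg E \<cdot>\<^bsub>N\<^esub> k"] assms
    cls_obj[OF comp_hom[OF assms int.src_hom]] cls_obj[OF comp_hom[OF assms int.trg_hom]] cls_arr[OF assms]
  by (simp add: int.externalization_hom)

text \<open>A code is recovered from its type by \<open>\<psi>\<close>, so codes are unique on the
  nose. Here a strict isomorphism gives more than an equivalence would.\<close>

lemma inverse_obj: "x \<in> hom N \<Gamma> (E0 E) \<Longrightarrow> FO (\<psi> \<Gamma>) (tsub N x U) = x"
  using inv_left[OF hom_obj(1), THEN arg_cong[where f="\<lambda>G. FO G x"], of x \<Gamma> "E0 E"] by (simp add: cls_obj)

lemma inverse_arr: "k \<in> hom N \<Gamma> (E1 E) \<Longrightarrow> FA (\<psi> \<Gamma>) (asub N k gen) = k"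
  using inv_left[OF hom_obj(1), THEN arg_cong[where f="\<lambda>G. FA G k"], of k \<Gamma> "E1 E"] by (simp add: cls_arr)

lemma classify_obj_ex1:
  assumes "\<Gamma> \<in> Obj N" "A \<in> Ty N \<Gamma>"
  shows "\<exists>!x. x \<in> hom N \<Gamma> (E0 E) \<and> tsub N x U = A"
proof (rule ex1I[of _ "FO (\<psi> \<Gamma>) A"])
  have "FO (\<psi> \<Gamma>) A \<in> hom N \<Gamma> (E0 E)" using strict_indexed_functor.map_obj[OF inverse assms] by simp
  then show "FO (\<psi> \<Gamma>) A \<in> hom N \<Gamma> (E0 E) \<and> tsub N (FO (\<psi> \<Gamma>) A) U = A"
    using inv_right[OF assms(1), THEN arg_cong[where f="\<lambda>G. FO G A"]] assms by (simp add: cls_obj)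
qed (auto simp: inverse_obj)

lemma classify_arr_inj:
  assumes "k \<in> hom N \<Gamma> (E1 E)" "l \<in> hom N \<Gamma> (E1 E)" "asub N k gen = asub N l gen"
  shows "k = l"
  using inverse_arr[OF assms(1)] inverse_arr[OF assms(2)] assms(3) by metis

lemma classify_arr_surj:
  assumes "x \<in> hom N \<Gamma> (E0 E)" "y \<in> hom N \<Gamma> (E0 E)" "f \<in> hom (Fib (Tp N) \<Gamma>) (tsub N x U) (tsub N y U)"
  obtains k where "k \<in> hom N \<Gamma> (E1 E)" "ESrc E \<cdot>\<^bsub>N\<^esub> k = x" "ETrg E \<cdot>\<^bsub>N\<^esub> k = y" "asub N k gen = f"
proof
  note \<Gamma> = hom_obj(1)[OF assms(1)]
  show k: "FA (\<psi> \<Gamma>) f \<in> hom N \<Gamma> (E1 E)" "ESrc E \<cdot>\<^bsub>N\<^esub> FA (\<psi> \<Gamma>) f = x" "ETrg E \<cdot>\<^bsub>N\<^esub> FA (\<psi> \<Gamma>) f = y"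
    using strict_indexed_functor.map_hom[OF inverse \<Gamma> assms(3)] inverse_obj[OF assms(1)] inverse_obj[OF assms(2)]
    by (simp_all add: int.externalization_hom)
  show "asub N (FA (\<psi> \<Gamma>) f) gen = f"
    using inv_right[OF \<Gamma>, THEN arg_cong[where f="\<lambda>G. FA G f"]] homD[OF assms(3)] cls_arr[OF k(1)] by simp
qed

lemma classify_unit: "x \<in> hom N \<Gamma> (E0 E) \<Longrightarrow> asub N (EUnit E \<cdot>\<^bsub>N\<^esub> x) gen = Ident (Fib (Tp N) \<Gamma>) (tsub N x U)"
  using cls.map_id[of \<Gamma> x] cls_obj[of x \<Gamma>] cls_arr[OF comp_hom[OF _ int.unit_hom], of x \<Gamma>] hom_obj(1)[of x \<Gamma> "E0 E"]
  by simp

lemma classify_comp: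
  assumes "k \<in> hom N \<Gamma> (E1 E)" "l \<in> hom N \<Gamma> (E1 E)" "ETrg E \<cdot>\<^bsub>N\<^esub> k = ESrc E \<cdot>\<^bsub>N\<^esub> l"
  shows "asub N (gcomp N E l k) gen = asub N l gen \<cdot>\<^bsub>Fib (Tp N) \<Gamma>\<^esub> asub N k gen"
  using cls.map_fcomp[OF hom_obj(1)[OF assms(1)], of k "ESrc E \<cdot>\<^bsub>N\<^esub> k" "ETrg E \<cdot>\<^bsub>N\<^esub> k" l "ETrg E \<cdot>\<^bsub>N\<^esub> l"] assms
    cls_arr[OF assms(1)] cls_arr[OF assms(2)] cls_arr[OF int.gcomp(1)[OF assms]] by (simp add: int.externalization_hom)

text \<open>The category of pointed types: its objects are pairs \<open>(x, e)\<close> of a code and a term of the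
  corresponding type, its arrows pairs \<open>(k, e)\<close> of a coded arrow and a term of its domain.\<close>

definition S1 :: 'u where "S1 = tsub N (ESrc E) U"
definition S2 :: 'u where "S2 = tsub N (EFst E) S1"

abbreviation "P0 \<equiv> Ext N (E0 E) U"
abbreviation "P1 \<equiv> Ext N (E1 E) S1"
abbreviation "P2 \<equiv> Ext N (Dom N (EFst E)) S2"

abbreviation "pr0 x e \<equiv> tup N (E0 E) U x e"
abbreviation "pr1 k e \<equiv> tup N (E1 E) S1 k e"
abbreviation "pr2 m e \<equiv> tup N (Dom N (EFst E)) S2 m e"

text \<open>A composable pair needs one term only: the point of the second arrow has to be the
  transport of the first point. Composition and units keep the point; \<open>ETrg\<close> and
  \<open>ESnd\<close> are the maps that transport it.\<close>

definition pointed :: "'u incat" where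
  "pointed = \<lparr>E0 = Dom N P0, E1 = Dom N P1,
     ESrc = pr0 (ESrc E \<cdot>\<^bsub>N\<^esub> P1) (Var N (E1 E) S1),
     ETrg = pr0 (ETrg E \<cdot>\<^bsub>N\<^esub> P1) (act N (Dom N P1) (asub N P1 gen) (Var N (E1 E) S1)),
     EUnit = pr1 (EUnit E \<cdot>\<^bsub>N\<^esub> P0) (Var N (E0 E) U),
     EFst = pr1 (EFst E \<cdot>\<^bsub>N\<^esub> P2) (Var N (Dom N (EFst E)) S2),
     ESnd = pr1 (ESnd E \<cdot>\<^bsub>N\<^esub> P2)
       (act N (Dom N P2) (asub N (EFst E \<cdot>\<^bsub>N\<^esub> P2) gen) (Var N (Dom N (EFst E)) S2)),
     EMult = pr1 (EMult E \<cdot>\<^bsub>N\<^esub> P2) (Var N (Dom N (EFst E)) S2)\<rparr>"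

lemma O2: "Dom N (EFst E) \<in> Obj N"
  using hom_obj(1)[OF int.proj_hom(1)] .

lemma S1_ty: "S1 \<in> Ty N (E1 E)" and S2_ty: "S2 \<in> Ty N (Dom N (EFst E))"
proof -
  show S1: "S1 \<in> Ty N (E1 E)" unfolding S1_def by (rule types.sub_obj[OF int.src_hom U_ty])
  show "S2 \<in> Ty N (Dom N (EFst E))" unfolding S2_def by (rule types.sub_obj[OF int.proj_hom(1) S1])
qed

lemma P_hom: "P0 \<in> hom N (Dom N P0) (E0 E)" "P1 \<in> hom N (Dom N P1) (E1 E)" "P2 \<in> hom N (Dom N P2) (Dom N (EFst E))"
  by (rule ext_hom[OF int.obj(1) U_ty], rule ext_hom[OF int.obj(2) S1_ty], rule ext_hom[OF O2 S2_ty])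

lemma S1_sub: "k \<in> hom N \<Gamma> (E1 E) \<Longrightarrow> tsub N k S1 = tsub N (ESrc E \<cdot>\<^bsub>N\<^esub> k) U"
  unfolding S1_def using types.sub_comp(1)[OF _ int.src_hom U_ty] by simp

lemma S2_sub: "m \<in> hom N \<Gamma> (Dom N (EFst E)) \<Longrightarrow> tsub N m S2 = tsub N (EFst E \<cdot>\<^bsub>N\<^esub> m) S1"
  unfolding S2_def using types.sub_comp(1)[OF _ int.proj_hom(1) S1_ty] by simp

lemma act_code:
  assumes "k \<in> hom N \<Gamma> (E1 E)" "e \<in> Tms N \<Gamma> (tsub N k S1)"
  shows "act N \<Gamma> (asub N k gen) e \<in> Tms N \<Gamma> (tsub N (ETrg E \<cdot>\<^bsub>N\<^esub> k) U)"
  using act_Tms[OF hom_obj(1)[OF assms(1)] classify_hom[OF assms(1)]] assms(2) S1_sub[OF assms(1)] by simp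

lemma gen_hom: "gen \<in> hom (Fib (Tp N) (E1 E)) S1 (tsub N (ETrg E) U)"
  using classify_hom[OF ident_hom[OF int.obj(2)]] homD[OF int.src_hom] homD[OF int.trg_hom]
    types.sub_id(2)[OF int.obj(2)]
  by (metis (no_types, lifting) S1_def cls_arr comp_ident(1) gen_def ident_hom int.obj(2))

section \<open>The structure maps on generalized elements\<close>

lemma src_pr1:
  assumes k: "k \<in> hom N \<Gamma> (E1 E)" and e: "e \<in> Tms N \<Gamma> (tsub N k S1)"
  shows "ESrc pointed \<cdot>\<^bsub>N\<^esub> pr1 k e = pr0 (ESrc E \<cdot>\<^bsub>N\<^esub> k) e"
proof -
  have v: "Var N (E1 E) S1 \<in> Tms N (Dom N P1) (tsub N (ESrc E \<cdot>\<^bsub>N\<^esub> P1) U)"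
    using var_Tms[OF int.obj(2) S1_ty] S1_sub[OF P_hom(2)] by simp
  show ?thesis
    using tup_comp_tup[OF S1_ty U_ty int.src_hom v k e] tup(3)[OF S1_ty k e] by (simp add: pointed_def)
qed

lemma trg_pr1:
  assumes k: "k \<in> hom N \<Gamma> (E1 E)" and e: "e \<in> Tms N \<Gamma> (tsub N k S1)"
  shows "ETrg pointed \<cdot>\<^bsub>N\<^esub> pr1 k e = pr0 (ETrg E \<cdot>\<^bsub>N\<^esub> k) (act N \<Gamma> (asub N k gen) e)"
  using tup_comp_tup[OF S1_ty U_ty int.trg_hom act_code[OF P_hom(2) var_Tms[OF int.obj(2) S1_ty]] k e]
    act_gen[OF k gen_hom tup[OF S1_ty k e]] by (simp add: pointed_def)

lemma unit_pr0:
  assumes x: "x \<in> hom N \<Gamma> (E0 E)" and e: "e \<in> Tms N \<Gamma> (tsub N x U)"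
  shows "EUnit pointed \<cdot>\<^bsub>N\<^esub> pr0 x e = pr1 (EUnit E \<cdot>\<^bsub>N\<^esub> x) e"
proof -
  have v: "Var N (E0 E) U \<in> Tms N (Dom N P0) (tsub N (EUnit E \<cdot>\<^bsub>N\<^esub> P0) S1)"
    using var_Tms[OF int.obj(1) U_ty] S1_sub[OF comp_hom[OF P_hom(1) int.unit_hom]] homD[OF P_hom(1)]
      homD[OF int.unit_hom] homD[OF int.src_hom] by (simp add: comp_reduce[OF int.src_unit])
  show ?thesis
    using tup_comp_tup[OF U_ty S1_ty int.unit_hom v x e] tup(3)[OF U_ty x e] by (simp add: pointed_def)
qed

lemma fst_pr2:
  assumes m: "m \<in> hom N \<Gamma> (Dom N (EFst E))" and e: "e \<in> Tms N \<Gamma> (tsub N m S2)"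
  shows "EFst pointed \<cdot>\<^bsub>N\<^esub> pr2 m e = pr1 (EFst E \<cdot>\<^bsub>N\<^esub> m) e"
proof -
  have v: "Var N (Dom N (EFst E)) S2 \<in> Tms N (Dom N P2) (tsub N (EFst E \<cdot>\<^bsub>N\<^esub> P2) S1)"
    using var_Tms[OF O2 S2_ty] S2_sub[OF P_hom(3)] by simp
  show ?thesis
    using tup_comp_tup[OF S2_ty S1_ty int.proj_hom(1) v m e] tup(3)[OF S2_ty m e] by (simp add: pointed_def)
qed

lemma act_fst:
  assumes m: "m \<in> hom N \<Gamma> (Dom N (EFst E))" and e: "e \<in> Tms N \<Gamma> (tsub N m S2)"
  shows "act N \<Gamma> (asub N (EFst E \<cdot>\<^bsub>N\<^esub> m) gen) e \<in> Tms N \<Gamma> (tsub N (ESnd E \<cdot>\<^bsub>N\<^esub> m) S1)"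
proof -
  note f = comp_hom[OF m int.proj_hom(1)] and s = comp_hom[OF m int.proj_hom(2)]
  have "ETrg E \<cdot>\<^bsub>N\<^esub> (EFst E \<cdot>\<^bsub>N\<^esub> m) = ESrc E \<cdot>\<^bsub>N\<^esub> (ESnd E \<cdot>\<^bsub>N\<^esub> m)"
    using homD(1,3)[OF int.proj_hom(1)] homD[OF int.proj_hom(2)] homD[OF int.src_hom] homD[OF int.trg_hom] homD[OF m]
      comp_reduce[OF pullback_squareD(9)[OF int.pullback], of m] by simp
  then show ?thesis using act_code[OF f] e S2_sub[OF m] S1_sub[OF s] by simp
qed

lemma snd_pr2:
  assumes m: "m \<in> hom N \<Gamma> (Dom N (EFst E))" and e: "e \<in> Tms N \<Gamma> (tsub N m S2)"
  shows "ESnd pointed \<cdot>\<^bsub>N\<^esub> pr2 m e = pr1 (ESnd E \<cdot>\<^bsub>N\<^esub> m) (act N \<Gamma> (asub N (EFst E \<cdot>\<^bsub>N\<^esub> m) gen) e)"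
proof -
  have g: "asub N (EFst E) gen \<in> hom (Fib (Tp N) (Dom N (EFst E))) S2 (tsub N (EFst E) (tsub N (ETrg E) U))"
    using types.sub_hom[OF int.proj_hom(1) gen_hom] by (simp add: S2_def)
  have "asub N (EFst E \<cdot>\<^bsub>N\<^esub> n) gen = asub N n (asub N (EFst E) gen)" if "n \<in> hom N \<Theta> (Dom N (EFst E))" for n \<Theta>
    using types.sub_comp(2)[OF that int.proj_hom(1) gen_hom] .
  note s = this[OF m] this[OF P_hom(3)]
  show ?thesis
    using tup_comp_tup[OF S2_ty S1_ty int.proj_hom(2) act_fst[OF P_hom(3) var_Tms[OF O2 S2_ty]] m e]
      act_gen[OF m g tup[OF S2_ty m e]] s by (simp add: pointed_def)
qed

lemma mult_pr2:
  assumes m: "m \<in> hom N \<Gamma> (Dom N (EFst E))" and e: "e \<in> Tms N \<Gamma> (tsub N m S2)"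
  shows "EMult pointed \<cdot>\<^bsub>N\<^esub> pr2 m e = pr1 (EMult E \<cdot>\<^bsub>N\<^esub> m) e"
proof -
  have v: "Var N (Dom N (EFst E)) S2 \<in> Tms N (Dom N P2) (tsub N (EMult E \<cdot>\<^bsub>N\<^esub> P2) S1)"
    using var_Tms[OF O2 S2_ty] S2_sub[OF P_hom(3)] S1_sub[OF comp_hom[OF P_hom(3) int.mult_hom]]
      S1_sub[OF comp_hom[OF P_hom(3) int.proj_hom(1)]] homD[OF P_hom(3)] homD[OF int.mult_hom] homD[OF int.src_hom]
      homD(1,3)[OF int.proj_hom(1)] comp_reduce[OF int.src_mult, of P2] by simp
  show ?thesis
    using tup_comp_tup[OF S2_ty S1_ty int.mult_hom v m e] tup(3)[OF S2_ty m e] by (simp add: pointed_def)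
qed

lemma pointed_simps [simp]: "E0 pointed = Dom N P0" "E1 pointed = Dom N P1"
  by (simp_all add: pointed_def)

text \<open>Representability once more: generalized elements of the three objects are pairs, so the
  laws of an internal category can be proved on pairs.\<close>

lemma pr_exhaust:
  "h \<in> hom N \<Gamma> (Dom N P0) \<Longrightarrow> \<exists>x e. h = pr0 x e \<and> x \<in> hom N \<Gamma> (E0 E) \<and> e \<in> Tms N \<Gamma> (tsub N x U)"
  "h \<in> hom N \<Gamma> (Dom N P1) \<Longrightarrow> \<exists>k e. h = pr1 k e \<and> k \<in> hom N \<Gamma> (E1 E) \<and> e \<in> Tms N \<Gamma> (tsub N k S1)"
  "h \<in> hom N \<Gamma> (Dom N P2) \<Longrightarrow> \<exists>m e. h = pr2 m e \<and> m \<in> hom N \<Gamma> (Dom N (EFst E)) \<and> e \<in> Tms N \<Gamma> (tsub N m S2)"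
  using tup_eqI[OF int.obj(1) U_ty _ refl refl, of h \<Gamma>] comp_hom[OF _ P_hom(1), of h \<Gamma>] var_sub_Tms[OF int.obj(1) U_ty, of h \<Gamma>]
    tup_eqI[OF int.obj(2) S1_ty _ refl refl, of h \<Gamma>] comp_hom[OF _ P_hom(2), of h \<Gamma>] var_sub_Tms[OF int.obj(2) S1_ty, of h \<Gamma>]
    tup_eqI[OF O2 S2_ty _ refl refl, of h \<Gamma>] comp_hom[OF _ P_hom(3), of h \<Gamma>] var_sub_Tms[OF O2 S2_ty, of h \<Gamma>]
  by metis+

lemma pr_inject:
  "\<lbrakk>pr0 x e = pr0 x' e'; x \<in> hom N \<Gamma> (E0 E); e \<in> Tms N \<Gamma> (tsub N x U); x' \<in> hom N \<Gamma> (E0 E); e' \<in> Tms N \<Gamma> (tsub N x' U)\<rbrakk>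
    \<Longrightarrow> x = x' \<and> e = e'"
  "\<lbrakk>pr1 k e = pr1 k' e'; k \<in> hom N \<Gamma> (E1 E); e \<in> Tms N \<Gamma> (tsub N k S1); k' \<in> hom N \<Gamma> (E1 E); e' \<in> Tms N \<Gamma> (tsub N k' S1)\<rbrakk>
    \<Longrightarrow> k = k' \<and> e = e'"
  using tup[OF U_ty] tup[OF S1_ty] by metis+

text \<open>Beyond typing, the equations say that the projections to \<open>E\<close> commute with
  the structure maps; they feed the axioms of an internal functor.\<close>

lemma pointed_hom: "ESrc pointed \<in> hom N (Dom N P1) (Dom N P0)" "ETrg pointed \<in> hom N (Dom N P1) (Dom N P0)"
  "EUnit pointed \<in> hom N (Dom N P0) (Dom N P1)" "EFst pointed \<in> hom N (Dom N P2) (Dom N P1)"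
  "ESnd pointed \<in> hom N (Dom N P2) (Dom N P1)" "EMult pointed \<in> hom N (Dom N P2) (Dom N P1)"
  "P0 \<cdot>\<^bsub>N\<^esub> ESrc pointed = ESrc E \<cdot>\<^bsub>N\<^esub> P1" "P0 \<cdot>\<^bsub>N\<^esub> ETrg pointed = ETrg E \<cdot>\<^bsub>N\<^esub> P1"
  "P1 \<cdot>\<^bsub>N\<^esub> EUnit pointed = EUnit E \<cdot>\<^bsub>N\<^esub> P0" "P1 \<cdot>\<^bsub>N\<^esub> EFst pointed = EFst E \<cdot>\<^bsub>N\<^esub> P2"
  "P1 \<cdot>\<^bsub>N\<^esub> ESnd pointed = ESnd E \<cdot>\<^bsub>N\<^esub> P2" "P1 \<cdot>\<^bsub>N\<^esub> EMult pointed = EMult E \<cdot>\<^bsub>N\<^esub> P2"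
proof -
  have v1: "Var N (E1 E) S1 \<in> Tms N (Dom N P1) (tsub N (ESrc E \<cdot>\<^bsub>N\<^esub> P1) U)"
    using var_Tms[OF int.obj(2) S1_ty] S1_sub[OF P_hom(2)] by simp
  have v2: "Var N (E0 E) U \<in> Tms N (Dom N P0) (tsub N (EUnit E \<cdot>\<^bsub>N\<^esub> P0) S1)"
    using var_Tms[OF int.obj(1) U_ty] S1_sub[OF comp_hom[OF P_hom(1) int.unit_hom]] homD[OF P_hom(1)]
      homD[OF int.unit_hom] homD[OF int.src_hom] by (simp add: comp_reduce[OF int.src_unit])
  have v3: "Var N (Dom N (EFst E)) S2 \<in> Tms N (Dom N P2) (tsub N (EFst E \<cdot>\<^bsub>N\<^esub> P2) S1)"
    using var_Tms[OF O2 S2_ty] S2_sub[OF P_hom(3)] by simp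
  have v4: "Var N (Dom N (EFst E)) S2 \<in> Tms N (Dom N P2) (tsub N (EMult E \<cdot>\<^bsub>N\<^esub> P2) S1)"
    using v3 S1_sub[OF comp_hom[OF P_hom(3) int.mult_hom]]
      S1_sub[OF comp_hom[OF P_hom(3) int.proj_hom(1)]] homD[OF P_hom(3)] homD[OF int.mult_hom] homD[OF int.src_hom]
      homD(1,3)[OF int.proj_hom(1)] comp_reduce[OF int.src_mult, of P2] by simp
  note t = tup[OF U_ty comp_hom[OF P_hom(2) int.src_hom] v1]
    tup[OF U_ty comp_hom[OF P_hom(2) int.trg_hom] act_code[OF P_hom(2) var_Tms[OF int.obj(2) S1_ty]]]
    tup[OF S1_ty comp_hom[OF P_hom(1) int.unit_hom] v2]
    tup[OF S1_ty comp_hom[OF P_hom(3) int.proj_hom(1)] v3]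
    tup[OF S1_ty comp_hom[OF P_hom(3) int.proj_hom(2)] act_fst[OF P_hom(3) var_Tms[OF O2 S2_ty]]]
    tup[OF S1_ty comp_hom[OF P_hom(3) int.mult_hom] v4]
  show "ESrc pointed \<in> hom N (Dom N P1) (Dom N P0)" "ETrg pointed \<in> hom N (Dom N P1) (Dom N P0)"
  "EUnit pointed \<in> hom N (Dom N P0) (Dom N P1)" "EFst pointed \<in> hom N (Dom N P2) (Dom N P1)"
  "ESnd pointed \<in> hom N (Dom N P2) (Dom N P1)" "EMult pointed \<in> hom N (Dom N P2) (Dom N P1)"
  "P0 \<cdot>\<^bsub>N\<^esub> ESrc pointed = ESrc E \<cdot>\<^bsub>N\<^esub> P1" "P0 \<cdot>\<^bsub>N\<^esub> ETrg pointed = ETrg E \<cdot>\<^bsub>N\<^esub> P1"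
  "P1 \<cdot>\<^bsub>N\<^esub> EUnit pointed = EUnit E \<cdot>\<^bsub>N\<^esub> P0" "P1 \<cdot>\<^bsub>N\<^esub> EFst pointed = EFst E \<cdot>\<^bsub>N\<^esub> P2"
  "P1 \<cdot>\<^bsub>N\<^esub> ESnd pointed = ESnd E \<cdot>\<^bsub>N\<^esub> P2" "P1 \<cdot>\<^bsub>N\<^esub> EMult pointed = EMult E \<cdot>\<^bsub>N\<^esub> P2"
    using t by (simp_all add: pointed_def)
qed

text \<open>The codes form a pullback because \<open>E\<close> is an internal category, and the
  point of the second arrow is forced by composability.\<close>

lemma pointed_pullback: "pullback_square N (ETrg pointed) (ESrc pointed) (EFst pointed) (ESnd pointed)"
proof (rule pullback_squareI[OF category_axioms pointed_hom(2,1,4,5)])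
  note id2 = ident_hom[OF hom_obj(1)[OF P_hom(3)]]
  note v = var_Tms[OF O2 S2_ty]
  have st: "ETrg pointed \<cdot>\<^bsub>N\<^esub> (EFst pointed \<cdot>\<^bsub>N\<^esub> pr2 m e) = ESrc pointed \<cdot>\<^bsub>N\<^esub> (ESnd pointed \<cdot>\<^bsub>N\<^esub> pr2 m e)"
    if m: "m \<in> hom N \<Gamma> (Dom N (EFst E))" and e: "e \<in> Tms N \<Gamma> (tsub N m S2)" for m e \<Gamma>
  proof -
    have "ETrg E \<cdot>\<^bsub>N\<^esub> (EFst E \<cdot>\<^bsub>N\<^esub> m) = ESrc E \<cdot>\<^bsub>N\<^esub> (ESnd E \<cdot>\<^bsub>N\<^esub> m)"
      using homD(1,3)[OF int.proj_hom(1)] homD[OF int.proj_hom(2)] homD[OF int.src_hom] homD[OF int.trg_hom] homD[OF m]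
        comp_reduce[OF pullback_squareD(9)[OF int.pullback], of m] by simp
    then show ?thesis
      using fst_pr2[OF m e] snd_pr2[OF m e] trg_pr1[OF comp_hom[OF m int.proj_hom(1)]]
        src_pr1[OF comp_hom[OF m int.proj_hom(2)] act_fst[OF m e]] e S2_sub[OF m] by simp
  qed
  \<comment> \<open>The tuple of projection and variable is the identity, so the law
    \<open>st\<close> for arbitrary elements yields the equation between the arrows.\<close>
  have "pr2 P2 (Var N (Dom N (EFst E)) S2) = Ident N (Dom N P2)"
    by (rule tup_eqI[OF O2 S2_ty id2]) (use homD[OF P_hom(3)] terms.sub_id(1)[OF hom_obj(1)[OF P_hom(3)] TmsD(1)[OF v]] in auto)
  with st[OF P_hom(3) v] show "ETrg pointed \<cdot>\<^bsub>N\<^esub> EFst pointed = ESrc pointed \<cdot>\<^bsub>N\<^esub> ESnd pointed"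
    using homD(1,3)[OF pointed_hom(4)] homD[OF pointed_hom(5)] homD(2)[OF pointed_hom(4)] by simp
next
  fix X f g assume f: "f \<in> hom N X (Dom N P1)" and g: "g \<in> hom N X (Dom N P1)"
    and fg: "ETrg pointed \<cdot>\<^bsub>N\<^esub> f = ESrc pointed \<cdot>\<^bsub>N\<^esub> g"
  obtain k e where k: "f = pr1 k e" "k \<in> hom N X (E1 E)" "e \<in> Tms N X (tsub N k S1)" using pr_exhaust(2)[OF f] by blast
  obtain l e' where l: "g = pr1 l e'" "l \<in> hom N X (E1 E)" "e' \<in> Tms N X (tsub N l S1)" using pr_exhaust(2)[OF g] by blast
  have "pr0 (ETrg E \<cdot>\<^bsub>N\<^esub> k) (act N X (asub N k gen) e) = pr0 (ESrc E \<cdot>\<^bsub>N\<^esub> l) e'"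
    using fg trg_pr1[OF k(2,3)] src_pr1[OF l(2,3)] k(1) l(1) by simp
  \<comment> \<open>Composability splits into composability of the codes and the statement that the
    second point is the transport of the first.\<close>
  from pr_inject(1)[OF this comp_hom[OF k(2) int.trg_hom] act_code[OF k(2,3)] comp_hom[OF l(2) int.src_hom]] l(3) S1_sub[OF l(2)]
  have kl: "ETrg E \<cdot>\<^bsub>N\<^esub> k = ESrc E \<cdot>\<^bsub>N\<^esub> l" "act N X (asub N k gen) e = e'" by auto
  note c = int.comp_sub[OF k(2) l(2) kl(1)]
  have e: "e \<in> Tms N X (tsub N (pairing N (EFst E) (ESnd E) k l) S2)" using k(3) S2_sub[OF c(1)] c(2) by simp
  show "\<exists>h\<in>hom N X (Dom N P2). EFst pointed \<cdot>\<^bsub>N\<^esub> h = f \<and> ESnd pointed \<cdot>\<^bsub>N\<^esub> h = g"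
    using fst_pr2[OF c(1) e] snd_pr2[OF c(1) e] c k(1) l(1) kl(2) tup(1)[OF S2_ty c(1) e]
    by (intro bexI[of _ "pr2 (pairing N (EFst E) (ESnd E) k l) e"]) simp_all
next
  fix X h h' assume h: "h \<in> hom N X (Dom N P2)" and h': "h' \<in> hom N X (Dom N P2)"
    and eq: "EFst pointed \<cdot>\<^bsub>N\<^esub> h = EFst pointed \<cdot>\<^bsub>N\<^esub> h'" "ESnd pointed \<cdot>\<^bsub>N\<^esub> h = ESnd pointed \<cdot>\<^bsub>N\<^esub> h'"
  obtain m e where m: "h = pr2 m e" "m \<in> hom N X (Dom N (EFst E))" "e \<in> Tms N X (tsub N m S2)" using pr_exhaust(3)[OF h] by blast
  obtain m' e' where m': "h' = pr2 m' e'" "m' \<in> hom N X (Dom N (EFst E))" "e' \<in> Tms N X (tsub N m' S2)" using pr_exhaust(3)[OF h'] by blast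
  have 1: "EFst E \<cdot>\<^bsub>N\<^esub> m = EFst E \<cdot>\<^bsub>N\<^esub> m' \<and> e = e'"
    by (rule pr_inject(2)[OF _ comp_hom[OF m(2) int.proj_hom(1)] _ comp_hom[OF m'(2) int.proj_hom(1)]])
      (use eq(1) fst_pr2[OF m(2,3)] fst_pr2[OF m'(2,3)] m m' S2_sub[OF m(2)] S2_sub[OF m'(2)] in auto)
  have 2: "ESnd E \<cdot>\<^bsub>N\<^esub> m = ESnd E \<cdot>\<^bsub>N\<^esub> m'"
    using pr_inject(2)[OF _ comp_hom[OF m(2) int.proj_hom(2)] act_fst[OF m(2,3)] comp_hom[OF m'(2) int.proj_hom(2)] act_fst[OF m'(2,3)]]
      eq(2) snd_pr2[OF m(2,3)] snd_pr2[OF m'(2,3)] m(1) m'(1) by simp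
  have "m = m'" by (rule pullback_eqI[OF int.pullback m(2) m'(2) category_axioms]) (use 1 2 in auto)
  with 1 m(1) m'(1) show "h = h'" by simp
qed

end

lemma disp_fibre_hom:
  "k \<in> hom (disp_fibre C \<Gamma>) p q \<longleftrightarrow> (\<exists>h. k = (p, h, q) \<and> p \<in> Disp C \<and> Cod C p = \<Gamma> \<and>
    q \<in> Disp C \<and> Cod C q = \<Gamma> \<and> h \<in> hom C (Dom C p) (Dom C q) \<and> q \<cdot>\<^bsub>C\<^esub> h = p)"
  by (auto simp: disp_fibre_def hom_def)

lemma (in display_category) disp_fibre_category: "category (disp_fibre C \<Gamma>)"
proof
  fix f assume "f \<in> Arr (disp_fibre C \<Gamma>)"
  then show "Dom (disp_fibre C \<Gamma>) f \<in> Obj (disp_fibre C \<Gamma>)" "Cod (disp_fibre C \<Gamma>) f \<in> Obj (disp_fibre C \<Gamma>)"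
    by (auto simp: disp_fibre_def)
next
  fix p assume p: "p \<in> Obj (disp_fibre C \<Gamma>)"
  then have "p \<in> Disp C" "Cod C p = \<Gamma>" by (simp_all add: disp_fibre_def)
  then show "Ident (disp_fibre C \<Gamma>) p \<in> hom (disp_fibre C \<Gamma>) p p"
    unfolding disp_fibre_hom by (intro exI[of _ "Ident C (Dom C p)"]) (simp add: disp_fibre_def disp_arr ident_hom)
next
  fix k p q l r assume "k \<in> hom (disp_fibre C \<Gamma>) p q"
  then obtain h where k: "k = (p, h, q)" "p \<in> Disp C" "Cod C p = \<Gamma>" "q \<in> Disp C" "Cod C q = \<Gamma>"
    "h \<in> hom C (Dom C p) (Dom C q)" "q \<cdot> h = p" unfolding disp_fibre_hom by blast
  show "Comp (disp_fibre C \<Gamma>) k (Ident (disp_fibre C \<Gamma>) p) = k" "Comp (disp_fibre C \<Gamma>) (Ident (disp_fibre C \<Gamma>) q) k = k"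
    using k(1,6) comp_ident_right comp_ident_left by (simp_all add: disp_fibre_def)
  assume "l \<in> hom (disp_fibre C \<Gamma>) q r"
  then obtain h' where l: "l = (q, h', r)" "r \<in> Disp C" "Cod C r = \<Gamma>"
    "h' \<in> hom C (Dom C q) (Dom C r)" "r \<cdot> h' = q" unfolding disp_fibre_hom by blast
  have "r \<cdot> (h' \<cdot> h) = p"
    using comp_assoc[OF k(6) l(4), of r "Cod C r"] disp_arr[OF l(2)] l(5) k(7) by (simp add: homI)
  then show "Comp (disp_fibre C \<Gamma>) l k \<in> hom (disp_fibre C \<Gamma>) p r"
    unfolding disp_fibre_hom using comp_hom[OF k(6) l(4)] k l
    by (intro exI[of _ "h' \<cdot> h"]) (simp add: disp_fibre_def)
  fix m s assume "m \<in> hom (disp_fibre C \<Gamma>) r s"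
  then obtain h'' where m: "m = (r, h'', s)" "h'' \<in> hom C (Dom C r) (Dom C s)" unfolding disp_fibre_hom by blast
  show "Comp (disp_fibre C \<Gamma>) m (Comp (disp_fibre C \<Gamma>) l k) = Comp (disp_fibre C \<Gamma>) (Comp (disp_fibre C \<Gamma>) m l) k"
    using comp_assoc[OF k(6) l(4) m(2)] k(1) l(1) m(1) by (simp add: disp_fibre_def)
qed

text \<open>The inverse of an isomorphism over the base is itself over the base, so invertibility in
  the fibre is invertibility of the map of total objects.\<close>

lemma (in display_category) disp_fibre_isomorphic:
  "isomorphic (disp_fibre C \<Gamma>) p q \<longleftrightarrow>
    p \<in> Disp C \<and> Cod C p = \<Gamma> \<and> q \<in> Disp C \<and> Cod C q = \<Gamma> \<and>
    (\<exists>i \<in> hom C (Dom C p) (Dom C q). is_iso C i \<and> q \<cdot> i = p)"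
proof (intro iffI)
  interpret F: category "disp_fibre C \<Gamma>" by (rule disp_fibre_category)
  assume "isomorphic (disp_fibre C \<Gamma>) p q"
  then obtain k where k: "k \<in> hom (disp_fibre C \<Gamma>) p q" "is_iso (disp_fibre C \<Gamma>) k"
    unfolding isomorphic_def by blast
  obtain l where l: "l \<in> hom (disp_fibre C \<Gamma>) q p" "Comp (disp_fibre C \<Gamma>) l k = Ident (disp_fibre C \<Gamma>) p"
    "Comp (disp_fibre C \<Gamma>) k l = Ident (disp_fibre C \<Gamma>) q" using F.is_isoE[OF k(2,1)] by metis
  obtain i where i: "k = (p, i, q)" "p \<in> Disp C" "Cod C p = \<Gamma>" "q \<in> Disp C" "Cod C q = \<Gamma>"
    "i \<in> hom C (Dom C p) (Dom C q)" "q \<cdot> i = p" using k(1) unfolding disp_fibre_hom by blast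
  obtain j where j: "l = (q, j, p)" "j \<in> hom C (Dom C q) (Dom C p)" using l(1) unfolding disp_fibre_hom by blast
  have "is_iso C i" by (rule is_isoI[OF i(6) j(2)]) (use l(2,3) i(1) j(1) in \<open>simp_all add: disp_fibre_def\<close>)
  with i show "p \<in> Disp C \<and> Cod C p = \<Gamma> \<and> q \<in> Disp C \<and> Cod C q = \<Gamma> \<and>
    (\<exists>i \<in> hom C (Dom C p) (Dom C q). is_iso C i \<and> q \<cdot> i = p)" by blast
next
  interpret F: category "disp_fibre C \<Gamma>" by (rule disp_fibre_category)
  assume a: "p \<in> Disp C \<and> Cod C p = \<Gamma> \<and> q \<in> Disp C \<and> Cod C q = \<Gamma> \<and>
    (\<exists>i \<in> hom C (Dom C p) (Dom C q). is_iso C i \<and> q \<cdot> i = p)"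
  then obtain i where i: "i \<in> hom C (Dom C p) (Dom C q)" "is_iso C i" "q \<cdot> i = p" by blast
  obtain j where j: "j \<in> hom C (Dom C q) (Dom C p)" "j \<cdot> i = Ident C (Dom C p)" "i \<cdot> j = Ident C (Dom C q)"
    using is_isoE[OF i(2,1)] by metis
  have q: "q \<in> Arr C" using a disp_arr by blast
  have "p \<cdot> j = q" using comp_assoc[OF j(1) i(1), of q "Cod C q"] q i(3) j(3) by (simp add: homI)
  then have k: "(p, i, q) \<in> hom (disp_fibre C \<Gamma>) p q" "(q, j, p) \<in> hom (disp_fibre C \<Gamma>) q p"
    using a i j unfolding disp_fibre_hom by blast+
  have "is_iso (disp_fibre C \<Gamma>) (p, i, q)"
    by (rule F.is_isoI[OF k]) (simp_all add: disp_fibre_def j)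
  then show "isomorphic (disp_fibre C \<Gamma>) p q"
    unfolding isomorphic_def using k(1) by blast
qed

section \<open>The pointed types as the total category of a universe\<close>

context classified_model
begin

lemma pr0_var: "pr0 P0 (Var N (E0 E) U) = Ident N (Dom N P0)"
  using tup_eqI[OF int.obj(1) U_ty ident_hom[OF hom_obj(1)[OF P_hom(1)]]] homD[OF P_hom(1)]
    terms.sub_id(1)[OF hom_obj(1)[OF P_hom(1)] TmsD(1)[OF var_Tms[OF int.obj(1) U_ty]]] by simp

lemma act_unit:
  assumes "x \<in> hom N \<Gamma> (E0 E)" "e \<in> Tms N \<Gamma> (tsub N x U)"
  shows "act N \<Gamma> (asub N (EUnit E \<cdot>\<^bsub>N\<^esub> x) gen) e = e"
  using act_ident[OF hom_obj(1)[OF assms(1)] assms(2)] classify_unit[OF assms(1)] by simp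

lemma act_gcomp:
  assumes "k \<in> hom N \<Gamma> (E1 E)" "l \<in> hom N \<Gamma> (E1 E)" "ETrg E \<cdot>\<^bsub>N\<^esub> k = ESrc E \<cdot>\<^bsub>N\<^esub> l" "e \<in> Tms N \<Gamma> (tsub N k S1)"
  shows "act N \<Gamma> (asub N (gcomp N E l k) gen) e = act N \<Gamma> (asub N l gen) (act N \<Gamma> (asub N k gen) e)"
  using act_comp[OF hom_obj(1)[OF assms(1)] classify_hom[OF assms(1)], of "asub N l gen" "tsub N (ETrg E \<cdot>\<^bsub>N\<^esub> l) U" e]
    classify_hom[OF assms(2)] classify_comp[OF assms(1-3)] assms(3,4) S1_sub[OF assms(1)] by simp

lemma unit_code:
  assumes "x \<in> hom N \<Gamma> (E0 E)"
  shows "EUnit E \<cdot>\<^bsub>N\<^esub> x \<in> hom N \<Gamma> (E1 E)" "ESrc E \<cdot>\<^bsub>N\<^esub> (EUnit E \<cdot>\<^bsub>N\<^esub> x) = x" "ETrg E \<cdot>\<^bsub>N\<^esub> (EUnit E \<cdot>\<^bsub>N\<^esub> x) = x"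
    "tsub N (EUnit E \<cdot>\<^bsub>N\<^esub> x) S1 = tsub N x U"
proof -
  show a: "EUnit E \<cdot>\<^bsub>N\<^esub> x \<in> hom N \<Gamma> (E1 E)" by (rule comp_hom[OF assms int.unit_hom])
  show b: "ESrc E \<cdot>\<^bsub>N\<^esub> (EUnit E \<cdot>\<^bsub>N\<^esub> x) = x" "ETrg E \<cdot>\<^bsub>N\<^esub> (EUnit E \<cdot>\<^bsub>N\<^esub> x) = x"
    using homD[OF assms] homD[OF int.unit_hom] homD[OF int.src_hom] homD[OF int.trg_hom]
    by (simp_all add: comp_reduce[OF int.src_unit] comp_reduce[OF int.trg_unit])
  show "tsub N (EUnit E \<cdot>\<^bsub>N\<^esub> x) S1 = tsub N x U" using S1_sub[OF a] b(1) by simp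
qed

text \<open>A pairing of the projections of an arrow is that arrow, so \<open>EMult\<close> along
  \<open>P2\<close> is the composite of the generic composable pair.\<close>

lemma mult_code:
  "gcomp N E (ESnd E \<cdot>\<^bsub>N\<^esub> P2) (EFst E \<cdot>\<^bsub>N\<^esub> P2) = EMult E \<cdot>\<^bsub>N\<^esub> P2"
  "ETrg E \<cdot>\<^bsub>N\<^esub> (EFst E \<cdot>\<^bsub>N\<^esub> P2) = ESrc E \<cdot>\<^bsub>N\<^esub> (ESnd E \<cdot>\<^bsub>N\<^esub> P2)"
  using pairing_unique[OF int.pullback P_hom(3) category_axioms] homD(1,3)[OF int.proj_hom(1)] homD[OF int.proj_hom(2)]
    homD[OF int.src_hom] homD[OF int.trg_hom] homD[OF P_hom(3)] comp_reduce[OF pullback_squareD(9)[OF int.pullback], of P2]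
  by (simp_all add: gcomp_def)

text \<open>By uniqueness in the pullback, the pairing of the two arrows is the \<open>pr2\<close>
  with the point of the first, and \<open>EMult\<close> keeps that point.\<close>

lemma gcomp_pr1:
  assumes k: "k \<in> hom N \<Gamma> (E1 E)" and l: "l \<in> hom N \<Gamma> (E1 E)" and kl: "ETrg E \<cdot>\<^bsub>N\<^esub> k = ESrc E \<cdot>\<^bsub>N\<^esub> l"
    and e: "e \<in> Tms N \<Gamma> (tsub N k S1)"
  shows "gcomp N pointed (pr1 l (act N \<Gamma> (asub N k gen) e)) (pr1 k e) = pr1 (gcomp N E l k) e"
proof -
  note c = int.comp_sub[OF k l kl]
  have e': "e \<in> Tms N \<Gamma> (tsub N (pairing N (EFst E) (ESnd E) k l) S2)" using e S2_sub[OF c(1)] c(2) by simp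
  let ?h = "pr2 (pairing N (EFst E) (ESnd E) k l) e"
  have "?h \<in> hom N \<Gamma> (Dom N (EFst pointed))" using tup(1)[OF S2_ty c(1) e'] homD(2)[OF pointed_hom(4)] by simp
  from pairing_unique[OF pointed_pullback this category_axioms]
  have "pairing N (EFst pointed) (ESnd pointed) (pr1 k e) (pr1 l (act N \<Gamma> (asub N k gen) e)) = ?h"
    using fst_pr2[OF c(1) e'] snd_pr2[OF c(1) e'] c(2,3) by simp
  then show ?thesis using mult_pr2[OF c(1) e'] by (simp add: gcomp_def)
qed

lemma composable_pr1:
  assumes k: "k \<in> hom N \<Gamma> (E1 E)" "e \<in> Tms N \<Gamma> (tsub N k S1)" and l: "l \<in> hom N \<Gamma> (E1 E)" "e' \<in> Tms N \<Gamma> (tsub N l S1)"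
    and eq: "ETrg pointed \<cdot>\<^bsub>N\<^esub> pr1 k e = ESrc pointed \<cdot>\<^bsub>N\<^esub> pr1 l e'"
  shows "ETrg E \<cdot>\<^bsub>N\<^esub> k = ESrc E \<cdot>\<^bsub>N\<^esub> l" "act N \<Gamma> (asub N k gen) e = e'"
  using pr_inject(1)[OF _ comp_hom[OF k(1) int.trg_hom] act_code[OF k] comp_hom[OF l(1) int.src_hom], of e'] l(2) S1_sub[OF l(1)]
    eq trg_pr1[OF k] src_pr1[OF l] by auto

text \<open>On pairs, each law splits into the law for codes and functoriality of transport, which
  is \<open>act_unit\<close> for units and \<open>act_gcomp\<close> for composites.\<close>

lemma pointed_internal_category: "internal_category N pointed"
proof (intro internal_category.intro internal_category_axioms.intro category_axioms)
  show "E0 pointed \<in> Obj N" "E1 pointed \<in> Obj N"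
    using hom_obj(1)[OF P_hom(1)] hom_obj(1)[OF P_hom(2)] by simp_all
  show "ESrc pointed \<in> hom N (E1 pointed) (E0 pointed)" "ETrg pointed \<in> hom N (E1 pointed) (E0 pointed)"
    "EUnit pointed \<in> hom N (E0 pointed) (E1 pointed)" "EMult pointed \<in> hom N (Dom N (EFst pointed)) (E1 pointed)"
    using pointed_hom homD(2)[OF pointed_hom(4)] by simp_all
  show "pullback_square N (ETrg pointed) (ESrc pointed) (EFst pointed) (ESnd pointed)" by (rule pointed_pullback)
  note v0 = var_Tms[OF int.obj(1) U_ty] and v2 = var_Tms[OF O2 S2_ty]
  note u = unit_code[OF P_hom(1)]
  have v0': "Var N (E0 E) U \<in> Tms N (Dom N P0) (tsub N (EUnit E \<cdot>\<^bsub>N\<^esub> P0) S1)" using v0 u(4) by simp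
  have unit: "EUnit pointed = pr1 (EUnit E \<cdot>\<^bsub>N\<^esub> P0) (Var N (E0 E) U)" by (simp add: pointed_def)
  show "ESrc pointed \<cdot>\<^bsub>N\<^esub> EUnit pointed = Ident N (E0 pointed)"
    unfolding unit using src_pr1[OF u(1) v0'] u(2) pr0_var by simp
  show "ETrg pointed \<cdot>\<^bsub>N\<^esub> EUnit pointed = Ident N (E0 pointed)"
    unfolding unit using trg_pr1[OF u(1) v0'] u(3) act_unit[OF P_hom(1) v0] pr0_var by simp
  note m = comp_hom[OF P_hom(3) int.mult_hom] and f = comp_hom[OF P_hom(3) int.proj_hom(1)] and s = comp_hom[OF P_hom(3) int.proj_hom(2)]
  have mf: "ESrc E \<cdot>\<^bsub>N\<^esub> (EMult E \<cdot>\<^bsub>N\<^esub> P2) = ESrc E \<cdot>\<^bsub>N\<^esub> (EFst E \<cdot>\<^bsub>N\<^esub> P2)"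
    "ETrg E \<cdot>\<^bsub>N\<^esub> (EMult E \<cdot>\<^bsub>N\<^esub> P2) = ETrg E \<cdot>\<^bsub>N\<^esub> (ESnd E \<cdot>\<^bsub>N\<^esub> P2)"
    using int.gcomp(2,3)[OF f s mult_code(2)] mult_code(1) by simp_all
  have v2f: "Var N (Dom N (EFst E)) S2 \<in> Tms N (Dom N P2) (tsub N (EFst E \<cdot>\<^bsub>N\<^esub> P2) S1)"
    using v2 S2_sub[OF P_hom(3)] by simp
  have v2m: "Var N (Dom N (EFst E)) S2 \<in> Tms N (Dom N P2) (tsub N (EMult E \<cdot>\<^bsub>N\<^esub> P2) S1)"
    using v2f S1_sub[OF m] S1_sub[OF f] mf(1) by simp
  have mult: "EMult pointed = pr1 (EMult E \<cdot>\<^bsub>N\<^esub> P2) (Var N (Dom N (EFst E)) S2)"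
    and fst: "EFst pointed = pr1 (EFst E \<cdot>\<^bsub>N\<^esub> P2) (Var N (Dom N (EFst E)) S2)"
    and snd: "ESnd pointed = pr1 (ESnd E \<cdot>\<^bsub>N\<^esub> P2)
       (act N (Dom N P2) (asub N (EFst E \<cdot>\<^bsub>N\<^esub> P2) gen) (Var N (Dom N (EFst E)) S2))"
    by (simp_all add: pointed_def)
  show "ESrc pointed \<cdot>\<^bsub>N\<^esub> EMult pointed = ESrc pointed \<cdot>\<^bsub>N\<^esub> EFst pointed"
    unfolding mult fst using src_pr1[OF m v2m] src_pr1[OF f v2f] mf(1) by simp
  show "ETrg pointed \<cdot>\<^bsub>N\<^esub> EMult pointed = ETrg pointed \<cdot>\<^bsub>N\<^esub> ESnd pointed"
    unfolding mult snd using trg_pr1[OF m v2m] trg_pr1[OF s act_fst[OF P_hom(3) v2]] mf(2)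
      act_gcomp[OF f s mult_code(2) v2f] mult_code(1) by simp
next
  fix h \<Gamma> assume "h \<in> hom N \<Gamma> (E1 pointed)"
  then have "h \<in> hom N \<Gamma> (Dom N P1)" by simp
  then obtain k e where h: "h = pr1 k e" and k: "k \<in> hom N \<Gamma> (E1 E)" and e: "e \<in> Tms N \<Gamma> (tsub N k S1)"
    using pr_exhaust(2) by blast
  note sk = comp_hom[OF k int.src_hom] and tk = comp_hom[OF k int.trg_hom]
  have eU: "e \<in> Tms N \<Gamma> (tsub N (ESrc E \<cdot>\<^bsub>N\<^esub> k) U)" using e S1_sub[OF k] by simp
  have e1: "e \<in> Tms N \<Gamma> (tsub N (EUnit E \<cdot>\<^bsub>N\<^esub> (ESrc E \<cdot>\<^bsub>N\<^esub> k)) S1)" using eU unit_code(4)[OF sk] by simp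
  show "gcomp N pointed h (EUnit pointed \<cdot>\<^bsub>N\<^esub> (ESrc pointed \<cdot>\<^bsub>N\<^esub> h)) = h"
    unfolding h src_pr1[OF k e] unit_pr0[OF sk eU]
    using gcomp_pr1[OF unit_code(1)[OF sk] k unit_code(3)[OF sk] e1] act_unit[OF sk eU] int.unit_right[OF k] by simp
  show "gcomp N pointed (EUnit pointed \<cdot>\<^bsub>N\<^esub> (ETrg pointed \<cdot>\<^bsub>N\<^esub> h)) h = h"
    unfolding h trg_pr1[OF k e] unit_pr0[OF tk act_code[OF k e]]
    using gcomp_pr1[OF k unit_code(1)[OF tk] unit_code(2)[OF tk, symmetric] e] int.unit_left[OF k] by simp
next
  fix f g h \<Gamma> assume "f \<in> hom N \<Gamma> (E1 pointed)" "g \<in> hom N \<Gamma> (E1 pointed)" "h \<in> hom N \<Gamma> (E1 pointed)"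
    and fg: "ETrg pointed \<cdot>\<^bsub>N\<^esub> f = ESrc pointed \<cdot>\<^bsub>N\<^esub> g" and gh: "ETrg pointed \<cdot>\<^bsub>N\<^esub> g = ESrc pointed \<cdot>\<^bsub>N\<^esub> h"
  then have a: "f \<in> hom N \<Gamma> (Dom N P1)" "g \<in> hom N \<Gamma> (Dom N P1)" "h \<in> hom N \<Gamma> (Dom N P1)" by simp_all
  obtain k e where f: "f = pr1 k e" and k: "k \<in> hom N \<Gamma> (E1 E)" "e \<in> Tms N \<Gamma> (tsub N k S1)" using pr_exhaust(2)[OF a(1)] by blast
  obtain l e' where g: "g = pr1 l e'" and l: "l \<in> hom N \<Gamma> (E1 E)" "e' \<in> Tms N \<Gamma> (tsub N l S1)" using pr_exhaust(2)[OF a(2)] by blast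
  obtain m e'' where h: "h = pr1 m e''" and m: "m \<in> hom N \<Gamma> (E1 E)" "e'' \<in> Tms N \<Gamma> (tsub N m S1)" using pr_exhaust(2)[OF a(3)] by blast
  note kl = composable_pr1[OF k l fg[unfolded f g]] and lm = composable_pr1[OF l m gh[unfolded g h]]
  note glk = int.gcomp[OF k(1) l(1) kl(1)] and gml = int.gcomp[OF l(1) m(1) lm(1)]
  have e1: "e \<in> Tms N \<Gamma> (tsub N (gcomp N E l k) S1)" using k(2) S1_sub[OF glk(1)] S1_sub[OF k(1)] glk(2) by simp
  have c1: "gcomp N pointed g f = pr1 (gcomp N E l k) e"
    using gcomp_pr1[OF k(1) l(1) kl(1) k(2)] f g kl(2) by simp
  have c2: "gcomp N pointed h g = pr1 (gcomp N E m l) e'"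
    using gcomp_pr1[OF l(1) m(1) lm(1) l(2)] g h lm(2) by simp
  have c3: "gcomp N pointed h (gcomp N pointed g f) = pr1 (gcomp N E m (gcomp N E l k)) e"
    unfolding c1 using gcomp_pr1[OF glk(1) m(1) _ e1] glk(3) lm act_gcomp[OF k(1) l(1) kl(1) k(2)] kl(2) h by simp
  have c4: "gcomp N pointed (gcomp N pointed h g) f = pr1 (gcomp N E (gcomp N E m l) k) e"
    unfolding c2 using gcomp_pr1[OF k(1) gml(1) _ k(2)] gml(2) kl f by simp
  show "gcomp N pointed h (gcomp N pointed g f) = gcomp N pointed (gcomp N pointed h g) f"
    unfolding c3 c4 using int.assoc[OF k(1) l(1) m(1) kl(1) lm(1)] by simp
qed

text \<open>The lifting square is the canonical square of the extension by \<open>U\<close> along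
  \<open>ESrc\<close>, since \<open>S1\<close> is by definition the reindexing of \<open>U\<close>
  along it.\<close>

lemma pointed_opfibration: "internal_discrete_opfibration N pointed E P0 P1"
proof (intro internal_discrete_opfibration.intro internal_functor.intro internal_functor_axioms.intro
    internal_discrete_opfibration_axioms.intro pointed_internal_category int.internal_category_axioms)
  show "P1 \<cdot>\<^bsub>N\<^esub> EMult pointed = gcomp N E (P1 \<cdot>\<^bsub>N\<^esub> ESnd pointed) (P1 \<cdot>\<^bsub>N\<^esub> EFst pointed)"
    using pointed_hom(10-12) mult_code(1) by simp
  show "pullback_square N (ESrc E) P0 P1 (ESrc pointed)"
    using ext_pullback(4)[OF int.src_hom U_ty] by (simp add: pointed_def S1_def)
qed (use P_hom(1,2) pointed_hom(7-9) in simp_all)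

lemma P0_disp: "P0 \<in> Disp N"
  using ext_disp[OF int.obj(1) U_ty] by simp

text \<open>The generic element of the chosen pullback of \<open>P0\<close> along \<open>A\<close>,
  as a term of the type coded by \<open>A\<close>.\<close>

definition el :: "'u \<Rightarrow> 'u" where "el A = tmsub N (PbTop N A P0) (Var N (E0 E) U)"

text \<open>A universe uses the chosen pullbacks \<open>Pb\<close>, a natural model the extensions
  \<open>Ext\<close>. The isomorphism between them makes \<open>Pb N A P0\<close> with
  \<open>el A\<close> a pair on which arrows of types can be tested.\<close>

lemma family:
  assumes A: "A \<in> hom N \<Gamma> (E0 E)"
  shows "pullback_square N A P0 (Pb N A P0) (PbTop N A P0)"
    and "Pb N A P0 \<in> Disp N" "Pb N A P0 \<in> hom N (Dom N (Pb N A P0)) \<Gamma>" "PbTop N A P0 \<in> hom N (Dom N (Pb N A P0)) (Dom N P0)"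
    and "el A \<in> Tms N (Dom N (Pb N A P0)) (tsub N (Pb N A P0) (tsub N A U))"
    and "is_iso N (tup N \<Gamma> (tsub N A U) (Pb N A P0) (el A))"
    and "PbTop N A P0 = pr0 (A \<cdot>\<^bsub>N\<^esub> Pb N A P0) (el A)"
proof -
  show pb: "pullback_square N A P0 (Pb N A P0) (PbTop N A P0)" and "Pb N A P0 \<in> Disp N"
    using disp_pullback[OF P0_disp homD(1)[OF A]] homD(3)[OF A] homD(3)[OF P_hom(1)] by simp_all
  note d = pullback_squareD[OF pb]
  show "Pb N A P0 \<in> hom N (Dom N (Pb N A P0)) \<Gamma>" and q: "PbTop N A P0 \<in> hom N (Dom N (Pb N A P0)) (Dom N P0)"
    using d homD[OF A] by (auto simp: hom_def)
  show "el A \<in> Tms N (Dom N (Pb N A P0)) (tsub N (Pb N A P0) (tsub N A U))"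
    "is_iso N (tup N \<Gamma> (tsub N A U) (Pb N A P0) (el A))"
    using pullback_ext_iso[OF pb int.obj(1) U_ty A] by (simp_all add: el_def)
  show "PbTop N A P0 = pr0 (A \<cdot>\<^bsub>N\<^esub> Pb N A P0) (el A)"
    using tup_eqI[OF int.obj(1) U_ty q d(9)[symmetric]] by (simp add: el_def)
qed

lemma family_eqI:
  assumes B: "B \<in> hom N \<Gamma> (E0 E)" and h: "h \<in> hom N X (Dom N (Pb N B P0))" and h': "h' \<in> hom N X (Dom N (Pb N B P0))"
    and eq: "Pb N B P0 \<cdot>\<^bsub>N\<^esub> h = Pb N B P0 \<cdot>\<^bsub>N\<^esub> h'" "tmsub N h (el B) = tmsub N h' (el B)"
  shows "h = h'"
proof -
  note F = family[OF B]
  have c: "P0 \<cdot>\<^bsub>N\<^esub> (PbTop N B P0 \<cdot>\<^bsub>N\<^esub> k) = B \<cdot>\<^bsub>N\<^esub> (Pb N B P0 \<cdot>\<^bsub>N\<^esub> k)" if "k \<in> hom N X (Dom N (Pb N B P0))" for k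
    using comp_reduce[OF pullback_squareD(9)[OF F(1), symmetric], of k] homD[OF F(3)] homD[OF F(4)] homD[OF that] homD[OF B] homD[OF P_hom(1)]
    by simp
  have "PbTop N B P0 \<cdot>\<^bsub>N\<^esub> h = PbTop N B P0 \<cdot>\<^bsub>N\<^esub> h'"
    by (rule ext_eqI[OF int.obj(1) U_ty comp_hom[OF h F(4)] comp_hom[OF h' F(4)]])
      (use c[OF h] c[OF h'] eq terms.sub_comp(1)[OF h F(4) var_term[OF int.obj(1) U_ty]]
        terms.sub_comp(1)[OF h' F(4) var_term[OF int.obj(1) U_ty]] in \<open>simp_all add: el_def\<close>)
  then show ?thesis by (rule pullback_eqI[OF F(1) h h' category_axioms eq(1)])
qed

text \<open>A description of \<open>classify\<close> by transport: the lift of the generic element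
  ends at the transported element, and the classifying map restricts \<open>el B\<close> to it. By
  \<open>family_eqI\<close> this determines the map.\<close>

lemma classify_arrow:
  assumes f: "f \<in> hom N \<Gamma> (E1 E)" and A: "ESrc E \<cdot>\<^bsub>N\<^esub> f = A" and B: "ETrg E \<cdot>\<^bsub>N\<^esub> f = B"
  obtains h where "FA (classify N pointed E P0 P1 \<Gamma>) f = (Pb N A P0, h, Pb N B P0)"
    "h \<in> hom N (Dom N (Pb N A P0)) (Dom N (Pb N B P0))" "Pb N B P0 \<cdot>\<^bsub>N\<^esub> h = Pb N A P0"
    "tmsub N h (el B) = act N (Dom N (Pb N A P0)) (asub N (Pb N A P0) (asub N f gen)) (el A)"
proof -
  have A': "A \<in> hom N \<Gamma> (E0 E)" and B': "B \<in> hom N \<Gamma> (E0 E)"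
    using comp_hom[OF f int.src_hom] comp_hom[OF f int.trg_hom] A B by simp_all
  note F = family[OF A'] and G = family[OF B']
  let ?q = "Pb N A P0" and ?X = "Dom N (Pb N A P0)"
  note k = comp_hom[OF F(3) f]
  have sk: "ESrc E \<cdot>\<^bsub>N\<^esub> (f \<cdot>\<^bsub>N\<^esub> ?q) = A \<cdot>\<^bsub>N\<^esub> ?q" and tk: "ETrg E \<cdot>\<^bsub>N\<^esub> (f \<cdot>\<^bsub>N\<^esub> ?q) = B \<cdot>\<^bsub>N\<^esub> ?q"
    using comp_reduce[OF A, of ?q] comp_reduce[OF B, of ?q] homD[OF f] homD[OF F(3)] homD[OF int.src_hom] homD[OF int.trg_hom] by simp_all
  have e: "el A \<in> Tms N ?X (tsub N (f \<cdot>\<^bsub>N\<^esub> ?q) S1)"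
    using F(5) types.sub_comp(1)[OF F(3) A' U_ty] S1_sub[OF k] sk by simp
  \<comment> \<open>The lift of the generic element pairs the restricted code with that element,
    since \<open>P1\<close> and \<open>ESrc pointed\<close> recover the two.\<close>
  have l: "pairing N P1 (ESrc pointed) (f \<cdot>\<^bsub>N\<^esub> ?q) (PbTop N A P0) = pr1 (f \<cdot>\<^bsub>N\<^esub> ?q) (el A)"
    using pairing_unique[OF internal_discrete_opfibration.lifting[OF pointed_opfibration] tup(1)[OF S1_ty k e] category_axioms]
      tup(2)[OF S1_ty k e] src_pr1[OF k e] sk F(7) by simp
  define \<tau> where "\<tau> = pr0 (B \<cdot>\<^bsub>N\<^esub> ?q) (act N ?X (asub N (f \<cdot>\<^bsub>N\<^esub> ?q) gen) (el A))"
  have a: "act N ?X (asub N (f \<cdot>\<^bsub>N\<^esub> ?q) gen) (el A) \<in> Tms N ?X (tsub N (B \<cdot>\<^bsub>N\<^esub> ?q) U)"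
    using act_code[OF k e] tk by simp
  note \<tau> = tup[OF U_ty comp_hom[OF F(3) B'] a, folded \<tau>_def]
  have tl: "ETrg pointed \<cdot>\<^bsub>N\<^esub> pr1 (f \<cdot>\<^bsub>N\<^esub> ?q) (el A) = \<tau>" using trg_pr1[OF k e] tk by (simp add: \<tau>_def)
  define h where "h = pairing N (Pb N B P0) (PbTop N B P0) ?q \<tau>"
  have h: "h \<in> hom N ?X (Dom N (Pb N B P0))" "Pb N B P0 \<cdot>\<^bsub>N\<^esub> h = ?q" "PbTop N B P0 \<cdot>\<^bsub>N\<^esub> h = \<tau>"
    unfolding h_def using pairing[OF G(1), of ?q ?X \<tau>] F(3) \<tau> homD[OF B'] by simp_all
  have "FA (classify N pointed E P0 P1 \<Gamma>) f = (?q, h, Pb N B P0)"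
    using f by (simp add: classify_def Let_def A B l tl h_def)
  moreover have "tmsub N h (el B) = act N ?X (asub N ?q (asub N f gen)) (el A)"
    using terms.sub_comp(1)[OF h(1) G(4) var_term[OF int.obj(1) U_ty]] h(3) \<tau>(3) types.sub_comp(2)[OF F(3) f gen_hom]
    by (simp add: el_def)
  ultimately show thesis using that h(1,2) by blast
qed

text \<open>Codes of arrows correspond bijectively to arrows of types, and these, tested on
  \<open>(Pb N A P0, el A)\<close>, to maps of displays; so the functor is fully faithful. Essential
  surjectivity is inherited from comprehension.\<close>

lemma classify_equivalence:
  assumes \<Gamma>: "\<Gamma> \<in> Obj N"
  shows "is_equivalence (Fib (externalization N E) \<Gamma>) (disp_fibre N \<Gamma>) (classify N pointed E P0 P1 \<Gamma>)"
proof (rule is_equivalenceI)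
  let ?K = "classify N pointed E P0 P1 \<Gamma>"
  have KO: "FO ?K A = Pb N A P0" if "A \<in> hom N \<Gamma> (E0 E)" for A using that by (simp add: classify_def)
  note codes = types.sub_obj[OF _ U_ty, of _ \<Gamma>]
  have mor: "f \<in> hom (Fib (Tp N) \<Gamma>) (tsub N A U) (tsub N B U)"
    if "k \<in> hom N \<Gamma> (E1 E)" "ESrc E \<cdot>\<^bsub>N\<^esub> k = A" "ETrg E \<cdot>\<^bsub>N\<^esub> k = B" "f = asub N k gen" for k A B f
    using classify_hom[OF that(1)] that(2-4) by simp
  show "is_functor (Fib (externalization N E) \<Gamma>) (disp_fibre N \<Gamma>) ?K"
  proof (intro is_functor.intro is_functor_axioms.intro int.externalization_category disp_fibre_category \<Gamma>)
    show "FO ?K \<in> extensional (Obj (Fib (externalization N E) \<Gamma>))" "FA ?K \<in> extensional (Arr (Fib (externalization N E) \<Gamma>))"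
      by (simp_all add: classify_def)
  next
    fix A assume "A \<in> Obj (Fib (externalization N E) \<Gamma>)"
    then have A: "A \<in> hom N \<Gamma> (E0 E)" by simp
    note F = family[OF A] and u = unit_code[OF A]
    note X = hom_obj(1)[OF F(3)]
    show "FO ?K A \<in> Obj (disp_fibre N \<Gamma>)" using F(2) homD[OF F(3)] KO[OF A] by (simp add: disp_fibre_def)
    obtain h where h: "FA ?K (EUnit E \<cdot>\<^bsub>N\<^esub> A) = (Pb N A P0, h, Pb N A P0)"
      "h \<in> hom N (Dom N (Pb N A P0)) (Dom N (Pb N A P0))" "Pb N A P0 \<cdot>\<^bsub>N\<^esub> h = Pb N A P0"
      "tmsub N h (el A) = act N (Dom N (Pb N A P0)) (asub N (Pb N A P0) (asub N (EUnit E \<cdot>\<^bsub>N\<^esub> A) gen)) (el A)"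
      by (rule classify_arrow[OF u(1-3)])
    have "h = Ident N (Dom N (Pb N A P0))"
      by (rule family_eqI[OF A h(2) ident_hom[OF X]])
        (use h(3,4) homD[OF F(3)] classify_unit[OF A] types.sub_ident[OF F(3) codes[OF A]] act_ident[OF X F(5)]
          terms.sub_id(1)[OF X TmsD(1)[OF F(5)]] in simp_all)
    then show "FA ?K (Ident (Fib (externalization N E) \<Gamma>) A) = Ident (disp_fibre N \<Gamma>) (FO ?K A)"
      using h(1) KO[OF A] by (simp add: disp_fibre_def)
  next
    fix f A B assume "f \<in> hom (Fib (externalization N E) \<Gamma>) A B"
    then have f: "f \<in> hom N \<Gamma> (E1 E)" "ESrc E \<cdot>\<^bsub>N\<^esub> f = A" "ETrg E \<cdot>\<^bsub>N\<^esub> f = B" by (simp_all add: int.externalization_hom)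
    have A: "A \<in> hom N \<Gamma> (E0 E)" and B: "B \<in> hom N \<Gamma> (E0 E)"
      using comp_hom[OF f(1) int.src_hom] comp_hom[OF f(1) int.trg_hom] f(2,3) by simp_all
    obtain h where h: "FA ?K f = (Pb N A P0, h, Pb N B P0)"
      "h \<in> hom N (Dom N (Pb N A P0)) (Dom N (Pb N B P0))" "Pb N B P0 \<cdot>\<^bsub>N\<^esub> h = Pb N A P0"
      "tmsub N h (el B) = act N (Dom N (Pb N A P0)) (asub N (Pb N A P0) (asub N f gen)) (el A)"
      by (rule classify_arrow[OF f])
    show "FA ?K f \<in> hom (disp_fibre N \<Gamma>) (FO ?K A) (FO ?K B)"
      unfolding disp_fibre_hom KO[OF A] KO[OF B]
      using h(1-3) family(2)[OF A] family(2)[OF B] homD(3)[OF family(3)[OF A]] homD(3)[OF family(3)[OF B]] by blast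
    fix g D assume "g \<in> hom (Fib (externalization N E) \<Gamma>) B D"
    then have g: "g \<in> hom N \<Gamma> (E1 E)" "ESrc E \<cdot>\<^bsub>N\<^esub> g = B" "ETrg E \<cdot>\<^bsub>N\<^esub> g = D" by (simp_all add: int.externalization_hom)
    have D: "D \<in> hom N \<Gamma> (E0 E)" using comp_hom[OF g(1) int.trg_hom] g(3) by simp
    have fg: "ETrg E \<cdot>\<^bsub>N\<^esub> f = ESrc E \<cdot>\<^bsub>N\<^esub> g" using f g by simp
    note c = int.gcomp[OF f(1) g(1) fg]
    obtain h' where h': "FA ?K g = (Pb N B P0, h', Pb N D P0)"
      "h' \<in> hom N (Dom N (Pb N B P0)) (Dom N (Pb N D P0))" "Pb N D P0 \<cdot>\<^bsub>N\<^esub> h' = Pb N B P0"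
      "tmsub N h' (el D) = act N (Dom N (Pb N B P0)) (asub N (Pb N B P0) (asub N g gen)) (el B)"
      by (rule classify_arrow[OF g])
    obtain h'' where h'': "FA ?K (gcomp N E g f) = (Pb N A P0, h'', Pb N D P0)"
      "h'' \<in> hom N (Dom N (Pb N A P0)) (Dom N (Pb N D P0))" "Pb N D P0 \<cdot>\<^bsub>N\<^esub> h'' = Pb N A P0"
      "tmsub N h'' (el D) = act N (Dom N (Pb N A P0)) (asub N (Pb N A P0) (asub N (gcomp N E g f) gen)) (el A)"
      by (rule classify_arrow[OF c(1)]) (use c f g in simp_all)
    note F = family[OF A] and G = family[OF B] and H = family[OF D]
    note mf = mor[OF f refl] and mg = mor[OF g refl]
    \<comment> \<open>Both sides lie over the base, so it suffices to compare the restrictions of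
      \<open>el D\<close> along them; there the claim is functoriality of transport.\<close>
    have "h'' = h' \<cdot>\<^bsub>N\<^esub> h"
    proof (rule family_eqI[OF D h''(2) comp_hom[OF h(2) h'(2)]])
      show "Pb N D P0 \<cdot>\<^bsub>N\<^esub> h'' = Pb N D P0 \<cdot>\<^bsub>N\<^esub> (h' \<cdot>\<^bsub>N\<^esub> h)"
        using h(3) h'(3) h''(3) comp_reduce[OF h'(3), of h] homD[OF h(2)] homD[OF h'(2)] homD[OF H(3)] by simp
      have "tmsub N (h' \<cdot>\<^bsub>N\<^esub> h) (el D) = tmsub N h (act N (Dom N (Pb N B P0)) (asub N (Pb N B P0) (asub N g gen)) (el B))"
        using terms.sub_comp(1)[OF h(2) h'(2) TmsD(1)[OF H(5)]] h'(4) by simp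
      also have "\<dots> = act N (Dom N (Pb N A P0)) (asub N (Pb N A P0) (asub N g gen)) (tmsub N h (el B))"
        using act_sub[OF h(2) types.sub_hom[OF G(3) mg] G(5)] types.sub_comp(2)[OF h(2) G(3) mg] h(3) by simp
      also have "\<dots> = tmsub N h'' (el D)"
        using h(4) h''(4) act_comp[OF hom_obj(1)[OF F(3)] types.sub_hom[OF F(3) mf] types.sub_hom[OF F(3) mg] F(5)]
          types.sub_fcomp[OF F(3) mf mg] classify_comp[OF f(1) g(1) fg] by simp
      finally show "tmsub N h'' (el D) = tmsub N (h' \<cdot>\<^bsub>N\<^esub> h) (el D)" by simp
    qed
    then show "FA ?K (Comp (Fib (externalization N E) \<Gamma>) g f) = Comp (disp_fibre N \<Gamma>) (FA ?K g) (FA ?K f)"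
      using h(1) h'(1) h''(1) by (simp add: disp_fibre_def)
  qed
next
  let ?K = "classify N pointed E P0 P1 \<Gamma>"
  fix A B f g assume "f \<in> hom (Fib (externalization N E) \<Gamma>) A B" "g \<in> hom (Fib (externalization N E) \<Gamma>) A B"
    and eq: "FA ?K f = FA ?K g"
  then have f: "f \<in> hom N \<Gamma> (E1 E)" "ESrc E \<cdot>\<^bsub>N\<^esub> f = A" "ETrg E \<cdot>\<^bsub>N\<^esub> f = B"
    and g: "g \<in> hom N \<Gamma> (E1 E)" "ESrc E \<cdot>\<^bsub>N\<^esub> g = A" "ETrg E \<cdot>\<^bsub>N\<^esub> g = B" by (simp_all add: int.externalization_hom)
  have A: "A \<in> hom N \<Gamma> (E0 E)" using comp_hom[OF f(1) int.src_hom] f(2) by simp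
  note F = family[OF A]
  obtain h where h: "FA ?K f = (Pb N A P0, h, Pb N B P0)"
    "tmsub N h (el B) = act N (Dom N (Pb N A P0)) (asub N (Pb N A P0) (asub N f gen)) (el A)"
    by (rule classify_arrow[OF f])
  obtain h' where h': "FA ?K g = (Pb N A P0, h', Pb N B P0)"
    "tmsub N h' (el B) = act N (Dom N (Pb N A P0)) (asub N (Pb N A P0) (asub N g gen)) (el A)"
    by (rule classify_arrow[OF g])
  have "act N (Dom N (Pb N A P0)) (asub N (Pb N A P0) (asub N f gen)) (el A)
      = act N (Dom N (Pb N A P0)) (asub N (Pb N A P0) (asub N g gen)) (el A)"
    using h h' eq by simp
  from test_inj[OF \<Gamma> classify_hom[OF f(1), unfolded f] classify_hom[OF g(1), unfolded g] F(3,5,6) this]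
  show "f = g" by (rule classify_arr_inj[OF f(1) g(1)])
next
  let ?K = "classify N pointed E P0 P1 \<Gamma>"
  fix A B k assume "A \<in> Obj (Fib (externalization N E) \<Gamma>)" "B \<in> Obj (Fib (externalization N E) \<Gamma>)"
    and k: "k \<in> hom (disp_fibre N \<Gamma>) (FO ?K A) (FO ?K B)"
  then have A: "A \<in> hom N \<Gamma> (E0 E)" and B: "B \<in> hom N \<Gamma> (E0 E)" by simp_all
  note F = family[OF A] and G = family[OF B]
  obtain h where h: "k = (Pb N A P0, h, Pb N B P0)" "h \<in> hom N (Dom N (Pb N A P0)) (Dom N (Pb N B P0))" "Pb N B P0 \<cdot>\<^bsub>N\<^esub> h = Pb N A P0"
    using k A B unfolding disp_fibre_hom by (auto simp: classify_def)
  \<comment> \<open>The map of displays is turned into the term it classifies;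
    \<open>test_surj\<close> realizes this term by an arrow of types, and the classifier provides a
    code for the arrow.\<close>
  have "tmsub N h (el B) \<in> Tms N (Dom N (Pb N A P0)) (tsub N (Pb N A P0) (tsub N B U))"
    using tms_sub[OF h(2) G(5)] types.sub_comp(1)[OF h(2) G(3) types.sub_obj[OF B U_ty]] h(3) by simp
  then obtain m where m: "m \<in> hom (Fib (Tp N) \<Gamma>) (tsub N A U) (tsub N B U)"
    "act N (Dom N (Pb N A P0)) (asub N (Pb N A P0) m) (el A) = tmsub N h (el B)"
    using test_surj[OF \<Gamma> types.sub_obj[OF A U_ty] types.sub_obj[OF B U_ty] F(3,5,6)] by blast
  obtain f where f: "f \<in> hom N \<Gamma> (E1 E)" "ESrc E \<cdot>\<^bsub>N\<^esub> f = A" "ETrg E \<cdot>\<^bsub>N\<^esub> f = B" "asub N f gen = m"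
    by (rule classify_arr_surj[OF A B m(1)])
  obtain h' where h': "FA ?K f = (Pb N A P0, h', Pb N B P0)"
    "h' \<in> hom N (Dom N (Pb N A P0)) (Dom N (Pb N B P0))" "Pb N B P0 \<cdot>\<^bsub>N\<^esub> h' = Pb N A P0"
    "tmsub N h' (el B) = act N (Dom N (Pb N A P0)) (asub N (Pb N A P0) (asub N f gen)) (el A)"
    by (rule classify_arrow[OF f(1-3)])
  have "h' = h" by (rule family_eqI[OF B h'(2) h(2)]) (use h(3) h'(3,4) m(2) f(4) in simp_all)
  then show "\<exists>f\<in>hom (Fib (externalization N E) \<Gamma>) A B. FA ?K f = k"
    using f h(1) h'(1) by (intro bexI[of _ f]) (simp_all add: int.externalization_hom)
next
  fix p assume p: "p \<in> Obj (disp_fibre N \<Gamma>)"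
  obtain A where A: "A \<in> Ty N \<Gamma>" "isomorphic (disp_fibre N \<Gamma>) (FO (comprehension N \<Gamma>) A) p"
    using is_equivalenceD(4)[OF comprehension_equivalence[OF \<Gamma>] p] by blast
  obtain x where x: "x \<in> hom N \<Gamma> (E0 E)" "tsub N x U = A" using classify_obj_ex1[OF \<Gamma> A(1)] by blast
  note F = family[OF x(1)]
  note i = tup[OF types.sub_obj[OF x(1) U_ty] F(3,5)]
  obtain j where j: "j \<in> hom N (ctxt N \<Gamma> A) (Dom N p)" "is_iso N j" "p \<cdot>\<^bsub>N\<^esub> j = Ext N \<Gamma> A" "p \<in> Disp N" "Cod N p = \<Gamma>"
    using A by (auto simp: disp_fibre_isomorphic comprehension_def)
  \<comment> \<open>The chosen pullback is compared with the extension, and the extension with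
    \<open>p\<close>.\<close>
  let ?i = "tup N \<Gamma> (tsub N x U) (Pb N x P0) (el x)"
  have "is_iso N (j \<cdot>\<^bsub>N\<^esub> ?i)" by (rule iso_comp[OF F(6) i(1) j(2)]) (use j x in simp)
  moreover have "j \<cdot>\<^bsub>N\<^esub> ?i \<in> hom N (Dom N (Pb N x P0)) (Dom N p)" by (rule comp_hom[OF i(1)]) (use j x in simp)
  moreover have "p \<cdot>\<^bsub>N\<^esub> (j \<cdot>\<^bsub>N\<^esub> ?i) = Pb N x P0"
    using comp_reduce[OF j(3), of ?i] homD[OF j(1)] homD[OF i(1)] disp_arr[OF j(4)] i(2) x(2) by simp
  ultimately show "\<exists>x\<in>Obj (Fib (externalization N E) \<Gamma>). isomorphic (disp_fibre N \<Gamma>) (FO (classify N pointed E P0 P1 \<Gamma>) x) p"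
    using x F(2) homD[OF F(3)] j(4,5) by (intro bexI[of _ x]) (auto simp: disp_fibre_isomorphic classify_def)
qed

lemma admits_universe: "admits_universe (dcat.truncate N)"
proof -
  have "internal_discrete_opfibration (dcat.truncate N) pointed E P0 P1"
    using pointed_opfibration
    by (simp add: internal_discrete_opfibration_def internal_functor_def internal_functor_axioms_def
        internal_discrete_opfibration_axioms_def)
  moreover have "classify (dcat.truncate N) = classify N" "disp_fibre (dcat.truncate N) = disp_fibre N"
    by (simp_all add: classify_def disp_fibre_def fun_eq_iff)
  ultimately have "universe (dcat.truncate N) pointed E P0 P1"
    using display_category_axioms P0_disp classify_equivalence
    by (intro universe.intro universe_axioms.intro) simp_all
  then show ?thesis unfolding admits_universe_def by blast
qed

end

lemma admits_type_classifierE: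
  assumes "small_natural_model N" "admits_type_classifier N"
  obtains E \<phi> \<psi> where "classified_model N E \<phi> \<psi>"
proof -
  obtain E \<phi> \<psi> where a: "internal_category N E" "strict_indexed_functor N (externalization N E) (Tp N) \<phi>"
    "strict_indexed_functor N (Tp N) (externalization N E) \<psi>"
    "\<forall>\<Gamma> \<in> Obj N. ftr_comp (Fib (externalization N E) \<Gamma>) (\<psi> \<Gamma>) (\<phi> \<Gamma>) = ftr_id (Fib (externalization N E) \<Gamma>) \<and>
                     ftr_comp (Fib (Tp N) \<Gamma>) (\<phi> \<Gamma>) (\<psi> \<Gamma>) = ftr_id (Fib (Tp N) \<Gamma>)"
    using assms(2) unfolding admits_type_classifier_def sicat_isomorphic_def by blast
  show thesis
    by (rule that[of E \<phi> \<psi>], intro classified_model.intro classified_model_axioms.intro assms(1)) (use a in auto)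
qed

section \<open>Lifting display functors to natural models\<close>

text \<open>An isomorphism of total objects is absorbed into the top arrow. This replaces the image
  of a display under a functor by an isomorphic extension.\<close>

lemma (in category) pullback_square_iso:
  assumes pb: "pullback_square C f (p \<cdot> j) p' q" and j: "is_iso C j" "j \<in> hom C E E'" and p: "p \<in> hom C E' B"
  shows "pullback_square C f p p' (j \<cdot> q)"
proof -
  note d = pullback_squareD[OF pb] and j' = homD[OF j(2)] and p' = homD[OF p]
  have f: "f \<in> hom C (Dom C f) B" and p'h: "p' \<in> hom C (Dom C p') (Dom C f)" and q: "q \<in> hom C (Dom C p') E"
    using d j' p' by (auto simp: hom_def)
  obtain i where i: "i \<in> hom C E' E" "j \<cdot> i = Ident C E'" using is_isoE[OF j] by metis
  show ?thesis
  proof (rule pullback_squareI[OF category_axioms f p p'h comp_hom[OF q j(2)]])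
    show "f \<cdot> p' = p \<cdot> (j \<cdot> q)" using d(9) comp_assoc[OF q j(2) p] by simp
  next
    fix X a b assume a: "a \<in> hom C X (Dom C f)" and b: "b \<in> hom C X E'" and ab: "f \<cdot> a = p \<cdot> b"
    have 1: "j \<cdot> (i \<cdot> b) = b" using comp_assoc[OF b i(1) j(2)] i(2) comp_ident_left[OF b] by simp
    have "(p \<cdot> j) \<cdot> (i \<cdot> b) = p \<cdot> b" using comp_assoc[OF comp_hom[OF b i(1)] j(2) p] 1 by simp
    then obtain h where h: "h \<in> hom C X (Dom C p')" "p' \<cdot> h = a" "q \<cdot> h = i \<cdot> b"
      using pullback_universal[OF pb a, of "i \<cdot> b"] comp_hom[OF b i(1)] homD[OF comp_hom[OF j(2) p]] ab by auto
    then show "\<exists>h \<in> hom C X (Dom C p'). p' \<cdot> h = a \<and> (j \<cdot> q) \<cdot> h = b"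
      using comp_assoc[OF h(1) q j(2)] 1 by (intro bexI[of _ h]) simp_all
  next
    fix X h k assume h: "h \<in> hom C X (Dom C p')" and k: "k \<in> hom C X (Dom C p')"
      and eq: "p' \<cdot> h = p' \<cdot> k" "(j \<cdot> q) \<cdot> h = (j \<cdot> q) \<cdot> k"
    have "q \<cdot> h = q \<cdot> k"
      by (rule iso_cancel_left[OF j(1) j'(1)])
        (use eq(2) homD[OF h] homD[OF k] homD[OF q] j' in simp_all)
    then show "h = k" by (rule pullback_eqI[OF pb h k category_axioms eq(1)])
  qed
qed

section \<open>Codes of types and of terms\<close>

context classified_model
begin

definition code :: "'u \<Rightarrow> 'u \<Rightarrow> 'u" where
  "code \<Gamma> A = (THE x. x \<in> hom N \<Gamma> (E0 E) \<and> tsub N x U = A)"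

lemma code:
  assumes "\<Gamma> \<in> Obj N" "A \<in> Ty N \<Gamma>"
  shows "code \<Gamma> A \<in> hom N \<Gamma> (E0 E)" "tsub N (code \<Gamma> A) U = A"
  using theI'[OF classify_obj_ex1[OF assms]] by (simp_all add: code_def)

lemma code_eqI: "\<lbrakk>x \<in> hom N \<Gamma> (E0 E); tsub N x U = A\<rbrakk> \<Longrightarrow> code \<Gamma> A = x"
  unfolding code_def by (rule the_equality) (metis inverse_obj)+

text \<open>The composite on the right is a code of the reindexed type, and codes are unique. The
  strict naturality of a lifted functor on types comes from this equation.\<close>

lemma code_sub:
  assumes u: "u \<in> hom N \<Delta> \<Gamma>" and A: "A \<in> Ty N \<Gamma>"
  shows "code \<Delta> (tsub N u A) = code \<Gamma> A \<cdot>\<^bsub>N\<^esub> u"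
  using code[OF hom_obj(2)[OF u] A] types.sub_comp(1)[OF u _ U_ty] comp_hom[OF u] by (intro code_eqI) auto

text \<open>A term amounts to an arrow into the object of pointed codes, lying over the code of its
  type.\<close>

definition term_code :: "'u \<Rightarrow> 'u \<Rightarrow> 'u" where
  "term_code \<Gamma> t = tup N (E0 E) U (code \<Gamma> (FO (TmTp N \<Gamma>) t)) t"

lemma term_code:
  assumes "\<Gamma> \<in> Obj N" "t \<in> Tms N \<Gamma> A"
  shows "term_code \<Gamma> t \<in> hom N \<Gamma> (ctxt N (E0 E) U)" "Ext N (E0 E) U \<cdot>\<^bsub>N\<^esub> term_code \<Gamma> t = code \<Gamma> A"
proof -
  note A = Tms_ty[OF assms]
  note c = code[OF assms(1) A]
  show "term_code \<Gamma> t \<in> hom N \<Gamma> (ctxt N (E0 E) U)" "Ext N (E0 E) U \<cdot>\<^bsub>N\<^esub> term_code \<Gamma> t = code \<Gamma> A"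
    using tup[OF U_ty c(1), of t] assms(2) c(2) TmsD(2)[OF assms(2)] by (simp_all add: term_code_def)
qed

lemma term_code_sub:
  assumes u: "u \<in> hom N \<Delta> \<Gamma>" and t: "t \<in> Tms N \<Gamma> A"
  shows "term_code \<Delta> (tmsub N u t) = term_code \<Gamma> t \<cdot>\<^bsub>N\<^esub> u"
proof -
  note \<Gamma> = hom_obj(2)[OF u]
  note A = Tms_ty[OF \<Gamma> t]
  note c = code[OF \<Gamma> A]
  have "t \<in> Tms N \<Gamma> (tsub N (code \<Gamma> A) U)" using t c(2) by simp
  from tup_sub[OF U_ty c(1) this u] show ?thesis
    using code_sub[OF u A] TmsD(2)[OF t] TmsD(2)[OF tms_sub[OF u t]] by (simp add: term_code_def)
qed

end

text \<open>
  Let \<open>U\<close> be the generic type of \<open>M\<close> and \<open>A0\<close> a type of \<open>N\<close> whose display is isomorphic, by \<open>j\<close>, to the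
  image under \<open>K\<close> of the display of \<open>U\<close>.  The type \<open>U[x]\<close> is sent to \<open>A0[K x]\<close>; since the code \<open>x\<close> of a
  type is unique and stable under substitution, this is strictly natural.
\<close>

locale functor_lift = M: classified_model M E \<phi> \<psi> + N: small_natural_model N + K: display_functor M N K
  for M :: "('u, 'x) nm_scheme" and E :: "'u incat" and \<phi> \<psi> :: "'u \<Rightarrow> 'u dftr"
    and N :: "('u, 'y) nm_scheme" and K :: "'u dftr" +
  fixes A0 j :: 'u
  assumes A0: "A0 \<in> Ty N (FO K (E0 E))"
    and j_hom: "j \<in> hom N (FO K (ctxt M (E0 E) M.U)) (ctxt N (FO K (E0 E)) A0)"
    and j_iso: "is_iso N j"
    and j_over: "Ext N (FO K (E0 E)) A0 \<cdot>\<^bsub>N\<^esub> j = FA K (Ext M (E0 E) M.U)"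
begin

text \<open>The variable of \<open>A0\<close> moved along \<open>j\<close> to the image of the
  generic extension. It plays the role of the image of the generic term.\<close>

definition v0 :: 'u where "v0 = tmsub N j (Var N (FO K (E0 E)) A0)"

definition Fty :: "'u \<Rightarrow> 'u \<Rightarrow> 'u" where "Fty \<Gamma> A = tsub N (FA K (M.code \<Gamma> A)) A0"

definition Ftm :: "'u \<Rightarrow> 'u \<Rightarrow> 'u" where "Ftm \<Gamma> t = tmsub N (FA K (M.term_code \<Gamma> t)) v0"

abbreviation "P \<equiv> Ext M (E0 E) M.U"

lemma KE0: "FO K (E0 E) \<in> Obj N"
  using K.obj_map[OF M.int.obj(1)] .

lemma v0_Tms: "v0 \<in> Tms N (FO K (ctxt M (E0 E) M.U)) (tsub N (FA K P) A0)"
  unfolding v0_def using N.var_sub_Tms[OF KE0 A0 j_hom] j_over by simp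

lemma Fty: "\<lbrakk>\<Gamma> \<in> Obj M; A \<in> Ty M \<Gamma>\<rbrakk> \<Longrightarrow> Fty \<Gamma> A \<in> Ty N (FO K \<Gamma>)"
  unfolding Fty_def using N.types.sub_obj[OF K.arr_map[OF M.code(1)] A0] .

lemma Fty_sub: "\<lbrakk>u \<in> hom M \<Delta> \<Gamma>; A \<in> Ty M \<Gamma>\<rbrakk> \<Longrightarrow> Fty \<Delta> (tsub M u A) = tsub N (FA K u) (Fty \<Gamma> A)"
  unfolding Fty_def
  using M.code_sub K.map_comp[OF _ M.code(1)] N.types.sub_comp(1)[OF K.arr_map K.arr_map[OF M.code(1)] A0]
    M.hom_obj(2) by metis

lemma Ftm:
  assumes \<Gamma>: "\<Gamma> \<in> Obj M" and t: "t \<in> Tms M \<Gamma> A"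
  shows "Ftm \<Gamma> t \<in> Tms N (FO K \<Gamma>) (Fty \<Gamma> A)"
proof -
  note c = M.term_code[OF \<Gamma> t]
  show ?thesis
    unfolding Ftm_def Fty_def
    by (rule N.tms_sub'[OF K.arr_map[OF c(1)] v0_Tms])
      (use N.types.sub_comp(1)[OF K.arr_map[OF c(1)] K.arr_map[OF M.P_hom(1)] A0] K.map_comp[OF c(1) M.P_hom(1)] c(2) in simp)
qed

lemma Ftm_sub:
  assumes u: "u \<in> hom M \<Delta> \<Gamma>" and t: "t \<in> Tms M \<Gamma> A"
  shows "Ftm \<Delta> (tmsub M u t) = tmsub N (FA K u) (Ftm \<Gamma> t)"
proof -
  note c = M.term_code(1)[OF M.hom_obj(2)[OF u] t]
  show ?thesis
    unfolding Ftm_def M.term_code_sub[OF u t]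
    using N.terms.sub_comp(1)[OF K.arr_map[OF u] K.arr_map[OF c] N.TmsD(1)[OF v0_Tms]] K.map_comp[OF u c] by simp
qed

text \<open>\<open>K\<close> preserves the square that exhibits the extension by \<open>A\<close> as
  a pullback of the generic one. Moved along \<open>j\<close>, it becomes a pullback of the
  extension by \<open>A0\<close>, and \<open>pullback_ext_iso\<close> applies. The result is both
  the pair used for testing and the comparison isomorphism of the lift.\<close>

lemma Fvar:
  assumes \<Gamma>: "\<Gamma> \<in> Obj M" and A: "A \<in> Ty M \<Gamma>"
  shows "FA K (Ext M \<Gamma> A) \<in> hom N (FO K (ctxt M \<Gamma> A)) (FO K \<Gamma>)"
    and "Ftm (ctxt M \<Gamma> A) (Var M \<Gamma> A) \<in> Tms N (FO K (ctxt M \<Gamma> A)) (tsub N (FA K (Ext M \<Gamma> A)) (Fty \<Gamma> A))"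
    and "is_iso N (tup N (FO K \<Gamma>) (Fty \<Gamma> A) (FA K (Ext M \<Gamma> A)) (Ftm (ctxt M \<Gamma> A) (Var M \<Gamma> A)))"
proof -
  note p = M.ext_hom[OF \<Gamma> A] and v = M.var_Tms[OF \<Gamma> A] and X = M.ctxt_obj[OF \<Gamma> A] and c = M.code[OF \<Gamma> A]
  show "FA K (Ext M \<Gamma> A) \<in> hom N (FO K (ctxt M \<Gamma> A)) (FO K \<Gamma>)" using K.arr_map[OF p] .
  show "Ftm (ctxt M \<Gamma> A) (Var M \<Gamma> A) \<in> Tms N (FO K (ctxt M \<Gamma> A)) (tsub N (FA K (Ext M \<Gamma> A)) (Fty \<Gamma> A))"
    using Ftm[OF X v] Fty_sub[OF p A] by simp
  let ?r = "M.term_code (ctxt M \<Gamma> A) (Var M \<Gamma> A)"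
  have r: "?r = tup M (E0 E) M.U (M.code \<Gamma> A \<cdot>\<^bsub>M\<^esub> Ext M \<Gamma> A) (Var M \<Gamma> A)"
    using M.code_sub[OF p A] M.TmsD(2)[OF v] by (simp add: M.term_code_def)
  have "pullback_square M (M.code \<Gamma> A) P (Ext M \<Gamma> A) ?r"
    unfolding r using M.ext_pullback(4)[OF c(1) M.U_ty] c(2) by simp
  from K.map_pullback[OF M.P0_disp this]
  have "pullback_square N (FA K (M.code \<Gamma> A)) (Ext N (FO K (E0 E)) A0 \<cdot>\<^bsub>N\<^esub> j) (FA K (Ext M \<Gamma> A)) (FA K ?r)"
    by (simp add: j_over)
  from N.pullback_square_iso[OF this j_iso j_hom N.ext_hom[OF KE0 A0]]
  have pb: "pullback_square N (FA K (M.code \<Gamma> A)) (Ext N (FO K (E0 E)) A0) (FA K (Ext M \<Gamma> A)) (j \<cdot>\<^bsub>N\<^esub> FA K ?r)" .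
  have "tmsub N (j \<cdot>\<^bsub>N\<^esub> FA K ?r) (Var N (FO K (E0 E)) A0) = Ftm (ctxt M \<Gamma> A) (Var M \<Gamma> A)"
    using N.terms.sub_comp(1)[OF K.arr_map[OF M.term_code(1)[OF X v]] j_hom N.var_term[OF KE0 A0]]
    by (simp add: Ftm_def v0_def)
  with N.pullback_ext_iso(2)[OF pb KE0 A0 K.arr_map[OF c(1)]]
  show "is_iso N (tup N (FO K \<Gamma>) (Fty \<Gamma> A) (FA K (Ext M \<Gamma> A)) (Ftm (ctxt M \<Gamma> A) (Var M \<Gamma> A)))"
    by (simp add: Fty_def)
qed

text \<open>The image of \<open>f\<close> is forced in the same way as the components of a
  2-morphism: a morphism preserves transport, so it must carry the image of the variable to the
  image of the transported variable.\<close>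

definition lifts :: "'u \<Rightarrow> 'u \<Rightarrow> 'u \<Rightarrow> bool" where
  "lifts \<Gamma> f g \<longleftrightarrow> (let A = Dom (Fib (Tp M) \<Gamma>) f; B = Cod (Fib (Tp M) \<Gamma>) f; X = ctxt M \<Gamma> A in
     g \<in> hom (Fib (Tp N) (FO K \<Gamma>)) (Fty \<Gamma> A) (Fty \<Gamma> B) \<and>
     act N (FO K X) (asub N (FA K (Ext M \<Gamma> A)) g) (Ftm X (Var M \<Gamma> A))
       = Ftm X (act M X (asub M (Ext M \<Gamma> A) f) (Var M \<Gamma> A)))"

lemma lifts_iff:
  assumes "f \<in> hom (Fib (Tp M) \<Gamma>) A B"
  shows "lifts \<Gamma> f g \<longleftrightarrow> g \<in> hom (Fib (Tp N) (FO K \<Gamma>)) (Fty \<Gamma> A) (Fty \<Gamma> B) \<and>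
     act N (FO K (ctxt M \<Gamma> A)) (asub N (FA K (Ext M \<Gamma> A)) g) (Ftm (ctxt M \<Gamma> A) (Var M \<Gamma> A))
       = Ftm (ctxt M \<Gamma> A) (act M (ctxt M \<Gamma> A) (asub M (Ext M \<Gamma> A) f) (Var M \<Gamma> A))"
  using homD[OF assms] by (simp add: lifts_def Let_def)

lemma ty_dom_cod:
  assumes "\<Gamma> \<in> Obj M" "f \<in> hom (Fib (Tp M) \<Gamma>) A B"
  shows "A \<in> Ty M \<Gamma>" "B \<in> Ty M \<Gamma>"
  using category.hom_obj[OF M.types.fib_category[OF assms(1)] assms(2)] .

lemma lifts_unique:
  assumes \<Gamma>: "\<Gamma> \<in> Obj M" and f: "f \<in> hom (Fib (Tp M) \<Gamma>) A B" and g: "lifts \<Gamma> f g" "lifts \<Gamma> f g'"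
  shows "g = g'"
proof -
  note A = ty_dom_cod(1)[OF \<Gamma> f]
  note a = g(1)[unfolded lifts_iff[OF f]] and b = g(2)[unfolded lifts_iff[OF f]]
  show ?thesis
    by (rule N.test_inj[OF K.obj_map[OF \<Gamma>] a[THEN conjunct1] b[THEN conjunct1] Fvar[OF \<Gamma> A]])
      (use a b in simp)
qed

definition Far :: "'u \<Rightarrow> 'u \<Rightarrow> 'u" where "Far \<Gamma> f = (SOME g. lifts \<Gamma> f g)"

lemma Far:
  assumes \<Gamma>: "\<Gamma> \<in> Obj M" and f: "f \<in> hom (Fib (Tp M) \<Gamma>) A B"
  shows "lifts \<Gamma> f (Far \<Gamma> f)" "Far \<Gamma> f \<in> hom (Fib (Tp N) (FO K \<Gamma>)) (Fty \<Gamma> A) (Fty \<Gamma> B)"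
proof -
  note AB = ty_dom_cod[OF \<Gamma> f]
  note p = M.ext_hom[OF \<Gamma> AB(1)] and X = M.ctxt_obj[OF \<Gamma> AB(1)]
  have b: "Ftm (ctxt M \<Gamma> A) (act M (ctxt M \<Gamma> A) (asub M (Ext M \<Gamma> A) f) (Var M \<Gamma> A))
      \<in> Tms N (FO K (ctxt M \<Gamma> A)) (tsub N (FA K (Ext M \<Gamma> A)) (Fty \<Gamma> B))"
    using Ftm[OF X M.gen_Tms[OF \<Gamma> f]] Fty_sub[OF p AB(2)] by simp
  obtain g where "g \<in> hom (Fib (Tp N) (FO K \<Gamma>)) (Fty \<Gamma> A) (Fty \<Gamma> B)"
    "act N (FO K (ctxt M \<Gamma> A)) (asub N (FA K (Ext M \<Gamma> A)) g) (Ftm (ctxt M \<Gamma> A) (Var M \<Gamma> A))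
      = Ftm (ctxt M \<Gamma> A) (act M (ctxt M \<Gamma> A) (asub M (Ext M \<Gamma> A) f) (Var M \<Gamma> A))"
    by (rule N.test_surj[OF K.obj_map[OF \<Gamma>] Fty[OF \<Gamma> AB(1)] Fty[OF \<Gamma> AB(2)] Fvar[OF \<Gamma> AB(1)] b])
  then have "lifts \<Gamma> f g" by (simp add: lifts_iff[OF f])
  then show "lifts \<Gamma> f (Far \<Gamma> f)" unfolding Far_def by (rule someI)
  then show "Far \<Gamma> f \<in> hom (Fib (Tp N) (FO K \<Gamma>)) (Fty \<Gamma> A) (Fty \<Gamma> B)" by (simp add: lifts_iff[OF f])
qed

lemma Far_eqI: "\<lbrakk>\<Gamma> \<in> Obj M; f \<in> hom (Fib (Tp M) \<Gamma>) A B; lifts \<Gamma> f g\<rbrakk> \<Longrightarrow> Far \<Gamma> f = g"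
  using lifts_unique Far(1) by blast

text \<open>The condition passes from the variable to all terms by restriction along
  \<open>w\<close>. The laws for \<open>Far\<close> use it at transported variables and at variables
  of reindexed types.\<close>

lemma Far_act:
  assumes u: "u \<in> hom M \<Delta> \<Gamma>" and f: "f \<in> hom (Fib (Tp M) \<Gamma>) A B" and t: "t \<in> Tms M \<Delta> (tsub M u A)"
  shows "act N (FO K \<Delta>) (asub N (FA K u) (Far \<Gamma> f)) (Ftm \<Delta> t) = Ftm \<Delta> (act M \<Delta> (asub M u f) t)"
proof -
  note \<Gamma> = M.hom_obj(2)[OF u]
  note A = ty_dom_cod(1)[OF \<Gamma> f]
  note F = Far[OF \<Gamma> f]
  define w where "w = tup M \<Gamma> A u t"
  note w = M.tup[OF A u t, folded w_def]
  note p = M.ext_hom[OF \<Gamma> A] and v = M.var_Tms[OF \<Gamma> A] and X = M.ctxt_obj[OF \<Gamma> A]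
  have "act N (FO K \<Delta>) (asub N (FA K u) (Far \<Gamma> f)) (Ftm \<Delta> t)
    = act N (FO K \<Delta>) (asub N (FA K w) (asub N (FA K (Ext M \<Gamma> A)) (Far \<Gamma> f))) (tmsub N (FA K w) (Ftm (ctxt M \<Gamma> A) (Var M \<Gamma> A)))"
    using N.types.sub_comp(2)[OF K.arr_map[OF w(1)] K.arr_map[OF p] F(2)] K.map_comp[OF w(1) p] w(2,3) Ftm_sub[OF w(1) v] by simp
  also have "\<dots> = tmsub N (FA K w) (Ftm (ctxt M \<Gamma> A) (act M (ctxt M \<Gamma> A) (asub M (Ext M \<Gamma> A) f) (Var M \<Gamma> A)))"
    using N.act_sub[OF K.arr_map[OF w(1)] N.types.sub_hom[OF Fvar(1)[OF \<Gamma> A] F(2)] Fvar(2)[OF \<Gamma> A]] F(1)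
    by (simp add: lifts_iff[OF f])
  also have "\<dots> = Ftm \<Delta> (act M \<Delta> (asub M u f) t)"
    using Ftm_sub[OF w(1) M.gen_Tms[OF \<Gamma> f]] M.act_gen[OF u f w] by simp
  finally show ?thesis .
qed

lemma Far_act_id:
  assumes \<Gamma>: "\<Gamma> \<in> Obj M" and f: "f \<in> hom (Fib (Tp M) \<Gamma>) A B" and t: "t \<in> Tms M \<Gamma> A"
  shows "act N (FO K \<Gamma>) (Far \<Gamma> f) (Ftm \<Gamma> t) = Ftm \<Gamma> (act M \<Gamma> f t)"
  using Far_act[OF M.ident_hom[OF \<Gamma>] f] t M.types.sub_id[OF \<Gamma>] f ty_dom_cod(1)[OF \<Gamma> f]
    N.types.sub_id(2)[OF K.obj_map[OF \<Gamma>] Far(2)[OF \<Gamma> f]] \<Gamma> by simp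

text \<open>As with the other laws for \<open>Far\<close>, the right-hand side satisfies the
  condition that determines the left-hand side.\<close>

lemma Far_ident:
  assumes \<Gamma>: "\<Gamma> \<in> Obj M" and A: "A \<in> Ty M \<Gamma>"
  shows "Far \<Gamma> (Ident (Fib (Tp M) \<Gamma>) A) = Ident (Fib (Tp N) (FO K \<Gamma>)) (Fty \<Gamma> A)"
proof -
  note i = category.ident_hom[OF M.types.fib_category[OF \<Gamma>] A]
  note i' = category.ident_hom[OF N.types.fib_category[OF K.obj_map[OF \<Gamma>]] Fty[OF \<Gamma> A]]
  note X = M.ctxt_obj[OF \<Gamma> A]
  show ?thesis
    by (rule Far_eqI[OF \<Gamma> i])
      (use i' N.types.sub_ident[OF Fvar(1)[OF \<Gamma> A] Fty[OF \<Gamma> A]] N.act_ident[OF K.obj_map[OF X] Fvar(2)[OF \<Gamma> A]]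
        M.types.sub_ident[OF M.ext_hom[OF \<Gamma> A] A] M.act_ident[OF X M.var_Tms[OF \<Gamma> A]] in \<open>simp add: lifts_iff[OF i]\<close>)
qed

lemma Far_comp:
  assumes \<Gamma>: "\<Gamma> \<in> Obj M" and f: "f \<in> hom (Fib (Tp M) \<Gamma>) A B" and g: "g \<in> hom (Fib (Tp M) \<Gamma>) B D"
  shows "Far \<Gamma> (g \<cdot>\<^bsub>Fib (Tp M) \<Gamma>\<^esub> f) = Far \<Gamma> g \<cdot>\<^bsub>Fib (Tp N) (FO K \<Gamma>)\<^esub> Far \<Gamma> f"
proof -
  note A = ty_dom_cod(1)[OF \<Gamma> f]
  note p = M.ext_hom[OF \<Gamma> A] and v = M.var_Tms[OF \<Gamma> A] and X = M.ctxt_obj[OF \<Gamma> A] and q = Fvar(1)[OF \<Gamma> A]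
  note Ff = Far[OF \<Gamma> f] and Fg = Far[OF \<Gamma> g]
  note gf = category.comp_hom[OF M.types.fib_category[OF \<Gamma>] f g]
  note pf = M.types.sub_hom[OF p f] and pg = M.types.sub_hom[OF p g]
  show ?thesis
    by (rule Far_eqI[OF \<Gamma> gf])
      (use category.comp_hom[OF N.types.fib_category[OF K.obj_map[OF \<Gamma>]] Ff(2) Fg(2)]
        N.types.sub_fcomp[OF q Ff(2) Fg(2)] N.act_comp[OF K.obj_map[OF X] N.types.sub_hom[OF q Ff(2)] N.types.sub_hom[OF q Fg(2)] Fvar(2)[OF \<Gamma> A]]
        Ff(1)[unfolded lifts_iff[OF f]] Far_act[OF p g M.act_Tms[OF X pf v]]
        M.types.sub_fcomp[OF p f g] M.act_comp[OF X pf pg v] in \<open>simp add: lifts_iff[OF gf]\<close>)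
qed

lemma Far_sub:
  assumes u: "u \<in> hom M \<Delta> \<Gamma>" and f: "f \<in> hom (Fib (Tp M) \<Gamma>) A B"
  shows "Far \<Delta> (asub M u f) = asub N (FA K u) (Far \<Gamma> f)"
proof -
  note \<Gamma> = M.hom_obj(2)[OF u] and \<Delta> = M.hom_obj(1)[OF u]
  note AB = ty_dom_cod[OF \<Gamma> f]
  note uf = M.types.sub_hom[OF u f]
  note Au = M.types.sub_obj[OF u AB(1)]
  note p = M.ext_hom[OF \<Delta> Au]
  note F = Far[OF \<Gamma> f]
  have v: "Var M \<Delta> (tsub M u A) \<in> Tms M (ctxt M \<Delta> (tsub M u A)) (tsub M (u \<cdot>\<^bsub>M\<^esub> Ext M \<Delta> (tsub M u A)) A)"
    using M.var_Tms[OF \<Delta> Au] M.types.sub_comp(1)[OF p u AB(1)] by simp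
  show ?thesis
    by (rule Far_eqI[OF \<Delta> uf])
      (use N.types.sub_hom[OF K.arr_map[OF u] F(2)] Fty_sub[OF u AB(1)] Fty_sub[OF u AB(2)]
        N.types.sub_comp(2)[OF K.arr_map[OF p] K.arr_map[OF u] F(2)] K.map_comp[OF p u]
        Far_act[OF M.comp_hom[OF p u] f v] M.types.sub_comp(2)[OF p u f] in \<open>simp add: lifts_iff[OF uf]\<close>)
qed

text \<open>An arrow of terms must go to an arrow that starts at the image of its source and lies
  over the image of its underlying arrow of types, hence to this lift.\<close>

definition Ftm_arr :: "'u \<Rightarrow> 'u \<Rightarrow> 'u" where
  "Ftm_arr \<Gamma> g = opfib_lift (Fib (Tm N) (FO K \<Gamma>)) (TmTp N (FO K \<Gamma>)) (Ftm \<Gamma> (Dom (Fib (Tm M) \<Gamma>) g))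
     (Far \<Gamma> (FA (TmTp M \<Gamma>) g))"

text \<open>That the lift ends at the image of \<open>t\<close> is preservation of transport at
  arbitrary terms, \<open>Far_act_id\<close>.\<close>

lemma Ftm_arr:
  assumes \<Gamma>: "\<Gamma> \<in> Obj M" and g: "g \<in> hom (Fib (Tm M) \<Gamma>) s t"
  shows "Ftm_arr \<Gamma> g \<in> hom (Fib (Tm N) (FO K \<Gamma>)) (Ftm \<Gamma> s) (Ftm \<Gamma> t)"
    and "FA (TmTp N (FO K \<Gamma>)) (Ftm_arr \<Gamma> g) = Far \<Gamma> (FA (TmTp M \<Gamma>) g)"
proof -
  note f = M.typing.map_hom[OF \<Gamma> g]
  have s: "s \<in> Tms M \<Gamma> (FO (TmTp M \<Gamma>) s)"
    using category.hom_obj(1)[OF M.terms.fib_category[OF \<Gamma>] g] by (simp add: Tms_def)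
  note l = N.lift[OF K.obj_map[OF \<Gamma>] Far(2)[OF \<Gamma> f] Ftm[OF \<Gamma> s]]
  show "Ftm_arr \<Gamma> g \<in> hom (Fib (Tm N) (FO K \<Gamma>)) (Ftm \<Gamma> s) (Ftm \<Gamma> t)"
    "FA (TmTp N (FO K \<Gamma>)) (Ftm_arr \<Gamma> g) = Far \<Gamma> (FA (TmTp M \<Gamma>) g)"
    using l Far_act_id[OF \<Gamma> f s] M.act_eqI[OF \<Gamma> g refl] homD(2)[OF g] by (simp_all add: Ftm_arr_def)
qed

definition lifted :: "'u nmor" where
  "lifted = ftr.extend K \<lparr>
     TpF = (\<lambda>\<Gamma> \<in> Obj M. \<lparr>FO = (\<lambda>A \<in> Ty M \<Gamma>. Fty \<Gamma> A), FA = (\<lambda>f \<in> Arr (Fib (Tp M) \<Gamma>). Far \<Gamma> f)\<rparr>),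
     TmF = (\<lambda>\<Gamma> \<in> Obj M. \<lparr>FO = (\<lambda>t \<in> Obj (Fib (Tm M) \<Gamma>). Ftm \<Gamma> t), FA = (\<lambda>g \<in> Arr (Fib (Tm M) \<Gamma>). Ftm_arr \<Gamma> g)\<rparr>)\<rparr>"

lemma lifted_simps [simp]:
  "FO lifted = FO K" "FA lifted = FA K" "ftr.truncate lifted = K"
  "TpF lifted = (\<lambda>\<Gamma> \<in> Obj M. \<lparr>FO = (\<lambda>A \<in> Ty M \<Gamma>. Fty \<Gamma> A), FA = (\<lambda>f \<in> Arr (Fib (Tp M) \<Gamma>). Far \<Gamma> f)\<rparr>)"
  "TmF lifted = (\<lambda>\<Gamma> \<in> Obj M. \<lparr>FO = (\<lambda>t \<in> Obj (Fib (Tm M) \<Gamma>). Ftm \<Gamma> t), FA = (\<lambda>g \<in> Arr (Fib (Tm M) \<Gamma>). Ftm_arr \<Gamma> g)\<rparr>)"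
  by (simp_all add: lifted_def ftr.defs)

lemma base_changed:
  "strict_indexed_category M (base_change lifted (Tp N))" "strict_indexed_category M (base_change lifted (Tm N))"
proof -
  have "is_functor M N lifted" using K.is_functor_axioms is_functor_cong[of lifted K M N] by simp
  then show "strict_indexed_category M (base_change lifted (Tp N))" "strict_indexed_category M (base_change lifted (Tm N))"
    using strict_indexed_category_base_change N.types.strict_indexed_category_axioms
      N.terms.strict_indexed_category_axioms by blast+
qed

lemma lifted_types: "strict_indexed_functor M (Tp M) (base_change lifted (Tp N)) (TpF lifted)"
proof (intro strict_indexed_functor.intro strict_indexed_functor_axioms.intro
    M.types.strict_indexed_category_axioms base_changed)
  show "TpF lifted \<in> extensional (Obj M)" by simp
next
  fix \<Gamma> assume \<Gamma>: "\<Gamma> \<in> Obj M"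
  interpret S: category "Fib (Tp M) \<Gamma>" by (rule M.types.fib_category[OF \<Gamma>])
  have G: "FO (TpF lifted \<Gamma>) = (\<lambda>A \<in> Ty M \<Gamma>. Fty \<Gamma> A)"
    "FA (TpF lifted \<Gamma>) = (\<lambda>f \<in> Arr (Fib (Tp M) \<Gamma>). Far \<Gamma> f)" using \<Gamma> by simp_all
  show "is_functor (Fib (Tp M) \<Gamma>) (Fib (base_change lifted (Tp N)) \<Gamma>) (TpF lifted \<Gamma>)"
    unfolding base_change_simps lifted_simps(1,2)
  proof (intro is_functor.intro is_functor_axioms.intro S.category_axioms N.types.fib_category K.obj_map \<Gamma>)
    fix A assume "A \<in> Ty M \<Gamma>"
    then show "FO (TpF lifted \<Gamma>) A \<in> Ty N (FO K \<Gamma>)"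
      "FA (TpF lifted \<Gamma>) (Ident (Fib (Tp M) \<Gamma>) A) = Ident (Fib (Tp N) (FO K \<Gamma>)) (FO (TpF lifted \<Gamma>) A)"
      using Fty[OF \<Gamma>] Far_ident[OF \<Gamma>] by (simp_all add: G \<Gamma>)
  next
    fix f A B assume f: "f \<in> hom (Fib (Tp M) \<Gamma>) A B"
    show "FA (TpF lifted \<Gamma>) f \<in> hom (Fib (Tp N) (FO K \<Gamma>)) (FO (TpF lifted \<Gamma>) A) (FO (TpF lifted \<Gamma>) B)"
      using Far(2)[OF \<Gamma> f] homD(1)[OF f] ty_dom_cod[OF \<Gamma> f] by (simp add: G \<Gamma>)
    fix g D assume g: "g \<in> hom (Fib (Tp M) \<Gamma>) B D"
    show "FA (TpF lifted \<Gamma>) (g \<cdot>\<^bsub>Fib (Tp M) \<Gamma>\<^esub> f)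
        = FA (TpF lifted \<Gamma>) g \<cdot>\<^bsub>Fib (Tp N) (FO K \<Gamma>)\<^esub> FA (TpF lifted \<Gamma>) f"
      using Far_comp[OF \<Gamma> f g] homD(1)[OF f] homD(1)[OF g] homD(1)[OF S.comp_hom[OF f g]] by (simp add: G \<Gamma>)
  qed (simp_all add: G \<Gamma>)
next
  fix u \<Delta> \<Gamma> assume u: "u \<in> hom M \<Delta> \<Gamma>"
  note o = M.hom_obj[OF u]
  interpret R: is_functor "Fib (Tp M) \<Gamma>" "Fib (Tp M) \<Delta>" "Reix (Tp M) u" by (rule M.types.reix_functor[OF u])
  show "ftr_comp (Fib (Tp M) \<Gamma>) (Reix (base_change lifted (Tp N)) u) (TpF lifted \<Gamma>)
      = ftr_comp (Fib (Tp M) \<Gamma>) (TpF lifted \<Delta>) (Reix (Tp M) u)"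
    by (rule ftr_eqI[where A="Ty M \<Gamma>" and B="Arr (Fib (Tp M) \<Gamma>)"])
      (use o Fty_sub[OF u] Far_sub[OF u homI[OF _ refl refl]] in simp_all)
qed

text \<open>Equations between arrows of terms are checked after applying typing, where they are the
  laws for \<open>Far\<close>.\<close>

lemma lifted_terms: "strict_indexed_functor M (Tm M) (base_change lifted (Tm N)) (TmF lifted)"
proof (intro strict_indexed_functor.intro strict_indexed_functor_axioms.intro
    M.terms.strict_indexed_category_axioms base_changed)
  show "TmF lifted \<in> extensional (Obj M)" by simp
next
  fix \<Gamma> assume \<Gamma>: "\<Gamma> \<in> Obj M"
  interpret S: category "Fib (Tm M) \<Gamma>" by (rule M.terms.fib_category[OF \<Gamma>])
  interpret T: category "Fib (Tm N) (FO K \<Gamma>)" by (rule N.terms.fib_category[OF K.obj_map[OF \<Gamma>]])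
  note K\<Gamma> = K.obj_map[OF \<Gamma>]
  have G: "FO (TmF lifted \<Gamma>) = (\<lambda>t \<in> Obj (Fib (Tm M) \<Gamma>). Ftm \<Gamma> t)"
    "FA (TmF lifted \<Gamma>) = (\<lambda>g \<in> Arr (Fib (Tm M) \<Gamma>). Ftm_arr \<Gamma> g)" using \<Gamma> by simp_all
  have t: "Ftm \<Gamma> t \<in> Obj (Fib (Tm N) (FO K \<Gamma>))" "FO (TmTp N (FO K \<Gamma>)) (Ftm \<Gamma> t) = Fty \<Gamma> (FO (TmTp M \<Gamma>) t)"
    if "t \<in> Obj (Fib (Tm M) \<Gamma>)" for t
    using Ftm[OF \<Gamma>, of t "FO (TmTp M \<Gamma>) t"] that by (simp_all add: Tms_def)
  show "is_functor (Fib (Tm M) \<Gamma>) (Fib (base_change lifted (Tm N)) \<Gamma>) (TmF lifted \<Gamma>)"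
    unfolding base_change_simps lifted_simps(1,2)
  proof (intro is_functor.intro is_functor_axioms.intro S.category_axioms T.category_axioms)
    fix a assume a: "a \<in> Obj (Fib (Tm M) \<Gamma>)"
    show "FO (TmF lifted \<Gamma>) a \<in> Obj (Fib (Tm N) (FO K \<Gamma>))" using t(1)[OF a] a by (simp add: G \<Gamma>)
    have "Ftm_arr \<Gamma> (Ident (Fib (Tm M) \<Gamma>) a) = Ident (Fib (Tm N) (FO K \<Gamma>)) (Ftm \<Gamma> a)"
      by (rule N.term_arr_eqI[OF K\<Gamma> Ftm_arr(1)[OF \<Gamma> S.ident_hom[OF a]] T.ident_hom[OF t(1)[OF a]]])
        (simp add: Ftm_arr(2)[OF \<Gamma> S.ident_hom[OF a]] M.typing.map_id[OF \<Gamma> a] Far_ident[OF \<Gamma> M.typing.map_obj[OF \<Gamma> a]]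
          N.typing.map_id[OF K\<Gamma> t(1)[OF a]] t(2)[OF a])
    then show "FA (TmF lifted \<Gamma>) (Ident (Fib (Tm M) \<Gamma>) a) = Ident (Fib (Tm N) (FO K \<Gamma>)) (FO (TmF lifted \<Gamma>) a)"
      using a by (simp add: G \<Gamma>)
  next
    fix f a b assume f: "f \<in> hom (Fib (Tm M) \<Gamma>) a b"
    show "FA (TmF lifted \<Gamma>) f \<in> hom (Fib (Tm N) (FO K \<Gamma>)) (FO (TmF lifted \<Gamma>) a) (FO (TmF lifted \<Gamma>) b)"
      using Ftm_arr(1)[OF \<Gamma> f] homD(1)[OF f] S.hom_obj[OF f] by (simp add: G \<Gamma>)
    fix g c assume g: "g \<in> hom (Fib (Tm M) \<Gamma>) b c"
    note Ff = Ftm_arr[OF \<Gamma> f] and Fg = Ftm_arr[OF \<Gamma> g]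
    have "Ftm_arr \<Gamma> (g \<cdot>\<^bsub>Fib (Tm M) \<Gamma>\<^esub> f) = Ftm_arr \<Gamma> g \<cdot>\<^bsub>Fib (Tm N) (FO K \<Gamma>)\<^esub> Ftm_arr \<Gamma> f"
      by (rule N.term_arr_eqI[OF K\<Gamma> Ftm_arr(1)[OF \<Gamma> S.comp_hom[OF f g]] T.comp_hom[OF Ff(1) Fg(1)]])
        (simp add: Ftm_arr(2)[OF \<Gamma> S.comp_hom[OF f g]] M.typing.map_fcomp[OF \<Gamma> f g]
          Far_comp[OF \<Gamma> M.typing.map_hom[OF \<Gamma> f] M.typing.map_hom[OF \<Gamma> g]] N.typing.map_fcomp[OF K\<Gamma> Ff(1) Fg(1)] Ff(2) Fg(2))
    then show "FA (TmF lifted \<Gamma>) (g \<cdot>\<^bsub>Fib (Tm M) \<Gamma>\<^esub> f)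
        = FA (TmF lifted \<Gamma>) g \<cdot>\<^bsub>Fib (Tm N) (FO K \<Gamma>)\<^esub> FA (TmF lifted \<Gamma>) f"
      using homD(1)[OF f] homD(1)[OF g] homD(1)[OF S.comp_hom[OF f g]] by (simp add: G \<Gamma>)
  qed (simp_all add: G \<Gamma>)
next
  fix u \<Delta> \<Gamma> assume u: "u \<in> hom M \<Delta> \<Gamma>"
  note o = M.hom_obj[OF u]
  interpret R: is_functor "Fib (Tm M) \<Gamma>" "Fib (Tm M) \<Delta>" "Reix (Tm M) u" by (rule M.terms.reix_functor[OF u])
  have t: "Ftm \<Delta> (tmsub M u t) = tmsub N (FA K u) (Ftm \<Gamma> t)" if "t \<in> Obj (Fib (Tm M) \<Gamma>)" for t
    using Ftm_sub[OF u, of t "FO (TmTp M \<Gamma>) t"] that by (simp add: Tms_def)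
  have g: "Ftm_arr \<Delta> (FA (Reix (Tm M) u) g) = FA (Reix (Tm N) (FA K u)) (Ftm_arr \<Gamma> g)" if g: "g \<in> Arr (Fib (Tm M) \<Gamma>)" for g
  proof -
    have g': "g \<in> hom (Fib (Tm M) \<Gamma>) (Dom (Fib (Tm M) \<Gamma>) g) (Cod (Fib (Tm M) \<Gamma>) g)" using g by (simp add: hom_def)
    note Fg = Ftm_arr[OF o(2) g'] and gu = M.terms.sub_hom[OF u g']
    note Fgu = Ftm_arr[OF o(1) gu]
    have d: "Dom (Fib (Tm M) \<Gamma>) g \<in> Obj (Fib (Tm M) \<Gamma>)" using g by simp
    show ?thesis
    proof (rule N.term_arr_eqI[OF K.obj_map[OF o(1)] Fgu(1)])
      show "FA (Reix (Tm N) (FA K u)) (Ftm_arr \<Gamma> g) \<in> hom (Fib (Tm N) (FO K \<Delta>)) (Ftm \<Delta> (tmsub M u (Dom (Fib (Tm M) \<Gamma>) g)))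
          (tmsub N (FA K u) (Ftm \<Gamma> (Cod (Fib (Tm M) \<Gamma>) g)))"
        using N.terms.sub_hom[OF K.arr_map[OF u] Fg(1)] t[OF d] by simp
      show "FA (TmTp N (FO K \<Delta>)) (Ftm_arr \<Delta> (FA (Reix (Tm M) u) g))
          = FA (TmTp N (FO K \<Delta>)) (FA (Reix (Tm N) (FA K u)) (Ftm_arr \<Gamma> g))"
        using Fgu(2) Fg(2) M.typing.map_sub(2)[OF u g] N.typing.map_sub(2)[OF K.arr_map[OF u] homD(1)[OF Fg(1)]]
          Far_sub[OF u M.typing.map_hom[OF o(2) g']] by simp
    qed
  qed
  show "ftr_comp (Fib (Tm M) \<Gamma>) (Reix (base_change lifted (Tm N)) u) (TmF lifted \<Gamma>)
      = ftr_comp (Fib (Tm M) \<Gamma>) (TmF lifted \<Delta>) (Reix (Tm M) u)"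
    by (rule ftr_eqI[where A="Obj (Fib (Tm M) \<Gamma>)" and B="Arr (Fib (Tm M) \<Gamma>)"]) (use o t g in simp_all)
qed

lemma lifted_morphism: "nm_morphism M N lifted"
proof (intro nm_morphism.intro nm_morphism_axioms.intro M.small_natural_model_axioms N.small_natural_model_axioms
    lifted_types lifted_terms)
  show "display_functor M N lifted" using K.display_functor_axioms display_functor_cong[of lifted K M N] by simp
next
  fix \<Gamma> assume \<Gamma>: "\<Gamma> \<in> Obj M"
  interpret S: is_functor "Fib (Tm M) \<Gamma>" "Fib (Tp M) \<Gamma>" "TmTp M \<Gamma>" by (rule M.typing.fib_functor[OF \<Gamma>])
  have t: "FO (TmTp N (FO K \<Gamma>)) (Ftm \<Gamma> t) = Fty \<Gamma> (FO (TmTp M \<Gamma>) t)"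
    if "t \<in> Obj (Fib (Tm M) \<Gamma>)" for t
    using Ftm[OF \<Gamma>, of t "FO (TmTp M \<Gamma>) t"] that by (simp add: Tms_def)
  show "ftr_comp (Fib (Tm M) \<Gamma>) (TmTp N (FO lifted \<Gamma>)) (TmF lifted \<Gamma>)
      = ftr_comp (Fib (Tm M) \<Gamma>) (TpF lifted \<Gamma>) (TmTp M \<Gamma>)"
    by (rule ftr_eqI[where A="Obj (Fib (Tm M) \<Gamma>)" and B="Arr (Fib (Tm M) \<Gamma>)"])
      (use \<Gamma> t Ftm_arr(2)[OF \<Gamma> homI[OF _ refl refl]] in simp_all)
  fix A assume A: "A \<in> Ty M \<Gamma>"
  show "is_iso N (ext_compare M N lifted \<Gamma> A)"
    using Fvar(3)[OF \<Gamma> A] homD[OF Fvar(1)[OF \<Gamma> A]] \<Gamma> A M.ctxt_obj[OF \<Gamma> A] M.var_term[OF \<Gamma> A]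
    by (simp add: ext_compare_tup)
qed

end

lemma display_functor_lift:
  fixes K :: "'u dftr" and M N :: "'u nm"
  assumes M: "small_natural_model M" "admits_type_classifier M" and N: "small_natural_model N"
    and K: "display_functor M N K"
  obtains F :: "'u nmor" where "nm_morphism M N F" "ftr.truncate F = K"
proof -
  obtain E \<phi> \<psi> where "classified_model M E \<phi> \<psi>" by (rule admits_type_classifierE[OF M])
  then interpret M: classified_model M E \<phi> \<psi> .
  interpret N: small_natural_model N by fact
  interpret K: display_functor M N K by fact
  note E = K.obj_map[OF M.int.obj(1)]
  \<comment> \<open>The image of the generic display lies over \<open>FO K (E0 E)\<close>, and there
    essential surjectivity of comprehension supplies an isomorphic extension. This is the only type
    that is chosen.\<close>
  have "FA K M.P0 \<in> Obj (disp_fibre N (FO K (E0 E)))"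
    using K.map_disp[OF M.P0_disp] homD(3)[OF K.arr_map[OF M.P_hom(1)]] by (simp add: disp_fibre_def)
  then obtain A0 where A0: "A0 \<in> Ty N (FO K (E0 E))"
    "isomorphic (disp_fibre N (FO K (E0 E))) (Ext N (FO K (E0 E)) A0) (FA K M.P0)"
    using is_equivalenceD(4)[OF N.comprehension_equivalence[OF E]] by (auto simp: comprehension_def)
  then obtain i where i: "i \<in> hom N (ctxt N (FO K (E0 E)) A0) (Dom N (FA K M.P0))" "is_iso N i"
    "FA K M.P0 \<cdot>\<^bsub>N\<^esub> i = Ext N (FO K (E0 E)) A0" unfolding N.disp_fibre_isomorphic by blast
  note P = K.arr_map[OF M.P_hom(1)]
  obtain j where j: "j \<in> hom N (Dom N (FA K M.P0)) (ctxt N (FO K (E0 E)) A0)" "is_iso N j"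
    "i \<cdot>\<^bsub>N\<^esub> j = Ident N (Dom N (FA K M.P0))" using N.is_isoE[OF i(2,1)] by metis
  have "Ext N (FO K (E0 E)) A0 \<cdot>\<^bsub>N\<^esub> j = FA K M.P0"
    using N.comp_assoc[OF j(1) i(1), of "FA K M.P0" "FO K (E0 E)"] P i(3) j(3) homD[OF P] N.comp_ident_right[OF P]
    by (simp add: hom_def)
  then interpret functor_lift M E \<phi> \<psi> N K A0 j
    using A0(1) j(1,2) homD(2)[OF P] by unfold_locales simp_all
  show thesis using that lifted_morphism lifted_simps(3) by blast
qed

lemma (in category) isomorphic_refl: "A \<in> Obj C \<Longrightarrow> isomorphic C A A"
  unfolding isomorphic_def using ident_hom ident_iso by blast

theorem theorem3p2p13:
  "two_equivalence
     (NM_U :: ('u nm, 'u nmor, 'u ncell) two_cat)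
     (DC_U :: ('u dcat, 'u dftr, 'u dtrans) two_cat)
     forgetful"
proof (intro two_equivalence.intro two_equivalence_axioms.intro forgetful_strict_2_functor)
  fix N :: "'u nm" assume "small_natural_model N" "admits_type_classifier N"
  then show "admits_universe (dcat.truncate N)"
    using admits_type_classifierE classified_model.admits_universe by metis
next
  fix D :: "'u dcat" assume "D \<in> TObj DC_U"
  then have D: "display_category D" "small_cat D" "admits_universe D" by (simp_all add: DC_U_TObj)
  obtain N :: "'u nm" where N: "small_natural_model N" "admits_type_classifier N" "dcat.truncate N = D"
    by (rule universe_natural_model[OF D])
  interpret D: display_category D by (rule D(1))
  note i = display_functor_ident[OF D(1)]
  \<comment> \<open>The model lies over \<open>D\<close> exactly, so the identity functor witnesses
    the equivalence.\<close>
  have "isomorphic (DC_hom D D) (ftr_comp D (ftr_id D) (ftr_id D)) (ftr_id D)"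
    using category.isomorphic_refl[OF DC_hom_category[OF D(1,1)], of "ftr_id D"] i
      ftr_comp_ident_right[OF is_functor_ident[OF D.category_axioms]] by simp
  then have "equivalent_in DC_U D D"
    using i by (auto simp: equivalent_in_def intro!: bexI[of _ "ftr_id D"])
  with N show "\<exists>A \<in> TObj NM_U. equivalent_in DC_U (T0 forgetful A) D"
    by (intro bexI[of _ N]) (simp_all add: NM_U_TObj)
next
  fix A B :: "'u nm" and k :: "'u dftr"
  assume "A \<in> TObj NM_U" "B \<in> TObj NM_U" and "k \<in> Obj (THom DC_U (T0 forgetful A) (T0 forgetful B))"
  then have AB: "small_natural_model A" "admits_type_classifier A" "small_natural_model B"
    and k': "display_functor (dcat.truncate A) (dcat.truncate B) k" by (simp_all add: NM_U_TObj)
  have "ftr.truncate k = k" by (simp add: ftr.truncate_def)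
  with k' have "display_functor A B k" using display_functor_truncate[of A B k] by metis
  then obtain F :: "'u nmor" where F: "nm_morphism A B F" "ftr.truncate F = k"
    by (rule display_functor_lift[OF AB])
  \<comment> \<open>The morphism lies over \<open>k\<close> exactly, so an identity transformation
    suffices.\<close>
  have "isomorphic (DC_hom (dcat.truncate A) (dcat.truncate B)) k k"
    using category.isomorphic_refl[OF DC_hom_category[OF display_functorD(2,3)[OF k']], of k] k' by simp
  with F show "\<exists>f \<in> Obj (THom NM_U A B).
      isomorphic (THom DC_U (T0 forgetful A) (T0 forgetful B)) (T1 forgetful A B f) k"
    by (intro bexI[of _ F]) simp_all
next
  fix A B :: "'u nm" and f g :: "'u nmor"
  assume "f \<in> Obj (THom NM_U A B)" "g \<in> Obj (THom NM_U A B)"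
  then have "bij_betw ncell_base (hom (NM_hom A B) f g)
      (hom (DC_hom (dcat.truncate A) (dcat.truncate B)) (ftr.truncate f) (ftr.truncate g))"
    by (intro forgetful_bij_2cell) simp_all
  moreover have "T2 forgetful A B = ncell_base" by (simp add: fun_eq_iff)
  ultimately show "bij_betw (T2 forgetful A B) (hom (THom NM_U A B) f g)
      (hom (THom DC_U (T0 forgetful A) (T0 forgetful B)) (T1 forgetful A B f) (T1 forgetful A B g))"
    by simp
qed

end
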